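(* The full subcategory $\mathbf{FS}_{\mathbf{WE}}$ of the category $\mathbf{FS}$ of Frölicher spaces and smooth mappings, consisting of all Weil-exponentiable Frölicher spaces, is Cartesian closed.
   Context: Frölicher spaces. A Frölicher space is a set $X$ with a set of curves $\mathbb{R}\to X$ and a set of functions $X\to\mathbb{R}$ such that the functions are exactly the maps $f$ with $f\circ c\in\mathcal{C}^\infty(\mathbb{R},\mathbb{R})$ for every curve $c$, and the curves are exactly the maps $c$ with $f\circ c\in\mathcal{C}^\infty(\mathbb{R},\mathbb{R})$ for every function $f$. A map is smooth if it sends curves to curves by composition. $\mathbf{FS}$ denotes the category of Frölicher spaces and smooth maps; it is Cartesian closed, with exponential $Y^X=\mathcal{C}^\infty(X,Y)$. $\mathbb{R}^n$ carries its usual structure, so the functions on $X$ are the elements of $\mathcal{C}^\infty(X,\mathbb{R})$. The initial structure on a set $S$ with respect to maps $g_i:S\to X_i$ into Frölicher spaces is the one whose curves are the maps $c$ with every $g_i\circ c$ a curve. Weil algebras. A Weil algebra is a finite-dimensional local real algebra with residue field $\mathbb{R}$, presented as $W=\mathcal{C}^\infty(\mathbb{R}^n)/I$, where $I$ is an ideal with $\mathfrak{m}_0^{k+1}\subseteq I\subseteq\mathfrak{m}_0$ for some $k$, and $\mathfrak{m}_0$ is the ideal of functions vanishing at $0$. For $W_1=\mathcal{C}^\infty(\mathbb{R}^n)/I$ and $W_2=\mathcal{C}^\infty(\mathbb{R}^m)/J$, $W_1\otimes_\infty W_2=\mathcal{C}^\infty(\mathbb{R}^{n+m})/(I,J)$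 is the coproduct of $\mathcal{C}^\infty$-rings, $(I,J)$ being the ideal generated by the pullbacks of $I$ and $J$ along the two projections. Weil prolongation. For $f,g\in\mathcal{C}^\infty(\mathbb{R}^n,X)$, $f\equiv g \bmod I$ means $f(0)=g(0)$ and $\chi\circ f-\chi\circ g\in I$ for every $\chi\in\mathcal{C}^\infty(X,\mathbb{R})$. $X\otimes W$ is the set of equivalence classes of $\mathcal{C}^\infty(\mathbb{R}^n,X)$ modulo this relation. $\mathbb{R}\otimes W$ is $W$ as a finite-dimensional vector space with its usual smooth structure. $X\otimes W$ has the initial structure with respect to the maps $\chi\otimes W:X\otimes W\to\mathbb{R}\otimes W$, $[f]\mapsto[\chi\circ f]$, $\chi\in\mathcal{C}^\infty(X,\mathbb{R})$. Weil-exponentiability. $X$ is Weil-exponentiable if $(X\otimes(W_1\otimes_\infty W_2))^Y=(X\otimes W_1)^Y\otimes W_2$ for every Frölicher space $Y$ and all Weil algebras $W_1,W_2$. Here the equality is the canonical identification: the assignments $\kappa:X\otimes(W_1\otimes_\infty W_2)\to(X\otimes W_1)\otimes W_2$, $[h]\mapsto[v\mapsto[h(\cdot,v)]]$, and $\varepsilon:(X\otimes W_1)^Y\otimes W_2\to((X\otimes W_1)\otimes W_2)^Y$, $[g]\mapsto(y\mapsto[v\mapsto g(v)(y)])$, are well defined and are isomorphisms of Frölicher spaces, so that the two sides are identified via $\kappa^Y$ and $\varepsilon$. (Taking $Y=1$ gives $X\otimes(W_1\otimes_\infty W_2)=(X\otimes W_1)\otimes W_2$; taking $W_1=\mathbb{R}$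 gives $(X\otimes W_2)^Y=X^Y\otimes W_2$.) *)

theory Defs
  imports "HOL-Analysis.Derivative" "HOL-Algebra.QuotRing" "HOL-Algebra.Ideal_Product"
begin

section \<open>Froelicher spaces\<close>

definition smooth_real :: "(real \<Rightarrow> real) \<Rightarrow> bool" where
  "smooth_real f \<longleftrightarrow> (\<forall>k x. (deriv ^^ k) f differentiable (at x))"

text \<open>Maps between spaces are extensional functions, so that equality of maps is
  equality of functions.\<close>

record 'a frolicher =
  points :: "'a set"
  curves :: "(real \<Rightarrow> 'a) set"
  funs :: "('a \<Rightarrow> real) set"

definition frolicher_space :: "'a frolicher \<Rightarrow> bool" where
  "frolicher_space X \<longleftrightarrow>
     funs X = {f \<in> extensional (points X). \<forall>c\<in>curves X. smooth_real (f \<circ> c)} \<and>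
     curves X = {c. range c \<subseteq> points X \<and> (\<forall>f\<in>funs X. smooth_real (f \<circ> c))}"

definition smooth_maps :: "'a frolicher \<Rightarrow> 'b frolicher \<Rightarrow> ('a \<Rightarrow> 'b) set" where
  "smooth_maps X Y =
     {f \<in> points X \<rightarrow>\<^sub>E points Y. \<forall>c\<in>curves X. f \<circ> c \<in> curves Y}"

definition frolicher_iso :: "'a frolicher \<Rightarrow> 'b frolicher \<Rightarrow> ('a \<Rightarrow> 'b) \<Rightarrow> bool" where
  "frolicher_iso X Y f \<longleftrightarrow>
     f \<in> smooth_maps X Y \<and> bij_betw f (points X) (points Y) \<and>
     (\<lambda>y\<in>points Y. inv_into (points X) f y) \<in> smooth_maps Y X"

text \<open>The curves determine the functions of a Froelicher space. The next constant only
  fills in the functions; that the result is a Froelicher space depends on the choice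
  of \<open>C\<close>.\<close>

definition curve_space :: "'a set \<Rightarrow> (real \<Rightarrow> 'a) set \<Rightarrow> 'a frolicher" where
  "curve_space S C =
     \<lparr>points = S, curves = C, funs = {f \<in> extensional S. \<forall>c\<in>C. smooth_real (f \<circ> c)}\<rparr>"

definition initial_space :: "'a set \<Rightarrow> ('a \<Rightarrow> 'b) set \<Rightarrow> 'b frolicher \<Rightarrow> 'a frolicher" where
  "initial_space S G Z = curve_space S {c. range c \<subseteq> S \<and> (\<forall>g\<in>G. g \<circ> c \<in> curves Z)}"

definition real_space :: "real frolicher" where
  "real_space =
     \<lparr>points = UNIV, curves = Collect smooth_real, funs = Collect smooth_real\<rparr>"

text \<open>\<open>\<real>\<^sup>n\<close>, for a number \<open>n\<close> that has to vary inside formulas, is the set of sequences that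
  vanish from index \<open>n\<close> on. Its curves are the usual smooth curves; by Boman's theorem its
  functions are then the usual \<open>C\<^sup>\<infinity>\<close> functions.\<close>

definition euclid :: "nat \<Rightarrow> (nat \<Rightarrow> real) frolicher" where
  "euclid n = initial_space {x. \<forall>i\<ge>n. x i = 0} ((\<lambda>i x. x i) ` {..<n}) real_space"

abbreviation origin :: "nat \<Rightarrow> real" where
  "origin \<equiv> (\<lambda>_. 0)"

definition one_space :: "unit frolicher" where
  "one_space = curve_space UNIV UNIV"

definition prod_space :: "'a frolicher \<Rightarrow> 'b frolicher \<Rightarrow> ('a \<times> 'b) frolicher" where
  "prod_space X Y =
     curve_space (points X \<times> points Y) {c. fst \<circ> c \<in> curves X \<and> snd \<circ> c \<in> curves Y}"

text \<open>The exponential \<open>Y\<^sup>X = C\<^sup>\<infinity>(X, Y)\<close>: a curve in it is the transpose of a smooth map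
  \<open>\<real> \<times> X \<rightarrow> Y\<close>.\<close>

definition map_space :: "'a frolicher \<Rightarrow> 'b frolicher \<Rightarrow> ('a \<Rightarrow> 'b) frolicher" where
  "map_space X Y =
     curve_space (smooth_maps X Y)
       {c. range c \<subseteq> smooth_maps X Y \<and>
           (\<lambda>p\<in>UNIV \<times> points X. c (fst p) (snd p)) \<in> smooth_maps (prod_space real_space X) Y}"

definition eval_map :: "'a frolicher \<Rightarrow> 'b frolicher \<Rightarrow> ('a \<Rightarrow> 'b) \<times> 'a \<Rightarrow> 'b" where
  "eval_map X Y = (\<lambda>p\<in>points (prod_space (map_space X Y) X). (fst p) (snd p))"


section \<open>Weil algebras\<close>

definition smooth_ring :: "nat \<Rightarrow> ((nat \<Rightarrow> real) \<Rightarrow> real) ring" where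
  "smooth_ring n =
     \<lparr>carrier = smooth_maps (euclid n) real_space,
      mult = (\<lambda>f g. \<lambda>x\<in>points (euclid n). f x * g x),
      one = (\<lambda>x\<in>points (euclid n). 1),
      zero = (\<lambda>x\<in>points (euclid n). 0),
      add = (\<lambda>f g. \<lambda>x\<in>points (euclid n). f x + g x)\<rparr>"

definition max_ideal :: "nat \<Rightarrow> ((nat \<Rightarrow> real) \<Rightarrow> real) set" where
  "max_ideal n = {f \<in> carrier (smooth_ring n). f origin = 0}"

text \<open>A Weil algebra is given by a presentation \<open>C\<^sup>\<infinity>(\<real>\<^sup>n)/I\<close>. The conditions on \<open>I\<close>
  make the quotient finite-dimensional and local with residue field \<open>\<real>\<close>.\<close>

record weil =
  wdim :: nat
  wideal :: "((nat \<Rightarrow> real) \<Rightarrow> real) set"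

definition weil_algebra :: "weil \<Rightarrow> bool" where
  "weil_algebra W \<longleftrightarrow>
     ideal (wideal W) (smooth_ring (wdim W)) \<and>
     wideal W \<subseteq> max_ideal (wdim W) \<and>
     (\<exists>k. (ideal_prod (smooth_ring (wdim W)) (max_ideal (wdim W)) ^^ k) (max_ideal (wdim W))
            \<subseteq> wideal W)"

definition weil_coset :: "weil \<Rightarrow> ((nat \<Rightarrow> real) \<Rightarrow> real) \<Rightarrow> ((nat \<Rightarrow> real) \<Rightarrow> real) set" where
  "weil_coset W f = wideal W +>\<^bsub>smooth_ring (wdim W)\<^esub> f"

text \<open>The linear functionals on the vector space \<open>W\<close>. The usual smooth structure of this
  finite-dimensional space is the initial one with respect to them.\<close>

definition weil_dual :: "weil \<Rightarrow> (((nat \<Rightarrow> real) \<Rightarrow> real) set \<Rightarrow> real) set" where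
  "weil_dual W =
     {l. \<forall>r s. \<forall>f\<in>carrier (smooth_ring (wdim W)). \<forall>g\<in>carrier (smooth_ring (wdim W)).
           l (weil_coset W (\<lambda>x\<in>points (euclid (wdim W)). r * f x + s * g x)) =
           r * l (weil_coset W f) + s * l (weil_coset W g)}"

definition weil_space :: "weil \<Rightarrow> ((nat \<Rightarrow> real) \<Rightarrow> real) set frolicher" where
  "weil_space W =
     initial_space (carrier (smooth_ring (wdim W) Quot wideal W)) (weil_dual W) real_space"

text \<open>\<open>\<real>\<^sup>n \<times> \<real>\<^sup>m\<close> is identified with \<open>\<real>\<^bsup>n+m\<^esup>\<close> by \<open>join_vec n\<close>, with projections
  \<open>fst_vec n\<close> and \<open>snd_vec n\<close>.\<close>

definition fst_vec :: "nat \<Rightarrow> (nat \<Rightarrow> real) \<Rightarrow> nat \<Rightarrow> real" where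
  "fst_vec n x = (\<lambda>i. if i < n then x i else 0)"

definition snd_vec :: "nat \<Rightarrow> (nat \<Rightarrow> real) \<Rightarrow> nat \<Rightarrow> real" where
  "snd_vec n x = (\<lambda>i. x (n + i))"

definition join_vec :: "nat \<Rightarrow> (nat \<Rightarrow> real) \<Rightarrow> (nat \<Rightarrow> real) \<Rightarrow> nat \<Rightarrow> real" where
  "join_vec n u v = (\<lambda>i. if i < n then u i else v (i - n))"

definition weil_tensor :: "weil \<Rightarrow> weil \<Rightarrow> weil" where
  "weil_tensor W\<^sub>1 W\<^sub>2 =
     (let n = wdim W\<^sub>1; m = wdim W\<^sub>2; P = points (euclid (n + m)) in
      \<lparr>wdim = n + m,
       wideal = genideal (smooth_ring (n + m))
         ((\<lambda>f. compose P f (fst_vec n)) ` wideal W\<^sub>1 \<union>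
          (\<lambda>g. compose P g (snd_vec n)) ` wideal W\<^sub>2)\<rparr>)"


section \<open>Weil prolongation\<close>

definition prolong_rel ::
    "'a frolicher \<Rightarrow> weil \<Rightarrow> (((nat \<Rightarrow> real) \<Rightarrow> 'a) \<times> ((nat \<Rightarrow> real) \<Rightarrow> 'a)) set" where
  "prolong_rel X W =
     {(f, g). f \<in> smooth_maps (euclid (wdim W)) X \<and> g \<in> smooth_maps (euclid (wdim W)) X \<and>
        f origin = g origin \<and>
        (\<forall>\<phi>\<in>smooth_maps X real_space.
           (\<lambda>x\<in>points (euclid (wdim W)). \<phi> (f x) - \<phi> (g x)) \<in> wideal W)}"

definition prolong_class ::
    "'a frolicher \<Rightarrow> weil \<Rightarrow> ((nat \<Rightarrow> real) \<Rightarrow> 'a) \<Rightarrow> ((nat \<Rightarrow> real) \<Rightarrow> 'a) set" where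
  "prolong_class X W f = prolong_rel X W `` {f}"

definition prolong_fun ::
    "weil \<Rightarrow> ('a \<Rightarrow> real) \<Rightarrow> ((nat \<Rightarrow> real) \<Rightarrow> 'a) set \<Rightarrow> ((nat \<Rightarrow> real) \<Rightarrow> real) set" where
  "prolong_fun W \<phi> A =
     the_elem ((\<lambda>f. weil_coset W (compose (points (euclid (wdim W))) \<phi> f)) ` A)"

definition prolong :: "'a frolicher \<Rightarrow> weil \<Rightarrow> ((nat \<Rightarrow> real) \<Rightarrow> 'a) set frolicher" where
  "prolong X W =
     initial_space (smooth_maps (euclid (wdim W)) X // prolong_rel X W)
       (prolong_fun W ` smooth_maps X real_space) (weil_space W)"


section \<open>Weil exponentiability\<close>

text \<open>The representatives \<open>v \<mapsto> [h(\<cdot>, v)]\<close> and \<open>v \<mapsto> g(v)(y)\<close> in the definitions of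
  \<open>\<kappa>\<close> and \<open>\<epsilon>\<close>.\<close>

definition kappa_rep ::
    "'a frolicher \<Rightarrow> weil \<Rightarrow> weil \<Rightarrow> ((nat \<Rightarrow> real) \<Rightarrow> 'a) \<Rightarrow> (nat \<Rightarrow> real) \<Rightarrow>
     ((nat \<Rightarrow> real) \<Rightarrow> 'a) set" where
  "kappa_rep X W\<^sub>1 W\<^sub>2 h =
     (\<lambda>v\<in>points (euclid (wdim W\<^sub>2)).
        prolong_class X W\<^sub>1 (\<lambda>u\<in>points (euclid (wdim W\<^sub>1)). h (join_vec (wdim W\<^sub>1) u v)))"

definition eps_rep :: "weil \<Rightarrow> ((nat \<Rightarrow> real) \<Rightarrow> 'y \<Rightarrow> 'z) \<Rightarrow> 'y \<Rightarrow> (nat \<Rightarrow> real) \<Rightarrow> 'z" where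
  "eps_rep W g y = (\<lambda>v\<in>points (euclid (wdim W)). g v y)"

text \<open>An assignment on representatives is well defined on classes iff there is a map on the
  quotient inducing it; that map is then unique.\<close>

definition kappa_iso :: "'a frolicher \<Rightarrow> weil \<Rightarrow> weil \<Rightarrow> bool" where
  "kappa_iso X W\<^sub>1 W\<^sub>2 \<longleftrightarrow>
     (\<exists>\<kappa>. frolicher_iso (prolong X (weil_tensor W\<^sub>1 W\<^sub>2)) (prolong (prolong X W\<^sub>1) W\<^sub>2) \<kappa> \<and>
        (\<forall>h\<in>smooth_maps (euclid (wdim W\<^sub>1 + wdim W\<^sub>2)) X.
           kappa_rep X W\<^sub>1 W\<^sub>2 h \<in> smooth_maps (euclid (wdim W\<^sub>2)) (prolong X W\<^sub>1) \<and>
           \<kappa> (prolong_class X (weil_tensor W\<^sub>1 W\<^sub>2) h) =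
             prolong_class (prolong X W\<^sub>1) W\<^sub>2 (kappa_rep X W\<^sub>1 W\<^sub>2 h)))"

definition eps_iso :: "'y frolicher \<Rightarrow> 'z frolicher \<Rightarrow> weil \<Rightarrow> bool" where
  "eps_iso Y Z W \<longleftrightarrow>
     (\<exists>\<epsilon>. frolicher_iso (prolong (map_space Y Z) W) (map_space Y (prolong Z W)) \<epsilon> \<and>
        (\<forall>g\<in>smooth_maps (euclid (wdim W)) (map_space Y Z).
           (\<forall>y\<in>points Y. eps_rep W g y \<in> smooth_maps (euclid (wdim W)) Z) \<and>
           \<epsilon> (prolong_class (map_space Y Z) W g) =
             (\<lambda>y\<in>points Y. prolong_class Z W (eps_rep W g y))))"

definition weil_exponentiable_at :: "'y frolicher \<Rightarrow> 'a frolicher \<Rightarrow> bool" where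
  "weil_exponentiable_at Y X \<longleftrightarrow>
     (\<forall>W\<^sub>1 W\<^sub>2. weil_algebra W\<^sub>1 \<longrightarrow> weil_algebra W\<^sub>2 \<longrightarrow>
        kappa_iso X W\<^sub>1 W\<^sub>2 \<and> eps_iso Y (prolong X W\<^sub>1) W\<^sub>2)"

text \<open>\<open>'a jets\<close> is the type of the points of \<open>X \<otimes> W\<close> if \<open>'a\<close> is the type of the points
  of \<open>X\<close>.\<close>

type_synonym 'a jets = "((nat \<Rightarrow> real) \<Rightarrow> 'a) set"

text \<open>A definition cannot quantify over the type of the points of \<open>Y\<close>, so a type must be
  chosen that is large enough for \<open>weil_exponentiable X\<close> to imply
  \<open>weil_exponentiable_at Y X\<close> for Froelicher spaces \<open>Y\<close> over every type. The type of
  \<open>(X \<otimes> W\<^sub>1) \<otimes> W\<^sub>2\<close> suffices. Let \<open>Z = X \<otimes> W\<^sub>1\<close> and \<open>W\<^sub>2 = C\<^sup>\<infinity>(\<real>\<^sup>m)/J\<close>.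
  Every smooth \<open>Y \<rightarrow> Z \<otimes> W\<^sub>2\<close> factors through the identity of \<open>Z \<otimes> W\<^sub>2\<close>, so \<open>\<epsilon>\<close> is
  surjective for all \<open>Y\<close> if it is for \<open>Y = Z \<otimes> W\<^sub>2\<close>. A pair \<open>g, g'\<close> of maps
  \<open>\<real>\<^sup>m \<rightarrow> Z\<^sup>Y\<close> with \<open>\<epsilon>[g] = \<epsilon>[g']\<close> is pulled back, along a smooth map from \<open>Y\<close>, from the
  tautological pair for the space of all pairs of congruent maps \<open>\<real>\<^sup>m \<rightarrow> Z\<close>, which has a
  copy over this type; so the same holds for injectivity.\<close>

definition weil_exponentiable :: "'a frolicher \<Rightarrow> bool" where
  "weil_exponentiable X \<longleftrightarrow>
     frolicher_space X \<and>
     (\<forall>Y :: 'a jets jets frolicher. frolicher_space Y \<longrightarrow> weil_exponentiable_at Y X)"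


section \<open>Cartesian closedness of a full subcategory\<close>

text \<open>Universal properties in the full subcategory given by a predicate \<open>Obj\<close>, tested on its
  objects over the type \<open>'t\<close>.\<close>

definition is_terminal :: "('t frolicher \<Rightarrow> bool) \<Rightarrow> 'e frolicher \<Rightarrow> bool" where
  "is_terminal Obj E \<longleftrightarrow> (\<forall>T. Obj T \<longrightarrow> (\<exists>!f. f \<in> smooth_maps T E))"

definition is_product ::
    "('t frolicher \<Rightarrow> bool) \<Rightarrow> 'a frolicher \<Rightarrow> 'b frolicher \<Rightarrow>
     'p frolicher \<Rightarrow> ('p \<Rightarrow> 'a) \<Rightarrow> ('p \<Rightarrow> 'b) \<Rightarrow> bool" where
  "is_product Obj X Y P p q \<longleftrightarrow>
     p \<in> smooth_maps P X \<and> q \<in> smooth_maps P Y \<and>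
     (\<forall>T. Obj T \<longrightarrow> (\<forall>f\<in>smooth_maps T X. \<forall>g\<in>smooth_maps T Y.
        \<exists>!h. h \<in> smooth_maps T P \<and> compose (points T) p h = f \<and> compose (points T) q h = g))"

definition is_exponential ::
    "('t frolicher \<Rightarrow> bool) \<Rightarrow> 'a frolicher \<Rightarrow> 'b frolicher \<Rightarrow>
     'e frolicher \<Rightarrow> ('e \<times> 'a \<Rightarrow> 'b) \<Rightarrow> bool" where
  "is_exponential Obj X Y E ev \<longleftrightarrow>
     ev \<in> smooth_maps (prod_space E X) Y \<and>
     (\<forall>T. Obj T \<longrightarrow> (\<forall>f\<in>smooth_maps (prod_space T X) Y.
        \<exists>!h. h \<in> smooth_maps T E \<and>
             (\<lambda>p\<in>points T \<times> points X. ev (h (fst p), snd p)) = f))"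

end

theory Submission
  imports Defs "HOL-Analysis.Henstock_Kurzweil_Integration"
begin

text \<open>
  The category of all Froelicher spaces is Cartesian closed, so what has to be shown is that Weil
  exponentiability is inherited by products and mapping spaces, and that it does not depend on the
  type over which the test spaces \<open>Y\<close> range.

  Weil exponentiability of \<open>X\<close> is equivalent to three conditions in which no test space occurs
  (\<open>weil_exponentiable_iff\<close>). For \<open>Z = X \<otimes> W\<^sub>1\<close>, the jets in \<open>Z \<otimes> W\<^sub>2\<close> have representatives
  depending smoothly on the jet (\<open>has_section\<close>); this is surjectivity of \<open>\<epsilon>\<close> for the universal case
  \<open>Y = Z \<otimes> W\<^sub>2\<close>. Families of maps into \<open>Z\<close> that are congruent for every value of the parameter
  are congruent as maps into \<open>Z\<^sup>Y\<close> (\<open>faithful\<close>); this is injectivity of \<open>\<epsilon>\<close>, tested on the space of all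
  pairs of congruent maps. Finally \<open>\<kappa>\<close> is well defined. Everything else comes for free: \<open>\<epsilon>\<close> is always
  smooth (\<open>eps_map_smooth\<close>), its inverse and both directions of \<open>\<kappa>\<close> are given by sections, and a smooth
  family of maps has a smooth family of jets (\<open>jet_class_smooth\<close>); \<open>\<kappa>\<close> is always injective
  (\<open>kappa_family_reflects\<close>).

  The first two conditions pass to retracts, to products and to mapping spaces. A prolongation
  \<open>(X \<times> Y) \<otimes> W\<close> is a retract of \<open>(X \<otimes> W) \<times> (Y \<otimes> W)\<close>, and \<open>Y\<^sup>X \<otimes> W\<close> is a retract of
  \<open>(Y \<otimes> W)\<^sup>X\<close>. So the conditions hold for products and mapping spaces if they hold for the
  factors and for \<open>Y\<close>, respectively; that \<open>\<kappa>\<close> is well defined is checked componentwise or pointwise.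

  Two analytic facts carry these arguments. The first one is Taylor's formula with parameters for
  functions that are smooth along curves (\<open>taylor_expansion\<close>). It shows that a smooth family of functions
  has smooth coordinates in a Weil algebra (\<open>weil_dual_smooth\<close>), and that a smooth family of elements of
  its ideal is a smooth combination of elements of the ideal (\<open>weil_zero_family\<close>). The second one is that
  the mapping space of two Froelicher spaces is one (\<open>frolicher_map_space\<close>), in the sharper form that a
  family of smooth functions on the line is smooth if certain linear functionals are smooth on it
  (\<open>regular2_if_functionals_smooth\<close>); linearity is what makes the functionals commute with those of a Weil
  algebra, and so \<open>\<epsilon>\<close> is smooth. Both facts reduce to functions of two real variables, for which
  smoothness along curves is equivalent to local bounds on the derivatives in the two coordinate
  directions (\<open>smooth2_iff_regular2\<close>).\<close>

section \<open>Smooth functions of one variable\<close>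

abbreviation nder :: "nat \<Rightarrow> (real \<Rightarrow> real) \<Rightarrow> real \<Rightarrow> real" where
  "nder k f \<equiv> (deriv ^^ k) f"

text \<open>The closure properties of smooth functions follow by induction on a number of derivatives, since the
derivative of a product, a composite or an inverse is built from functions with one derivative less.\<close>

definition diff_upto :: "nat \<Rightarrow> (real \<Rightarrow> real) \<Rightarrow> bool" where
  "diff_upto n f \<longleftrightarrow> (\<forall>k<n. \<forall>x. nder k f differentiable (at x))"

lemma smooth_real_iff_diff_upto: "smooth_real f \<longleftrightarrow> (\<forall>n. diff_upto n f)"
  unfolding smooth_real_def diff_upto_def by blast

lemma nder_Suc: "nder (Suc k) f = nder k (deriv f)"
  by (simp add: funpow_swap1)

lemma diff_upto_0 [simp]: "diff_upto 0 f"
  by (simp add: diff_upto_def)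

lemma diff_upto_Suc:
  "diff_upto (Suc n) f \<longleftrightarrow> (\<forall>x. f differentiable (at x)) \<and> diff_upto n (deriv f)"
proof -
  have "diff_upto (Suc n) f \<longleftrightarrow> (\<forall>x. nder 0 f differentiable (at x)) \<and>
      (\<forall>k<n. \<forall>x. nder (Suc k) f differentiable (at x))"
    unfolding diff_upto_def by (auto simp: less_Suc_eq_0_disj simp del: funpow.simps)
  then show ?thesis
    unfolding diff_upto_def nder_Suc by simp
qed

lemma diff_upto_SucI:
  assumes "\<And>x. DERIV f x :> f' x" "diff_upto n f'"
  shows "diff_upto (Suc n) f"
proof -
  have "deriv f = f'"
    using assms(1) by (intro ext DERIV_imp_deriv)
  then show ?thesis
    using assms unfolding diff_upto_Suc by (metis real_differentiable_def)
qed

lemma diff_upto_SucD: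
  assumes "diff_upto (Suc n) f"
  shows "DERIV f x :> deriv f x" "diff_upto n (deriv f)"
  using assms unfolding diff_upto_Suc by (auto simp: DERIV_deriv_iff_real_differentiable)

lemma diff_upto_less: "diff_upto (Suc n) f \<Longrightarrow> diff_upto n f"
  by (auto simp: diff_upto_def)

lemma diff_upto_const: "diff_upto n (\<lambda>x. c)"
proof (induction n arbitrary: c)
  case (Suc n)
  show ?case by (rule diff_upto_SucI[where f'="\<lambda>_. 0"]) (auto intro!: derivative_eq_intros Suc)
qed simp

lemma diff_upto_ident: "diff_upto n (\<lambda>x. x)"
proof (cases n)
  case (Suc m)
  show ?thesis unfolding Suc
    by (rule diff_upto_SucI[where f'="\<lambda>_. 1"]) (auto intro!: derivative_eq_intros diff_upto_const)
qed simp

lemma diff_upto_add: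
  "diff_upto n f \<Longrightarrow> diff_upto n g \<Longrightarrow> diff_upto n (\<lambda>x. f x + g x)"
proof (induction n arbitrary: f g)
  case (Suc n)
  note d = diff_upto_SucD[OF Suc.prems(1)] diff_upto_SucD[OF Suc.prems(2)]
  show ?case
    by (rule diff_upto_SucI[where f'="\<lambda>x. deriv f x + deriv g x"])
       (auto intro!: derivative_eq_intros Suc.IH d)
qed simp

lemma diff_upto_mult:
  "diff_upto n f \<Longrightarrow> diff_upto n g \<Longrightarrow> diff_upto n (\<lambda>x. f x * g x)"
proof (induction n arbitrary: f g)
  case (Suc n)
  note d = diff_upto_SucD[OF Suc.prems(1)] diff_upto_SucD[OF Suc.prems(2)]
  show ?case
    by (rule diff_upto_SucI[where f'="\<lambda>x. deriv f x * g x + f x * deriv g x"])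
       (auto intro!: derivative_eq_intros diff_upto_add Suc.IH d Suc.prems[THEN diff_upto_less])
qed simp

lemma diff_upto_compose:
  "diff_upto n f \<Longrightarrow> diff_upto n g \<Longrightarrow> diff_upto n (\<lambda>x. f (g x))"
proof (induction n arbitrary: f)
  case (Suc n)
  note d = diff_upto_SucD[OF Suc.prems(1)] diff_upto_SucD[OF Suc.prems(2)]
  show ?case
  proof (rule diff_upto_SucI[where f'="\<lambda>x. deriv f (g x) * deriv g x"])
    show "((\<lambda>x. f (g x)) has_real_derivative deriv f (g x) * deriv g x) (at x)" for x
      by (rule DERIV_chain2[OF d(1) d(3)])
    show "diff_upto n (\<lambda>x. deriv f (g x) * deriv g x)"
      by (rule diff_upto_mult[OF Suc.IH[OF d(2) diff_upto_less[OF Suc.prems(2)]] d(4)])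
  qed
qed simp

lemma diff_upto_inverse:
  assumes "\<And>x. f x \<noteq> 0"
  shows "diff_upto n f \<Longrightarrow> diff_upto n (\<lambda>x. inverse (f x))"
proof (induction n)
  case (Suc n)
  note d = diff_upto_SucD[OF Suc.prems]
  show ?case
  proof (rule diff_upto_SucI[where f'="\<lambda>x. (-1) * (inverse (f x) * deriv f x * inverse (f x))"])
    show "((\<lambda>x. inverse (f x)) has_real_derivative
        (-1) * (inverse (f x) * deriv f x * inverse (f x))) (at x)" for x
      using DERIV_inverse'[OF d(1) assms] by simp
    show "diff_upto n (\<lambda>x. (-1) * (inverse (f x) * deriv f x * inverse (f x)))"
      by (intro diff_upto_mult diff_upto_const Suc.IH d Suc.prems[THEN diff_upto_less])
  qed
qed simp

named_theorems smooth_intros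

lemma smooth_real_const [smooth_intros]: "smooth_real (\<lambda>x. c)"
  by (simp add: smooth_real_iff_diff_upto diff_upto_const)

lemma smooth_real_ident [smooth_intros]: "smooth_real (\<lambda>x. x)"
  by (simp add: smooth_real_iff_diff_upto diff_upto_ident)

lemma smooth_real_add [smooth_intros]:
  "smooth_real f \<Longrightarrow> smooth_real g \<Longrightarrow> smooth_real (\<lambda>x. f x + g x)"
  by (simp add: smooth_real_iff_diff_upto diff_upto_add)

lemma smooth_real_mult [smooth_intros]:
  "smooth_real f \<Longrightarrow> smooth_real g \<Longrightarrow> smooth_real (\<lambda>x. f x * g x)"
  by (simp add: smooth_real_iff_diff_upto diff_upto_mult)

lemma smooth_real_compose:
  "smooth_real f \<Longrightarrow> smooth_real g \<Longrightarrow> smooth_real (\<lambda>x. f (g x))"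
  by (simp add: smooth_real_iff_diff_upto diff_upto_compose)

lemma smooth_real_minus [smooth_intros]: "smooth_real f \<Longrightarrow> smooth_real (\<lambda>x. - f x)"
  using smooth_real_mult[OF smooth_real_const[of "-1"]] by simp

lemma smooth_real_diff [smooth_intros]:
  "smooth_real f \<Longrightarrow> smooth_real g \<Longrightarrow> smooth_real (\<lambda>x. f x - g x)"
  using smooth_real_add[of f "\<lambda>x. - g x"] smooth_real_minus[of g] by simp

lemma smooth_real_sum [smooth_intros]:
  "(\<And>i. i \<in> A \<Longrightarrow> smooth_real (f i)) \<Longrightarrow> smooth_real (\<lambda>x. \<Sum>i\<in>A. f i x)"
  by (induction A rule: infinite_finite_induct) (auto intro: smooth_intros)

lemma smooth_real_divide_nonzero:
  assumes "smooth_real f" "smooth_real g" "\<And>x. g x \<noteq> 0"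
  shows "smooth_real (\<lambda>x. f x / g x)"
  using smooth_real_mult[of f "\<lambda>x. inverse (g x)"] assms
  by (simp add: smooth_real_iff_diff_upto diff_upto_inverse divide_inverse)

text \<open>A sequence of functions, each the derivative of its predecessor, consists of the
  derivatives of its first member. This is how higher derivatives are computed below.\<close>

lemma derivative_tower:
  assumes "\<And>k x. DERIV (F k) x :> F (Suc k) x"
  shows "smooth_real (F 0)" "nder k (F 0) = F k"
proof -
  have eq: "nder k (F 0) = F k" for k
  proof (induction k)
    case (Suc k)
    then show ?case using assms by (auto intro!: DERIV_imp_deriv)
  qed simp
  show "nder k (F 0) = F k" by (rule eq)
  show "smooth_real (F 0)"
    unfolding smooth_real_def eq using assms by (auto simp: real_differentiable_def)
qed

lemma nder_has_derivative:
  "smooth_real f \<Longrightarrow> DERIV (nder k f) x :> nder (Suc k) f x"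
  unfolding smooth_real_def by (simp add: DERIV_deriv_iff_real_differentiable)

lemma smooth_real_nder: "smooth_real f \<Longrightarrow> smooth_real (nder k f)"
  using derivative_tower(1)[of "\<lambda>j. nder (j + k) f"] nder_has_derivative[of f] by simp

lemma smooth_real_deriv [smooth_intros]: "smooth_real f \<Longrightarrow> smooth_real (deriv f)"
  using smooth_real_nder[of f 1] by simp

lemma smooth_real_has_derivative: "smooth_real f \<Longrightarrow> DERIV f x :> deriv f x"
  using nder_has_derivative[of f 0] by simp

lemma nder_continuous: "smooth_real f \<Longrightarrow> continuous_on S (nder k f)"
  by (rule DERIV_continuous_on[OF has_field_derivative_at_within[OF nder_has_derivative]])

lemma smooth_real_continuous: "smooth_real f \<Longrightarrow> continuous_on S f"
  using nder_continuous[of f S 0] by simp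

lemma nder_bounded_on_interval:
  assumes "smooth_real f"
  obtains B where "\<And>x. a \<le> x \<Longrightarrow> x \<le> b \<Longrightarrow> \<bar>nder k f x\<bar> \<le> B"
proof -
  have "compact (nder k f ` {a..b})"
    by (intro compact_continuous_image nder_continuous assms) simp
  then have "bounded (nder k f ` {a..b})" by (rule compact_imp_bounded)
  then obtain B where "\<forall>x\<in>{a..b}. \<bar>nder k f x\<bar> \<le> B"
    unfolding bounded_iff by auto
  then show ?thesis
    using that[of B] by auto
qed

lemma nder_add:
  assumes "smooth_real f" "smooth_real g"
  shows "nder k (\<lambda>x. f x + g x) = (\<lambda>x. nder k f x + nder k g x)"
proof -
  have "DERIV (\<lambda>x. nder k f x + nder k g x) x :> nder (Suc k) f x + nder (Suc k) g x" for k x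
    by (intro DERIV_add nder_has_derivative assms)
  from derivative_tower(2)[of "\<lambda>k x. nder k f x + nder k g x", OF this] show ?thesis by simp
qed

lemma nder_cmult:
  assumes "smooth_real f"
  shows "nder k (\<lambda>x. c * f x) = (\<lambda>x. c * nder k f x)"
proof -
  have "DERIV (\<lambda>x. c * nder k f x) x :> c * nder (Suc k) f x" for k x
    by (intro DERIV_cmult nder_has_derivative assms)
  from derivative_tower(2)[of "\<lambda>k x. c * nder k f x", OF this] show ?thesis by simp
qed

lemma nder_diff:
  assumes "smooth_real f" "smooth_real g"
  shows "nder k (\<lambda>x. f x - g x) = (\<lambda>x. nder k f x - nder k g x)"
  using nder_add[OF assms(1) smooth_real_mult[OF smooth_real_const[of "-1"] assms(2)], of k]
    nder_cmult[OF assms(2), of k "-1"] by simp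

lemma nder_affine:
  assumes "smooth_real f"
  shows "nder k (\<lambda>x. f (a * x + b)) = (\<lambda>x. a ^ k * nder k f (a * x + b))"
proof -
  have "((\<lambda>x. a ^ k * nder k f (a * x + b)) has_real_derivative
      a ^ Suc k * nder (Suc k) f (a * x + b)) (at x)" for k x
  proof -
    have "((\<lambda>x. nder k f (a * x + b)) has_real_derivative nder (Suc k) f (a * x + b) * a) (at x)"
      by (rule DERIV_chain2[OF nder_has_derivative[OF assms]]) (auto intro!: derivative_eq_intros)
    from DERIV_cmult[OF this, of "a ^ k"] show ?thesis by (simp add: mult_ac)
  qed
  from derivative_tower(2)[of "\<lambda>k x. a ^ k * nder k f (a * x + b)", OF this] show ?thesis by simp
qed

lemma nder_cong_open:
  assumes "open S" "\<And>x. x \<in> S \<Longrightarrow> f x = g x" "x \<in> S"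
  shows "nder k f x = nder k g x"
  using assms(3)
proof (induction k arbitrary: x)
  case (Suc k)
  have "eventually (\<lambda>y. y \<in> S) (nhds x)"
    using assms(1) Suc.prems by (rule eventually_nhds_in_open)
  then have "eventually (\<lambda>y. nder k f y = nder k g y) (nhds x)"
    by eventually_elim (rule Suc.IH)
  then show ?case by (auto intro: deriv_cong_ev)
qed (use assms in auto)

text \<open>Smooth functions are constructed below as sums of series, all of whose derivatives converge
uniformly on bounded sets.\<close>

lemma smooth_series:
  fixes f :: "nat \<Rightarrow> real \<Rightarrow> real"
  assumes smooth: "\<And>n. smooth_real (f n)"
    and bound: "\<And>k R. \<exists>M. summable M \<and> (\<forall>n x. \<bar>x\<bar> \<le> R \<longrightarrow> \<bar>nder k (f n) x\<bar> \<le> M n)"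
  shows "smooth_real (\<lambda>x. \<Sum>n. f n x)" "nder k (\<lambda>x. \<Sum>n. f n x) x = (\<Sum>n. nder k (f n) x)"
proof -
  let ?F = "\<lambda>k x. \<Sum>n. nder k (f n) x"
  have "DERIV (?F k) x :> ?F (Suc k) x" for k x
  proof (rule has_field_derivative_series'(2))
    let ?S = "{- (\<bar>x\<bar> + 1) .. \<bar>x\<bar> + 1}"
    show "convex ?S" by simp
    show "x \<in> interior ?S" by simp arith
    show "x \<in> ?S" by simp arith
    show "(nder k (f n) has_real_derivative nder (Suc k) (f n) y) (at y within ?S)" for n y
      using nder_has_derivative[OF smooth] by (rule has_field_derivative_at_within)
    obtain M where M: "summable M" "\<And>n y. \<bar>y\<bar> \<le> \<bar>x\<bar> + 1 \<Longrightarrow> \<bar>nder (Suc k) (f n) y\<bar> \<le> M n"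
      using bound[of "\<bar>x\<bar> + 1" "Suc k"] by blast
    show "uniformly_convergent_on ?S (\<lambda>n x. \<Sum>i<n. nder (Suc k) (f i) x)"
      by (rule Weierstrass_m_test'[OF _ M(1)]) (use M(2) in \<open>auto simp: abs_le_iff\<close>)
    obtain M where M: "summable M" "\<And>n y. \<bar>y\<bar> \<le> \<bar>x\<bar> \<Longrightarrow> \<bar>nder k (f n) y\<bar> \<le> M n"
      using bound[of "\<bar>x\<bar>" k] by blast
    show "summable (\<lambda>n. nder k (f n) x)"
      by (rule summable_comparison_test'[OF M(1), of 0]) (use M(2) in auto)
  qed
  from derivative_tower[of ?F, OF this]
  show "smooth_real (\<lambda>x. \<Sum>n. f n x)" "nder k (\<lambda>x. \<Sum>n. f n x) x = (\<Sum>n. nder k (f n) x)"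
    by simp_all
qed

subsection \<open>A bump function\<close>

text \<open>The functions \<open>x\<^sup>-\<^sup>k exp (-1/x)\<close>, continued by \<open>0\<close>. Differentiation leads from this family to linear
combinations of it, and so smoothness at \<open>0\<close> reduces to the existence of one derivative.\<close>

definition flat :: "nat \<Rightarrow> real \<Rightarrow> real" where
  "flat k x = (if x \<le> 0 then 0 else (1 / x) ^ k * exp (- (1 / x)))"

lemma flat_has_derivative:
  "(flat k has_real_derivative flat (k + 2) x - real k * flat (k + 1) x) (at x)"
proof -
  consider "x < 0" | "x = 0" | "x > 0" by linarith
  then show ?thesis
  proof cases
    case 1
    have "eventually (\<lambda>y. flat k y = 0) (nhds x)"
      using eventually_nhds_in_open[of "{..<0}" x] 1 by (auto elim!: eventually_mono simp: flat_def)
    then have "(flat k has_real_derivative 0) (at x) = ((\<lambda>_. 0) has_real_derivative 0) (at x)"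
      by (intro DERIV_cong_ev) auto
    then show ?thesis using 1 by (simp add: flat_def)
  next
    case 3
    have "eventually (\<lambda>y. flat k y = (1 / y) ^ k * exp (- (1 / y))) (nhds x)"
      using eventually_nhds_in_open[of "{0<..}" x] 3 by (auto elim!: eventually_mono simp: flat_def)
    then have eq: "(flat k has_real_derivative D) (at x) =
        ((\<lambda>y. (1 / y) ^ k * exp (- (1 / y))) has_real_derivative D) (at x)" for D
      by (intro DERIV_cong_ev) auto
    have inv: "((\<lambda>y. 1 / y) has_real_derivative - ((1 / x)\<^sup>2)) (at x)"
      using 3 by (auto intro!: derivative_eq_intros simp: power2_eq_square)
    have "real k * (1 / x) ^ (k - 1) * (- ((1 / x)\<^sup>2)) = - real k * (1 / x) ^ (k + 1)"
      by (cases k) (auto simp: power2_eq_square algebra_simps diff_divide_distrib add_divide_distrib)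
    then have "((\<lambda>y. (1 / y) ^ k) has_real_derivative - real k * (1 / x) ^ (k + 1)) (at x)"
      using DERIV_power[OF inv, of k] by (simp add: mult_ac)
    moreover have "((\<lambda>y. exp (- (1 / y))) has_real_derivative exp (- (1 / x)) * (1 / x)\<^sup>2) (at x)"
      using DERIV_fun_exp[OF DERIV_minus[OF inv]] by simp
    ultimately have "((\<lambda>y. (1 / y) ^ k * exp (- (1 / y))) has_real_derivative
        - real k * (1 / x) ^ (k + 1) * exp (- (1 / x)) +
        exp (- (1 / x)) * (1 / x)\<^sup>2 * (1 / x) ^ k) (at x)"
      by (rule DERIV_mult)
    then show ?thesis unfolding eq
      by (rule DERIV_cong) (use 3 in \<open>simp add: flat_def power_add power2_eq_square mult_ac\<close>)
  next
    case 2
    have "((\<lambda>y::real. y ^ (k + 1) / exp y) \<longlongrightarrow> 0) at_top"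
      by (rule tendsto_power_div_exp_0)
    then have "((\<lambda>h. (inverse h) ^ (k + 1) / exp (inverse h)) \<longlongrightarrow> 0) (at_right (0::real))"
      by (rule filterlim_compose[OF _ filterlim_inverse_at_top_right])
    then have "((\<lambda>h. flat k h / h) \<longlongrightarrow> 0) (at_right 0)"
      by (rule Lim_transform_eventually)
        (auto simp: eventually_at_filter flat_def exp_minus field_simps)
    moreover have "((\<lambda>h. flat k h / h) \<longlongrightarrow> 0) (at_left 0)"
      by (rule tendsto_eventually) (auto simp: eventually_at_filter flat_def)
    ultimately have "((\<lambda>h. flat k h / h) \<longlongrightarrow> 0) (at 0)"
      by (simp add: filterlim_at_split)
    then show ?thesis
      using 2 by (simp add: DERIV_def flat_def)
  qed
qed

lemma smooth_real_flat: "smooth_real (flat k)"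
  unfolding smooth_real_iff_diff_upto
proof
  fix n show "diff_upto n (flat k)"
  proof (induction n arbitrary: k)
    case (Suc n)
    have "diff_upto n (\<lambda>x. flat (k + 2) x + (- real k) * flat (k + 1) x)"
      by (intro diff_upto_add diff_upto_mult diff_upto_const Suc)
    then show ?case
      using diff_upto_SucI[of "flat k" "\<lambda>x. flat (k + 2) x - real k * flat (k + 1) x" n]
        flat_has_derivative by simp
  qed simp
qed

definition smooth_step :: "real \<Rightarrow> real" where
  "smooth_step x = flat 0 x / (flat 0 x + flat 0 (1 - x))"

lemma smooth_step_eq: "x \<le> 0 \<Longrightarrow> smooth_step x = 0" "x \<ge> 1 \<Longrightarrow> smooth_step x = 1"
  by (auto simp: smooth_step_def flat_def)

lemma smooth_real_step: "smooth_real smooth_step"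
  unfolding smooth_step_def[abs_def]
proof (rule smooth_real_divide_nonzero)
  show "smooth_real (\<lambda>x. flat 0 x + flat 0 (1 - x))"
    by (intro smooth_intros smooth_real_compose[OF smooth_real_flat] smooth_real_flat)
  show "flat 0 x + flat 0 (1 - x) \<noteq> 0" for x
  proof -
    have "flat 0 y \<ge> 0" "y > 0 \<Longrightarrow> flat 0 y > 0" for y by (auto simp: flat_def)
    then show ?thesis by (smt (verit))
  qed
qed (rule smooth_real_flat)

definition bump :: "real \<Rightarrow> real" where
  "bump x = smooth_step (2 + 2 * x) * smooth_step (2 - 2 * x)"

lemma smooth_real_bump [smooth_intros]: "smooth_real bump"
  unfolding bump_def[abs_def] by (intro smooth_intros smooth_real_compose[OF smooth_real_step])

lemma bump_eq: "\<bar>x\<bar> \<le> 1 / 2 \<Longrightarrow> bump x = 1" "\<bar>x\<bar> \<ge> 1 \<Longrightarrow> bump x = 0"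
  using smooth_step_eq[of "2 + 2 * x"] smooth_step_eq[of "2 - 2 * x"]
  by (auto simp: bump_def abs_le_iff abs_real_def split: if_splits)

lemma nder_bounded_compact_support:
  assumes "smooth_real f" "\<And>x. \<bar>x\<bar> \<ge> 1 \<Longrightarrow> f x = 0"
  obtains B where "\<And>x. \<bar>nder k f x\<bar> \<le> B" "B \<ge> 0"
proof -
  obtain B where B: "\<And>x. -1 \<le> x \<Longrightarrow> x \<le> 1 \<Longrightarrow> \<bar>nder k f x\<bar> \<le> B"
    using nder_bounded_on_interval[OF assms(1)] by metis
  have "\<bar>nder k f x\<bar> \<le> B" for x
  proof (cases "\<bar>x\<bar> \<le> 1")
    case False
    have "open {x::real. \<bar>x\<bar> > 1}" by (intro open_Collect_less continuous_intros)
    then have "nder k f x = nder k (\<lambda>_. 0) x"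
      by (rule nder_cong_open) (use False assms in auto)
    also have "nder k (\<lambda>_. 0) x = 0"
      using nder_cmult[OF smooth_real_ident, of k 0] by simp
    finally show ?thesis using B[of 0] by simp
  qed (use B in \<open>auto simp: abs_le_iff\<close>)
  moreover have "B \<ge> 0" using B[of 0] by simp
  ultimately show ?thesis using that by blast
qed

subsection \<open>Finite differences\<close>

primrec fdiff :: "nat \<Rightarrow> real \<Rightarrow> (real \<Rightarrow> real) \<Rightarrow> real \<Rightarrow> real" where
  "fdiff 0 d f = f"
| "fdiff (Suc p) d f = fdiff p d (\<lambda>s. f (s + d) - f s)"

lemma fdiff_mean_value:
  assumes "smooth_real f" "d > 0"
  shows "\<exists>\<xi>. s \<le> \<xi> \<and> \<xi> \<le> s + real p * d \<and> fdiff p d f s = d ^ p * nder p f \<xi>"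
  using assms(1)
proof (induction p arbitrary: f)
  case (Suc p)
  have sh: "smooth_real (\<lambda>s. f (s + d))"
    by (intro smooth_real_compose[OF Suc.prems] smooth_intros)
  have "smooth_real (\<lambda>s. f (s + d) - f s)"
    by (intro smooth_intros sh Suc.prems)
  from Suc.IH[OF this] obtain \<xi> where \<xi>: "s \<le> \<xi>" "\<xi> \<le> s + real p * d"
    "fdiff (Suc p) d f s = d ^ p * nder p (\<lambda>s. f (s + d) - f s) \<xi>" by auto
  have "nder p (\<lambda>s. f (s + d) - f s) \<xi> = nder p f (\<xi> + d) - nder p f \<xi>"
    using nder_affine[OF Suc.prems, of p 1 d] nder_diff[OF sh Suc.prems] by simp
  moreover obtain \<eta> where "\<xi> < \<eta>" "\<eta> < \<xi> + d"
    "nder p f (\<xi> + d) - nder p f \<xi> = (\<xi> + d - \<xi>) * nder (Suc p) f \<eta>"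
    using MVT2[of \<xi> "\<xi> + d" "nder p f" "nder (Suc p) f"] nder_has_derivative[OF Suc.prems] assms(2)
    by (auto simp del: funpow.simps)
  ultimately show ?case
    using \<xi> by (intro exI[of _ \<eta>]) (auto simp: algebra_simps simp del: funpow.simps fdiff.simps)
qed auto

lemma fdiff_abs_le:
  assumes "\<And>t. s \<le> t \<Longrightarrow> t \<le> s + real p * d \<Longrightarrow> \<bar>f t\<bar> \<le> a" "d \<ge> 0"
  shows "\<bar>fdiff p d f s\<bar> \<le> 2 ^ p * a"
  using assms(1)
proof (induction p arbitrary: f a)
  case (Suc p)
  have "\<bar>f (t + d) - f t\<bar> \<le> 2 * a" if "s \<le> t" "t \<le> s + real p * d" for t
    using Suc.prems[of t] Suc.prems[of "t + d"] that assms(2) by (auto simp: algebra_simps)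
  from Suc.IH[OF this] show ?case by (simp add: mult_ac)
qed auto

text \<open>The inequality of Landau and Kolmogorov. On an interval of length \<open>\<delta>\<close>, bounds on a
  function and on a high derivative bound the derivatives between. Some point of the interval has a
  small derivative of order \<open>p\<close> because finite differences are small, and from there the mean
  value theorem leads to all other points.\<close>

lemma exists_small_nder:
  assumes "smooth_real f" "\<delta> > 0" "\<And>t. s \<le> t \<Longrightarrow> t \<le> s + \<delta> \<Longrightarrow> \<bar>f t\<bar> \<le> a"
  shows "\<exists>\<xi>. s \<le> \<xi> \<and> \<xi> \<le> s + \<delta> \<and> \<bar>nder m f \<xi>\<bar> \<le> (2 * real m) ^ m * (a / \<delta> ^ m)"
proof (cases "m = 0")
  case True
  then show ?thesis using assms(2) assms(3)[of s] by (intro exI[of _ s]) auto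
next
  case False
  define d where "d = \<delta> / real m"
  have d: "d > 0" "real m * d = \<delta>" using False assms(2) by (auto simp: d_def)
  obtain \<xi> where \<xi>: "s \<le> \<xi>" "\<xi> \<le> s + \<delta>" "fdiff m d f s = d ^ m * nder m f \<xi>"
    using fdiff_mean_value[OF assms(1) d(1), of s m] d(2) by auto
  have "d ^ m * \<bar>nder m f \<xi>\<bar> = \<bar>fdiff m d f s\<bar>" using \<xi>(3) d(1) by (simp add: abs_mult)
  also have "\<dots> \<le> 2 ^ m * a"
    by (rule fdiff_abs_le) (use assms(3) d in auto)
  finally have "\<bar>nder m f \<xi>\<bar> \<le> 2 ^ m * a / d ^ m"
    using d(1) by (simp add: field_simps)
  also have "\<dots> = (2 * real m) ^ m * (a / \<delta> ^ m)"
    by (simp add: d_def power_divide power_mult_distrib)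
  finally show ?thesis using \<xi> by blast
qed

lemma landau_kolmogorov:
  "\<exists>C\<ge>0. \<forall>f a b s \<delta>. smooth_real f \<longrightarrow> \<delta> > 0 \<longrightarrow>
     (\<forall>t\<in>{s..s+\<delta>}. \<bar>f t\<bar> \<le> a) \<longrightarrow> (\<forall>t\<in>{s..s+\<delta>}. \<bar>nder (p + j) f t\<bar> \<le> b) \<longrightarrow>
     (\<forall>t\<in>{s..s+\<delta>}. \<bar>nder p f t\<bar> \<le> C * (a / \<delta> ^ p + b * \<delta> ^ j))"
proof (induction j)
  case 0
  show ?case
  proof (intro exI[of _ 1] conjI allI impI ballI)
    fix f :: "real \<Rightarrow> real" and a b s \<delta> t :: real
    assume "\<delta> > 0" "\<forall>t\<in>{s..s+\<delta>}. \<bar>f t\<bar> \<le> a" "\<forall>t\<in>{s..s+\<delta>}. \<bar>nder (p + 0) f t\<bar> \<le> b"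
      and t: "t \<in> {s..s+\<delta>}"
    then have "a / \<delta> ^ p \<ge> 0" "\<bar>nder p f t\<bar> \<le> b"
      by (fastforce intro!: divide_nonneg_pos dest: bspec[of _ _ t])+
    then show "\<bar>nder p f t\<bar> \<le> 1 * (a / \<delta> ^ p + b * \<delta> ^ 0)" by simp
  qed simp
next
  case (Suc j)
  then obtain C where C: "C \<ge> 0" "\<And>f a b s \<delta> t. smooth_real f \<Longrightarrow> \<delta> > 0 \<Longrightarrow>
     (\<forall>t\<in>{s..s+\<delta>}. \<bar>f t\<bar> \<le> a) \<Longrightarrow> (\<forall>t\<in>{s..s+\<delta>}. \<bar>nder (p + j) f t\<bar> \<le> b) \<Longrightarrow>
     t\<in>{s..s+\<delta>} \<Longrightarrow> \<bar>nder p f t\<bar> \<le> C * (a / \<delta> ^ p + b * \<delta> ^ j)"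
    by blast
  define m where "m = p + j"
  define c where "c = (2 * real m) ^ m"
  have c: "c \<ge> 0" by (simp add: c_def)
  show ?case
  proof (intro exI[of _ "C * (1 + c)"] conjI allI impI ballI)
    show "0 \<le> C * (1 + c)" using C c by simp
    fix f :: "real \<Rightarrow> real" and a b s \<delta> t :: real
    assume f: "smooth_real f" and \<delta>: "\<delta> > 0" and a: "\<forall>t\<in>{s..s+\<delta>}. \<bar>f t\<bar> \<le> a"
      and b: "\<forall>t\<in>{s..s+\<delta>}. \<bar>nder (p + Suc j) f t\<bar> \<le> b" and t: "t \<in> {s..s+\<delta>}"
    obtain \<xi> where \<xi>: "\<xi> \<in> {s..s+\<delta>}" "\<bar>nder m f \<xi>\<bar> \<le> c * (a / \<delta> ^ m)"
      using exists_small_nder[OF f \<delta>, of s a m] a by (auto simp: c_def)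
    have b0: "b \<ge> 0" and a0: "a \<ge> 0" using b a t by fastforce+
    have "\<bar>nder m f u\<bar> \<le> c * (a / \<delta> ^ m) + b * \<delta>" if u: "u \<in> {s..s+\<delta>}" for u
    proof -
      have "norm (nder m f u - nder m f \<xi>) \<le> b * norm (u - \<xi>)"
        by (rule field_differentiable_bound[of "{s..s+\<delta>}" _ "nder (Suc m) f"])
          (use b u \<xi> in \<open>auto simp: m_def simp del: funpow.simps
            intro: has_field_derivative_at_within nder_has_derivative[OF f]\<close>)
      also have "\<dots> \<le> b * \<delta>"
        using u \<xi> b0 by (intro mult_left_mono) (auto simp: abs_le_iff)
      finally show ?thesis using \<xi>(2) by (simp add: abs_le_iff)
    qed
    then have "\<bar>nder p f t\<bar> \<le> C * (a / \<delta> ^ p + (c * (a / \<delta> ^ m) + b * \<delta>) * \<delta> ^ j)"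
      using C(2)[OF f \<delta> a _ t] by (simp add: m_def)
    also have "(c * (a / \<delta> ^ m) + b * \<delta>) * \<delta> ^ j = c * (a / \<delta> ^ p) + b * \<delta> ^ Suc j"
      using \<delta> by (simp add: m_def power_add field_simps)
    also have "C * (a / \<delta> ^ p + (c * (a / \<delta> ^ p) + b * \<delta> ^ Suc j))
        \<le> C * ((1 + c) * (a / \<delta> ^ p + b * \<delta> ^ Suc j))"
    proof (intro mult_left_mono C(1))
      have "0 \<le> c * (b * \<delta> ^ Suc j)" using c b0 \<delta> by simp
      then show "a / \<delta> ^ p + (c * (a / \<delta> ^ p) + b * \<delta> ^ Suc j)
        \<le> (1 + c) * (a / \<delta> ^ p + b * \<delta> ^ Suc j)" by (simp add: algebra_simps add_divide_distrib)
    qed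
    finally show "\<bar>nder p f t\<bar> \<le> C * (1 + c) * (a / \<delta> ^ p + b * \<delta> ^ Suc j)"
      by (simp add: mult_ac)
  qed
qed

section \<open>Smooth functions of two variables\<close>

text \<open>Smoothness along all smooth curves, as for the smooth maps on the Froelicher space \<open>\<real> \<times> \<real>\<close>, and
an analytic counterpart. The latter speaks of the derivatives in the two coordinate directions only,
so that it can be verified by arguments in one variable at a time; that the mixed derivatives
exist and are continuous is a consequence.\<close>

definition smooth2 :: "(real \<Rightarrow> real \<Rightarrow> real) \<Rightarrow> bool" where
  "smooth2 K \<longleftrightarrow> (\<forall>a b. smooth_real a \<longrightarrow> smooth_real b \<longrightarrow> smooth_real (\<lambda>t. K (a t) (b t)))"

definition regular2 :: "(real \<Rightarrow> real \<Rightarrow> real) \<Rightarrow> bool" where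
  "regular2 K \<longleftrightarrow> (\<forall>s. smooth_real (K s)) \<and> (\<forall>x. smooth_real (\<lambda>s. K s x)) \<and>
     (\<forall>p R. \<exists>B. \<forall>s x. \<bar>s\<bar> \<le> R \<longrightarrow> \<bar>x\<bar> \<le> R \<longrightarrow>
        \<bar>nder p (K s) x\<bar> \<le> B \<and> \<bar>nder p (\<lambda>s. K s x) s\<bar> \<le> B)"

lemma regular2_flip: "regular2 K \<Longrightarrow> regular2 (\<lambda>x s. K s x)"
  unfolding regular2_def by (simp add: conj_commute) blast

lemma smooth2_flip: "smooth2 K \<Longrightarrow> smooth2 (\<lambda>x s. K s x)"
  unfolding smooth2_def by blast

lemma regular2_smooth:
  assumes "regular2 K"
  shows "smooth_real (K s)" "smooth_real (\<lambda>s. K s x)"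
  using assms unfolding regular2_def by auto

lemma regular2_bound:
  assumes "regular2 K"
  obtains B where "B \<ge> 0" "\<And>s x. \<bar>s\<bar> \<le> R \<Longrightarrow> \<bar>x\<bar> \<le> R \<Longrightarrow> \<bar>nder p (K s) x\<bar> \<le> B"
    "\<And>s x. \<bar>s\<bar> \<le> R \<Longrightarrow> \<bar>x\<bar> \<le> R \<Longrightarrow> \<bar>nder p (\<lambda>s. K s x) s\<bar> \<le> B"
proof -
  obtain B where "\<And>s x. \<bar>s\<bar> \<le> R \<Longrightarrow> \<bar>x\<bar> \<le> R \<Longrightarrow>
      \<bar>nder p (K s) x\<bar> \<le> B \<and> \<bar>nder p (\<lambda>s. K s x) s\<bar> \<le> B"
    using assms unfolding regular2_def by blast
  then show ?thesis
    by (intro that[of "\<bar>B\<bar>"]) (auto intro: order_trans[OF _ abs_ge_self])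
qed

lemma smooth_real_lipschitz:
  assumes "smooth_real f" "\<And>y. y \<in> {a..b} \<Longrightarrow> \<bar>deriv f y\<bar> \<le> B" "x \<in> {a..b}" "x' \<in> {a..b}"
  shows "\<bar>f x - f x'\<bar> \<le> B * \<bar>x - x'\<bar>"
proof -
  have "norm (f x - f x') \<le> B * norm (x - x')"
  proof (rule field_differentiable_bound)
    show "convex {a..b}" by simp
    show "(f has_field_derivative deriv f z) (at z within {a..b})" for z
      using smooth_real_has_derivative[OF assms(1)] by (rule has_field_derivative_at_within)
  qed (use assms in auto)
  then show ?thesis by simp
qed

lemma regular2_lipschitz:
  assumes "regular2 K"
  obtains B where "B \<ge> 0" "\<And>s x s' x'. \<bar>s\<bar> \<le> R \<Longrightarrow> \<bar>x\<bar> \<le> R \<Longrightarrow> \<bar>s'\<bar> \<le> R \<Longrightarrow> \<bar>x'\<bar> \<le> R \<Longrightarrow>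
    \<bar>K s x - K s' x'\<bar> \<le> B * (\<bar>s - s'\<bar> + \<bar>x - x'\<bar>)"
proof -
  obtain B where B: "B \<ge> 0" "\<And>s x. \<bar>s\<bar> \<le> R \<Longrightarrow> \<bar>x\<bar> \<le> R \<Longrightarrow> \<bar>nder 1 (K s) x\<bar> \<le> B"
    "\<And>s x. \<bar>s\<bar> \<le> R \<Longrightarrow> \<bar>x\<bar> \<le> R \<Longrightarrow> \<bar>nder 1 (\<lambda>s. K s x) s\<bar> \<le> B"
    using regular2_bound[OF assms, of R 1] by blast
  show ?thesis
  proof (rule that[OF B(1)])
    fix s x s' x' assume *: "\<bar>s\<bar> \<le> R" "\<bar>x\<bar> \<le> R" "\<bar>s'\<bar> \<le> R" "\<bar>x'\<bar> \<le> R"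
    have "\<bar>K s x - K s x'\<bar> \<le> B * \<bar>x - x'\<bar>"
      by (rule smooth_real_lipschitz[where a="-R" and b=R])
        (use B * regular2_smooth[OF assms] in \<open>auto simp: abs_le_iff\<close>)
    moreover have "\<bar>K s x' - K s' x'\<bar> \<le> B * \<bar>s - s'\<bar>"
      by (rule smooth_real_lipschitz[where a="-R" and b=R])
        (use B * regular2_smooth[OF assms] in \<open>auto simp: abs_le_iff\<close>)
    ultimately show "\<bar>K s x - K s' x'\<bar> \<le> B * (\<bar>s - s'\<bar> + \<bar>x - x'\<bar>)"
      by (simp add: distrib_left)
  qed
qed

lemma regular2_tendsto:
  assumes "regular2 K" "(a \<longlongrightarrow> s) F" "(b \<longlongrightarrow> x) F"
  shows "((\<lambda>t. K (a t) (b t)) \<longlongrightarrow> K s x) F"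
proof -
  define R where "R = max \<bar>s\<bar> \<bar>x\<bar> + 1"
  obtain B where B: "B \<ge> 0" "\<And>s x s' x'. \<bar>s\<bar> \<le> R \<Longrightarrow> \<bar>x\<bar> \<le> R \<Longrightarrow> \<bar>s'\<bar> \<le> R \<Longrightarrow> \<bar>x'\<bar> \<le> R \<Longrightarrow>
    \<bar>K s x - K s' x'\<bar> \<le> B * (\<bar>s - s'\<bar> + \<bar>x - x'\<bar>)"
    using regular2_lipschitz[OF assms(1)] by metis
  have "eventually (\<lambda>t. dist (a t) s < 1) F" "eventually (\<lambda>t. dist (b t) x < 1) F"
    using tendstoD[OF assms(2), of 1] tendstoD[OF assms(3), of 1] by auto
  then have "eventually (\<lambda>t. norm (K (a t) (b t) - K s x) \<le> B * (\<bar>a t - s\<bar> + \<bar>b t - x\<bar>)) F"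
  proof eventually_elim
    case (elim t)
    have "\<bar>a t\<bar> \<le> R" "\<bar>s\<bar> \<le> R" "\<bar>b t\<bar> \<le> R" "\<bar>x\<bar> \<le> R"
      using elim unfolding R_def dist_real_def by linarith+
    then show ?case using B(2) by simp
  qed
  moreover have "((\<lambda>t. B * (\<bar>a t - s\<bar> + \<bar>b t - x\<bar>)) \<longlongrightarrow> B * (\<bar>s - s\<bar> + \<bar>x - x\<bar>)) F"
    by (intro tendsto_intros assms)
  ultimately have "((\<lambda>t. K (a t) (b t) - K s x) \<longlongrightarrow> 0) F"
    by (intro Lim_null_comparison[of "\<lambda>t. K (a t) (b t) - K s x"
          "\<lambda>t. B * (\<bar>a t - s\<bar> + \<bar>b t - x\<bar>)"]) simp_all
  then show ?thesis by (rule LIM_zero_cancel)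
qed

lemma regular2_continuous:
  assumes "regular2 K"
  shows "continuous_on S (\<lambda>p. K (fst p) (snd p))"
  unfolding continuous_on_def
proof
  fix p
  show "((\<lambda>p. K (fst p) (snd p)) \<longlongrightarrow> K (fst p) (snd p)) (at p within S)"
    by (rule regular2_tendsto[OF assms]) (intro tendsto_intros)+
qed

text \<open>The partial derivative in the second variable is again smooth in the first one: the difference
  quotients with increments \<open>2\<^bsup>-n\<^esup>\<close> converge like \<open>2\<^bsup>-n\<^esup>\<close>, while their derivatives
  of any order in the first variable grow at most like \<open>2\<^sup>n\<close>. By the inequality of Landau and
  Kolmogorov, all derivatives of the quotients converge geometrically.\<close>

definition dquot :: "(real \<Rightarrow> real \<Rightarrow> real) \<Rightarrow> nat \<Rightarrow> real \<Rightarrow> real \<Rightarrow> real" where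
  "dquot K n x s = 2 ^ n * (K s (x + (1/2) ^ n) - K s x)"

lemma smooth_real_dquot: "regular2 K \<Longrightarrow> smooth_real (dquot K n x)"
  unfolding dquot_def[abs_def] by (intro smooth_intros regular2_smooth)

lemma nder_dquot:
  assumes "regular2 K"
  shows "nder r (dquot K n x) s =
    2 ^ n * (nder r (\<lambda>s. K s (x + (1/2) ^ n)) s - nder r (\<lambda>s. K s x) s)"
proof -
  have "smooth_real (\<lambda>s. K s (x + (1/2) ^ n) - K s x)"
    by (intro smooth_intros regular2_smooth assms)
  then show ?thesis
    unfolding dquot_def[abs_def]
    by (simp add: nder_cmult nder_diff[OF regular2_smooth(2)[OF assms] regular2_smooth(2)[OF assms]])
qed

lemma dquot_error:
  assumes "regular2 K" "\<And>y. y \<in> {x..x+1} \<Longrightarrow> \<bar>nder 2 (K s) y\<bar> \<le> B" "B \<ge> 0"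
  shows "\<bar>dquot K n x s - deriv (K s) x\<bar> \<le> B * (1/2) ^ n"
proof -
  have sm: "smooth_real (K s)" by (rule regular2_smooth[OF assms(1)])
  let ?e = "(1/2::real) ^ n"
  have e: "0 < ?e" "?e \<le> 1" "2 ^ n * ?e = 1" by (auto simp: power_le_one power_mult_distrib[symmetric])
  obtain \<xi> where \<xi>: "x < \<xi>" "\<xi> < x + ?e" "K s (x + ?e) - K s x = (x + ?e - x) * deriv (K s) \<xi>"
    using MVT2[of x "x + ?e" "K s" "deriv (K s)"] smooth_real_has_derivative[OF sm] e(1) by auto
  have "dquot K n x s = (2 ^ n * ?e) * deriv (K s) \<xi>"
    unfolding dquot_def \<xi>(3) by simp
  then have eq: "dquot K n x s = deriv (K s) \<xi>" by (simp only: e mult_1)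
  have "\<bar>deriv (K s) \<xi> - deriv (K s) x\<bar> \<le> B * \<bar>\<xi> - x\<bar>"
    by (rule smooth_real_lipschitz[where a=x and b="x+1"])
      (use \<xi> e assms(2) in \<open>auto intro!: smooth_intros sm simp: numeral_2_eq_2\<close>)
  also have "\<dots> \<le> B * ?e" using \<xi> assms(3) by (intro mult_left_mono) auto
  finally show ?thesis unfolding eq .
qed

lemma dquot_increments_geometric:
  assumes K: "regular2 K"
  obtains C \<theta> where "0 \<le> \<theta>" "\<theta> < 1" "\<And>n s x. \<bar>s\<bar> \<le> R \<Longrightarrow> \<bar>x\<bar> \<le> R \<Longrightarrow>
    \<bar>nder p (\<lambda>s. dquot K (Suc n) x s - dquot K n x s) s\<bar> \<le> C * \<theta> ^ n"
proof -
  define N where "N = p + 1"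
  obtain B1 where B1: "B1 \<ge> 0" "\<And>s x. \<bar>s\<bar> \<le> R + 1 \<Longrightarrow> \<bar>x\<bar> \<le> R + 1 \<Longrightarrow> \<bar>nder 2 (K s) x\<bar> \<le> B1"
    using regular2_bound[OF K, of "R + 1" 2] by metis
  obtain B2 where B2: "B2 \<ge> 0"
    "\<And>s x. \<bar>s\<bar> \<le> R + 1 \<Longrightarrow> \<bar>x\<bar> \<le> R + 1 \<Longrightarrow> \<bar>nder (p + 4 * N) (\<lambda>s. K s x) s\<bar> \<le> B2"
    using regular2_bound[OF K, of "R + 1" "p + 4 * N"] by metis
  obtain C where C: "C \<ge> 0" "\<And>f a b s \<delta> t. smooth_real f \<Longrightarrow> \<delta> > 0 \<Longrightarrow>
     (\<forall>t\<in>{s..s+\<delta>}. \<bar>f t\<bar> \<le> a) \<Longrightarrow> (\<forall>t\<in>{s..s+\<delta>}. \<bar>nder (p + 4 * N) f t\<bar> \<le> b) \<Longrightarrow>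
     t\<in>{s..s+\<delta>} \<Longrightarrow> \<bar>nder p f t\<bar> \<le> C * (a / \<delta> ^ p + b * \<delta> ^ (4 * N))"
    using landau_kolmogorov[of p "4 * N"] by blast
  \<comment> \<open>With \<open>\<delta> = \<theta>\<^sup>n\<close> the increment \<open>2\<^sup>-\<^sup>n\<close> is \<open>\<delta>\<^bsup>2N\<^esup>\<close>. The terms \<open>2\<^sup>-\<^sup>n / \<delta>\<^sup>p\<close> and \<open>2\<^sup>n \<delta>\<^bsup>4N\<^esup>\<close> of the
    interpolation inequality are then both at most \<open>\<delta>\<close>.\<close>
  define \<theta> where "\<theta> = root (2 * N) (1/2)"
  have \<theta>: "0 < \<theta>" "\<theta> < 1" "\<theta> ^ (2 * N) = 1 / 2"
    by (auto simp: \<theta>_def N_def real_root_pow_pos2 simp del: power_Suc mult_Suc_right)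
  show ?thesis
  proof (rule that[of \<theta> "C * (2 * B1 + 6 * B2)"])
    fix n s x assume s: "\<bar>s\<bar> \<le> R" and x: "\<bar>x\<bar> \<le> R"
    define D where "D = (\<lambda>s. dquot K (Suc n) x s - dquot K n x s)"
    have smD: "smooth_real D"
      unfolding D_def by (intro smooth_intros smooth_real_dquot K)
    define \<delta> where "\<delta> = \<theta> ^ n"
    have \<delta>: "0 < \<delta>" "\<delta> \<le> 1" using \<theta> by (auto simp: \<delta>_def power_le_one)
    have "\<delta> ^ (2 * N) = (\<theta> ^ (2 * N)) ^ n"
      unfolding \<delta>_def by (simp only: power_mult[symmetric] mult.commute)
    then have \<delta>N: "\<delta> ^ (2 * N) = (1/2) ^ n" by (simp only: \<theta>)
    have e2: "(2::real) ^ n * (1/2) ^ n = 1" by (simp add: power_mult_distrib[symmetric])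
    let ?a = "2 * B1 * (1/2) ^ n" and ?b = "6 * B2 * 2 ^ n"
    have a: "\<bar>D t\<bar> \<le> ?a" if t: "t \<in> {s..s+\<delta>}" for t
    proof -
      have "\<bar>dquot K m x t - deriv (K t) x\<bar> \<le> B1 * (1/2) ^ m" for m
        by (rule dquot_error[OF K _ B1(1)], rule B1(2)) (use s x t \<delta> in auto)
      from this[of n] this[of "Suc n"] have "\<bar>D t\<bar> \<le> B1 * (1/2) ^ n + B1 * (1/2) ^ Suc n"
        unfolding D_def by linarith
      also have "\<dots> \<le> ?a" using B1(1) by (simp add: mult_left_mono)
      finally show ?thesis .
    qed
    have b: "\<bar>nder (p + 4 * N) D t\<bar> \<le> ?b" if t: "t \<in> {s..s+\<delta>}" for t
    proof -
      have "\<bar>nder (p + 4 * N) (dquot K m x) t\<bar> \<le> 2 ^ m * (B2 + B2)" for m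
      proof -
        have e: "0 \<le> (1/2::real) ^ m" "(1/2::real) ^ m \<le> 1" by (auto simp: power_le_one)
        have t1: "\<bar>t\<bar> \<le> R + 1" using t s \<delta> by auto
        have x1: "\<bar>x + (1/2) ^ m\<bar> \<le> R + 1" "\<bar>x\<bar> \<le> R + 1" using x e by linarith+
        from B2(2)[OF t1 x1(1)] B2(2)[OF t1 x1(2)] show ?thesis
          unfolding nder_dquot[OF K] abs_mult power_abs abs_numeral
          by (intro mult_left_mono) (auto intro: order_trans[OF abs_triangle_ineq4])
      qed
      from this[of n] this[of "Suc n"]
      have "\<bar>nder (p + 4 * N) D t\<bar> \<le> 2 ^ n * (B2 + B2) + 2 ^ Suc n * (B2 + B2)"
        unfolding D_def nder_diff[OF smooth_real_dquot[OF K] smooth_real_dquot[OF K]] by linarith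
      then show ?thesis by (simp add: algebra_simps)
    qed
    have "\<bar>nder p D s\<bar> \<le> C * (?a / \<delta> ^ p + ?b * \<delta> ^ (4 * N))"
      by (rule C(2)[OF smD \<delta>(1)]) (use a b \<delta>(1) in auto)
    also have "\<dots> \<le> C * (2 * B1 * \<delta> + 6 * B2 * \<delta>)"
    proof (intro mult_left_mono add_mono C(1))
      have "?a / \<delta> ^ p = 2 * B1 * (\<delta> ^ (2 * N) / \<delta> ^ p)" by (simp add: \<delta>N)
      also have "\<delta> ^ (2 * N) / \<delta> ^ p = \<delta> ^ (p + 2)"
      proof -
        have "2 * N = (p + 2) + p" by (simp add: N_def)
        then have "\<delta> ^ (2 * N) = \<delta> ^ (p + 2) * \<delta> ^ p" by (simp only: power_add)
        then show ?thesis using \<delta>(1) by simp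
      qed
      also have "\<delta> ^ (p + 2) \<le> \<delta> ^ 1" using \<delta> by (intro power_decreasing) auto
      finally show "?a / \<delta> ^ p \<le> 2 * B1 * \<delta>" using B1(1) by (simp add: mult_left_mono)
      have "\<delta> ^ (4 * N) = \<delta> ^ (2 * N) * \<delta> ^ (2 * N)" by (simp add: power_add[symmetric])
      then have "?b * \<delta> ^ (4 * N) = 6 * B2 * (2 ^ n * (1/2) ^ n) * \<delta> ^ (2 * N)" by (simp add: \<delta>N)
      also have "\<dots> = 6 * B2 * \<delta> ^ (2 * N)" by (simp only: e2 mult_1_right)
      also have "\<delta> ^ (2 * N) \<le> \<delta> ^ 1" using \<delta> by (intro power_decreasing) (auto simp: N_def)
      finally show "?b * \<delta> ^ (4 * N) \<le> 6 * B2 * \<delta>" using B2(1) by (simp add: mult_left_mono)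
    qed
    also have "\<dots> = C * (2 * B1 + 6 * B2) * \<theta> ^ n" by (simp add: \<delta>_def algebra_simps)
    finally show "\<bar>nder p (\<lambda>s. dquot K (Suc n) x s - dquot K n x s) s\<bar> \<le> C * (2 * B1 + 6 * B2) * \<theta> ^ n"
      unfolding D_def .
  qed (use \<theta> in auto)
qed

lemma regular2_partial:
  assumes K: "regular2 K"
  shows "regular2 (\<lambda>s x. deriv (K s) x)"
proof -
  define D where "D = (\<lambda>n x s. dquot K (Suc n) x s - dquot K n x s)"
  have smD: "smooth_real (D n x)" for n x
    unfolding D_def by (intro smooth_intros smooth_real_dquot K)
  have geo: "\<exists>C \<theta>. 0 \<le> \<theta> \<and> \<theta> < 1 \<and>
      (\<forall>n s x. \<bar>s\<bar> \<le> R \<longrightarrow> \<bar>x\<bar> \<le> R \<longrightarrow> \<bar>nder p (D n x) s\<bar> \<le> C * \<theta> ^ n)" for p R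
    using dquot_increments_geometric[OF K, of R p] unfolding D_def by metis
  have bound: "\<exists>M. summable M \<and> (\<forall>n s. \<bar>s\<bar> \<le> R \<longrightarrow> \<bar>nder p (D n x) s\<bar> \<le> M n)" for p R x
  proof -
    obtain C \<theta> where *: "0 \<le> \<theta>" "\<theta> < 1"
      "\<And>n s y. \<bar>s\<bar> \<le> max R \<bar>x\<bar> \<Longrightarrow> \<bar>y\<bar> \<le> max R \<bar>x\<bar> \<Longrightarrow> \<bar>nder p (D n y) s\<bar> \<le> C * \<theta> ^ n"
      using geo[of "max R \<bar>x\<bar>" p] by blast
    have "summable (\<lambda>n. C * \<theta> ^ n)" using * by (intro summable_mult summable_geometric) auto
    with * show ?thesis by (intro exI[of _ "\<lambda>n. C * \<theta> ^ n"]) auto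
  qed
  note series = smooth_series[OF smD bound]
  have eq: "deriv (K s) x = dquot K 0 x s + (\<Sum>n. D n x s)" for s x
  proof -
    obtain B where B: "B \<ge> 0" "\<And>y. y \<in> {x..x+1} \<Longrightarrow> \<bar>nder 2 (K s) y\<bar> \<le> B"
    proof -
      obtain B where "\<And>y. x \<le> y \<Longrightarrow> y \<le> x+1 \<Longrightarrow> \<bar>nder 2 (K s) y\<bar> \<le> B"
        using nder_bounded_on_interval[OF regular2_smooth(1)[OF K]] by metis
      then show ?thesis by (intro that[of "\<bar>B\<bar>"]) (auto intro: order_trans[OF _ abs_ge_self])
    qed
    have "(\<lambda>n. dquot K n x s - deriv (K s) x) \<longlonglongrightarrow> 0"
    proof (rule Lim_null_comparison)
      show "eventually (\<lambda>n. norm (dquot K n x s - deriv (K s) x) \<le> B * (1/2) ^ n) sequentially"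
        using dquot_error[OF K B(2) B(1)] by auto
      show "(\<lambda>n. B * (1/2) ^ n) \<longlonglongrightarrow> 0"
        by (intro tendsto_mult_right_zero LIMSEQ_power_zero) auto
    qed
    then have "(\<lambda>n. dquot K n x s) \<longlonglongrightarrow> deriv (K s) x" by (simp add: LIM_zero_iff)
    from telescope_sums[OF this] have "(\<lambda>n. D n x s) sums (deriv (K s) x - dquot K 0 x s)"
      unfolding D_def .
    then show ?thesis by (simp add: sums_iff)
  qed
  have sm: "smooth_real (\<lambda>s. deriv (K s) x)" for x
    unfolding eq by (intro smooth_intros smooth_real_dquot K series(1))
  have "\<exists>B. \<forall>s x. \<bar>s\<bar> \<le> R \<longrightarrow> \<bar>x\<bar> \<le> R \<longrightarrow>
        \<bar>nder p (deriv (K s)) x\<bar> \<le> B \<and> \<bar>nder p (\<lambda>s. deriv (K s) x) s\<bar> \<le> B" for p R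
  proof -
    obtain C \<theta> where *: "0 \<le> \<theta>" "\<theta> < 1"
      "\<And>n s y. \<bar>s\<bar> \<le> R \<Longrightarrow> \<bar>y\<bar> \<le> R \<Longrightarrow> \<bar>nder p (D n y) s\<bar> \<le> C * \<theta> ^ n"
      using geo[of R p] by blast
    obtain B1 where B1: "B1 \<ge> 0"
      "\<And>s x. \<bar>s\<bar> \<le> R \<Longrightarrow> \<bar>x\<bar> \<le> R \<Longrightarrow> \<bar>nder (Suc p) (K s) x\<bar> \<le> B1"
      using regular2_bound[OF K, of R "Suc p"] by metis
    obtain B2 where B2: "B2 \<ge> 0"
      "\<And>s x. \<bar>s\<bar> \<le> R + 1 \<Longrightarrow> \<bar>x\<bar> \<le> R + 1 \<Longrightarrow> \<bar>nder p (\<lambda>s. K s x) s\<bar> \<le> B2"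
      using regular2_bound[OF K, of "R + 1" p] by metis
    have sumC: "summable (\<lambda>n. C * \<theta> ^ n)" using * by (intro summable_mult summable_geometric) auto
    have "\<bar>nder p (\<lambda>s. deriv (K s) x) s\<bar> \<le> 2 * B2 + (\<Sum>n. C * \<theta> ^ n)"
      if s: "\<bar>s\<bar> \<le> R" and x: "\<bar>x\<bar> \<le> R" for s x
    proof -
      have "nder p (\<lambda>s. deriv (K s) x) s = nder p (dquot K 0 x) s + (\<Sum>n. nder p (D n x) s)"
        unfolding eq by (subst nder_add[OF smooth_real_dquot[OF K] series(1)]) (simp add: series(2))
      moreover have "\<bar>nder p (dquot K 0 x) s\<bar> \<le> 2 * B2"
        using B2(2)[of s "x + 1"] B2(2)[of s x] s x unfolding nder_dquot[OF K] by simp linarith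
      moreover have "norm (\<Sum>n. nder p (D n x) s) \<le> (\<Sum>n. C * \<theta> ^ n)"
        by (rule norm_suminf_le[OF _ sumC]) (use *(3) s x in auto)
      ultimately show ?thesis by simp
    qed
    then show ?thesis
      using B1 by (intro exI[of _ "max B1 (2 * B2 + (\<Sum>n. C * \<theta> ^ n))"])
        (auto simp: nder_Suc le_max_iff_disj simp del: funpow.simps)
  qed
  then show ?thesis
    unfolding regular2_def
    using sm regular2_smooth(1)[OF K] smooth_real_deriv by auto
qed

lemma regular2_partial_fst:
  "regular2 K \<Longrightarrow> regular2 (\<lambda>s x. deriv (\<lambda>s. K s x) s)"
  using regular2_flip[OF regular2_partial[OF regular2_flip]] .

lemma regular2_nder: "regular2 K \<Longrightarrow> regular2 (\<lambda>s x. nder p (K s) x)"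
proof (induction p)
  case (Suc p)
  then show ?case using regular2_partial[of "\<lambda>s x. nder p (K s) x"] by simp
qed simp

text \<open>Changing the second argument of \<open>K\<close> contributes, by the mean value theorem, the partial derivative at
an intermediate point; that derivative is continuous because it is again regular.\<close>

lemma regular2_chain_rule:
  assumes K: "regular2 K" and a: "DERIV a t :> a'" and b: "DERIV b t :> b'"
  shows "DERIV (\<lambda>t. K (a t) (b t)) t :>
    deriv (\<lambda>s. K s (b t)) (a t) * a' + deriv (K (a t)) (b t) * b'"
proof -
  have ac: "a \<midarrow>t\<rightarrow> a t" and bc: "b \<midarrow>t\<rightarrow> b t"
    using DERIV_isCont[OF a] DERIV_isCont[OF b] by (auto simp: isCont_def)
  define \<eta> where "\<eta> = (\<lambda>u. SOME y. y \<in> closed_segment (b t) (b u) \<and>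
    K (a u) (b u) - K (a u) (b t) = deriv (K (a u)) y * (b u - b t))"
  have \<eta>: "\<eta> u \<in> closed_segment (b t) (b u) \<and>
    K (a u) (b u) - K (a u) (b t) = deriv (K (a u)) (\<eta> u) * (b u - b t)" for u
  proof -
    note d = smooth_real_has_derivative[OF regular2_smooth(1)[OF K, of "a u"]]
    have "\<exists>y. y \<in> closed_segment (b t) (b u) \<and>
      K (a u) (b u) - K (a u) (b t) = deriv (K (a u)) y * (b u - b t)"
    proof (cases "b t = b u")
      case False
      then consider "b t < b u" | "b u < b t" by linarith
      then show ?thesis
      proof cases
        case 1
        from MVT2[OF this, of "K (a u)" "deriv (K (a u))"] d obtain z where
          "b t < z" "z < b u" "K (a u) (b u) - K (a u) (b t) = (b u - b t) * deriv (K (a u)) z" by auto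
        then show ?thesis
          by (intro exI[of _ z]) (auto simp: closed_segment_eq_real_ivl)
      next
        case 2
        from MVT2[OF this, of "K (a u)" "deriv (K (a u))"] d obtain z where
          "b u < z" "z < b t" "K (a u) (b t) - K (a u) (b u) = (b t - b u) * deriv (K (a u)) z" by auto
        then show ?thesis
          by (intro exI[of _ z]) (auto simp: closed_segment_eq_real_ivl algebra_simps)
      qed
    qed auto
    then show ?thesis unfolding \<eta>_def by (rule someI_ex)
  qed
  have \<eta>c: "\<eta> \<midarrow>t\<rightarrow> b t"
  proof -
    have "(\<lambda>u. \<eta> u - b t) \<midarrow>t\<rightarrow> 0"
    proof (rule Lim_null_comparison)
      have "norm (\<eta> u - b t) \<le> \<bar>b u - b t\<bar>" for u
        using \<eta>[of u] by (auto simp: closed_segment_eq_real_ivl split: if_splits)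
      then show "\<forall>\<^sub>F u in at t. norm (\<eta> u - b t) \<le> \<bar>b u - b t\<bar>" by simp
      have "((\<lambda>u. \<bar>b u - b t\<bar>) \<longlongrightarrow> \<bar>b t - b t\<bar>) (at t)"
        by (intro tendsto_intros bc)
      then show "((\<lambda>u. \<bar>b u - b t\<bar>) \<longlongrightarrow> 0) (at t)" by simp
    qed
    then show ?thesis by (simp add: LIM_zero_iff)
  qed
  have "DERIV (\<lambda>u. K (a u) (b t)) t :> deriv (\<lambda>s. K s (b t)) (a t) * a'"
    by (rule DERIV_chain2[OF smooth_real_has_derivative[OF regular2_smooth(2)[OF K]] a])
  then have "((\<lambda>u. (K (a u) (b t) - K (a t) (b t)) / (u - t)) \<longlongrightarrow>
      deriv (\<lambda>s. K s (b t)) (a t) * a') (at t)"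
    by (simp add: has_field_derivative_iff)
  moreover have "((\<lambda>u. deriv (K (a u)) (\<eta> u) * ((b u - b t) / (u - t))) \<longlongrightarrow>
      deriv (K (a t)) (b t) * b') (at t)"
    using b by (intro tendsto_mult regular2_tendsto[OF regular2_partial[OF K]] ac \<eta>c)
      (simp add: has_field_derivative_iff)
  ultimately have "((\<lambda>u. (K (a u) (b t) - K (a t) (b t)) / (u - t) +
      deriv (K (a u)) (\<eta> u) * ((b u - b t) / (u - t))) \<longlongrightarrow>
      deriv (\<lambda>s. K s (b t)) (a t) * a' + deriv (K (a t)) (b t) * b') (at t)"
    by (rule tendsto_add)
  moreover have "(K (a u) (b t) - K (a t) (b t)) / (u - t) +
      deriv (K (a u)) (\<eta> u) * ((b u - b t) / (u - t)) = (K (a u) (b u) - K (a t) (b t)) / (u - t)" for u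
    using \<eta>[of u] by (simp add: add_divide_distrib[symmetric])
  ultimately show ?thesis by (simp add: has_field_derivative_iff)
qed

lemma regular2_imp_smooth2:
  assumes "regular2 K"
  shows "smooth2 K"
proof -
  have "diff_upto n (\<lambda>t. K (a t) (b t))" if "regular2 K" "smooth_real a" "smooth_real b" for n a b K
    using that(1)
  proof (induction n arbitrary: K)
    case (Suc n)
    have ab: "diff_upto n (deriv a)" "diff_upto n (deriv b)"
      using smooth_real_deriv that smooth_real_iff_diff_upto by blast+
    show ?case
      by (rule diff_upto_SucI[OF regular2_chain_rule[OF Suc.prems
            smooth_real_has_derivative[OF that(2)] smooth_real_has_derivative[OF that(3)]]])
        (intro diff_upto_add diff_upto_mult ab Suc.IH[OF regular2_partial_fst[OF Suc.prems]]
            Suc.IH[OF regular2_partial[OF Suc.prems]])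
  qed simp
  then show ?thesis using assms unfolding smooth2_def smooth_real_iff_diff_upto by blast
qed

subsection \<open>Smoothness along curves\<close>

text \<open>Any sequence of segments that shrinks fast enough lies on one smooth curve: segment number \<open>n\<close>
  is traversed around the time \<open>2\<^bsup>-n\<^esup>\<close>, cut off by a bump.\<close>

lemma curve_through_segments:
  assumes \<alpha>: "\<And>n. \<bar>\<alpha> n\<bar> \<le> inverse (fact n)" and \<beta>: "\<And>n. \<bar>\<beta> n\<bar> \<le> inverse (fact n)"
  shows "\<exists>c. smooth_real c \<and>
    (\<forall>n t. \<bar>t - (1/2) ^ n\<bar> \<le> (1/2) ^ (n + 3) \<longrightarrow> c t = \<alpha> n + \<beta> n * (t - (1/2) ^ n))"
proof -
  define b1 where "b1 = (\<lambda>x. x * bump x)"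
  have b1: "smooth_real b1" "\<bar>x\<bar> \<ge> 1 \<Longrightarrow> b1 x = 0" "\<bar>x\<bar> \<le> 1/2 \<Longrightarrow> b1 x = x" for x
    unfolding b1_def by (auto intro!: smooth_intros simp: bump_eq)
  \<comment> \<open>The argument \<open>2\<^bsup>n+2\<^esup> t - 4\<close> of the bump is \<open>(t - 2\<^sup>-\<^sup>n) / 2\<^bsup>-n-2\<^esup>\<close>; these radii make the supports disjoint from
    the plateaus of the other bumps.\<close>
  define f where "f = (\<lambda>n t. \<alpha> n * bump (2 ^ (n + 2) * t + (-4)) +
    (\<beta> n / 2 ^ (n + 2)) * b1 (2 ^ (n + 2) * t + (-4)))"
  have sm0: "smooth_real (\<lambda>t. bump (2 ^ (n + 2) * t + (-4)))"
    "smooth_real (\<lambda>t. b1 (2 ^ (n + 2) * t + (-4)))" for n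
    by (rule smooth_real_compose[OF smooth_real_bump] smooth_real_compose[OF b1(1)];
        intro smooth_intros)+
  have sm: "smooth_real (f n)" for n
    unfolding f_def by (intro smooth_intros sm0)
  have bound: "\<exists>M. summable M \<and> (\<forall>n t. \<bar>t\<bar> \<le> R \<longrightarrow> \<bar>nder k (f n) t\<bar> \<le> M n)" for k R
  proof -
    obtain B where B: "\<And>x. \<bar>nder k bump x\<bar> \<le> B" "B \<ge> 0"
      using nder_bounded_compact_support[OF smooth_real_bump bump_eq(2)] by metis
    obtain B' where B': "\<And>x. \<bar>nder k b1 x\<bar> \<le> B'" "B' \<ge> 0"
      using nder_bounded_compact_support[OF b1(1) b1(2)] by metis
    define M where "M = (\<lambda>n. (4 ^ k * (B + B')) * (inverse (fact n) * (2 ^ k :: real) ^ n))"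
    have "summable M" unfolding M_def by (intro summable_mult summable_exp)
    moreover have "\<bar>nder k (f n) t\<bar> \<le> M n" for n t
    proof -
      let ?y = "2 ^ (n + 2) * t + (-4)"
      have nd: "nder k (f n) t = \<alpha> n * ((2 ^ (n + 2)) ^ k * nder k bump ?y) +
          (\<beta> n / 2 ^ (n + 2)) * ((2 ^ (n + 2)) ^ k * nder k b1 ?y)"
      proof -
        have "smooth_real (\<lambda>t. \<alpha> n * bump (2 ^ (n + 2) * t + (-4)))"
          "smooth_real (\<lambda>t. (\<beta> n / 2 ^ (n + 2)) * b1 (2 ^ (n + 2) * t + (-4)))"
          by (intro smooth_intros sm0)+
        from nder_add[OF this] show ?thesis unfolding f_def
          by (simp only: nder_cmult[OF sm0(1)] nder_cmult[OF sm0(2)]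
              nder_affine[OF smooth_real_bump] nder_affine[OF b1(1)])
      qed
      have "\<bar>nder k (f n) t\<bar> \<le> \<bar>\<alpha> n\<bar> * ((2 ^ (n + 2)) ^ k * B) + \<bar>\<beta> n / 2 ^ (n + 2)\<bar> * ((2 ^ (n + 2)) ^ k * B')"
        unfolding nd by (rule order_trans[OF abs_triangle_ineq], unfold abs_mult)
          (intro add_mono mult_left_mono, auto simp: B B')
      also have "\<dots> \<le> inverse (fact n) * ((2 ^ (n + 2)) ^ k * B) + inverse (fact n) * ((2 ^ (n + 2)) ^ k * B')"
      proof (intro add_mono mult_right_mono \<alpha>)
        have "\<bar>\<beta> n / 2 ^ (n + 2)\<bar> = \<bar>\<beta> n\<bar> / 2 ^ (n + 2)" by (simp add: abs_divide)
        also have "\<dots> \<le> \<bar>\<beta> n\<bar> / 1" by (intro divide_left_mono one_le_power) auto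
        finally show "\<bar>\<beta> n / 2 ^ (n + 2)\<bar> \<le> inverse (fact n)" using \<beta>[of n] by simp
      qed (use B B' in auto)
      also have "\<dots> = inverse (fact n) * ((2 ^ (n + 2)) ^ k * (B + B'))" by (simp add: algebra_simps)
      also have "((2::real) ^ (n + 2)) ^ k = 4 ^ k * (2 ^ k) ^ n"
        by (simp add: power_add power_mult_distrib power_mult[symmetric] mult.commute)
      finally show ?thesis by (simp add: M_def mult_ac)
    qed
    ultimately show ?thesis by blast
  qed
  define c where "c = (\<lambda>t. \<Sum>n. f n t)"
  have smc: "smooth_real c" unfolding c_def by (rule smooth_series(1)[OF sm bound])
  have "c t = \<alpha> n + \<beta> n * (t - (1/2) ^ n)" if t: "\<bar>t - (1/2) ^ n\<bar> \<le> (1/2) ^ (n + 3)" for n t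
  proof -
    have tn: "7/8 * (1/2) ^ n \<le> t" "t \<le> 9/8 * (1/2) ^ n"
    proof -
      have "\<bar>t - (1/2) ^ n\<bar> \<le> 1/8 * (1/2) ^ n" using t by (simp add: power_add power3_eq_cube)
      then show "7/8 * (1/2) ^ n \<le> t" "t \<le> 9/8 * (1/2) ^ n" by linarith+
    qed
    have "f m t = 0" if "m \<noteq> n" for m
    proof -
      have pm: "(2::real) ^ m * (1/2) ^ m = 1" by (simp add: power_mult_distrib[symmetric])
      have "\<bar>2 ^ (m + 2) * t + (-4)\<bar> \<ge> 1"
      proof (cases "m < n")
        case True
        have "(1/2::real) ^ n \<le> (1/2) ^ Suc m" using True by (intro power_decreasing) auto
        then have "t \<le> 9/16 * (1/2) ^ m" using tn by simp
        then have "2 ^ m * t \<le> 2 ^ m * (9/16 * (1/2) ^ m)" by (intro mult_left_mono) auto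
        also have "\<dots> = 9/16 * (2 ^ m * (1/2) ^ m)" by simp
        also have "\<dots> = 9/16" by (simp only: pm)
        finally show ?thesis by (simp add: power_add)
      next
        case False
        then have "(1/2::real) ^ m \<le> (1/2) ^ Suc n" using \<open>m \<noteq> n\<close> by (intro power_decreasing) auto
        then have "t \<ge> 7/4 * (1/2) ^ m" using tn by simp
        then have "2 ^ m * (7/4 * (1/2) ^ m) \<le> 2 ^ m * t" by (intro mult_left_mono) auto
        moreover have "2 ^ m * (7/4 * (1/2) ^ m) = 7/4 * (2 ^ m * (1/2::real) ^ m)" by simp
        ultimately have "7/4 \<le> 2 ^ m * t" by (simp only: pm)
        then show ?thesis by (simp add: power_add)
      qed
      then show ?thesis unfolding f_def using bump_eq(2) b1(2) by simp
    qed
    then have "c t = f n t" unfolding c_def by (subst suminf_finite[of "{n}"]) auto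
    also have "\<dots> = \<alpha> n + \<beta> n * (t - (1/2) ^ n)"
    proof -
      have p: "(2::real) ^ n * (1/2) ^ n = 1" by (simp add: power_mult_distrib[symmetric])
      have y: "2 ^ (n + 2) * t + (-4) = 2 ^ (n + 2) * (t - (1/2) ^ n)"
      proof -
        have "2 ^ (n + 2) * (t - (1/2) ^ n) = 2 ^ (n + 2) * t - 4 * (2 ^ n * (1/2) ^ n)"
          by (simp add: algebra_simps power_add)
        then show ?thesis by (simp only: p)
      qed
      have "\<bar>2 ^ (n + 2) * (t - (1/2) ^ n)\<bar> \<le> 2 ^ (n + 2) * (1/2) ^ (n + 3)"
        unfolding abs_mult using t by (auto intro: mult_left_mono)
      also have "\<dots> = (2 ^ n * (1/2) ^ n) * (1/2::real)"
        by (simp add: power_add power3_eq_cube)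
      also have "\<dots> = 1/2" by (simp only: p)
      finally have "bump (2 ^ (n + 2) * (t - (1/2) ^ n)) = 1"
        "b1 (2 ^ (n + 2) * (t - (1/2) ^ n)) = 2 ^ (n + 2) * (t - (1/2) ^ n)"
        using bump_eq(1) b1(3) by auto
      then show ?thesis unfolding f_def y by simp
    qed
    finally show ?thesis .
  qed
  then show ?thesis using smc by blast
qed

lemma smooth2D:
  "smooth2 K \<Longrightarrow> smooth_real a \<Longrightarrow> smooth_real b \<Longrightarrow> smooth_real (\<lambda>t. K (a t) (b t))"
  unfolding smooth2_def by blast

lemma smooth2_smooth:
  assumes "smooth2 K"
  shows "smooth_real (K s)" "smooth_real (\<lambda>s. K s x)"
  using smooth2D[OF assms smooth_real_const[of s] smooth_real_ident]
    smooth2D[OF assms smooth_real_ident smooth_real_const[of x]] by simp_all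

text \<open>If the derivatives of order \<open>p\<close> in the second variable were unbounded near a point, a smooth curve
could be led through a sequence of points with derivatives larger than \<open>n (n!)\<^sup>p\<close>, with velocity
\<open>1/n!\<close> in the second direction. Along this curve the derivative of order \<open>p\<close> exceeds \<open>n\<close> in
absolute value at the time \<open>2\<^sup>-\<^sup>n\<close>, for every \<open>n\<close>, and so it is unbounded on \<open>[0, 1]\<close>.\<close>

lemma smooth2_locally_bounded:
  assumes K: "smooth2 K"
  shows "\<exists>r>0. \<exists>B. \<forall>s x. \<bar>s - s0\<bar> \<le> r \<longrightarrow> \<bar>x - x0\<bar> \<le> r \<longrightarrow> \<bar>nder p (K s) x\<bar> \<le> B"
proof (rule ccontr)
  assume neg: "\<not> ?thesis"
  have "\<exists>s x. \<bar>s - s0\<bar> \<le> inverse (fact n) \<and> \<bar>x - x0\<bar> \<le> inverse (fact n) \<and>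
      \<bar>nder p (K s) x\<bar> > real n * fact n ^ p" for n
  proof (rule ccontr)
    assume "\<not> ?thesis"
    then have "\<forall>s x. \<bar>s - s0\<bar> \<le> inverse (fact n) \<longrightarrow> \<bar>x - x0\<bar> \<le> inverse (fact n) \<longrightarrow>
      \<bar>nder p (K s) x\<bar> \<le> real n * fact n ^ p" by (meson not_le)
    moreover have "inverse (fact n) > (0::real)" by simp
    ultimately show False using neg by blast
  qed
  then obtain s x where sx: "\<And>n. \<bar>s n - s0\<bar> \<le> inverse (fact n)" "\<And>n. \<bar>x n - x0\<bar> \<le> inverse (fact n)"
      "\<And>n. \<bar>nder p (K (s n)) (x n)\<bar> > real n * fact n ^ p" by metis
  obtain c where c: "smooth_real c" "\<And>n t. \<bar>t - (1/2) ^ n\<bar> \<le> (1/2) ^ (n + 3) \<Longrightarrow>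
      c t = (s n - s0) + 0 * (t - (1/2) ^ n)"
    using curve_through_segments[of "\<lambda>n. s n - s0" "\<lambda>_. 0"] sx(1) by auto
  obtain d where d: "smooth_real d" "\<And>n t. \<bar>t - (1/2) ^ n\<bar> \<le> (1/2) ^ (n + 3) \<Longrightarrow>
      d t = (x n - x0) + inverse (fact n) * (t - (1/2) ^ n)"
    using curve_through_segments[of "\<lambda>n. x n - x0" "\<lambda>n. inverse (fact n)"] sx(2) by auto
  define F where "F = (\<lambda>t. K (s0 + c t) (x0 + d t))"
  have F: "smooth_real F"
  proof -
    have "smooth_real (\<lambda>t. s0 + c t)" "smooth_real (\<lambda>t. x0 + d t)"
      by (intro smooth_intros c d)+
    then show ?thesis using K unfolding smooth2_def F_def by blast
  qed
  note Kn = smooth2_smooth(1)[OF K]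
  obtain B where B: "\<And>t. 0 \<le> t \<Longrightarrow> t \<le> 1 \<Longrightarrow> \<bar>nder p F t\<bar> \<le> B"
    using nder_bounded_on_interval[OF F] by metis
  obtain n where n: "real n > B" using reals_Archimedean2 by blast
  let ?t = "(1/2::real) ^ n" and ?i = "inverse (fact n) :: real"
  have "nder p F ?t = nder p (\<lambda>t. K (s n) (?i * t + (x n - ?i * ?t))) ?t"
  proof (rule nder_cong_open)
    show "open {?t - (1/2) ^ (n + 3)<..<?t + (1/2) ^ (n + 3)}" by simp
    show "?t \<in> {?t - (1/2) ^ (n + 3)<..<?t + (1/2) ^ (n + 3)}" by simp
    fix t assume "t \<in> {?t - (1/2) ^ (n + 3)<..<?t + (1/2) ^ (n + 3)}"
    then have "\<bar>t - ?t\<bar> \<le> (1/2) ^ (n + 3)" by (auto simp: abs_le_iff)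
    from c(2)[OF this] d(2)[OF this]
    have e: "s0 + c t = s n" "x0 + d t = ?i * t + (x n - ?i * ?t)"
      by (simp_all add: right_diff_distrib)
    show "F t = K (s n) (?i * t + (x n - ?i * ?t))"
      unfolding F_def e ..
  qed
  also have "\<dots> = ?i ^ p * nder p (K (s n)) (x n)"
    unfolding nder_affine[OF Kn] by simp
  finally have "\<bar>nder p F ?t\<bar> = ?i ^ p * \<bar>nder p (K (s n)) (x n)\<bar>" by (simp add: abs_mult)
  also have "\<dots> \<ge> ?i ^ p * (real n * fact n ^ p)"
    using sx(3)[of n] by (intro mult_left_mono) auto
  also have "?i ^ p * (real n * fact n ^ p) = real n" by (simp add: power_inverse)
  finally have "real n \<le> B" using B[of ?t] by (simp add: power_le_one)
  then show False using n by simp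
qed

lemma smooth2_bounded:
  assumes K: "smooth2 K"
  shows "\<exists>B. \<forall>s x. \<bar>s\<bar> \<le> R \<longrightarrow> \<bar>x\<bar> \<le> R \<longrightarrow> \<bar>nder p (K s) x\<bar> \<le> B"
proof (rule ccontr)
  assume neg: "\<nexists>B. \<forall>s x. \<bar>s\<bar> \<le> R \<longrightarrow> \<bar>x\<bar> \<le> R \<longrightarrow> \<bar>nder p (K s) x\<bar> \<le> B"
  have "\<exists>z\<in>{-R..R} \<times> {-R..R}. \<bar>nder p (K (fst z)) (snd z)\<bar> > real n" for n :: nat
  proof -
    obtain s x where "\<bar>s\<bar> \<le> R" "\<bar>x\<bar> \<le> R" "\<bar>nder p (K s) x\<bar> > real n"
      using neg by (meson not_le)
    then show ?thesis by (intro bexI[of _ "(s, x)"]) auto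
  qed
  then obtain z where z: "\<And>n::nat. z n \<in> {-R..R} \<times> {-R..R}"
    "\<And>n. \<bar>nder p (K (fst (z n))) (snd (z n))\<bar> > real n" by metis
  have "compact ({-R..R} \<times> {-R..R})" by (intro compact_Times) auto
  then obtain l r where r: "strict_mono (r :: nat \<Rightarrow> nat)" "(z \<circ> r) \<longlonglongrightarrow> l"
    using z(1) unfolding compact_def by metis
  obtain e B where e: "e > 0" "\<And>s x. \<bar>s - fst l\<bar> \<le> e \<Longrightarrow> \<bar>x - snd l\<bar> \<le> e \<Longrightarrow> \<bar>nder p (K s) x\<bar> \<le> B"
    using smooth2_locally_bounded[OF K, of "fst l" "snd l" p] by blast
  have "eventually (\<lambda>n. dist ((z \<circ> r) n) l < e) sequentially"
    using tendstoD[OF r(2) e(1)] .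
  moreover have "eventually (\<lambda>n. real n > B) sequentially"
    using filterlim_real_sequentially by (auto simp: filterlim_at_top_dense)
  ultimately have "eventually (\<lambda>n. False) sequentially"
  proof eventually_elim
    case (elim n)
    have "\<bar>fst (z (r n)) - fst l\<bar> \<le> e" "\<bar>snd (z (r n)) - snd l\<bar> \<le> e"
      using elim(1) dist_fst_le[of "z (r n)" l] dist_snd_le[of "z (r n)" l]
      by (auto simp: dist_real_def)
    from e(2)[OF this] z(2)[of "r n"] have "real (r n) < B" by linarith
    moreover have "real n \<le> real (r n)" using seq_suble[OF r(1), of n] by simp
    ultimately show False using elim(2) by linarith
  qed
  then show False by simp
qed

text \<open>The two-dimensional case of Boman's theorem. Smoothness along curves gives the bounds on the
  derivatives in the coordinate directions. Conversely, these bounds pass to the partial derivatives,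
  so that the chain rule can be iterated.\<close>

theorem smooth2_iff_regular2: "smooth2 K \<longleftrightarrow> regular2 K"
proof
  assume K: "smooth2 K"
  note sm = smooth2_smooth[OF K]
  have "\<exists>B. \<forall>s x. \<bar>s\<bar> \<le> R \<longrightarrow> \<bar>x\<bar> \<le> R \<longrightarrow>
        \<bar>nder p (K s) x\<bar> \<le> B \<and> \<bar>nder p (\<lambda>s. K s x) s\<bar> \<le> B" for p R
  proof -
    obtain B where B: "\<And>s x. \<bar>s\<bar> \<le> R \<Longrightarrow> \<bar>x\<bar> \<le> R \<Longrightarrow> \<bar>nder p (K s) x\<bar> \<le> B"
      using smooth2_bounded[OF K] by metis
    obtain B' where B': "\<And>s x. \<bar>s\<bar> \<le> R \<Longrightarrow> \<bar>x\<bar> \<le> R \<Longrightarrow> \<bar>nder p (\<lambda>s. K s x) s\<bar> \<le> B'"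
      using smooth2_bounded[OF smooth2_flip[OF K]] by metis
    show ?thesis using B B'
      by (intro exI[of _ "max B B'"]) (auto simp: le_max_iff_disj)
  qed
  then show "regular2 K" using sm unfolding regular2_def by blast
qed (rule regular2_imp_smooth2)

subsection \<open>The quotient in Hadamard's lemma\<close>

lemma regular2_integral:
  assumes "regular2 L"
  shows "smooth_real (\<lambda>t. integral {0..1} (\<lambda>\<tau>. L \<tau> t))"
proof -
  have "diff_upto n (\<lambda>t. integral {0..1} (\<lambda>\<tau>. L \<tau> t))" if "regular2 L" for n L
    using that
  proof (induction n arbitrary: L)
    case (Suc n)
    note L' = regular2_partial[OF Suc.prems]
    have d: "((\<lambda>t. integral (cbox 0 1) (\<lambda>\<tau>. L \<tau> t)) has_real_derivative
        integral (cbox 0 1) (\<lambda>\<tau>. deriv (L \<tau>) t)) (at t within UNIV)" for t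
    proof (rule leibniz_rule_field_derivative[where U=UNIV])
      show "((\<lambda>t. L \<tau> t) has_real_derivative deriv (L \<tau>) t) (at t within UNIV)" for t \<tau>
        using smooth_real_has_derivative[OF regular2_smooth(1)[OF Suc.prems]] by simp
      show "(\<lambda>\<tau>. L \<tau> t) integrable_on cbox 0 1" for t
        by (intro integrable_continuous smooth_real_continuous regular2_smooth(2)[OF Suc.prems])
      show "continuous_on (UNIV \<times> cbox 0 1) (\<lambda>(t, \<tau>). deriv (L \<tau>) t)"
        using regular2_continuous[OF regular2_flip[OF L']] by (simp add: case_prod_beta)
    qed auto
    show ?case
      by (rule diff_upto_SucI[OF _ Suc.IH[OF L']]) (use d in simp)
  qed simp
  then show ?thesis using assms unfolding smooth_real_iff_diff_upto by blast
qed

text \<open>The quotient \<open>f(s)/s\<close>, for a function with \<open>f(0) = 0\<close>, with its limit as value at \<open>0\<close>.\<close>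

definition hquot :: "(real \<Rightarrow> real) \<Rightarrow> real \<Rightarrow> real" where
  "hquot f s = (if s = 0 then deriv f 0 else f s / s)"

lemma hquot_mult: "f 0 = 0 \<Longrightarrow> s * hquot f s = f s"
  by (simp add: hquot_def)

lemma hquot_integral:
  assumes f: "smooth_real f" and "f 0 = 0"
  shows "hquot f s = integral {0..1} (\<lambda>\<tau>. deriv f (\<tau> * s))"
proof (cases "s = 0")
  case False
  have "((\<lambda>\<tau>. deriv f (\<tau> * s)) has_integral (f (1 * s) / s - f (0 * s) / s)) {0..1}"
  proof (rule fundamental_theorem_of_calculus)
    fix \<tau> :: real
    have "((\<lambda>\<tau>. f (\<tau> * s)) has_real_derivative deriv f (\<tau> * s) * s) (at \<tau>)"
      by (rule DERIV_chain2[OF smooth_real_has_derivative[OF f]]) (auto intro!: derivative_eq_intros)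
    from DERIV_cdivide[OF this, of s]
    have "((\<lambda>\<tau>. f (\<tau> * s) / s) has_real_derivative deriv f (\<tau> * s)) (at \<tau>)"
      using False by simp
    then show "((\<lambda>\<tau>. f (\<tau> * s) / s) has_vector_derivative deriv f (\<tau> * s)) (at \<tau> within {0..1})"
      by (simp add: has_real_derivative_iff_has_vector_derivative has_vector_derivative_at_within)
  qed simp
  then show ?thesis using False assms by (simp add: hquot_def integral_unique)
qed (simp add: hquot_def)

lemma smooth2_hquot:
  assumes K: "smooth2 K" and 0: "\<And>y. K 0 y = 0"
  shows "smooth2 (\<lambda>x y. hquot (\<lambda>x. K x y) x)"
  unfolding smooth2_def
proof (intro allI impI)
  fix a b assume ab: "smooth_real a" "smooth_real b"
  define L where "L = (\<lambda>\<tau> t. deriv (\<lambda>x. K x (b t)) (\<tau> * a t))"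
  have "smooth2 L"
    unfolding smooth2_def L_def
  proof (intro allI impI)
    fix c d assume cd: "smooth_real c" "smooth_real d"
    have "smooth2 (\<lambda>x y. deriv (\<lambda>x. K x y) x)"
      using K regular2_partial_fst unfolding smooth2_iff_regular2 by blast
    moreover have "smooth_real (\<lambda>t. c t * a (d t))" "smooth_real (\<lambda>t. b (d t))"
      using ab cd by (auto intro: smooth_intros smooth_real_compose)
    ultimately show "smooth_real (\<lambda>t. deriv (\<lambda>x. K x (b (d t))) (c t * a (d t)))"
      unfolding smooth2_def by blast
  qed
  then have "smooth_real (\<lambda>t. integral {0..1} (\<lambda>\<tau>. L \<tau> t))"
    by (intro regular2_integral) (simp add: smooth2_iff_regular2)
  then show "smooth_real (\<lambda>t. hquot (\<lambda>x. K x (b t)) (a t))"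
    unfolding L_def using hquot_integral[OF smooth2_smooth(2)[OF K] 0] by simp
qed

subsection \<open>Detecting smooth families by functionals\<close>

text \<open>A gliding hump: weights \<open>e\<^sub>k\<close> and indices \<open>i\<^sub>k\<close>, \<open>x\<^sub>k\<close> are chosen such that the \<open>k\<close>-th summand of
  \<open>\<Sum>e\<^sub>j f(i\<^sub>k, x\<^sub>j)\<close> dominates all other ones. The earlier summands are bounded in \<open>i\<close>; the
  later ones are small because their weights are chosen after \<open>i\<^sub>k\<close>.\<close>

lemma uniform_boundedness_l1:
  fixes f :: "'i \<Rightarrow> 'x \<Rightarrow> real"
  assumes bi: "\<And>i. i \<in> I \<Longrightarrow> \<exists>B. \<forall>x\<in>X. \<bar>f i x\<bar> \<le> B"
    and weak: "\<And>a x. summable (\<lambda>n. \<bar>a n\<bar>) \<Longrightarrow> (\<And>n. x n \<in> X) \<Longrightarrow>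
      \<exists>B. \<forall>i\<in>I. \<bar>\<Sum>n. a n * f i (x n)\<bar> \<le> B"
  shows "\<exists>B. \<forall>i\<in>I. \<forall>x\<in>X. \<bar>f i x\<bar> \<le> B"
proof (rule ccontr)
  assume "\<not> ?thesis"
  then have unb: "\<exists>i\<in>I. \<exists>x\<in>X. \<bar>f i x\<bar> > B" for B by (meson not_le)
  have "\<exists>B\<ge>0. \<forall>i\<in>I. \<bar>f i x\<bar> \<le> B" if "x \<in> X" for x
  proof -
    let ?a = "\<lambda>n::nat. if n = 0 then 1 else 0 :: real"
    have "summable (\<lambda>n. \<bar>?a n\<bar>)" by (rule summable_finite[of "{0}"]) auto
    then have "\<exists>B. \<forall>i\<in>I. \<bar>\<Sum>n. ?a n * f i x\<bar> \<le> B"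
      by (rule weak) (rule that)
    then obtain B where B: "\<forall>i\<in>I. \<bar>\<Sum>n. ?a n * f i x\<bar> \<le> B" by blast
    have "(\<Sum>n. ?a n * f i x) = f i x" for i by (subst suminf_finite[of "{0}"]) auto
    then show ?thesis using B by (intro exI[of _ "\<bar>B\<bar>"]) auto
  qed
  then obtain P where P: "\<And>x. x \<in> X \<Longrightarrow> P x \<ge> 0" "\<And>x i. x \<in> X \<Longrightarrow> i \<in> I \<Longrightarrow> \<bar>f i x\<bar> \<le> P x"
    by metis
  have "\<exists>B\<ge>0. \<forall>x\<in>X. \<bar>f i x\<bar> \<le> B" if "i \<in> I" for i
    using bi[OF that] by (metis abs_ge_self abs_ge_zero order_trans)
  then obtain Q where Q: "\<And>i. i \<in> I \<Longrightarrow> Q i \<ge> 0" "\<And>x i. x \<in> X \<Longrightarrow> i \<in> I \<Longrightarrow> \<bar>f i x\<bar> \<le> Q i"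
    by metis
  define good where "good = (\<lambda>k (e, i, x, S). 0 < e \<and> e \<le> (1::real) \<and> i \<in> I \<and> x \<in> X \<and> 0 \<le> S \<and>
    e * \<bar>f i x\<bar> > real k + 1 + S)"
  define nxt where "nxt = (\<lambda>(e, i, x, S) (e', i'::'i, x'::'x, S'). e' = e / (2 * (1 + Q i)) \<and> S' = S + e * P x)"
  have step: "\<exists>i\<in>I. \<exists>x\<in>X. e * \<bar>f i x\<bar> > B" if "e > 0" for e B
  proof -
    obtain i x where "i \<in> I" "x \<in> X" "\<bar>f i x\<bar> > B / e" using unb by blast
    then show ?thesis using that by (auto simp: field_simps intro!: bexI[of _ i] bexI[of _ x])
  qed
  have "\<exists>st. \<forall>n. good n (st n) \<and> nxt (st n) (st (Suc n))"
  proof (rule dependent_nat_choice)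
    obtain i x where "i \<in> I" "x \<in> X" "1 * \<bar>f i x\<bar> > real 0 + 1 + 0" using step[of 1 "real 0 + 1 + 0", OF zero_less_one] by blast
    then show "\<exists>u. good 0 u" by (intro exI[of _ "(1, i, x, 0)"]) (auto simp: good_def)
  next
    fix u n assume "good n u"
    obtain e i x S where u: "u = (e, i, x, S)" by (cases u) auto
    have g: "0 < e" "e \<le> 1" "i \<in> I" "x \<in> X" "0 \<le> S" using \<open>good n u\<close> by (auto simp: good_def u)
    let ?e = "e / (2 * (1 + Q i))"
    have e: "0 < ?e" "?e \<le> 1" using g Q(1)[OF g(3)] by (auto simp: field_simps)
    obtain i' x' where "i' \<in> I" "x' \<in> X" "?e * \<bar>f i' x'\<bar> > real (Suc n) + 1 + (S + e * P x)"
      using step[OF e(1)] by blast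
    then show "\<exists>v. good (Suc n) v \<and> nxt u v"
      using e g P(1)[OF g(4)] by (intro exI[of _ "(?e, i', x', S + e * P x)"]) (auto simp: good_def nxt_def u)
  qed
  then obtain st where st: "\<And>n. good n (st n)" "\<And>n. nxt (st n) (st (Suc n))" by blast
  define e i x S where "e n = fst (st n)" and "i n = fst (snd (st n))"
    and "x n = fst (snd (snd (st n)))" and "S n = snd (snd (snd (st n)))" for n
  have g: "0 < e n" "e n \<le> 1" "i n \<in> I" "x n \<in> X" "0 \<le> S n" "e n * \<bar>f (i n) (x n)\<bar> > real n + 1 + S n" for n
    using st(1)[of n] by (auto simp: good_def e_def i_def x_def S_def case_prod_beta)
  have nx: "e (Suc n) = e n / (2 * (1 + Q (i n)))" "S (Suc n) = S n + e n * P (x n)" for n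
    using st(2)[of n] by (auto simp: nxt_def e_def i_def x_def S_def case_prod_beta)
  have half: "e (Suc n) \<le> e n / 2" for n
    unfolding nx using g(1)[of n] Q(1)[OF g(3)[of n]] by (intro divide_left_mono) auto
  have eQ: "e (Suc n) * Q (i n) \<le> 1 / 2" for n
  proof -
    have "e (Suc n) * Q (i n) = e n * (Q (i n) / (1 + Q (i n))) / 2" by (simp add: nx field_simps)
    also have "\<dots> \<le> 1 * 1 / 2"
      using g[of n] Q(1)[OF g(3)[of n]] by (intro divide_right_mono mult_mono) auto
    finally show ?thesis by simp
  qed
  have dec: "e (n + m) \<le> e n * (1/2) ^ m" for n m
  proof (induction m)
    case (Suc m)
    then show ?case using half[of "n + m"] by simp
  qed simp
  have sum_e: "summable (\<lambda>n. \<bar>e n\<bar>)"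
  proof (rule summable_comparison_test'[of "\<lambda>n. e 0 * (1/2) ^ n" 0])
    show "summable (\<lambda>n. e 0 * (1/2) ^ n)" by (intro summable_mult summable_geometric) auto
    show "norm \<bar>e n\<bar> \<le> e 0 * (1/2) ^ n" for n using dec[of 0 n] g(1)[of n] by simp
  qed
  then have "\<exists>B. \<forall>j\<in>I. \<bar>\<Sum>n. e n * f j (x n)\<bar> \<le> B" by (rule weak) (rule g(4))
  then obtain B where B: "\<And>j. j \<in> I \<Longrightarrow> \<bar>\<Sum>n. e n * f j (x n)\<bar> \<le> B" by blast
  obtain n where n: "real n > B" using reals_Archimedean2 by blast
  have S: "(\<Sum>j<n. e j * P (x j)) \<le> S n"
    using g(5)[of 0] by (induction n) (auto simp: nx)
  let ?g = "\<lambda>j. e j * f (i n) (x j)"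
  have tail: "norm (?g (m + Suc n)) \<le> 1/2 * (1/2) ^ m" for m
  proof -
    have "norm (?g (m + Suc n)) \<le> e (Suc n + m) * Q (i n)"
      using g[of "m + Suc n"] Q(2)[OF g(4) g(3)] by (simp add: abs_mult add.commute)
    also have "\<dots> \<le> e (Suc n) * (1/2) ^ m * Q (i n)"
      using dec[of "Suc n" m] Q(1)[OF g(3)] by (rule mult_right_mono)
    also have "\<dots> = e (Suc n) * Q (i n) * (1/2) ^ m" by simp
    also have "\<dots> \<le> 1/2 * (1/2) ^ m" using eQ by (intro mult_right_mono) auto
    finally show ?thesis .
  qed
  have sum_half: "summable (\<lambda>m. 1/2 * (1/2::real) ^ m)"
    by (intro summable_mult summable_geometric) auto
  have "summable (\<lambda>m. ?g (m + Suc n))"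
    by (rule summable_comparison_test'[OF sum_half, of 0]) (use tail in auto)
  then have sum_g: "summable ?g" by (subst (asm) summable_iff_shift)
  have "(\<Sum>m. 1/2 * (1/2::real) ^ m) = 1"
    by (subst suminf_mult) (auto simp: suminf_geometric intro: summable_geometric)
  with norm_suminf_le[OF tail sum_half] have t: "\<bar>\<Sum>m. ?g (m + Suc n)\<bar> \<le> 1" by simp
  have "\<bar>\<Sum>j<n. ?g j\<bar> \<le> (\<Sum>j<n. e j * P (x j))"
    by (rule order_trans[OF sum_abs], rule sum_mono)
      (use P(2)[OF g(4) g(3)] g(1)[THEN less_imp_le] in
        \<open>simp add: abs_mult abs_of_pos[OF g(1)] mult_left_mono\<close>)
  also have "\<dots> \<le> S n" by (rule S)
  finally have h: "\<bar>\<Sum>j<n. ?g j\<bar> \<le> S n" .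
  have "(\<Sum>j. ?g j) = (\<Sum>m. ?g (m + Suc n)) + ((\<Sum>j<n. ?g j) + ?g n)"
    using suminf_split_initial_segment[OF sum_g, of "Suc n"] by simp
  moreover have "\<bar>?g n\<bar> > real n + 1 + S n"
    using g[of n] by (simp add: abs_mult)
  ultimately have "\<bar>\<Sum>j. ?g j\<bar> > real n" using t h by linarith
  then show False using B[OF g(3)[of n]] n by linarith
qed

lemma fdiff_suminf:
  assumes "\<And>s. summable (\<lambda>n. a n * f n s)"
  shows "summable (\<lambda>n. a n * fdiff p d (f n) s) \<and>
    fdiff p d (\<lambda>s. \<Sum>n. a n * f n s) s = (\<Sum>n. a n * fdiff p d (f n) s)"
  using assms
proof (induction p arbitrary: f)
  case (Suc p)
  have "summable (\<lambda>n. a n * (f n (s + d) - f n s))" for s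
    unfolding right_diff_distrib by (intro summable_diff Suc.prems)
  from Suc.IH[of "\<lambda>n s. f n (s + d) - f n s", OF this]
  show ?case
    by (simp add: right_diff_distrib suminf_diff[OF Suc.prems Suc.prems])
qed auto

lemma fdiff_bounded_family:
  assumes "\<And>s. \<exists>B. \<forall>x\<in>X. \<bar>f x s\<bar> \<le> (B::real)"
  shows "\<exists>B. \<forall>x\<in>X. \<bar>fdiff p d (f x) s\<bar> \<le> B"
  using assms
proof (induction p arbitrary: f)
  case (Suc p)
  have "\<exists>B. \<forall>x\<in>X. \<bar>f x (s + d) - f x s\<bar> \<le> B" for s
  proof -
    obtain B B' where "\<forall>x\<in>X. \<bar>f x (s + d)\<bar> \<le> B" "\<forall>x\<in>X. \<bar>f x s\<bar> \<le> B'"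
      using Suc.prems by metis
    then show ?thesis by (intro exI[of _ "B + B'"]) (force intro: order_trans[OF abs_triangle_ineq4])
  qed
  from Suc.IH[OF this] show ?case by simp
qed auto

lemma abs_summable_mult_bounded:
  fixes a b :: "nat \<Rightarrow> real"
  assumes "summable (\<lambda>n. \<bar>a n\<bar>)" "\<And>n. \<bar>b n\<bar> \<le> B"
  shows "summable (\<lambda>n. a n * b n)"
proof (rule summable_comparison_test'[of "\<lambda>n. \<bar>a n\<bar> * B" 0])
  show "summable (\<lambda>n. \<bar>a n\<bar> * B)" using assms(1) by (rule summable_mult2)
  show "norm (a n * b n) \<le> \<bar>a n\<bar> * B" for n
    using assms(2) by (simp add: abs_mult mult_left_mono)
qed

text \<open>The functionals \<open>g \<mapsto> \<Sum>a\<^sub>n g\<^bsup>(q)\<^esup>(x\<^sub>n)\<close> suffice to recognize a smooth family of smooth functions. The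
derivatives in \<open>x\<close> are bounded by the uniform boundedness principle. It is not clear beforehand that
\<open>\<Sum>a\<^sub>n c(s)(x\<^sub>n)\<close> can be differentiated termwise in \<open>s\<close>; therefore the principle is applied to difference
quotients in \<open>s\<close>, which are finite combinations of values, and the increment is sent to \<open>0\<close> at the end.\<close>

theorem regular2_if_functionals_smooth:
  assumes sm: "\<And>s. smooth_real (c s)"
    and fn: "\<And>a x q R. summable (\<lambda>n. \<bar>a n\<bar>) \<Longrightarrow> (\<And>n. \<bar>x n\<bar> \<le> R) \<Longrightarrow>
      smooth_real (\<lambda>s. \<Sum>n. a n * nder q (c s) (x n))"
  shows "regular2 c"
proof -
  have smx: "smooth_real (\<lambda>s. c s x)" for x
  proof -
    let ?a = "\<lambda>n::nat. if n = 0 then 1 else 0 :: real"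
    have "summable (\<lambda>n. \<bar>?a n\<bar>)" by (rule summable_finite[of "{0}"]) auto
    then have "smooth_real (\<lambda>s. \<Sum>n. ?a n * nder 0 (c s) x)"
      using fn[of ?a "\<lambda>_. x" "\<bar>x\<bar>" 0] by simp
    moreover have "(\<Sum>n. ?a n * nder 0 (c s) x) = c s x" for s
      by (subst suminf_finite[of "{0}"]) auto
    ultimately show ?thesis by simp
  qed
  have bd: "\<exists>B. \<forall>x\<in>{-R..R}. \<bar>nder q (c s) x\<bar> \<le> B" for q s R
    using nder_bounded_on_interval[OF sm] by (metis atLeastAtMost_iff)
  have "\<exists>B. \<forall>s\<in>{-R..R}. \<forall>x\<in>{-R..R}. \<bar>nder q (c s) x\<bar> \<le> B" for q R
  proof (rule uniform_boundedness_l1[OF bd])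
    fix a x :: "nat \<Rightarrow> real"
    assume a: "summable (\<lambda>n. \<bar>a n\<bar>)" and "\<And>n::nat. x n \<in> {-R..R}"
    then have "\<And>n. \<bar>x n\<bar> \<le> R" by (auto simp: abs_le_iff minus_le_iff)
    with a have sm': "smooth_real (\<lambda>s. \<Sum>n. a n * nder q (c s) (x n))" by (rule fn)
    obtain B where
      "\<And>s. -R \<le> s \<Longrightarrow> s \<le> R \<Longrightarrow> \<bar>nder 0 (\<lambda>s. \<Sum>n. a n * nder q (c s) (x n)) s\<bar> \<le> B"
      using nder_bounded_on_interval[OF sm', where a="-R" and b=R and k=0] by blast
    then show "\<exists>B. \<forall>s\<in>{-R..R}. \<bar>\<Sum>n. a n * nder q (c s) (x n)\<bar> \<le> B"
      by (intro exI[of _ B]) simp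
  qed
  moreover have "\<exists>B. \<forall>s\<in>{-R..R}. \<forall>x\<in>{-R..R}. \<bar>nder p (\<lambda>s. c s x) s\<bar> \<le> B" for p R
  proof -
    let ?I = "{-R..R} \<times> {0<..1}"
    have "\<exists>B. \<forall>i\<in>?I. \<forall>x\<in>{-R..R}. \<bar>fdiff p (snd i) (\<lambda>s. c s x) (fst i) / snd i ^ p\<bar> \<le> B"
    proof (rule uniform_boundedness_l1)
      fix i :: "real \<times> real" assume i: "i \<in> ?I"
      obtain B where "\<forall>x\<in>{-R..R}. \<bar>fdiff p (snd i) (\<lambda>s. c s x) (fst i)\<bar> \<le> B"
        using fdiff_bounded_family[of "{-R..R}" "\<lambda>x s. c s x" p "snd i" "fst i"] bd[of R 0] by auto
      then show "\<exists>B. \<forall>x\<in>{-R..R}. \<bar>fdiff p (snd i) (\<lambda>s. c s x) (fst i) / snd i ^ p\<bar> \<le> B"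
        using i by (intro exI[of _ "B / snd i ^ p"]) (auto simp: abs_divide intro!: divide_right_mono)
    next
      fix a x :: "nat \<Rightarrow> real"
    assume a: "summable (\<lambda>n. \<bar>a n\<bar>)" and x: "\<And>n::nat. x n \<in> {-R..R}"
      define \<phi> where "\<phi> = (\<lambda>s. \<Sum>n. a n * c s (x n))"
      have "\<And>n. \<bar>x n\<bar> \<le> R" using x by (auto simp: abs_le_iff minus_le_iff)
      with a have "smooth_real (\<lambda>s. \<Sum>n. a n * nder 0 (c s) (x n))" by (rule fn)
      then have \<phi>: "smooth_real \<phi>" by (simp add: \<phi>_def)
      obtain B where B: "\<And>s. -R \<le> s \<Longrightarrow> s \<le> R + real p \<Longrightarrow> \<bar>nder p \<phi> s\<bar> \<le> B"
        using nder_bounded_on_interval[OF \<phi>] by metis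
      have "\<bar>\<Sum>n. a n * (fdiff p (snd i) (\<lambda>s. c s (x n)) (fst i) / snd i ^ p)\<bar> \<le> B"
        if i: "i \<in> ?I" for i
      proof -
        have "summable (\<lambda>n. a n * c s (x n))" for s
        proof -
          obtain B where "\<forall>x\<in>{-R..R}. \<bar>c s x\<bar> \<le> B" using bd[of R 0 s] by auto
          then show ?thesis using x by (intro abs_summable_mult_bounded[OF a]) auto
        qed
        from fdiff_suminf[of a "\<lambda>n s. c s (x n)", OF this]
        have *: "summable (\<lambda>n. a n * fdiff p (snd i) (\<lambda>s. c s (x n)) (fst i))"
          "fdiff p (snd i) \<phi> (fst i) = (\<Sum>n. a n * fdiff p (snd i) (\<lambda>s. c s (x n)) (fst i))"
          unfolding \<phi>_def by auto
        obtain \<xi> where \<xi>: "fst i \<le> \<xi>" "\<xi> \<le> fst i + real p * snd i"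
          "fdiff p (snd i) \<phi> (fst i) = snd i ^ p * nder p \<phi> \<xi>"
          using fdiff_mean_value[OF \<phi>, of "snd i" "fst i" p] i by auto
        have "real p * snd i \<le> real p * 1" using i by (intro mult_left_mono) auto
        then have "\<bar>nder p \<phi> \<xi>\<bar> \<le> B" using \<xi> i by (intro B) auto
        moreover have "(\<Sum>n. a n * (fdiff p (snd i) (\<lambda>s. c s (x n)) (fst i) / snd i ^ p)) = nder p \<phi> \<xi>"
          using suminf_divide[OF *(1), of "snd i ^ p"] i unfolding *(2)[symmetric] \<xi>(3) by auto
        ultimately show ?thesis by simp
      qed
      then show "\<exists>B. \<forall>i\<in>?I. \<bar>\<Sum>n. a n * (fdiff p (snd i) (\<lambda>s. c s (x n)) (fst i) / snd i ^ p)\<bar> \<le> B"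
        by blast
    qed
    then obtain B where B': "\<forall>i\<in>?I. \<forall>x\<in>{-R..R}. \<bar>fdiff p (snd i) (\<lambda>s. c s x) (fst i) / snd i ^ p\<bar> \<le> B"
      by blast
    have B: "\<bar>fdiff p d (\<lambda>s. c s x) s / d ^ p\<bar> \<le> B"
      if "s \<in> {-R..R}" "0 < d" "d \<le> 1" "x \<in> {-R..R}" for s d x
      using bspec[OF bspec[OF B', of "(s, d)"] that(4)] that by simp
    have "\<bar>nder p (\<lambda>s. c s x) s\<bar> \<le> B" if s: "s \<in> {-R..R}" and x: "x \<in> {-R..R}" for s x
    proof -
      define d where "d n = inverse (real (Suc n))" for n
      have d: "0 < d n" "d n \<le> 1" for n by (auto simp: d_def field_simps)
      have "\<exists>\<xi>. s \<le> \<xi> \<and> \<xi> \<le> s + real p * d n \<and>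
          fdiff p (d n) (\<lambda>s. c s x) s = d n ^ p * nder p (\<lambda>s. c s x) \<xi>" for n
        by (rule fdiff_mean_value[OF smx d(1)])
      then obtain \<xi> where \<xi>: "\<And>n. s \<le> \<xi> n" "\<And>n. \<xi> n \<le> s + real p * d n"
          "\<And>n. fdiff p (d n) (\<lambda>s. c s x) s = d n ^ p * nder p (\<lambda>s. c s x) (\<xi> n)" by metis
      have b: "\<bar>nder p (\<lambda>s. c s x) (\<xi> n)\<bar> \<le> B" for n
        using B[OF s d(1) d(2) x, of n] d(1)[of n] unfolding \<xi>(3) by simp
      have "(\<lambda>n. s + real p * d n) \<longlonglongrightarrow> s + real p * 0"
        unfolding d_def by (intro tendsto_intros LIMSEQ_inverse_real_of_nat)
      then have lim_d: "(\<lambda>n. s + real p * d n) \<longlonglongrightarrow> s" by simp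
      have lim: "\<xi> \<longlonglongrightarrow> s"
        by (rule real_tendsto_sandwich[OF _ _ tendsto_const lim_d]) (use \<xi> in auto)
      have "isCont (nder p (\<lambda>s. c s x)) s"
        using nder_has_derivative[OF smx] by (rule DERIV_isCont)
      then have "(\<lambda>n. \<bar>nder p (\<lambda>s. c s x) (\<xi> n)\<bar>) \<longlonglongrightarrow> \<bar>nder p (\<lambda>s. c s x) s\<bar>"
        by (intro tendsto_rabs isCont_tendsto_compose[OF _ lim])
      then show ?thesis by (rule LIMSEQ_le_const2) (use b in auto)
    qed
    then show ?thesis by blast
  qed
  ultimately have "\<exists>B. \<forall>s x. \<bar>s\<bar> \<le> R \<longrightarrow> \<bar>x\<bar> \<le> R \<longrightarrow>
        \<bar>nder p (c s) x\<bar> \<le> B \<and> \<bar>nder p (\<lambda>s. c s x) s\<bar> \<le> B" for p R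
  proof -
    obtain B B' where "\<forall>s\<in>{-R..R}. \<forall>x\<in>{-R..R}. \<bar>nder p (c s) x\<bar> \<le> B"
      "\<forall>s\<in>{-R..R}. \<forall>x\<in>{-R..R}. \<bar>nder p (\<lambda>s. c s x) s\<bar> \<le> B'"
      using \<open>\<And>q R. \<exists>B. \<forall>s\<in>{-R..R}. \<forall>x\<in>{-R..R}. \<bar>nder q (c s) x\<bar> \<le> B\<close>
        \<open>\<And>p R. \<exists>B. \<forall>s\<in>{-R..R}. \<forall>x\<in>{-R..R}. \<bar>nder p (\<lambda>s. c s x) s\<bar> \<le> B\<close> by meson
    then show ?thesis
      by (intro exI[of _ "max B B'"]) (auto simp: le_max_iff_disj abs_le_iff minus_le_iff)
  qed
  then show ?thesis unfolding regular2_def using sm smx by blast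
qed

text \<open>Conversely, these functionals are smooth along smooth families.\<close>

lemma smooth_weighted_sum_nder:
  assumes K: "smooth2 K" and a: "summable (\<lambda>n. \<bar>a n\<bar>)" and x: "\<And>n. \<bar>x n\<bar> \<le> R"
  shows "smooth_real (\<lambda>s. \<Sum>n. a n * nder q (K s) (x n))"
proof (rule smooth_series(1))
  have L: "regular2 (\<lambda>s x. nder q (K s) x)"
    using K regular2_nder unfolding smooth2_iff_regular2 by blast
  note sm = regular2_smooth(2)[OF L]
  show "smooth_real (\<lambda>s. a n * nder q (K s) (x n))" for n by (intro smooth_intros sm)
  show "\<exists>M. summable M \<and> (\<forall>n s. \<bar>s\<bar> \<le> R' \<longrightarrow> \<bar>nder k (\<lambda>s. a n * nder q (K s) (x n)) s\<bar> \<le> M n)"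
    for k R'
  proof -
    obtain B where B: "B \<ge> 0" "\<And>s y. \<bar>s\<bar> \<le> max R R' \<Longrightarrow> \<bar>y\<bar> \<le> max R R' \<Longrightarrow>
        \<bar>nder k (\<lambda>s. nder q (K s) y) s\<bar> \<le> B"
      using regular2_bound[OF L, of "max R R'" k] by metis
    have "summable (\<lambda>n. \<bar>a n\<bar> * B)" using a by (rule summable_mult2)
    moreover have "\<bar>nder k (\<lambda>s. a n * nder q (K s) (x n)) s\<bar> \<le> \<bar>a n\<bar> * B" if "\<bar>s\<bar> \<le> R'" for n s
      unfolding nder_cmult[OF sm] abs_mult using x that
      by (intro mult_left_mono B(2)) (auto simp: le_max_iff_disj)
    ultimately show ?thesis by blast
  qed
qed

section \<open>Froelicher spaces\<close>

text \<open>Smoothness of maps that need not be extensional. It is closed under composition, so that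
  it can be established compositionally; restricting to the points of the domain gives the elements
  of \<^const>\<open>smooth_maps\<close>.\<close>

definition smooth_between :: "'a frolicher \<Rightarrow> 'b frolicher \<Rightarrow> ('a \<Rightarrow> 'b) \<Rightarrow> bool" where
  "smooth_between X Y f \<longleftrightarrow>
     (\<forall>x\<in>points X. f x \<in> points Y) \<and> (\<forall>c\<in>curves X. (\<lambda>t. f (c t)) \<in> curves Y)"

lemma smooth_between_points: "smooth_between X Y f \<Longrightarrow> x \<in> points X \<Longrightarrow> f x \<in> points Y"
  by (simp add: smooth_between_def)

lemma smooth_between_curves: "smooth_between X Y f \<Longrightarrow> c \<in> curves X \<Longrightarrow> (\<lambda>t. f (c t)) \<in> curves Y"
  by (simp add: smooth_between_def)

lemma smooth_maps_iff: "f \<in> smooth_maps X Y \<longleftrightarrow> f \<in> extensional (points X) \<and> smooth_between X Y f"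
  by (auto simp: smooth_maps_def smooth_between_def PiE_def Pi_def o_def)

lemma smooth_maps_smooth_between: "f \<in> smooth_maps X Y \<Longrightarrow> smooth_between X Y f"
  by (simp add: smooth_maps_iff)

lemma smooth_maps_restrict: "f \<in> smooth_maps X Y \<Longrightarrow> restrict f (points X) = f"
  by (simp add: smooth_maps_iff extensional_restrict)

lemma funs_unfold:
  "frolicher_space X \<Longrightarrow> f \<in> funs X \<longleftrightarrow> f \<in> extensional (points X) \<and> (\<forall>c\<in>curves X. smooth_real (f \<circ> c))"
  and curves_unfold:
  "frolicher_space X \<Longrightarrow> c \<in> curves X \<longleftrightarrow> range c \<subseteq> points X \<and> (\<forall>f\<in>funs X. smooth_real (f \<circ> c))"
  unfolding frolicher_space_def set_eq_iff by blast+

lemma curve_in_points: "frolicher_space X \<Longrightarrow> c \<in> curves X \<Longrightarrow> c t \<in> points X"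
  by (subst (asm) curves_unfold) auto

lemma smooth_between_cong:
  assumes "frolicher_space X" "\<And>x. x \<in> points X \<Longrightarrow> f x = g x"
  shows "smooth_between X Y f \<longleftrightarrow> smooth_between X Y g"
proof -
  have "(\<lambda>t. f (c t)) = (\<lambda>t. g (c t))" if "c \<in> curves X" for c
    using assms curve_in_points[OF assms(1) that] by auto
  then show ?thesis using assms(2) unfolding smooth_between_def by auto
qed

lemma smooth_between_restrict [simp]:
  "frolicher_space X \<Longrightarrow> smooth_between X Y (restrict f (points X)) \<longleftrightarrow> smooth_between X Y f"
  by (rule smooth_between_cong) auto

lemma restrict_in_smooth_maps:
  "frolicher_space X \<Longrightarrow> smooth_between X Y f \<Longrightarrow> restrict f (points X) \<in> smooth_maps X Y"
  by (simp add: smooth_maps_iff)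

lemma points_real [simp]: "points real_space = UNIV"
  and curves_real [simp]: "c \<in> curves real_space \<longleftrightarrow> smooth_real c"
  by (auto simp: real_space_def)

lemma smooth_between_real_iff:
  "smooth_between X real_space f \<longleftrightarrow> (\<forall>c\<in>curves X. smooth_real (\<lambda>t. f (c t)))"
  by (simp add: smooth_between_def)

lemma funs_iff: "frolicher_space X \<Longrightarrow> f \<in> funs X \<longleftrightarrow> f \<in> extensional (points X) \<and> smooth_between X real_space f"
  by (simp add: funs_unfold smooth_between_real_iff o_def)

lemma curve_iff:
  assumes "frolicher_space X"
  shows "c \<in> curves X \<longleftrightarrow> (\<forall>t. c t \<in> points X) \<and>
    (\<forall>f. smooth_between X real_space f \<longrightarrow> smooth_real (\<lambda>t. f (c t)))"
proof
  assume "c \<in> curves X"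
  then show "(\<forall>t. c t \<in> points X) \<and> (\<forall>f. smooth_between X real_space f \<longrightarrow> smooth_real (\<lambda>t. f (c t)))"
    using curve_in_points[OF assms] by (auto simp: smooth_between_real_iff)
next
  assume c: "(\<forall>t. c t \<in> points X) \<and> (\<forall>f. smooth_between X real_space f \<longrightarrow> smooth_real (\<lambda>t. f (c t)))"
  have "smooth_real (f \<circ> c)" if "f \<in> funs X" for f
    using that c by (auto simp: funs_iff[OF assms] o_def)
  then show "c \<in> curves X"
    using c by (subst curves_unfold[OF assms]) auto
qed

lemma curve_reparam:
  assumes "frolicher_space X" "c \<in> curves X" "smooth_real a"
  shows "(\<lambda>t. c (a t)) \<in> curves X"
  using assms(2) unfolding curve_iff[OF assms(1)] by (auto intro: smooth_real_compose[OF _ assms(3)])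

lemma curve_const: "frolicher_space X \<Longrightarrow> x \<in> points X \<Longrightarrow> (\<lambda>t. x) \<in> curves X"
  by (auto simp: curve_iff smooth_real_const)

lemma curve_smooth_real: "c \<in> curves X \<Longrightarrow> smooth_between X real_space f \<Longrightarrow> smooth_real (\<lambda>t. f (c t))"
  by (simp add: smooth_between_real_iff)

text \<open>A space given by a set of curves is a Froelicher space as soon as every map into it on which
  all functions are smooth is one of these curves.\<close>

lemma frolicher_curve_space:
  assumes "\<And>c. c \<in> C \<Longrightarrow> range c \<subseteq> S"
    and "\<And>c. (\<And>t. c t \<in> S) \<Longrightarrow>
      (\<And>f. (\<And>d. d \<in> C \<Longrightarrow> smooth_real (\<lambda>t. f (d t))) \<Longrightarrow> smooth_real (\<lambda>t. f (c t))) \<Longrightarrow> c \<in> C"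
  shows "frolicher_space (curve_space S C)"
proof -
  have *: "c \<in> C" if c: "range c \<subseteq> S" "\<forall>f \<in> {f \<in> extensional S. \<forall>c\<in>C. smooth_real (f \<circ> c)}. smooth_real (f \<circ> c)" for c
  proof (rule assms(2))
    show "c t \<in> S" for t using c by auto
    fix f assume f: "\<And>d. d \<in> C \<Longrightarrow> smooth_real (\<lambda>t. f (d t))"
    have "restrict f S \<circ> d = (\<lambda>t. f (d t))" if "d \<in> C \<or> d = c" for d
      using that assms(1) c(1) by (auto simp: fun_eq_iff image_subset_iff)
    then have r: "restrict f S \<in> {f \<in> extensional S. \<forall>c\<in>C. smooth_real (f \<circ> c)}"
      "restrict f S \<circ> c = (\<lambda>t. f (c t))" using f by auto
    then show "smooth_real (\<lambda>t. f (c t))" using bspec[OF c(2) r(1)] by simp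
  qed
  show ?thesis
    unfolding frolicher_space_def
  proof
    show "curves (curve_space S C) = {c. range c \<subseteq> points (curve_space S C) \<and>
        (\<forall>f\<in>funs (curve_space S C). smooth_real (f \<circ> c))}"
      unfolding curve_space_def frolicher.select_convs
    proof (rule subset_antisym; rule subsetI)
      fix c assume "c \<in> C"
      then show "c \<in> {c. range c \<subseteq> S \<and> (\<forall>f\<in>{f \<in> extensional S. \<forall>c\<in>C. smooth_real (f \<circ> c)}. smooth_real (f \<circ> c))}"
        using assms(1) by blast
    next
      fix c assume "c \<in> {c. range c \<subseteq> S \<and>
        (\<forall>f\<in>{f \<in> extensional S. \<forall>c\<in>C. smooth_real (f \<circ> c)}. smooth_real (f \<circ> c))}"
      then show "c \<in> C" using * by blast
    qed
  qed (simp add: curve_space_def)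
qed

lemma points_curve_space [simp]: "points (curve_space S C) = S"
  and curves_curve_space [simp]: "curves (curve_space S C) = C"
  by (simp_all add: curve_space_def)

lemma points_initial [simp]: "points (initial_space S G Z) = S"
  and curves_initial: "c \<in> curves (initial_space S G Z) \<longleftrightarrow>
    (\<forall>t. c t \<in> S) \<and> (\<forall>g\<in>G. (\<lambda>t. g (c t)) \<in> curves Z)"
  by (auto simp: initial_space_def o_def)

lemma frolicher_initial:
  assumes "frolicher_space Z" "\<And>g x. g \<in> G \<Longrightarrow> x \<in> S \<Longrightarrow> g x \<in> points Z"
  shows "frolicher_space (initial_space S G Z)"
  unfolding initial_space_def
proof (rule frolicher_curve_space)
  fix c assume c: "\<And>t. c t \<in> S"
    "\<And>f. (\<And>d. d \<in> {c. range c \<subseteq> S \<and> (\<forall>g\<in>G. g \<circ> c \<in> curves Z)} \<Longrightarrow> smooth_real (\<lambda>t. f (d t))) \<Longrightarrow>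
      smooth_real (\<lambda>t. f (c t))"
  have "(\<lambda>t. g (c t)) \<in> curves Z" if g: "g \<in> G" for g
    unfolding curve_iff[OF assms(1)]
  proof (intro conjI allI impI)
    show "g (c t) \<in> points Z" for t using assms(2)[OF g c(1)] .
    fix f assume f: "smooth_between Z real_space f"
    show "smooth_real (\<lambda>t. f (g (c t)))"
      by (rule c(2)[of "\<lambda>x. f (g x)"]) (use f g in \<open>auto simp: o_def smooth_between_real_iff\<close>)
  qed
  then show "c \<in> {c. range c \<subseteq> S \<and> (\<forall>g\<in>G. g \<circ> c \<in> curves Z)}"
    using c(1) by (auto simp: o_def)
qed auto

lemma frolicher_real [simp]: "frolicher_space real_space"
proof -
  have "{f. \<forall>c. smooth_real c \<longrightarrow> smooth_real (f \<circ> c)} = Collect smooth_real"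
    "{c. \<forall>f. smooth_real f \<longrightarrow> smooth_real (f \<circ> c)} = Collect smooth_real"
    using smooth_real_compose smooth_real_ident by (fastforce simp: o_def)+
  then show ?thesis by (simp add: frolicher_space_def real_space_def)
qed

lemma points_euclid: "points (euclid n) = {x. \<forall>i\<ge>n. x i = 0}"
  by (simp add: euclid_def)

lemma curves_euclid:
  "c \<in> curves (euclid n) \<longleftrightarrow> (\<forall>t. \<forall>i\<ge>n. c t i = 0) \<and> (\<forall>i<n. smooth_real (\<lambda>t. c t i))"
  by (auto simp: euclid_def curves_initial)

lemma frolicher_euclid [simp]: "frolicher_space (euclid n)"
  unfolding euclid_def by (rule frolicher_initial[OF frolicher_real]) auto

lemma points_prod [simp]: "points (prod_space X Y) = points X \<times> points Y"
  by (simp add: prod_space_def)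

lemma curves_prod:
  "c \<in> curves (prod_space X Y) \<longleftrightarrow> (\<lambda>t. fst (c t)) \<in> curves X \<and> (\<lambda>t. snd (c t)) \<in> curves Y"
  by (simp add: prod_space_def o_def)

lemma frolicher_prod:
  assumes "frolicher_space X" "frolicher_space Y"
  shows "frolicher_space (prod_space X Y)"
  unfolding prod_space_def
proof (rule frolicher_curve_space)
  fix c assume "c \<in> {c. fst \<circ> c \<in> curves X \<and> snd \<circ> c \<in> curves Y}"
  then have "fst (c t) \<in> points X" "snd (c t) \<in> points Y" for t
    using curve_in_points[OF assms(1), of "fst \<circ> c"] curve_in_points[OF assms(2), of "snd \<circ> c"] by auto
  then show "range c \<subseteq> points X \<times> points Y" by (simp add: image_subset_iff mem_Times_iff)
next
  fix c assume c: "\<And>t. c t \<in> points X \<times> points Y" "\<And>f. (\<And>d. d \<in> {c. fst \<circ> c \<in> curves X \<and> snd \<circ> c \<in> curves Y}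
    \<Longrightarrow> smooth_real (\<lambda>t. f (d t))) \<Longrightarrow> smooth_real (\<lambda>t. f (c t))"
  have "fst \<circ> c \<in> curves X"
    unfolding curve_iff[OF assms(1)]
  proof (intro conjI allI impI)
    show "(fst \<circ> c) t \<in> points X" for t using c(1)[of t] by (auto simp: mem_Times_iff)
    fix f assume f: "smooth_between X real_space f"
    show "smooth_real (\<lambda>t. f ((fst \<circ> c) t))" unfolding o_apply
      by (rule c(2)[of "\<lambda>x. f (fst x)"]) (use curve_smooth_real[OF _ f] in \<open>force simp: o_def\<close>)
  qed
  moreover have "snd \<circ> c \<in> curves Y"
    unfolding curve_iff[OF assms(2)]
  proof (intro conjI allI impI)
    show "(snd \<circ> c) t \<in> points Y" for t using c(1)[of t] by (auto simp: mem_Times_iff)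
    fix f assume f: "smooth_between Y real_space f"
    show "smooth_real (\<lambda>t. f ((snd \<circ> c) t))" unfolding o_apply
      by (rule c(2)[of "\<lambda>x. f (snd x)"]) (use curve_smooth_real[OF _ f] in \<open>force simp: o_def\<close>)
  qed
  ultimately show "c \<in> {c. fst \<circ> c \<in> curves X \<and> snd \<circ> c \<in> curves Y}" by simp
qed

lemma frolicher_one [simp]: "frolicher_space one_space"
  unfolding one_space_def by (rule frolicher_curve_space) auto

subsection \<open>Rules for smooth maps\<close>

lemma smooth_between_id: "smooth_between X X (\<lambda>x. x)"
  by (simp add: smooth_between_def)

lemma smooth_between_const: "frolicher_space Y \<Longrightarrow> y \<in> points Y \<Longrightarrow> smooth_between X Y (\<lambda>_. y)"
  by (simp add: smooth_between_def curve_const)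

lemma smooth_between_compose:
  "smooth_between Y Z g \<Longrightarrow> smooth_between X Y f \<Longrightarrow> smooth_between X Z (\<lambda>x. g (f x))"
  by (simp add: smooth_between_def)

lemma smooth_between_pair:
  "smooth_between T X f \<Longrightarrow> smooth_between T Y g \<Longrightarrow> smooth_between T (prod_space X Y) (\<lambda>t. (f t, g t))"
  by (simp add: smooth_between_def curves_prod)

lemma smooth_between_fst_id: "smooth_between (prod_space X Y) X fst"
  and smooth_between_snd_id: "smooth_between (prod_space X Y) Y snd"
  by (auto simp: smooth_between_def curves_prod)

lemma smooth_between_fst: "smooth_between T (prod_space X Y) f \<Longrightarrow> smooth_between T X (\<lambda>t. fst (f t))"
  and smooth_between_snd: "smooth_between T (prod_space X Y) f \<Longrightarrow> smooth_between T Y (\<lambda>t. snd (f t))"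
  by (auto simp: smooth_between_def curves_prod mem_Times_iff)

text \<open>Substitution into a map of two arguments.\<close>

lemma smooth_between_subst2:
  assumes "smooth_between (prod_space X Y) Z (\<lambda>p. f (fst p) (snd p))"
    "smooth_between T X a" "smooth_between T Y b"
  shows "smooth_between T Z (\<lambda>t. f (a t) (b t))"
  using smooth_between_compose[OF assms(1) smooth_between_pair[OF assms(2,3)]] by simp

lemma smooth_between_real_const: "smooth_between X real_space (\<lambda>_. c)"
  by (simp add: smooth_between_const frolicher_real)

lemma smooth_between_real_add:
  "smooth_between X real_space f \<Longrightarrow> smooth_between X real_space g \<Longrightarrow>
   smooth_between X real_space (\<lambda>x. f x + g x)"
  by (simp add: smooth_between_real_iff smooth_real_add)

lemma smooth_between_real_mult:
  "smooth_between X real_space f \<Longrightarrow> smooth_between X real_space g \<Longrightarrow>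
   smooth_between X real_space (\<lambda>x. f x * g x)"
  by (simp add: smooth_between_real_iff smooth_real_mult)

lemma smooth_between_real_diff:
  "smooth_between X real_space f \<Longrightarrow> smooth_between X real_space g \<Longrightarrow>
   smooth_between X real_space (\<lambda>x. f x - g x)"
  by (simp add: smooth_between_real_iff smooth_real_diff)

lemma smooth_between_real_sum:
  "(\<And>i. i \<in> A \<Longrightarrow> smooth_between X real_space (f i)) \<Longrightarrow>
   smooth_between X real_space (\<lambda>x. \<Sum>i\<in>A. f i x)"
  by (simp add: smooth_between_real_iff smooth_real_sum)

lemma smooth_between_euclidI:
  assumes "frolicher_space X" "\<And>i. i < n \<Longrightarrow> smooth_between X real_space (\<lambda>x. f x i)"
    "\<And>x i. x \<in> points X \<Longrightarrow> i \<ge> n \<Longrightarrow> f x i = 0"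
  shows "smooth_between X (euclid n) f"
  using assms(2,3) curve_in_points[OF assms(1)]
  by (auto simp: smooth_between_def points_euclid curves_euclid)

lemma smooth_between_coord: "smooth_between (euclid n) real_space (\<lambda>x. x i)"
  unfolding smooth_between_real_iff
proof
  fix c assume "c \<in> curves (euclid n)"
  then show "smooth_real (\<lambda>t. c t i)"
    by (cases "i < n") (auto simp: curves_euclid smooth_real_const)
qed

lemma origin_in_euclid [simp]: "origin \<in> points (euclid n)"
  by (simp add: points_euclid)

subsection \<open>Mapping spaces\<close>

lemma points_map [simp]: "points (map_space X Y) = smooth_maps X Y"
  by (simp add: map_space_def)

lemma curves_map:
  assumes "frolicher_space X"
  shows "c \<in> curves (map_space X Y) \<longleftrightarrow> (\<forall>t. c t \<in> smooth_maps X Y) \<and>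
    smooth_between (prod_space real_space X) Y (\<lambda>p. c (fst p) (snd p))"
proof -
  have "(\<lambda>p\<in>UNIV \<times> points X. c (fst p) (snd p)) \<in> smooth_maps (prod_space real_space X) Y \<longleftrightarrow>
    smooth_between (prod_space real_space X) Y (\<lambda>p. c (fst p) (snd p))"
    using smooth_between_restrict[OF frolicher_prod[OF frolicher_real assms],
        of Y "\<lambda>p. c (fst p) (snd p)"]
    by (simp add: smooth_maps_iff)
  then show ?thesis by (auto simp: map_space_def)
qed

lemma smooth_between_slice:
  assumes "smooth_between (prod_space T X) Y (\<lambda>p. f (fst p) (snd p))" "frolicher_space T" "t \<in> points T"
  shows "smooth_between X Y (f t)"
  using smooth_between_subst2[OF assms(1) smooth_between_const[OF assms(2,3)] smooth_between_id] .

lemma smooth_between_curry: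
  assumes "frolicher_space T" "frolicher_space X"
    "smooth_between (prod_space T X) Y (\<lambda>p. f (fst p) (snd p))"
  shows "smooth_between T (map_space X Y) (\<lambda>t. restrict (f t) (points X))"
proof -
  have pts: "restrict (f t) (points X) \<in> smooth_maps X Y" if "t \<in> points T" for t
    by (intro restrict_in_smooth_maps assms(2) smooth_between_slice[OF assms(3,1) that])
  have "(\<lambda>s. restrict (f (c s)) (points X)) \<in> curves (map_space X Y)" if c: "c \<in> curves T" for c
    unfolding curves_map[OF assms(2)]
  proof
    show "\<forall>t. restrict (f (c t)) (points X) \<in> smooth_maps X Y"
      using pts curve_in_points[OF assms(1) c] by blast
    have "smooth_between real_space T c"
      using curve_in_points[OF assms(1) c] curve_reparam[OF assms(1) c]
      by (simp add: smooth_between_def)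
    then have "smooth_between (prod_space real_space X) T (\<lambda>p. c (fst p))"
      by (rule smooth_between_compose) (rule smooth_between_fst_id)
    from smooth_between_subst2[OF assms(3) this smooth_between_snd_id]
    show "smooth_between (prod_space real_space X) Y (\<lambda>p. restrict (f (c (fst p))) (points X) (snd p))"
      by (subst smooth_between_cong[OF frolicher_prod[OF frolicher_real assms(2)],
            of _ "\<lambda>p. f (c (fst p)) (snd p)"]) auto
  qed
  then show ?thesis using pts by (simp add: smooth_between_def)
qed

lemma smooth_between_apply:
  assumes "frolicher_space X" "smooth_between T (map_space X Y) f" "smooth_between T X g"
  shows "smooth_between T Y (\<lambda>t. f t (g t))"
  unfolding smooth_between_def
proof (intro conjI ballI)
  show "f t (g t) \<in> points Y" if "t \<in> points T" for t
    using smooth_between_points[OF assms(2) that] smooth_between_points[OF assms(3) that]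
    by (auto simp: smooth_maps_iff smooth_between_points)
  fix c assume c: "c \<in> curves T"
  from smooth_between_curves[OF assms(2) c]
  have "smooth_between (prod_space real_space X) Y (\<lambda>p. f (c (fst p)) (snd p))"
    by (simp add: curves_map[OF assms(1)])
  from smooth_between_curves[OF this, of "\<lambda>t. (t, g (c t))"]
  show "(\<lambda>t. f (c t) (g (c t))) \<in> curves Y"
    using smooth_between_curves[OF assms(3) c] by (simp add: curves_prod smooth_real_ident)
qed

lemma smooth_between_uncurry:
  assumes "frolicher_space X" "smooth_between T (map_space X Y) f"
  shows "smooth_between (prod_space T X) Y (\<lambda>p. f (fst p) (snd p))"
  by (rule smooth_between_apply[OF assms(1)
        smooth_between_compose[OF assms(2) smooth_between_fst_id] smooth_between_snd_id])

lemma smooth2_along_curve: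
  assumes "frolicher_space Y" "smooth_between (prod_space real_space Y) real_space (\<lambda>p. F (fst p) (snd p))"
    "y \<in> curves Y"
  shows "smooth2 (\<lambda>s t. F s (y t))"
  unfolding smooth2_def
proof (intro allI impI)
  fix a b assume "smooth_real a" "smooth_real b"
  then have "(\<lambda>t. (a t, y (b t))) \<in> curves (prod_space real_space Y)"
    using curve_reparam[OF assms(1,3)] by (simp add: curves_prod)
  from curve_smooth_real[OF this assms(2)] show "smooth_real (\<lambda>t. F (a t) (y (b t)))" by simp
qed

text \<open>A map \<open>c\<close> into the mapping space that is smooth when tested with all real functions is a
  curve. Along a curve of \<open>X\<close> and after a function of \<open>Y\<close> this is a statement on maps of two
  real variables; the functions needed are the functionals \<open>g \<mapsto> \<Sum>a\<^sub>n g\<^bsup>(q)\<^esup>(x\<^sub>n)\<close> of that curve.\<close>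

lemma frolicher_map_space:
  assumes X: "frolicher_space X" and Y: "frolicher_space Y"
  shows "frolicher_space (map_space X Y)"
proof -
  let ?C = "curves (map_space X Y)"
  have eq: "map_space X Y = curve_space (smooth_maps X Y) ?C"
    by (simp add: map_space_def)
  have "frolicher_space (curve_space (smooth_maps X Y) ?C)"
  proof (rule frolicher_curve_space)
    show "range c \<subseteq> smooth_maps X Y" if "c \<in> ?C" for c
      using that by (auto simp: curves_map[OF X])
    fix c assume c: "\<And>t. c t \<in> smooth_maps X Y"
      and test: "\<And>f. (\<And>d. d \<in> ?C \<Longrightarrow> smooth_real (\<lambda>t. f (d t))) \<Longrightarrow> smooth_real (\<lambda>t. f (c t))"
    have "(\<lambda>t. c (fst (z t)) (snd (z t))) \<in> curves Y" if z: "z \<in> curves (prod_space real_space X)" for z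
      unfolding curve_iff[OF Y]
    proof (intro conjI allI impI)
      have s: "smooth_real (\<lambda>t. fst (z t))" and x: "(\<lambda>t. snd (z t)) \<in> curves X"
        using z by (auto simp: curves_prod)
      show "c (fst (z t)) (snd (z t)) \<in> points Y" for t
        by (rule smooth_between_points[OF smooth_maps_smooth_between[OF c] curve_in_points[OF X x]])
      fix h assume h: "smooth_between Y real_space h"
      define k where "k = (\<lambda>\<sigma> \<xi>. h (c (fst (z \<sigma>)) (snd (z \<xi>))))"
      have "regular2 k"
      proof (rule regular2_if_functionals_smooth)
        show "smooth_real (k \<sigma>)" for \<sigma>
          unfolding k_def
          by (rule curve_smooth_real[OF x, of "\<lambda>x. h (c (fst (z \<sigma>)) x)"])
            (rule smooth_between_compose[OF h smooth_maps_smooth_between[OF c]])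
        fix a x' :: "nat \<Rightarrow> real" and q R assume a: "summable (\<lambda>n. \<bar>a n\<bar> :: real)" and x': "\<And>n. \<bar>x' n\<bar> \<le> (R::real)"
        define \<phi> where "\<phi> = (\<lambda>g. \<Sum>n. a n * nder q (\<lambda>\<xi>. h (g (snd (z \<xi>)))) (x' n))"
        have "smooth_real (\<lambda>t. \<phi> (d t))" if d: "d \<in> ?C" for d
        proof -
          have "smooth_between (prod_space real_space X) real_space (\<lambda>p. h (d (fst p) (snd p)))"
            using d by (intro smooth_between_compose[OF h]) (simp add: curves_map[OF X])
          from smooth2_along_curve[OF X this x]
          show ?thesis unfolding \<phi>_def by (rule smooth_weighted_sum_nder[OF _ a x'])
        qed
        then have "smooth_real (\<lambda>t. \<phi> (c t))" by (rule test)
        from smooth_real_compose[OF this s]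
        show "smooth_real (\<lambda>\<sigma>. \<Sum>n. a n * nder q (k \<sigma>) (x' n))"
          by (simp add: \<phi>_def k_def)
      qed
      from smooth2D[OF regular2_imp_smooth2[OF this] smooth_real_ident smooth_real_ident]
      show "smooth_real (\<lambda>t. h (c (fst (z t)) (snd (z t))))" by (simp add: k_def)
    qed
    then have "smooth_between (prod_space real_space X) Y (\<lambda>p. c (fst p) (snd p))"
      using smooth_between_points[OF smooth_maps_smooth_between[OF c]]
      unfolding smooth_between_def by auto
    then show "c \<in> ?C" using c by (simp add: curves_map[OF X])
  qed
  then show ?thesis by (subst eq)
qed

subsection \<open>Hadamard's lemma\<close>

text \<open>Along a curve of \<open>Y\<close> this is the statement for two real variables.\<close>

lemma smooth_between_hquot:
  assumes Y: "frolicher_space Y"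
    and F: "smooth_between (prod_space real_space Y) real_space (\<lambda>p. F (fst p) (snd p))"
    and 0: "\<And>y. y \<in> points Y \<Longrightarrow> F 0 y = 0"
  shows "smooth_between (prod_space real_space Y) real_space (\<lambda>p. hquot (\<lambda>s. F s (snd p)) (fst p))"
  unfolding smooth_between_real_iff
proof
  fix z assume "z \<in> curves (prod_space real_space Y)"
  then have s: "smooth_real (\<lambda>t. fst (z t))" and y: "(\<lambda>t. snd (z t)) \<in> curves Y"
    by (auto simp: curves_prod)
  have "smooth2 (\<lambda>s t. hquot (\<lambda>s. F s (snd (z t))) s)"
    by (rule smooth2_hquot[OF smooth2_along_curve[OF Y F y]]) (use 0 curve_in_points[OF Y y] in auto)
  from smooth2D[OF this s smooth_real_ident]
  show "smooth_real (\<lambda>t. hquot (\<lambda>s. F s (snd (z t))) (fst (z t)))" .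
qed

definition trunc_vec :: "nat \<Rightarrow> (nat \<Rightarrow> real) \<Rightarrow> nat \<Rightarrow> real" where
  "trunc_vec i u = (\<lambda>j. if j < i then u j else 0)"

text \<open>Each summand arises from changing one coordinate from \<open>0\<close> to its value, which is a function of
  one real variable with parameters that vanishes at \<open>0\<close>.\<close>

lemma hadamard:
  assumes Y: "frolicher_space Y"
    and K: "smooth_between (prod_space (euclid n) Y) real_space (\<lambda>p. K (fst p) (snd p))"
  obtains R where
    "\<And>i. i < n \<Longrightarrow> smooth_between (prod_space (euclid n) Y) real_space (\<lambda>p. R i (fst p) (snd p))"
    "\<And>u y. u \<in> points (euclid n) \<Longrightarrow> y \<in> points Y \<Longrightarrow> K u y = K origin y + (\<Sum>i<n. u i * R i u y)"
proof -
  let ?UY = "prod_space (euclid n) Y"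
  have UY: "frolicher_space ?UY" by (intro frolicher_prod frolicher_euclid Y)
  define F where "F i s p = K ((trunc_vec i (fst p))(i := s)) (snd p) - K (trunc_vec i (fst p)) (snd p)"
    for i and s :: real and p
  define R where "R i u y = hquot (\<lambda>s. F i s (u, y)) (u i)" for i u y
  have tr: "smooth_between ?UY (euclid n) (\<lambda>p. trunc_vec i (fst p))" if "i < n" for i
  proof (rule smooth_between_euclidI[OF UY])
    show "smooth_between ?UY real_space (\<lambda>p. trunc_vec i (fst p) j)" for j
      by (cases "j < i") (auto simp: trunc_vec_def intro: smooth_between_real_const
        smooth_between_compose[OF smooth_between_coord smooth_between_fst_id])
  qed (use that in \<open>auto simp: trunc_vec_def\<close>)
  have upd: "smooth_between (prod_space real_space ?UY) (euclid n)
      (\<lambda>p. (trunc_vec i (fst (snd p)))(i := fst p))" if "i < n" for i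
  proof (rule smooth_between_euclidI[OF frolicher_prod[OF frolicher_real UY]])
    have "smooth_between (prod_space real_space ?UY) (euclid n) (\<lambda>p. fst (snd p))"
      by (rule smooth_between_fst[OF smooth_between_snd_id])
    then show "smooth_between (prod_space real_space ?UY) real_space
        (\<lambda>p. ((trunc_vec i (fst (snd p)))(i := fst p)) j)" for j
      using smooth_between_compose[OF smooth_between_coord[of n j]]
      by (cases "j = i"; cases "j < i")
        (auto simp: trunc_vec_def intro: smooth_between_real_const smooth_between_fst_id)
    show "((trunc_vec i (fst (snd p)))(i := fst p)) j = 0" if "j \<ge> n" for p :: "real \<times> (nat \<Rightarrow> real) \<times> 'a" and j
      using that \<open>i < n\<close> by (auto simp: trunc_vec_def)
  qed
  have F0: "F i 0 p = 0" for i p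
  proof -
    have "(trunc_vec i (fst p))(i := 0) = trunc_vec i (fst p)" by (auto simp: trunc_vec_def)
    then show ?thesis by (simp add: F_def)
  qed
  have "smooth_between (prod_space real_space ?UY) real_space (\<lambda>p. F i (fst p) (snd p))" if i: "i < n" for i
    unfolding F_def
    by (rule smooth_between_real_diff[OF
          smooth_between_subst2[OF K upd[OF i] smooth_between_snd[OF smooth_between_snd_id]]
          smooth_between_subst2[OF K smooth_between_compose[OF tr[OF i] smooth_between_snd_id]
            smooth_between_snd[OF smooth_between_snd_id]]])
  from smooth_between_hquot[OF UY this F0]
  have hq: "smooth_between (prod_space real_space ?UY) real_space
      (\<lambda>p. hquot (\<lambda>s. F i s (snd p)) (fst p))" if "i < n" for i
    using that by blast
  show ?thesis
  proof (rule that[of R])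
    fix i assume i: "i < n"
    have "smooth_between ?UY (prod_space real_space ?UY) (\<lambda>p. (fst p i, p))"
      by (intro smooth_between_pair smooth_between_id
          smooth_between_compose[OF smooth_between_coord smooth_between_fst_id])
    from smooth_between_compose[OF hq[OF i] this]
    show "smooth_between ?UY real_space (\<lambda>p. R i (fst p) (snd p))" by (simp add: R_def)
  next
    fix u y assume u: "u \<in> points (euclid n)" and y: "y \<in> points Y"
    have "u i * R i u y = K (trunc_vec (Suc i) u) y - K (trunc_vec i u) y" for i
    proof -
      from hquot_mult[of "\<lambda>s. F i s (u, y)", OF F0] have "u i * R i u y = F i (u i) (u, y)"
        by (simp add: R_def)
      moreover have "(trunc_vec i u)(i := u i) = trunc_vec (Suc i) u"
        by (auto simp: trunc_vec_def)
      ultimately show ?thesis by (simp add: F_def)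
    qed
    then have "(\<Sum>i<n. u i * R i u y) = K (trunc_vec n u) y - K (trunc_vec 0 u) y"
      using sum_lessThan_telescope[of "\<lambda>i. K (trunc_vec i u) y" n] by simp
    moreover have "trunc_vec n u = u" "trunc_vec 0 u = origin"
      using u by (auto simp: trunc_vec_def points_euclid)
    ultimately show "K u y = K origin y + (\<Sum>i<n. u i * R i u y)" by simp
  qed
qed

section \<open>Weil algebras\<close>

lemma carrier_smooth_ring:
  "f \<in> carrier (smooth_ring n) \<longleftrightarrow> f \<in> extensional (points (euclid n)) \<and> smooth_between (euclid n) real_space f"
  by (simp add: smooth_ring_def smooth_maps_iff)

lemma smooth_ring_simps [simp]:
  "mult (smooth_ring n) f g = (\<lambda>x\<in>points (euclid n). f x * g x)"
  "one (smooth_ring n) = (\<lambda>x\<in>points (euclid n). 1)"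
  "zero (smooth_ring n) = (\<lambda>x\<in>points (euclid n). 0)"
  "add (smooth_ring n) f g = (\<lambda>x\<in>points (euclid n). f x + g x)"
  by (simp_all add: smooth_ring_def)

lemma restrict_in_carrier:
  "smooth_between (euclid n) real_space f \<Longrightarrow> restrict f (points (euclid n)) \<in> carrier (smooth_ring n)"
  by (simp add: carrier_smooth_ring frolicher_euclid)

lemma cring_smooth_ring: "cring (smooth_ring n)"
proof -
  let ?P = "points (euclid n)"
  have cl: "(\<lambda>x\<in>?P. f x + g x) \<in> carrier (smooth_ring n)" "(\<lambda>x\<in>?P. f x * g x) \<in> carrier (smooth_ring n)"
    if "f \<in> carrier (smooth_ring n)" "g \<in> carrier (smooth_ring n)" for f g
    using that
    by (auto intro!: smooth_between_real_add smooth_between_real_mult simp: carrier_smooth_ring)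
  have c: "(\<lambda>x\<in>?P. r) \<in> carrier (smooth_ring n)" for r
    by (intro restrict_in_carrier smooth_between_real_const)
  have m: "(\<lambda>x\<in>?P. - f x) \<in> carrier (smooth_ring n)" if "f \<in> carrier (smooth_ring n)" for f
    using smooth_between_real_mult[OF smooth_between_real_const[of _ "-1"]] that
    by (intro restrict_in_carrier) (fastforce simp: carrier_smooth_ring)
  have "abelian_group (smooth_ring n)"
  proof (rule abelian_groupI)
    fix x assume x: "x \<in> carrier (smooth_ring n)"
    show "\<exists>y\<in>carrier (smooth_ring n). y \<oplus>\<^bsub>smooth_ring n\<^esub> x = \<zero>\<^bsub>smooth_ring n\<^esub>"
      by (rule bexI[OF _ m[OF x]]) (auto simp: fun_eq_iff)
    show "\<zero>\<^bsub>smooth_ring n\<^esub> \<oplus>\<^bsub>smooth_ring n\<^esub> x = x"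
      using x by (auto simp: carrier_smooth_ring fun_eq_iff extensional_def)
  qed (auto intro!: cl c simp: fun_eq_iff)
  moreover have "comm_monoid (smooth_ring n)"
  proof (rule comm_monoidI)
    fix x assume x: "x \<in> carrier (smooth_ring n)"
    show "\<one>\<^bsub>smooth_ring n\<^esub> \<otimes>\<^bsub>smooth_ring n\<^esub> x = x"
      using x by (auto simp: carrier_smooth_ring fun_eq_iff extensional_def)
  qed (auto intro!: cl c simp: fun_eq_iff)
  ultimately show ?thesis
    by (rule cringI) (auto simp: fun_eq_iff algebra_simps)
qed

lemma ring_smooth_ring: "ring (smooth_ring n)"
  using cring_smooth_ring cring.axioms(1) by blast

subsection \<open>Membership in ideals\<close>

text \<open>Elements of the rings are extensional functions. Membership in an ideal is stated for arbitrary
functions here, so that sums and products can be formed pointwise.\<close>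

definition ideal_mem :: "nat \<Rightarrow> ((nat \<Rightarrow> real) \<Rightarrow> real) set \<Rightarrow> ((nat \<Rightarrow> real) \<Rightarrow> real) \<Rightarrow> bool" where
  "ideal_mem n I f \<longleftrightarrow> restrict f (points (euclid n)) \<in> I"

lemma ideal_mem_cong:
  "ideal_mem n I f \<Longrightarrow> (\<And>u. u \<in> points (euclid n) \<Longrightarrow> f u = g u) \<Longrightarrow> ideal_mem n I g"
  unfolding ideal_mem_def by (metis restrict_ext)

context
  fixes n I assumes I: "ideal I (smooth_ring n)"
begin

lemma ideal_carrier: "f \<in> I \<Longrightarrow> f \<in> carrier (smooth_ring n)"
  using ideal.Icarr[OF I] .

lemma ideal_mem_smooth: "ideal_mem n I f \<Longrightarrow> smooth_between (euclid n) real_space f"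
  using ideal_carrier[of "restrict f (points (euclid n))"]
  by (auto simp: ideal_mem_def carrier_smooth_ring frolicher_euclid)

lemma ideal_mem_of_mem: "f \<in> I \<Longrightarrow> ideal_mem n I f"
  using ideal_carrier[of f] by (auto simp: ideal_mem_def carrier_smooth_ring extensional_restrict)

lemma ideal_mem_0: "(\<And>u. u \<in> points (euclid n) \<Longrightarrow> f u = 0) \<Longrightarrow> ideal_mem n I f"
  using additive_subgroup.zero_closed[OF ideal.axioms(1)[OF I]]
  by (auto simp: ideal_mem_def cong: restrict_cong)

lemma ideal_mem_add:
  assumes "ideal_mem n I f" "ideal_mem n I g"
  shows "ideal_mem n I (\<lambda>u. f u + g u)"
proof -
  let ?P = "points (euclid n)"
  have "restrict f ?P \<oplus>\<^bsub>smooth_ring n\<^esub> restrict g ?P \<in> I"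
    using additive_subgroup.a_closed[OF ideal.axioms(1)[OF I]] assms unfolding ideal_mem_def .
  moreover have "restrict f ?P \<oplus>\<^bsub>smooth_ring n\<^esub> restrict g ?P = restrict (\<lambda>u. f u + g u) ?P"
    by (auto simp: fun_eq_iff)
  ultimately show ?thesis by (simp only: ideal_mem_def)
qed

lemma ideal_mem_mult:
  assumes "smooth_between (euclid n) real_space h" "ideal_mem n I f"
  shows "ideal_mem n I (\<lambda>u. h u * f u)"
proof -
  let ?P = "points (euclid n)"
  have "restrict h ?P \<otimes>\<^bsub>smooth_ring n\<^esub> restrict f ?P \<in> I"
    using ideal.I_l_closed[OF I _ restrict_in_carrier[OF assms(1)]] assms(2) unfolding ideal_mem_def .
  moreover have "restrict h ?P \<otimes>\<^bsub>smooth_ring n\<^esub> restrict f ?P = restrict (\<lambda>u. h u * f u) ?P"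
    by (auto simp: fun_eq_iff)
  ultimately show ?thesis by (simp only: ideal_mem_def)
qed

lemma ideal_mem_cmult: "ideal_mem n I f \<Longrightarrow> ideal_mem n I (\<lambda>u. c * f u)"
  by (rule ideal_mem_mult[OF smooth_between_real_const])

lemma ideal_mem_diff:
  "ideal_mem n I f \<Longrightarrow> ideal_mem n I g \<Longrightarrow> ideal_mem n I (\<lambda>u. f u - g u)"
  using ideal_mem_add[OF _ ideal_mem_cmult[of g "-1"], of f] by simp

lemma ideal_mem_sum:
  "(\<And>i. i \<in> A \<Longrightarrow> ideal_mem n I (f i)) \<Longrightarrow> ideal_mem n I (\<lambda>u. \<Sum>i\<in>A. f i u)"
  by (induction A rule: infinite_finite_induct) (auto intro: ideal_mem_0 ideal_mem_add)

end

subsection \<open>Expansions with parameters\<close>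

text \<open>Functions \<open>F(u, y)\<close> of the form \<open>\<Sum>p(u) a(y) + \<Sum>q(u) R(u, y)\<close>, the finite sums ranging
  over \<open>p \<in> P\<close> and \<open>q \<in> B\<close>. For \<open>P\<close> the monomials of degree at most \<open>k\<close> and \<open>B\<close> those of
  degree \<open>k + 1\<close> this is a Taylor expansion with smooth remainder.\<close>

inductive expansion for n :: nat and Y :: "'y frolicher"
    and P B :: "((nat \<Rightarrow> real) \<Rightarrow> real) set" where
  zero: "(\<And>u y. u \<in> points (euclid n) \<Longrightarrow> y \<in> points Y \<Longrightarrow> F u y = 0) \<Longrightarrow> expansion n Y P B F"
| main: "expansion n Y P B F \<Longrightarrow> p \<in> P \<Longrightarrow> smooth_between Y real_space a \<Longrightarrow>
    (\<And>u y. u \<in> points (euclid n) \<Longrightarrow> y \<in> points Y \<Longrightarrow> H u y = F u y + p u * a y) \<Longrightarrow>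
    expansion n Y P B H"
| rest: "expansion n Y P B F \<Longrightarrow> q \<in> B \<Longrightarrow>
    smooth_between (prod_space (euclid n) Y) real_space (\<lambda>z. R (fst z) (snd z)) \<Longrightarrow>
    (\<And>u y. u \<in> points (euclid n) \<Longrightarrow> y \<in> points Y \<Longrightarrow> H u y = F u y + q u * R u y) \<Longrightarrow>
    expansion n Y P B H"

lemma expansion_cong:
  assumes "expansion n Y P B F" "\<And>u y. u \<in> points (euclid n) \<Longrightarrow> y \<in> points Y \<Longrightarrow> F u y = G u y"
  shows "expansion n Y P B G"
  using assms(1)
proof cases
  case zero
  then show ?thesis by (intro expansion.zero) (simp add: assms(2)[symmetric])
next
  case (main F p a)
  show ?thesis by (rule expansion.main[OF main(1-3)]) (simp add: assms(2)[symmetric] main(4))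
next
  case (rest F q R)
  show ?thesis by (rule expansion.rest[OF rest(1-3)]) (simp add: assms(2)[symmetric] rest(4))
qed

lemma expansion_add:
  assumes "expansion n Y P B F" "expansion n Y P B G"
  shows "expansion n Y P B (\<lambda>u y. F u y + G u y)"
  using assms(2)
proof induction
  case (zero G)
  then show ?case by (intro expansion_cong[OF assms(1)]) auto
next
  case (main G p a H)
  then show ?case by (intro expansion.main[OF main.IH main(2,3)]) auto
next
  case (rest G q R H)
  then show ?case by (intro expansion.rest[OF rest.IH rest(2,3)]) auto
qed

lemma expansion_sum:
  "(\<And>i. i \<in> A \<Longrightarrow> expansion n Y P B (F i)) \<Longrightarrow> expansion n Y P B (\<lambda>u y. \<Sum>i\<in>A. F i u y)"
  by (induction A rule: infinite_finite_induct) (auto intro: expansion.zero expansion_add)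

lemma expansion_main1:
  "p \<in> P \<Longrightarrow> smooth_between Y real_space a \<Longrightarrow> expansion n Y P B (\<lambda>u y. p u * a y)"
  by (rule expansion.main[OF expansion.zero[of n Y "\<lambda>_ _. 0"]]) auto

lemma expansion_rest1:
  "q \<in> B \<Longrightarrow> smooth_between (prod_space (euclid n) Y) real_space (\<lambda>z. R (fst z) (snd z)) \<Longrightarrow>
   expansion n Y P B (\<lambda>u y. q u * R u y)"
  by (rule expansion.rest[OF expansion.zero[of n Y "\<lambda>_ _. 0"]]) auto

lemma expansion_bind:
  assumes "expansion n Y P B F"
    and "\<And>p a. p \<in> P \<Longrightarrow> smooth_between Y real_space a \<Longrightarrow> expansion n Y P' B' (\<lambda>u y. p u * a y)"
    and "\<And>q R. q \<in> B \<Longrightarrow> smooth_between (prod_space (euclid n) Y) real_space (\<lambda>z. R (fst z) (snd z)) \<Longrightarrow>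
      expansion n Y P' B' (\<lambda>u y. q u * R u y)"
  shows "expansion n Y P' B' F"
  using assms(1)
proof induction
  case (zero F)
  then show ?case by (rule expansion.zero)
next
  case (main F p a H)
  then show ?case by (intro expansion_cong[OF expansion_add[OF main.IH assms(2)]]) auto
next
  case (rest F q R H)
  then show ?case by (intro expansion_cong[OF expansion_add[OF rest.IH assms(3)]]) auto
qed

lemma expansion_mono:
  assumes "expansion n Y P B F" "P \<subseteq> P'" "B \<subseteq> B'"
  shows "expansion n Y P' B' F"
  using assms(2,3) by (intro expansion_bind[OF assms(1)] expansion_main1 expansion_rest1) auto

lemma expansion_extract:
  assumes "finite P" "expansion n Y P B F"
  shows "\<exists>a. (\<forall>p\<in>P. smooth_between Y real_space (a p)) \<and>
    expansion n Y {} B (\<lambda>u y. F u y - (\<Sum>p\<in>P. p u * a p y))"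
  using assms(2)
proof induction
  case (zero F)
  then show ?case
    by (intro exI[of _ "\<lambda>_ _. 0"]) (auto intro!: expansion.zero smooth_between_real_const)
next
  case (main F p a H)
  then obtain b where b: "\<And>p. p \<in> P \<Longrightarrow> smooth_between Y real_space (b p)"
    "expansion n Y {} B (\<lambda>u y. F u y - (\<Sum>p\<in>P. p u * b p y))" by auto
  let ?b = "\<lambda>r. if r = p then (\<lambda>y. b p y + a y) else b r"
  have "(\<Sum>r\<in>P. r u * ?b r y) = (\<Sum>r\<in>P. r u * b r y) + p u * a y" for u y
  proof -
    have "(\<Sum>r\<in>P. r u * ?b r y) = (\<Sum>r\<in>P. r u * b r y + (if r = p then p u * a y else 0))"
      by (intro sum.cong) (auto simp: algebra_simps)
    then show ?thesis using assms(1) main(2) by (simp add: sum.distrib)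
  qed
  with main show ?case
    by (intro exI[of _ ?b] conjI expansion_cong[OF b(2)])
      (auto intro!: smooth_between_real_add b)
next
  case (rest F q R H)
  then obtain b where b: "\<And>p. p \<in> P \<Longrightarrow> smooth_between Y real_space (b p)"
    "expansion n Y {} B (\<lambda>u y. F u y - (\<Sum>p\<in>P. p u * b p y))" by auto
  show ?case
    by (intro exI[of _ b] conjI expansion.rest[OF b(2) rest(2,3)]) (use b rest in auto)
qed

lemma expansion_mult:
  assumes "expansion n Y {} B F" "smooth_between (prod_space (euclid n) Y) real_space (\<lambda>z. S (fst z) (snd z))"
  shows "expansion n Y {} B (\<lambda>u y. S u y * F u y)"
  using assms(1)
proof induction
  case (zero F)
  then show ?case by (intro expansion.zero) auto
next
  case (rest F q R H)
  have "expansion n Y {} B (\<lambda>u y. q u * (S u y * R u y))"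
    by (rule expansion_rest1[OF rest(2)]) (rule smooth_between_real_mult[OF assms(2) rest(3)])
  from expansion_add[OF rest.IH this] show ?case
    by (rule expansion_cong) (auto simp: rest(4) algebra_simps)
qed auto

text \<open>The remainder stays in the ideal generated by \<open>B\<close> when \<open>y\<close> is replaced by a smooth
  function of \<open>u\<close>.\<close>

lemma expansion_ideal_mem:
  assumes I: "ideal I (smooth_ring n)" and "expansion n Y {} {q. ideal_mem n I q} F"
    and \<beta>: "smooth_between (euclid n) Y \<beta>"
  shows "ideal_mem n I (\<lambda>u. F u (\<beta> u))"
  using assms(2)
proof induction
  case (zero F)
  then show ?case using smooth_between_points[OF \<beta>] by (intro ideal_mem_0[OF I]) auto
next
  case (rest F q R H)
  have "smooth_between (euclid n) real_space (\<lambda>u. R u (\<beta> u))"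
    by (rule smooth_between_subst2[OF rest(3) smooth_between_id \<beta>])
  then have "ideal_mem n I (\<lambda>u. R u (\<beta> u) * q u)"
    using rest(2) by (intro ideal_mem_mult[OF I]) auto
  from ideal_mem_add[OF I rest.IH this] show ?case
    by (rule ideal_mem_cong) (use rest(4) smooth_between_points[OF \<beta>] in auto)
qed auto

subsection \<open>Taylor expansions\<close>

primrec monomials :: "nat \<Rightarrow> nat \<Rightarrow> ((nat \<Rightarrow> real) \<Rightarrow> real) set" where
  "monomials n 0 = {\<lambda>_. 1}"
| "monomials n (Suc k) = (\<lambda>(i, f) u. u i * f u) ` ({..<n} \<times> monomials n k)"

lemma finite_monomials: "finite (monomials n k)"
  by (induction k) auto

lemma monomials_smooth: "p \<in> monomials n k \<Longrightarrow> smooth_between (euclid n) real_space p"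
  by (induction k arbitrary: p)
    (auto intro: smooth_between_real_const smooth_between_real_mult[OF smooth_between_coord])

text \<open>One step of Taylor's formula: Hadamard's lemma splits the coefficient \<open>R\<close> of a monomial into its
value at the origin and multiples of the coordinates.\<close>

lemma monomial_step:
  assumes Y: "frolicher_space Y" and q: "q \<in> monomials n k"
    and R: "smooth_between (prod_space (euclid n) Y) real_space (\<lambda>z. R (fst z) (snd z))"
  shows "expansion n Y (monomials n k) (monomials n (Suc k)) (\<lambda>u y. q u * R u y)"
proof -
  obtain S where S:
    "\<And>i. i < n \<Longrightarrow> smooth_between (prod_space (euclid n) Y) real_space (\<lambda>p. S i (fst p) (snd p))"
    "\<And>u y. u \<in> points (euclid n) \<Longrightarrow> y \<in> points Y \<Longrightarrow> R u y = R origin y + (\<Sum>i<n. u i * S i u y)"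
    using hadamard[OF Y R] by blast
  have "smooth_between Y real_space (\<lambda>y. R origin y)"
    by (rule smooth_between_slice[OF R frolicher_euclid origin_in_euclid])
  then have "expansion n Y (monomials n k) (monomials n (Suc k)) (\<lambda>u y. q u * R origin y)"
    by (rule expansion_main1[OF q])
  moreover have "expansion n Y (monomials n k) (monomials n (Suc k)) (\<lambda>u y. \<Sum>i<n. (u i * q u) * S i u y)"
    by (intro expansion_sum expansion_rest1 S) (use q in force)+
  ultimately have "expansion n Y (monomials n k) (monomials n (Suc k))
      (\<lambda>u y. q u * R origin y + (\<Sum>i<n. (u i * q u) * S i u y))"
    by (rule expansion_add)
  then show ?thesis
  proof (rule expansion_cong)
    fix u y assume "u \<in> points (euclid n)" "y \<in> points Y"
    then have "R u y = R origin y + (\<Sum>i<n. u i * S i u y)" by (rule S(2))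
    then show "q u * R origin y + (\<Sum>i<n. (u i * q u) * S i u y) = q u * R u y"
      by (simp add: algebra_simps sum_distrib_left)
  qed
qed

lemma taylor_expansion:
  assumes Y: "frolicher_space Y"
    and K: "smooth_between (prod_space (euclid n) Y) real_space (\<lambda>z. K (fst z) (snd z))"
  shows "expansion n Y (\<Union>a\<le>k. monomials n a) (monomials n (Suc k)) K"
proof (induction k)
  case 0
  have "expansion n Y (monomials n 0) (monomials n (Suc 0)) (\<lambda>u y. 1 * K u y)"
    by (rule monomial_step[OF Y _ K]) simp
  then show ?case by simp
next
  case (Suc k)
  show ?case
  proof (rule expansion_bind[OF Suc])
    fix q R assume "q \<in> monomials n (Suc k)"
      "smooth_between (prod_space (euclid n) Y) real_space (\<lambda>z. R (fst z) (snd z))"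
    from monomial_step[OF Y this]
    show "expansion n Y (\<Union>a\<le>Suc k. monomials n a) (monomials n (Suc (Suc k))) (\<lambda>u y. q u * R u y)"
      by (rule expansion_mono) (auto simp del: monomials.simps)
  next
    fix p a assume "p \<in> (\<Union>a\<le>k. monomials n a)" "smooth_between Y real_space a"
    then have "expansion n Y (\<Union>a\<le>k. monomials n a) (monomials n (Suc (Suc k))) (\<lambda>u y. p u * a y)"
      by (rule expansion_main1)
    then show "expansion n Y (\<Union>a\<le>Suc k. monomials n a) (monomials n (Suc (Suc k))) (\<lambda>u y. p u * a y)"
      by (rule expansion_mono, intro UN_mono) auto
  qed
qed

lemma monomials_in_max_ideal_power:
  "p \<in> monomials n (Suc k) \<Longrightarrow>
   ideal_mem n ((ideal_prod (smooth_ring n) (max_ideal n) ^^ k) (max_ideal n)) p"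
proof (induction k arbitrary: p)
  case 0
  then obtain i where "p = (\<lambda>u. u i * 1)" by auto
  then show ?case
    using restrict_in_carrier[OF smooth_between_coord[of n i]]
    by (simp add: ideal_mem_def max_ideal_def)
next
  case (Suc k)
  let ?P = "points (euclid n)"
  from Suc.prems obtain i q where p: "p = (\<lambda>u. u i * q u)" "q \<in> monomials n (Suc k)"
    unfolding monomials.simps(2)[of n "Suc k"] by (auto simp del: monomials.simps)
  have "restrict (\<lambda>u. u i) ?P \<in> max_ideal n"
    using restrict_in_carrier[OF smooth_between_coord[of n i]] by (simp add: max_ideal_def)
  from ideal_prod.prod[OF this Suc.IH[OF p(2), unfolded ideal_mem_def], of "smooth_ring n"]
  have "restrict (\<lambda>u. u i) ?P \<otimes>\<^bsub>smooth_ring n\<^esub> restrict q ?P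
    \<in> (ideal_prod (smooth_ring n) (max_ideal n) ^^ Suc k) (max_ideal n)" by simp
  moreover have "restrict (\<lambda>u. u i) ?P \<otimes>\<^bsub>smooth_ring n\<^esub> restrict q ?P = restrict p ?P"
    by (auto simp: fun_eq_iff p(1))
  ultimately show ?case by (simp only: ideal_mem_def)
qed

subsection \<open>Bases of Weil algebras\<close>

abbreviation weil_zero :: "weil \<Rightarrow> ((nat \<Rightarrow> real) \<Rightarrow> real) \<Rightarrow> bool" where
  "weil_zero W \<equiv> ideal_mem (wdim W) (wideal W)"

lemma weil_ideal: "weil_algebra W \<Longrightarrow> ideal (wideal W) (smooth_ring (wdim W))"
  by (simp add: weil_algebra_def)

lemma weil_zero_origin: "weil_algebra W \<Longrightarrow> weil_zero W f \<Longrightarrow> f origin = 0"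
  by (auto simp: weil_algebra_def ideal_mem_def max_ideal_def)

lemma weil_monomials:
  assumes "weil_algebra W"
  obtains k where "\<And>p. p \<in> monomials (wdim W) (Suc k) \<Longrightarrow> weil_zero W p"
  using assms monomials_in_max_ideal_power unfolding weil_algebra_def ideal_mem_def by blast

text \<open>A basis of the vector space \<open>W\<close>. It is required to span only finitely many monomials; that it spans
everything follows from Taylor's formula, with smooth dependence on parameters.\<close>

definition weil_basis :: "weil \<Rightarrow> ((nat \<Rightarrow> real) \<Rightarrow> real) set \<Rightarrow> bool" where
  "weil_basis W P \<longleftrightarrow> finite P \<and> (\<forall>p\<in>P. smooth_between (euclid (wdim W)) real_space p) \<and>
     (\<forall>c. weil_zero W (\<lambda>u. \<Sum>p\<in>P. c p * p u) \<longrightarrow> (\<forall>p\<in>P. c p = 0)) \<and>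
     (\<exists>k. (\<forall>q\<in>monomials (wdim W) (Suc k). weil_zero W q) \<and>
       (\<forall>q\<in>(\<Union>a\<le>k. monomials (wdim W) a). \<exists>c. weil_zero W (\<lambda>u. q u - (\<Sum>p\<in>P. c p * p u))))"

lemma weil_basis_independent:
  "weil_basis W P \<Longrightarrow> weil_zero W (\<lambda>u. \<Sum>p\<in>P. c p * p u) \<Longrightarrow> p \<in> P \<Longrightarrow> c p = 0"
  unfolding weil_basis_def by (elim conjE) (drule spec, drule (1) mp, erule (1) bspec)

text \<open>A maximal independent subset of the monomials of low degree is a basis.\<close>

lemma weil_basis_exists:
  assumes W: "weil_algebra W"
  shows "\<exists>P. weil_basis W P"
proof -
  let ?n = "wdim W"
  note I = weil_ideal[OF W]
  obtain k where k: "\<And>p. p \<in> monomials (wdim W) (Suc k) \<Longrightarrow> weil_zero W p"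
    using weil_monomials[OF W] by blast
  have "\<exists>P\<subseteq>Q. (\<forall>c. weil_zero W (\<lambda>u. \<Sum>p\<in>P. c p * p u) \<longrightarrow> (\<forall>p\<in>P. c p = 0)) \<and>
      (\<forall>q\<in>Q. \<exists>c. weil_zero W (\<lambda>u. q u - (\<Sum>p\<in>P. c p * p u)))"
    if "finite Q" for Q :: "((nat \<Rightarrow> real) \<Rightarrow> real) set"
    using that
  proof (induction Q)
    case (insert q Q)
    from insert.IH obtain P where P: "P \<subseteq> Q"
      "\<forall>c. weil_zero W (\<lambda>u. \<Sum>p\<in>P. c p * p u) \<longrightarrow> (\<forall>p\<in>P. c p = 0)"
      "\<forall>q\<in>Q. \<exists>c. weil_zero W (\<lambda>u. q u - (\<Sum>p\<in>P. c p * p u))" by (elim exE conjE)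
    have fin: "finite P" "q \<notin> P" using P(1) insert by (auto intro: finite_subset)
    show ?case
    proof (cases "\<exists>c. weil_zero W (\<lambda>u. q u - (\<Sum>p\<in>P. c p * p u))")
      case True
      then show ?thesis using P by (intro exI[of _ P]) auto
    next
      case False
      have span: "\<exists>c. weil_zero W (\<lambda>u. r u - (\<Sum>p\<in>insert q P. c p * p u))" if r: "r \<in> insert q Q" for r
      proof (cases "r = q")
        case True
        have "(\<Sum>p\<in>P. (if p = q then 1 else 0) * p u) = 0" for u :: "nat \<Rightarrow> real"
          using fin by (intro sum.neutral) auto
        then have "weil_zero W (\<lambda>u. r u - (\<Sum>p\<in>insert q P. (if p = q then 1 else 0) * p u))"
          using fin True by (intro ideal_mem_0[OF I]) simp
        then show ?thesis by (rule exI[of _ "\<lambda>p. if p = q then 1 else 0"])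
      next
        case False
        then obtain c where c: "weil_zero W (\<lambda>u. r u - (\<Sum>p\<in>P. c p * p u))" using r P(3) by auto
        have "(\<Sum>p\<in>insert q P. (c(q := 0)) p * p u) = (\<Sum>p\<in>P. c p * p u)" for u
          using fin by (auto intro!: sum.cong)
        with c show ?thesis by (intro exI[of _ "c(q := 0)"]) (simp only:)
      qed
      have indep: "\<forall>p\<in>insert q P. c p = 0" if c: "weil_zero W (\<lambda>u. \<Sum>p\<in>insert q P. c p * p u)" for c
      proof -
        have "c q = 0"
        proof (rule ccontr)
          assume "c q \<noteq> 0"
          have "weil_zero W (\<lambda>u. (1 / c q) * (\<Sum>p\<in>insert q P. c p * p u))"
            by (rule ideal_mem_cmult[OF I c])
          then have "weil_zero W (\<lambda>u. q u - (\<Sum>p\<in>P. (- c p / c q) * p u))"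
            by (rule ideal_mem_cong)
              (use fin \<open>c q \<noteq> 0\<close> in \<open>simp add: distrib_left sum_distrib_left sum_negf\<close>)
          then have "\<exists>c. weil_zero W (\<lambda>u. q u - (\<Sum>p\<in>P. c p * p u))"
            by (rule exI[of _ "\<lambda>p. - c p / c q"])
          then show False using False by contradiction
        qed
        moreover have "weil_zero W (\<lambda>u. \<Sum>p\<in>P. c p * p u)" using c fin \<open>c q = 0\<close> by simp
        ultimately show ?thesis using P(2) by blast
      qed
      show ?thesis
        using P(1) span indep by (intro exI[of _ "insert q P"]) blast
    qed
  qed (auto intro!: exI[of _ "{}"])
  note span = this
  have "finite (\<Union>a\<le>k. monomials ?n a)" by (simp add: finite_monomials)
  from span[OF this] obtain P where P: "P \<subseteq> (\<Union>a\<le>k. monomials ?n a)"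
    "\<forall>c. weil_zero W (\<lambda>u. \<Sum>p\<in>P. c p * p u) \<longrightarrow> (\<forall>p\<in>P. c p = 0)"
    "\<forall>q\<in>(\<Union>a\<le>k. monomials ?n a). \<exists>c. weil_zero W (\<lambda>u. q u - (\<Sum>p\<in>P. c p * p u))"
    by (elim exE conjE)
  have fin: "finite P" using P(1) \<open>finite (\<Union>a\<le>k. monomials ?n a)\<close> by (rule finite_subset)
  have "weil_basis W P"
    unfolding weil_basis_def
  proof (intro conjI)
    show "\<forall>p\<in>P. smooth_between (euclid ?n) real_space p" using P(1) monomials_smooth by fast
    show "\<exists>k. (\<forall>q\<in>monomials ?n (Suc k). weil_zero W q) \<and>
       (\<forall>q\<in>(\<Union>a\<le>k. monomials ?n a). \<exists>c. weil_zero W (\<lambda>u. q u - (\<Sum>p\<in>P. c p * p u)))"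
    proof (intro exI[of _ k] conjI)
      show "\<forall>q\<in>monomials ?n (Suc k). weil_zero W q" by (intro ballI k)
    qed (rule P(3))
  qed (rule fin P(2))+
  then show ?thesis by blast
qed

lemma weil_basis_expansion:
  assumes W: "weil_algebra W" and P: "weil_basis W P" and Y: "frolicher_space Y"
    and K: "smooth_between (prod_space (euclid (wdim W)) Y) real_space (\<lambda>z. K (fst z) (snd z))"
  shows "expansion (wdim W) Y P {q. weil_zero W q} K"
proof -
  note I = weil_ideal[OF W]
  from P obtain k where k: "\<forall>q\<in>monomials (wdim W) (Suc k). weil_zero W q"
    "\<forall>q\<in>(\<Union>a\<le>k. monomials (wdim W) a). \<exists>c. weil_zero W (\<lambda>u. q u - (\<Sum>p\<in>P. c p * p u))"
    unfolding weil_basis_def by (elim exE conjE)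
  show ?thesis
  proof (rule expansion_bind[OF taylor_expansion[OF Y K, of k]])
    fix q a assume q: "q \<in> (\<Union>a\<le>k. monomials (wdim W) a)" and a: "smooth_between Y real_space a"
    obtain c where c: "weil_zero W (\<lambda>u. q u - (\<Sum>p\<in>P. c p * p u))" using bspec[OF k(2) q] by blast
    have "expansion (wdim W) Y P {q. weil_zero W q} (\<lambda>u y. (q u - (\<Sum>p\<in>P. c p * p u)) * a y)"
      using c by (intro expansion_rest1 smooth_between_compose[OF a smooth_between_snd_id]) simp
    moreover have "expansion (wdim W) Y P {q. weil_zero W q} (\<lambda>u y. \<Sum>p\<in>P. p u * (c p * a y))"
      by (intro expansion_sum expansion_main1 smooth_between_real_mult smooth_between_real_const a)
    ultimately show "expansion (wdim W) Y P {q. weil_zero W q} (\<lambda>u y. q u * a y)"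
      by (rule expansion_cong[OF expansion_add])
        (simp add: algebra_simps sum_distrib_left sum_distrib_right)
  next
    fix q R assume "q \<in> monomials (wdim W) (Suc k)"
      and R: "smooth_between (prod_space (euclid (wdim W)) Y) real_space (\<lambda>z. R (fst z) (snd z))"
    then show "expansion (wdim W) Y P {q. weil_zero W q} (\<lambda>u y. q u * R u y)"
      using k(1) by (intro expansion_rest1 R) (simp del: monomials.simps)
  qed
qed

text \<open>A family \<open>K(\<cdot>, y)\<close> of elements of the ideal is a combination of elements of the ideal with
  coefficients that are smooth in both variables: the coordinates of \<open>K(\<cdot>, y)\<close> with respect to a basis
  vanish, and only the remainder of the expansion is left.\<close>

lemma weil_zero_family:
  assumes W: "weil_algebra W" and Y: "frolicher_space Y"
    and K: "smooth_between (prod_space (euclid (wdim W)) Y) real_space (\<lambda>z. K (fst z) (snd z))"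
    and zero: "\<And>y. y \<in> points Y \<Longrightarrow> weil_zero W (\<lambda>u. K u y)"
  shows "expansion (wdim W) Y {} {q. weil_zero W q} K"
proof -
  note I = weil_ideal[OF W]
  obtain P where P: "weil_basis W P" using weil_basis_exists[OF W] by blast
  then have "finite P" by (simp add: weil_basis_def)
  then obtain a where a: "\<And>p. p \<in> P \<Longrightarrow> smooth_between Y real_space (a p)"
    "expansion (wdim W) Y {} {q. weil_zero W q} (\<lambda>u y. K u y - (\<Sum>p\<in>P. p u * a p y))"
    using expansion_extract[OF _ weil_basis_expansion[OF W P Y K]] by blast
  have "a p y = 0" if p: "p \<in> P" and y: "y \<in> points Y" for p y
  proof -
    from expansion_ideal_mem[OF I a(2) smooth_between_const[OF Y y]]
    have "weil_zero W (\<lambda>u. K u y - (\<Sum>p\<in>P. p u * a p y))" .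
    from ideal_mem_diff[OF I zero[OF y] this]
    have "weil_zero W (\<lambda>u. \<Sum>p\<in>P. a p y * p u)" by (simp add: mult.commute)
    then show ?thesis by (rule weil_basis_independent[OF P _ p])
  qed
  then show ?thesis by (intro expansion_cong[OF a(2)]) simp
qed

subsection \<open>Classes and linear functionals\<close>

definition weil_class :: "weil \<Rightarrow> ((nat \<Rightarrow> real) \<Rightarrow> real) \<Rightarrow> ((nat \<Rightarrow> real) \<Rightarrow> real) set" where
  "weil_class W f = weil_coset W (restrict f (points (euclid (wdim W))))"

lemma smooth_ring_minus:
  assumes "f \<in> carrier (smooth_ring n)" "g \<in> carrier (smooth_ring n)"
  shows "f \<ominus>\<^bsub>smooth_ring n\<^esub> g = (\<lambda>x\<in>points (euclid n). f x - g x)"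
proof -
  interpret cring "smooth_ring n" by (rule cring_smooth_ring)
  let ?h = "\<lambda>x\<in>points (euclid n). - g x"
  have h: "?h \<in> carrier (smooth_ring n)"
    using smooth_between_real_mult[OF smooth_between_real_const[of _ "-1"]] assms(2)
    by (intro restrict_in_carrier) (fastforce simp: carrier_smooth_ring)
  have "\<ominus>\<^bsub>smooth_ring n\<^esub> g = ?h"
    by (rule minus_equality[OF _ assms(2) h]) (auto simp: fun_eq_iff)
  then show ?thesis unfolding a_minus_def by (auto simp: fun_eq_iff)
qed

lemma weil_class_eq_iff:
  assumes W: "weil_algebra W" and "smooth_between (euclid (wdim W)) real_space f"
    "smooth_between (euclid (wdim W)) real_space g"
  shows "weil_class W f = weil_class W g \<longleftrightarrow> weil_zero W (\<lambda>u. f u - g u)"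
proof -
  let ?P = "points (euclid (wdim W))"
  have "weil_class W f = weil_class W g \<longleftrightarrow>
      restrict f ?P \<ominus>\<^bsub>smooth_ring (wdim W)\<^esub> restrict g ?P \<in> wideal W"
    unfolding weil_class_def weil_coset_def
    using ring.quotient_eq_iff_same_a_r_cos[OF ring_smooth_ring weil_ideal[OF W]
        restrict_in_carrier[OF assms(2)] restrict_in_carrier[OF assms(3)]] by simp
  also have "restrict f ?P \<ominus>\<^bsub>smooth_ring (wdim W)\<^esub> restrict g ?P = restrict (\<lambda>u. f u - g u) ?P"
    by (subst smooth_ring_minus) (auto simp: fun_eq_iff restrict_in_carrier assms)
  finally show ?thesis unfolding ideal_mem_def .
qed

lemma weil_class_carrier:
  "smooth_between (euclid (wdim W)) real_space f \<Longrightarrow>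
   weil_class W f \<in> carrier (smooth_ring (wdim W) Quot wideal W)"
  using restrict_in_carrier[of "wdim W" f]
  by (auto simp: weil_class_def weil_coset_def FactRing_def A_RCOSETS_def')

lemma weil_dual_linear:
  assumes l: "l \<in> weil_dual W" and "smooth_between (euclid (wdim W)) real_space f"
    "smooth_between (euclid (wdim W)) real_space g"
  shows "l (weil_class W (\<lambda>u. r * f u + s * g u)) = r * l (weil_class W f) + s * l (weil_class W g)"
  using l restrict_in_carrier[OF assms(2)] restrict_in_carrier[OF assms(3)]
  unfolding weil_dual_def weil_class_def by (force cong: restrict_cong)

lemma weil_dual_0: "l \<in> weil_dual W \<Longrightarrow> l (weil_class W (\<lambda>u. 0)) = 0"
  using weil_dual_linear[OF _ smooth_between_real_const smooth_between_real_const, of l W 0 0 0 0] by simp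

lemma weil_dual_sum:
  assumes l: "l \<in> weil_dual W" and p: "\<And>p. p \<in> P \<Longrightarrow> smooth_between (euclid (wdim W)) real_space (f p)"
  shows "l (weil_class W (\<lambda>u. \<Sum>p\<in>P. c p * f p u)) = (\<Sum>p\<in>P. c p * l (weil_class W (f p)))"
  using p
proof (induction P rule: infinite_finite_induct)
  case (insert q P)
  have "smooth_between (euclid (wdim W)) real_space (\<lambda>u. \<Sum>p\<in>P. c p * f p u)"
    by (intro smooth_between_real_sum smooth_between_real_mult smooth_between_real_const insert.prems) auto
  from weil_dual_linear[OF l _ this, of "f q" "c q" 1] insert show ?case by simp
qed (simp_all add: weil_dual_0[OF l])

lemma weil_dual_cong:
  assumes "weil_algebra W" "smooth_between (euclid (wdim W)) real_space f"
    "smooth_between (euclid (wdim W)) real_space g" "weil_zero W (\<lambda>u. f u - g u)"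
  shows "l (weil_class W f) = l (weil_class W g)"
  using weil_class_eq_iff[OF assms(1-3)] assms(4) by simp

text \<open>A family \<open>K(\<cdot>, y)\<close> of functions induces a smooth family of elements of the algebra, because its
  coordinates with respect to a basis are smooth in \<open>y\<close>. The coordinate functions and the remainder
  are kept in the statement for the use with other functionals.\<close>

lemma weil_dual_family:
  assumes W: "weil_algebra W" and l: "l \<in> weil_dual W" and Y: "frolicher_space Y"
    and K: "smooth_between (prod_space (euclid (wdim W)) Y) real_space (\<lambda>z. K (fst z) (snd z))"
  obtains P a where "finite P" "\<And>p. p \<in> P \<Longrightarrow> smooth_between (euclid (wdim W)) real_space p"
    "\<And>p. p \<in> P \<Longrightarrow> smooth_between Y real_space (a p)"
    "expansion (wdim W) Y {} {q. weil_zero W q} (\<lambda>u y. K u y - (\<Sum>p\<in>P. p u * a p y))"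
    "\<And>y. y \<in> points Y \<Longrightarrow> l (weil_class W (\<lambda>u. K u y)) = (\<Sum>p\<in>P. a p y * l (weil_class W p))"
proof -
  note I = weil_ideal[OF W]
  obtain P where P: "weil_basis W P" using weil_basis_exists[OF W] by blast
  then have fin: "finite P" and sm: "\<And>p. p \<in> P \<Longrightarrow> smooth_between (euclid (wdim W)) real_space p"
    by (auto simp: weil_basis_def)
  obtain a where a: "\<And>p. p \<in> P \<Longrightarrow> smooth_between Y real_space (a p)"
    "expansion (wdim W) Y {} {q. weil_zero W q} (\<lambda>u y. K u y - (\<Sum>p\<in>P. p u * a p y))"
    using expansion_extract[OF fin weil_basis_expansion[OF W P Y K]] by blast
  have "l (weil_class W (\<lambda>u. K u y)) = (\<Sum>p\<in>P. a p y * l (weil_class W p))" if y: "y \<in> points Y" for y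
  proof -
    have "weil_zero W (\<lambda>u. K u y - (\<Sum>p\<in>P. p u * a p y))"
      using expansion_ideal_mem[OF I a(2) smooth_between_const[OF Y y]] .
    then have "weil_zero W (\<lambda>u. K u y - (\<Sum>p\<in>P. a p y * p u))" by (simp add: mult.commute)
    moreover have "smooth_between (euclid (wdim W)) real_space (\<lambda>u. K u y)"
      using smooth_between_subst2[OF K smooth_between_id smooth_between_const[OF Y y]] .
    moreover have "smooth_between (euclid (wdim W)) real_space (\<lambda>u. \<Sum>p\<in>P. a p y * p u)"
      by (intro smooth_between_real_sum smooth_between_real_mult smooth_between_real_const sm)
    ultimately have "l (weil_class W (\<lambda>u. K u y)) = l (weil_class W (\<lambda>u. \<Sum>p\<in>P. a p y * p u))"
      using weil_dual_cong[OF W] by blast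
    also have "\<dots> = (\<Sum>p\<in>P. a p y * l (weil_class W p))"
      by (rule weil_dual_sum[OF l sm])
    finally show ?thesis .
  qed
  then show ?thesis using that fin sm a by blast
qed

lemma weil_dual_smooth:
  assumes W: "weil_algebra W" and l: "l \<in> weil_dual W" and Y: "frolicher_space Y"
    and K: "smooth_between (prod_space (euclid (wdim W)) Y) real_space (\<lambda>z. K (fst z) (snd z))"
  shows "smooth_between Y real_space (\<lambda>y. l (weil_class W (\<lambda>u. K u y)))"
proof -
  show ?thesis
  proof (rule weil_dual_family[OF W l Y K])
    fix P a assume a: "\<And>p. p \<in> P \<Longrightarrow> smooth_between Y real_space (a p)"
      and eq: "\<And>y. y \<in> points Y \<Longrightarrow> l (weil_class W (\<lambda>u. K u y)) = (\<Sum>p\<in>P. a p y * l (weil_class W p))"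
    have "smooth_between Y real_space (\<lambda>y. \<Sum>p\<in>P. a p y * l (weil_class W p))"
      by (intro smooth_between_real_sum smooth_between_real_mult smooth_between_real_const a)
    then show ?thesis by (subst smooth_between_cong[OF Y eq])
  qed
qed

text \<open>The coordinates with respect to a basis are linear functionals on the algebra. A functional is
  defined on classes; it is well defined since the coordinates of a function are determined by its
  class, the basis being independent modulo the ideal.\<close>

lemma weil_basis_coordinate:
  assumes W: "weil_algebra W" and P: "weil_basis W P" and p: "p \<in> P"
  obtains l where "l \<in> weil_dual W"
    "\<And>f c. smooth_between (euclid (wdim W)) real_space f \<Longrightarrow>
       weil_zero W (\<lambda>u. f u - (\<Sum>p\<in>P. c p * p u)) \<Longrightarrow> l (weil_class W f) = c p"
proof -
  note I = weil_ideal[OF W]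
  have fin: "finite P" using P by (simp add: weil_basis_def)
  define l where "l A = (SOME r. \<exists>f c. smooth_between (euclid (wdim W)) real_space f \<and> weil_class W f = A \<and>
    weil_zero W (\<lambda>u. f u - (\<Sum>p\<in>P. c p * p u)) \<and> r = c p)" for A
  have uniq: "c p = d p" if "smooth_between (euclid (wdim W)) real_space f"
    "smooth_between (euclid (wdim W)) real_space g" "weil_class W f = weil_class W g"
    "weil_zero W (\<lambda>u. f u - (\<Sum>p\<in>P. c p * p u))" "weil_zero W (\<lambda>u. g u - (\<Sum>p\<in>P. d p * p u))" for f g c d
  proof -
    have "weil_zero W (\<lambda>u. f u - g u)" using weil_class_eq_iff[OF W that(1,2)] that(3) by simp
    from ideal_mem_diff[OF I ideal_mem_diff[OF I this that(4)] ideal_mem_cmult[OF I that(5), of "-1"]]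
    have "weil_zero W (\<lambda>u. \<Sum>p\<in>P. (c p - d p) * p u)"
      by (rule ideal_mem_cong) (simp add: left_diff_distrib sum_subtractf)
    from weil_basis_independent[OF P this p] show ?thesis by simp
  qed
  have l: "l (weil_class W f) = c p" if f: "smooth_between (euclid (wdim W)) real_space f"
    "weil_zero W (\<lambda>u. f u - (\<Sum>p\<in>P. c p * p u))" for f c
    unfolding l_def
  proof (rule some_equality)
    show "\<exists>g d. smooth_between (euclid (wdim W)) real_space g \<and> weil_class W g = weil_class W f \<and>
      weil_zero W (\<lambda>u. g u - (\<Sum>p\<in>P. d p * p u)) \<and> c p = d p" using f by blast
  qed (use uniq f in blast)
  have ex: "\<exists>c. weil_zero W (\<lambda>u. f u - (\<Sum>p\<in>P. c p * p u))"
    if f: "smooth_between (euclid (wdim W)) real_space f" for f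
  proof -
    have "expansion (wdim W) one_space P {q. weil_zero W q} (\<lambda>u y. f u)"
      by (rule weil_basis_expansion[OF W P frolicher_one])
        (rule smooth_between_compose[OF f smooth_between_fst_id])
    from expansion_extract[OF fin this] obtain a where
      a: "expansion (wdim W) one_space {} {q. weil_zero W q} (\<lambda>u y. f u - (\<Sum>p\<in>P. p u * a p y))" by blast
    have "weil_zero W (\<lambda>u. f u - (\<Sum>p\<in>P. p u * a p ()))"
      using expansion_ideal_mem[OF I a smooth_between_const[OF frolicher_one, of "()"]]
      by (simp add: one_space_def)
    then have "weil_zero W (\<lambda>u. f u - (\<Sum>p\<in>P. a p () * p u))" by (simp add: mult.commute)
    then show ?thesis by (intro exI[of _ "\<lambda>p. a p ()"])
  qed
  have "l \<in> weil_dual W"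
    unfolding weil_dual_def
  proof (intro CollectI allI ballI)
    fix r s f g assume "f \<in> carrier (smooth_ring (wdim W))" "g \<in> carrier (smooth_ring (wdim W))"
    then have f: "smooth_between (euclid (wdim W)) real_space f" "restrict f (points (euclid (wdim W))) = f"
      and g: "smooth_between (euclid (wdim W)) real_space g" "restrict g (points (euclid (wdim W))) = g"
      by (auto simp: carrier_smooth_ring extensional_restrict)
    obtain c d where cd: "weil_zero W (\<lambda>u. f u - (\<Sum>p\<in>P. c p * p u))"
      "weil_zero W (\<lambda>u. g u - (\<Sum>p\<in>P. d p * p u))" using ex f g by meson
    have "weil_zero W (\<lambda>u. (r * f u + s * g u) - (\<Sum>p\<in>P. (r * c p + s * d p) * p u))"
      using ideal_mem_add[OF I ideal_mem_cmult[OF I cd(1), of r] ideal_mem_cmult[OF I cd(2), of s]]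
      by (rule ideal_mem_cong) (simp add: sum.distrib sum_distrib_left algebra_simps)
    moreover have "smooth_between (euclid (wdim W)) real_space (\<lambda>u. r * f u + s * g u)"
      by (intro smooth_between_real_add smooth_between_real_mult smooth_between_real_const f g)
    ultimately have "l (weil_class W (\<lambda>u. r * f u + s * g u)) = r * c p + s * d p" by (intro l)
    moreover have "l (weil_class W f) = c p" "l (weil_class W g) = d p" using l f g cd by auto
    ultimately show "l (weil_coset W (\<lambda>x\<in>points (euclid (wdim W)). r * f x + s * g x)) =
        r * l (weil_coset W f) + s * l (weil_coset W g)"
      using f(2) g(2) by (simp add: weil_class_def)
  qed
  then show ?thesis using that l by blast
qed

section \<open>Weil prolongation\<close>

text \<open>The congruence and its classes for maps that need not be extensional.\<close>

definition jet_eq :: "'a frolicher \<Rightarrow> weil \<Rightarrow> ((nat \<Rightarrow> real) \<Rightarrow> 'a) \<Rightarrow> ((nat \<Rightarrow> real) \<Rightarrow> 'a) \<Rightarrow> bool" where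
  "jet_eq X W f g \<longleftrightarrow> smooth_between (euclid (wdim W)) X f \<and> smooth_between (euclid (wdim W)) X g \<and>
     f origin = g origin \<and>
     (\<forall>\<psi>. smooth_between X real_space \<psi> \<longrightarrow> weil_zero W (\<lambda>u. \<psi> (f u) - \<psi> (g u)))"

definition jet_class :: "'a frolicher \<Rightarrow> weil \<Rightarrow> ((nat \<Rightarrow> real) \<Rightarrow> 'a) \<Rightarrow> 'a jets" where
  "jet_class X W f = prolong_class X W (restrict f (points (euclid (wdim W))))"

lemma jet_class_cong:
  "(\<And>u. u \<in> points (euclid (wdim W)) \<Longrightarrow> f u = g u) \<Longrightarrow> jet_class X W f = jet_class X W g"
  unfolding jet_class_def by (metis restrict_ext)

lemma jet_eq_cong:
  assumes "jet_eq X W f g" "\<And>u. u \<in> points (euclid (wdim W)) \<Longrightarrow> f u = f' u"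
    "\<And>u. u \<in> points (euclid (wdim W)) \<Longrightarrow> g u = g' u"
  shows "jet_eq X W f' g'"
proof -
  have "smooth_between (euclid (wdim W)) X f'" "smooth_between (euclid (wdim W)) X g'"
    using assms(1) smooth_between_cong[OF frolicher_euclid assms(2)]
      smooth_between_cong[OF frolicher_euclid assms(3)] by (auto simp: jet_eq_def)
  moreover have "f' origin = g' origin"
    using assms(1) assms(2)[OF origin_in_euclid] assms(3)[OF origin_in_euclid] by (simp add: jet_eq_def)
  moreover have "weil_zero W (\<lambda>u. \<psi> (f' u) - \<psi> (g' u))" if "smooth_between X real_space \<psi>" for \<psi>
  proof -
    have "weil_zero W (\<lambda>u. \<psi> (f u) - \<psi> (g u))" using assms(1) that by (simp add: jet_eq_def)
    then show ?thesis by (rule ideal_mem_cong) (simp add: assms(2,3))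
  qed
  ultimately show ?thesis by (simp add: jet_eq_def)
qed

lemma jet_eq_smooth:
  "jet_eq X W f g \<Longrightarrow> smooth_between (euclid (wdim W)) X f"
  "jet_eq X W f g \<Longrightarrow> smooth_between (euclid (wdim W)) X g"
  by (simp_all add: jet_eq_def)

lemma jet_eq_map:
  assumes "jet_eq X W f g" "smooth_between X Y \<phi>"
  shows "jet_eq Y W (\<lambda>u. \<phi> (f u)) (\<lambda>u. \<phi> (g u))"
proof -
  have "weil_zero W (\<lambda>u. \<psi> (\<phi> (f u)) - \<psi> (\<phi> (g u)))" if "smooth_between Y real_space \<psi>" for \<psi>
    using assms(1) smooth_between_compose[OF that assms(2)] unfolding jet_eq_def
    by (elim conjE) (drule spec[of _ "\<lambda>x. \<psi> (\<phi> x)"], simp)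
  then show ?thesis
    using assms smooth_between_compose[OF assms(2)] by (auto simp: jet_eq_def)
qed

context
  fixes W :: weil assumes W: "weil_algebra W"
begin

lemma jet_eq_refl: "smooth_between (euclid (wdim W)) X f \<Longrightarrow> jet_eq X W f f"
  using ideal_mem_0[OF weil_ideal[OF W]] by (auto simp: jet_eq_def)

lemma jet_eq_sym:
  assumes "jet_eq X W f g"
  shows "jet_eq X W g f"
proof -
  have "weil_zero W (\<lambda>u. \<psi> (g u) - \<psi> (f u))" if "smooth_between X real_space \<psi>" for \<psi>
  proof -
    have "weil_zero W (\<lambda>u. \<psi> (f u) - \<psi> (g u))" using assms that by (simp add: jet_eq_def)
    from ideal_mem_cmult[OF weil_ideal[OF W] this, of "-1"] show ?thesis by simp
  qed
  then show ?thesis using assms by (auto simp: jet_eq_def)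
qed

lemma jet_eq_trans:
  assumes "jet_eq X W f g" "jet_eq X W g h"
  shows "jet_eq X W f h"
proof -
  have "weil_zero W (\<lambda>u. \<psi> (f u) - \<psi> (h u))" if "smooth_between X real_space \<psi>" for \<psi>
  proof -
    have "weil_zero W (\<lambda>u. \<psi> (f u) - \<psi> (g u))" "weil_zero W (\<lambda>u. \<psi> (g u) - \<psi> (h u))"
      using assms that by (auto simp: jet_eq_def)
    from ideal_mem_add[OF weil_ideal[OF W] this] show ?thesis by simp
  qed
  then show ?thesis using assms by (auto simp: jet_eq_def)
qed

end

context
  fixes W :: weil and X :: "'a frolicher" assumes W: "weil_algebra W" and X: "frolicher_space X"
begin

lemma prolong_rel_iff:
  "(f, g) \<in> prolong_rel X W \<longleftrightarrow>
   f \<in> extensional (points (euclid (wdim W))) \<and> g \<in> extensional (points (euclid (wdim W))) \<and> jet_eq X W f g"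
proof -
  have "weil_zero W (\<lambda>u. \<psi> (f u) - \<psi> (g u)) \<longleftrightarrow>
      weil_zero W (\<lambda>u. restrict \<psi> (points X) (f u) - restrict \<psi> (points X) (g u))"
    if "smooth_between (euclid (wdim W)) X f" "smooth_between (euclid (wdim W)) X g" for \<psi>
  proof -
    have "restrict (\<lambda>u. \<psi> (f u) - \<psi> (g u)) (points (euclid (wdim W))) =
        restrict (\<lambda>u. restrict \<psi> (points X) (f u) - restrict \<psi> (points X) (g u)) (points (euclid (wdim W)))"
      by (rule restrict_ext) (simp add: smooth_between_points[OF that(1)] smooth_between_points[OF that(2)])
    then show ?thesis by (simp add: ideal_mem_def)
  qed
  moreover have "(\<forall>\<phi>\<in>smooth_maps X real_space. Q \<phi>) \<longleftrightarrow>
      (\<forall>\<psi>. smooth_between X real_space \<psi> \<longrightarrow> Q (restrict \<psi> (points X)))" for Q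
    using restrict_in_smooth_maps[OF X] smooth_maps_restrict smooth_maps_smooth_between by metis
  ultimately show ?thesis
    unfolding prolong_rel_def jet_eq_def ideal_mem_def[symmetric]
    by (auto simp: smooth_maps_iff)
qed

lemma jet_class_eqI:
  assumes "jet_eq X W f g"
  shows "jet_class X W f = jet_class X W g"
proof -
  let ?P = "points (euclid (wdim W))"
  have *: "jet_eq X W (restrict f ?P) h \<longleftrightarrow> jet_eq X W f h" for f h
    using jet_eq_cong[of X W "restrict f ?P" h f h] jet_eq_cong[of X W f h "restrict f ?P" h] by auto
  have "jet_eq X W f h \<longleftrightarrow> jet_eq X W g h" for h
    using jet_eq_trans[OF W] jet_eq_sym[OF W] assms by blast
  then show ?thesis
    unfolding jet_class_def prolong_class_def Image_singleton prolong_rel_iff * by simp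
qed

lemma jet_class_eqD:
  assumes "jet_class X W f = jet_class X W g" "smooth_between (euclid (wdim W)) X g"
  shows "jet_eq X W f g"
proof -
  let ?P = "points (euclid (wdim W))"
  have "jet_eq X W (restrict g ?P) (restrict g ?P)"
    using assms(2) by (intro jet_eq_refl[OF W]) simp
  then have "restrict g ?P \<in> jet_class X W g"
    unfolding jet_class_def prolong_class_def Image_singleton prolong_rel_iff by simp
  then have "jet_eq X W (restrict f ?P) (restrict g ?P)"
    unfolding assms(1)[symmetric]
    unfolding jet_class_def prolong_class_def Image_singleton prolong_rel_iff by simp
  then show ?thesis by (rule jet_eq_cong) auto
qed

lemma jet_class_point: "smooth_between (euclid (wdim W)) X f \<Longrightarrow> jet_class X W f \<in> points (prolong X W)"
  unfolding prolong_def jet_class_def prolong_class_def points_initial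
  by (intro quotientI restrict_in_smooth_maps frolicher_euclid)

lemma prolong_point:
  assumes "z \<in> points (prolong X W)"
  obtains f where "smooth_between (euclid (wdim W)) X f" "z = jet_class X W f"
proof -
  obtain f where f: "f \<in> smooth_maps (euclid (wdim W)) X" "z = prolong_class X W f"
    using assms unfolding prolong_def points_initial prolong_class_def by (auto elim: quotientE)
  then have "z = jet_class X W f" by (simp add: jet_class_def smooth_maps_restrict)
  with f show ?thesis using that smooth_maps_smooth_between by blast
qed

lemma prolong_fun_jet_class:
  assumes f: "smooth_between (euclid (wdim W)) X f" and \<psi>: "smooth_between X real_space \<psi>"
  shows "prolong_fun W \<psi> (jet_class X W f) = weil_class W (\<lambda>u. \<psi> (f u))"
proof -
  let ?P = "points (euclid (wdim W))"
  let ?F = "\<lambda>g. weil_coset W (compose ?P \<psi> g)"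
  have mem: "g \<in> jet_class X W f \<longleftrightarrow> g \<in> extensional ?P \<and> jet_eq X W (restrict f ?P) g" for g
    unfolding jet_class_def prolong_class_def Image_singleton by (simp add: prolong_rel_iff)
  have "?F g = weil_class W (\<lambda>u. \<psi> (f u))" if "g \<in> jet_class X W f" for g
  proof -
    have j: "jet_eq X W (restrict f ?P) g" using that mem by blast
    then have "weil_zero W (\<lambda>u. \<psi> (restrict f ?P u) - \<psi> (g u))" using \<psi> by (simp add: jet_eq_def)
    then have "weil_zero W (\<lambda>u. \<psi> (f u) - \<psi> (g u))" by (rule ideal_mem_cong) simp
    then have "weil_class W (\<lambda>u. \<psi> (f u)) = weil_class W (\<lambda>u. \<psi> (g u))"
      using weil_class_eq_iff[OF W smooth_between_compose[OF \<psi> f]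
          smooth_between_compose[OF \<psi> jet_eq_smooth(2)[OF j]]] by blast
    then show ?thesis by (simp add: weil_class_def compose_def)
  qed
  moreover have "restrict f ?P \<in> jet_class X W f"
    unfolding mem using f by (auto intro!: jet_eq_refl[OF W])
  ultimately have "?F ` jet_class X W f = {weil_class W (\<lambda>u. \<psi> (f u))}" by blast
  then show ?thesis by (simp add: prolong_fun_def)
qed

lemma prolong_fun_restrict:
  assumes "z \<in> points (prolong X W)" "smooth_between X real_space \<psi>"
  shows "prolong_fun W (restrict \<psi> (points X)) z = prolong_fun W \<psi> z"
proof -
  obtain f where f: "smooth_between (euclid (wdim W)) X f" "z = jet_class X W f"
    using prolong_point[OF assms(1)] .
  have "weil_class W (\<lambda>u. restrict \<psi> (points X) (f u)) = weil_class W (\<lambda>u. \<psi> (f u))"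
    unfolding weil_class_def
    by (rule arg_cong[where f="weil_coset W"], rule restrict_ext) (simp add: smooth_between_points[OF f(1)])
  then show ?thesis
    using prolong_fun_jet_class[OF f(1)] assms(2) X by (simp add: f(2))
qed

lemma prolong_fun_carrier:
  assumes "z \<in> points (prolong X W)" "smooth_between X real_space \<psi>"
  shows "prolong_fun W \<psi> z \<in> carrier (smooth_ring (wdim W) Quot wideal W)"
proof -
  obtain f where f: "smooth_between (euclid (wdim W)) X f" "z = jet_class X W f"
    using prolong_point[OF assms(1)] .
  show ?thesis
    unfolding f(2) prolong_fun_jet_class[OF f(1) assms(2)]
    by (rule weil_class_carrier[OF smooth_between_compose[OF assms(2) f(1)]])
qed

lemma frolicher_prolong: "frolicher_space (prolong X W)"
  unfolding prolong_def
proof (rule frolicher_initial)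
  show "frolicher_space (weil_space W)"
    unfolding weil_space_def by (rule frolicher_initial) simp_all
  fix g z assume "g \<in> prolong_fun W ` smooth_maps X real_space"
    and z: "z \<in> smooth_maps (euclid (wdim W)) X // prolong_rel X W"
  then obtain \<psi> where \<psi>: "g = prolong_fun W \<psi>" "smooth_between X real_space \<psi>"
    using smooth_maps_smooth_between by blast
  have "z \<in> points (prolong X W)" using z by (simp add: prolong_def)
  from prolong_fun_carrier[OF this \<psi>(2)] show "g z \<in> points (weil_space W)"
    by (simp add: \<psi>(1) weil_space_def)
qed

text \<open>The structure of \<open>X \<otimes> W\<close> is initial with respect to real functions.\<close>

lemma curves_prolong:
  "c \<in> curves (prolong X W) \<longleftrightarrow> (\<forall>t. c t \<in> points (prolong X W)) \<and>
    (\<forall>\<psi> l. smooth_between X real_space \<psi> \<longrightarrow> l \<in> weil_dual W \<longrightarrow>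
       smooth_real (\<lambda>t. l (prolong_fun W \<psi> (c t))))"
    (is "_ \<longleftrightarrow> ?R")
proof -
  have "c \<in> curves (prolong X W) \<longleftrightarrow> (\<forall>t. c t \<in> points (prolong X W)) \<and>
    (\<forall>\<psi>\<in>smooth_maps X real_space. (\<lambda>t. prolong_fun W \<psi> (c t)) \<in> curves (weil_space W))"
    unfolding prolong_def curves_initial by simp
  also have "\<dots> \<longleftrightarrow> (\<forall>t. c t \<in> points (prolong X W)) \<and>
    (\<forall>\<psi>\<in>smooth_maps X real_space. \<forall>l\<in>weil_dual W. smooth_real (\<lambda>t. l (prolong_fun W \<psi> (c t))))"
    using prolong_fun_carrier smooth_maps_smooth_between
    unfolding weil_space_def curves_initial curves_real by blast
  also have "\<dots> \<longleftrightarrow> ?R"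
  proof (intro conj_cong refl iffI)
    assume c: "\<forall>t. c t \<in> points (prolong X W)"
      and *: "\<forall>\<psi>\<in>smooth_maps X real_space. \<forall>l\<in>weil_dual W. smooth_real (\<lambda>t. l (prolong_fun W \<psi> (c t)))"
    show "\<forall>\<psi> l. smooth_between X real_space \<psi> \<longrightarrow> l \<in> weil_dual W \<longrightarrow>
       smooth_real (\<lambda>t. l (prolong_fun W \<psi> (c t)))"
    proof (intro allI impI)
      fix \<psi> l assume \<psi>: "smooth_between X real_space \<psi>" and l: "l \<in> weil_dual W"
      from * restrict_in_smooth_maps[OF X \<psi>] l
      have "smooth_real (\<lambda>t. l (prolong_fun W (restrict \<psi> (points X)) (c t)))" by blast
      then show "smooth_real (\<lambda>t. l (prolong_fun W \<psi> (c t)))"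
        using c by (simp add: prolong_fun_restrict[OF _ \<psi>])
    qed
  qed (use smooth_maps_smooth_between in blast)
  finally show ?thesis .
qed

end

definition jet_rep :: "'a frolicher \<Rightarrow> weil \<Rightarrow> 'a jets \<Rightarrow> (nat \<Rightarrow> real) \<Rightarrow> 'a" where
  "jet_rep X W z = (SOME f. smooth_between (euclid (wdim W)) X f \<and> z = jet_class X W f)"

lemma jet_rep:
  assumes "weil_algebra W" "frolicher_space X" "z \<in> points (prolong X W)"
  shows "smooth_between (euclid (wdim W)) X (jet_rep X W z)" "jet_class X W (jet_rep X W z) = z"
proof -
  have "\<exists>f. smooth_between (euclid (wdim W)) X f \<and> z = jet_class X W f"
    using prolong_point[OF assms] by blast
  from someI_ex[OF this] show "smooth_between (euclid (wdim W)) X (jet_rep X W z)"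
    "jet_class X W (jet_rep X W z) = z"
    unfolding jet_rep_def by auto
qed

lemma jet_rep_class:
  assumes "weil_algebra W" "frolicher_space X" "smooth_between (euclid (wdim W)) X f"
  shows "jet_eq X W (jet_rep X W (jet_class X W f)) f"
  using jet_class_eqD[OF assms(1,2) jet_rep(2)[OF assms(1,2) jet_class_point[OF assms]] assms(3)] .

abbreviation weil_dom :: "weil \<Rightarrow> (nat \<Rightarrow> real) frolicher" where
  "weil_dom W \<equiv> euclid (wdim W)"

subsection \<open>Smooth maps to and from prolongations\<close>

text \<open>The source of all smooth maps into prolongations below: a smooth family of maps has a smooth family
of jets. A curve in \<open>X \<otimes> W\<close> need not arise in this way; the sections introduced later provide it.\<close>

lemma jet_class_smooth:
  assumes W: "weil_algebra W" and X: "frolicher_space X" and Y: "frolicher_space Y"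
    and h: "smooth_between (prod_space (weil_dom W) Y) X (\<lambda>p. h (fst p) (snd p))"
  shows "smooth_between Y (prolong X W) (\<lambda>y. jet_class X W (\<lambda>u. h u y))"
proof -
  have hy: "smooth_between (weil_dom W) X (\<lambda>u. h u y)" if "y \<in> points Y" for y
    by (rule smooth_between_subst2[OF h smooth_between_id smooth_between_const[OF Y that]])
  have "(\<lambda>t. jet_class X W (\<lambda>u. h u (c t))) \<in> curves (prolong X W)" if c: "c \<in> curves Y" for c
    unfolding curves_prolong[OF W X]
  proof (intro conjI allI impI)
    note hc = hy[OF curve_in_points[OF Y c]]
    show "jet_class X W (\<lambda>u. h u (c t)) \<in> points (prolong X W)" for t
      by (rule jet_class_point[OF W X hc])
    fix \<psi> l assume \<psi>: "smooth_between X real_space \<psi>" and l: "l \<in> weil_dual W"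
    have "smooth_between Y real_space (\<lambda>y. l (weil_class W (\<lambda>u. \<psi> (h u y))))"
      by (rule weil_dual_smooth[OF W l Y smooth_between_compose[OF \<psi> h]])
    from curve_smooth_real[OF c this]
    show "smooth_real (\<lambda>t. l (prolong_fun W \<psi> (jet_class X W (\<lambda>u. h u (c t)))))"
      by (simp add: prolong_fun_jet_class[OF W X hc \<psi>])
  qed
  then show ?thesis
    unfolding smooth_between_def using jet_class_point[OF W X hy] by blast
qed

definition prolong_map :: "'a frolicher \<Rightarrow> 'b frolicher \<Rightarrow> weil \<Rightarrow> ('a \<Rightarrow> 'b) \<Rightarrow> 'a jets \<Rightarrow> 'b jets" where
  "prolong_map X Y W \<phi> z = jet_class Y W (\<lambda>u. \<phi> (jet_rep X W z u))"

lemma prolong_map_jet_class: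
  assumes "weil_algebra W" "frolicher_space X" "frolicher_space Y" "smooth_between X Y \<phi>"
    "smooth_between (weil_dom W) X f"
  shows "prolong_map X Y W \<phi> (jet_class X W f) = jet_class Y W (\<lambda>u. \<phi> (f u))"
  unfolding prolong_map_def
  by (rule jet_class_eqI[OF assms(1,3) jet_eq_map[OF jet_rep_class[OF assms(1,2,5)] assms(4)]])

lemma prolong_map_smooth:
  assumes W: "weil_algebra W" and X: "frolicher_space X" and Y: "frolicher_space Y"
    and \<phi>: "smooth_between X Y \<phi>"
  shows "smooth_between (prolong X W) (prolong Y W) (prolong_map X Y W \<phi>)"
proof -
  have sm: "smooth_between (weil_dom W) Y (\<lambda>u. \<phi> (jet_rep X W z u))"
    if "z \<in> points (prolong X W)" for z
    by (rule smooth_between_compose[OF \<phi> jet_rep(1)[OF W X that]])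
  have pts: "prolong_map X Y W \<phi> z \<in> points (prolong Y W)" if "z \<in> points (prolong X W)" for z
    unfolding prolong_map_def by (rule jet_class_point[OF W Y sm[OF that]])
  have "(\<lambda>t. prolong_map X Y W \<phi> (c t)) \<in> curves (prolong Y W)" if c: "c \<in> curves (prolong X W)" for c
    unfolding curves_prolong[OF W Y]
  proof (intro conjI allI impI)
    have ct: "c t \<in> points (prolong X W)" for t using c by (simp add: curves_prolong[OF W X])
    show "prolong_map X Y W \<phi> (c t) \<in> points (prolong Y W)" for t by (rule pts[OF ct])
    fix \<psi> l assume \<psi>: "smooth_between Y real_space \<psi>" and l: "l \<in> weil_dual W"
    note \<psi>\<phi> = smooth_between_compose[OF \<psi> \<phi>]
    have "prolong_fun W \<psi> (prolong_map X Y W \<phi> (c t)) = prolong_fun W (\<lambda>x. \<psi> (\<phi> x)) (c t)" for t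
      unfolding prolong_map_def prolong_fun_jet_class[OF W Y sm[OF ct] \<psi>]
      using prolong_fun_jet_class[OF W X jet_rep(1)[OF W X ct] \<psi>\<phi>] jet_rep(2)[OF W X ct] by simp
    then show "smooth_real (\<lambda>t. l (prolong_fun W \<psi> (prolong_map X Y W \<phi> (c t))))"
      using c \<psi>\<phi> l by (simp add: curves_prolong[OF W X])
  qed
  then show ?thesis unfolding smooth_between_def using pts by blast
qed

text \<open>Evaluation at the origin is a linear functional on the algebra, as its ideal lies in the
  maximal one. Hence the base point of a jet depends smoothly on the jet.\<close>

lemma weil_dual_origin:
  assumes W: "weil_algebra W"
  obtains l where "l \<in> weil_dual W"
    "\<And>f. smooth_between (weil_dom W) real_space f \<Longrightarrow> l (weil_class W f) = f origin"
proof -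
  define l where "l A = (SOME r. \<exists>f. smooth_between (weil_dom W) real_space f \<and> weil_class W f = A \<and> r = f origin)" for A
  have l: "l (weil_class W f) = f origin" if f: "smooth_between (weil_dom W) real_space f" for f
    unfolding l_def
  proof (rule some_equality)
    show "\<exists>g. smooth_between (weil_dom W) real_space g \<and> weil_class W g = weil_class W f \<and> f origin = g origin"
      using f by blast
    fix r assume "\<exists>g. smooth_between (weil_dom W) real_space g \<and> weil_class W g = weil_class W f \<and> r = g origin"
    then obtain g where "smooth_between (weil_dom W) real_space g" "weil_class W g = weil_class W f"
      "r = g origin" by blast
    then show "r = f origin"
      using weil_class_eq_iff[OF W _ f] weil_zero_origin[OF W] by fastforce
  qed
  have "l \<in> weil_dual W"
    unfolding weil_dual_def
  proof (intro CollectI allI ballI)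
    fix r s f g assume "f \<in> carrier (smooth_ring (wdim W))" "g \<in> carrier (smooth_ring (wdim W))"
    then have f: "smooth_between (weil_dom W) real_space f" "restrict f (points (weil_dom W)) = f"
      and g: "smooth_between (weil_dom W) real_space g" "restrict g (points (weil_dom W)) = g"
      by (auto simp: carrier_smooth_ring extensional_restrict)
    have "smooth_between (weil_dom W) real_space (\<lambda>u. r * f u + s * g u)"
      by (intro smooth_between_real_add smooth_between_real_mult smooth_between_real_const f g)
    from l[OF this] l[OF f(1)] l[OF g(1)]
    show "l (weil_coset W (\<lambda>x\<in>points (weil_dom W). r * f x + s * g x)) =
        r * l (weil_coset W f) + s * l (weil_coset W g)"
      using f(2) g(2) by (simp add: weil_class_def)
  qed
  then show ?thesis using that l by blast
qed

definition jet_base :: "'a frolicher \<Rightarrow> weil \<Rightarrow> 'a jets \<Rightarrow> 'a" where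
  "jet_base X W z = jet_rep X W z origin"

lemma jet_base_jet_class:
  assumes "weil_algebra W" "frolicher_space X" "smooth_between (weil_dom W) X f"
  shows "jet_base X W (jet_class X W f) = f origin"
  using jet_rep_class[OF assms] by (simp add: jet_base_def jet_eq_def)

lemma jet_base_smooth:
  assumes W: "weil_algebra W" and X: "frolicher_space X"
  shows "smooth_between (prolong X W) X (jet_base X W)"
proof -
  have pts: "jet_base X W z \<in> points X" if "z \<in> points (prolong X W)" for z
    unfolding jet_base_def by (rule smooth_between_points[OF jet_rep(1)[OF W X that]]) simp
  obtain l where l: "l \<in> weil_dual W"
    "\<And>f. smooth_between (weil_dom W) real_space f \<Longrightarrow> l (weil_class W f) = f origin"
    using weil_dual_origin[OF W] by blast
  have "(\<lambda>t. jet_base X W (c t)) \<in> curves X" if c: "c \<in> curves (prolong X W)" for c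
    unfolding curve_iff[OF X]
  proof (intro conjI allI impI)
    have ct: "c t \<in> points (prolong X W)" for t using c by (simp add: curves_prolong[OF W X])
    show "jet_base X W (c t) \<in> points X" for t by (rule pts[OF ct])
    fix \<psi> assume \<psi>: "smooth_between X real_space \<psi>"
    have "\<psi> (jet_base X W (c t)) = l (prolong_fun W \<psi> (c t))" for t
    proof -
      note r = jet_rep[OF W X ct]
      have "prolong_fun W \<psi> (c t) = weil_class W (\<lambda>u. \<psi> (jet_rep X W (c t) u))"
        using prolong_fun_jet_class[OF W X r(1) \<psi>] by (simp add: r(2))
      then show ?thesis using l(2)[OF smooth_between_compose[OF \<psi> r(1)]] by (simp add: jet_base_def)
    qed
    then show "smooth_real (\<lambda>t. \<psi> (jet_base X W (c t)))"
      using c \<psi> l(1) by (simp add: curves_prolong[OF W X])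
  qed
  then show ?thesis unfolding smooth_between_def using pts by blast
qed

definition jet_const :: "'a frolicher \<Rightarrow> weil \<Rightarrow> 'a \<Rightarrow> 'a jets" where
  "jet_const X W x = jet_class X W (\<lambda>_. x)"

lemma jet_const_smooth:
  assumes "weil_algebra W" "frolicher_space X"
  shows "smooth_between X (prolong X W) (jet_const X W)"
  unfolding jet_const_def
  by (rule jet_class_smooth[OF assms assms(2) smooth_between_snd_id])

lemma jet_base_const:
  assumes "weil_algebra W" "frolicher_space X" "x \<in> points X"
  shows "jet_base X W (jet_const X W x) = x"
  unfolding jet_const_def
  by (rule jet_base_jet_class[OF assms(1,2) smooth_between_const[OF assms(2,3)]])

subsection \<open>Jets of pairs\<close>

text \<open>It suffices to replace one component. For a function \<open>\<psi>\<close> on the product, the differences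
\<open>K(u, v) = \<psi>(f(u), k(v)) - \<psi>(g(u), k(v))\<close> are in the ideal for every fixed \<open>v\<close>. Hence \<open>K\<close> is a combination of
elements of the ideal with smooth coefficients, and so is its restriction to the diagonal.\<close>

lemma jet_eq_pair:
  assumes W: "weil_algebra W" and X: "frolicher_space X" and Y: "frolicher_space Y"
    and fg: "jet_eq X W f g" and fg': "jet_eq Y W f' g'"
  shows "jet_eq (prod_space X Y) W (\<lambda>u. (f u, f' u)) (\<lambda>u. (g u, g' u))"
proof -
  have one_side: "jet_eq (prod_space X Y) W (\<lambda>u. (f u, k u)) (\<lambda>u. (g u, k u))"
    if X: "frolicher_space X" and Y: "frolicher_space Y" and fg: "jet_eq X W f g"
      and k: "smooth_between (weil_dom W) Y k"
    for X :: "'c frolicher" and Y :: "'d frolicher" and f g k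
    unfolding jet_eq_def
  proof (intro conjI allI impI)
    show "smooth_between (weil_dom W) (prod_space X Y) (\<lambda>u. (f u, k u))"
      "smooth_between (weil_dom W) (prod_space X Y) (\<lambda>u. (g u, k u))"
      by (rule smooth_between_pair[OF jet_eq_smooth(1)[OF fg] k] smooth_between_pair[OF jet_eq_smooth(2)[OF fg] k])+
    show "(f origin, k origin) = (g origin, k origin)" using fg by (simp add: jet_eq_def)
    fix \<psi> assume \<psi>: "smooth_between (prod_space X Y) real_space \<psi>"
    let ?DD = "prod_space (weil_dom W) (weil_dom W)"
    define K where "K = (\<lambda>u v. \<psi> (f u, k v) - \<psi> (g u, k v))"
    have K: "smooth_between ?DD real_space (\<lambda>z. K (fst z) (snd z))"
      unfolding K_def
      by (intro smooth_between_real_diff smooth_between_compose[OF \<psi>] smooth_between_pair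
          smooth_between_compose[OF jet_eq_smooth(1)[OF fg] smooth_between_fst_id]
          smooth_between_compose[OF jet_eq_smooth(2)[OF fg] smooth_between_fst_id]
          smooth_between_compose[OF k smooth_between_snd_id])
    have "weil_zero W (\<lambda>u. K u v)" if v: "v \<in> points (weil_dom W)" for v
    proof -
      have "smooth_between X real_space (\<lambda>x. \<psi> (x, k v))"
        by (rule smooth_between_compose[OF \<psi> smooth_between_pair[OF smooth_between_id
                smooth_between_const[OF Y smooth_between_points[OF k v]]]])
      then show ?thesis using fg unfolding jet_eq_def K_def by blast
    qed
    from weil_zero_family[OF W frolicher_euclid K this]
    have "expansion (wdim W) (weil_dom W) {} {q. weil_zero W q} K" .
    from expansion_ideal_mem[OF weil_ideal[OF W] this smooth_between_id]
    show "weil_zero W (\<lambda>u. \<psi> (f u, k u) - \<psi> (g u, k u))" by (simp add: K_def)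
  qed
  have "jet_eq (prod_space Y X) W (\<lambda>u. (f' u, g u)) (\<lambda>u. (g' u, g u))"
    by (rule one_side[OF Y X fg' jet_eq_smooth(2)[OF fg]])
  from jet_eq_map[OF this smooth_between_pair[OF smooth_between_snd_id smooth_between_fst_id]]
  have "jet_eq (prod_space X Y) W (\<lambda>u. (g u, f' u)) (\<lambda>u. (g u, g' u))" by simp
  with one_side[OF X Y fg jet_eq_smooth(1)[OF fg']] show ?thesis
    by (rule jet_eq_trans[OF W])
qed

subsection \<open>Jets of families\<close>

text \<open>The functionals that recognize smooth families.\<close>

definition der_functional :: "(nat \<Rightarrow> real) \<Rightarrow> nat \<Rightarrow> (nat \<Rightarrow> real) \<Rightarrow> (real \<Rightarrow> real) \<Rightarrow> real" where
  "der_functional a q x k = (\<Sum>n. a n * nder q k (x n))"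

context
  fixes a x :: "nat \<Rightarrow> real" and R :: real
  assumes a: "summable (\<lambda>n. \<bar>a n\<bar>)" and x: "\<And>n. \<bar>x n\<bar> \<le> R"
begin

lemma der_functional_summable:
  assumes "smooth_real k"
  shows "summable (\<lambda>n. a n * nder q k (x n))"
proof -
  obtain B where "\<And>y. -R \<le> y \<Longrightarrow> y \<le> R \<Longrightarrow> \<bar>nder q k y\<bar> \<le> B"
    using nder_bounded_on_interval[OF assms, where a="-R" and b=R and k=q] by blast
  moreover have "-R \<le> x n" "x n \<le> R" for n using x[of n] by (auto simp: abs_le_iff)
  ultimately show ?thesis by (intro abs_summable_mult_bounded[OF a]) blast
qed

lemma der_functional_add:
  assumes "smooth_real k" "smooth_real m"
  shows "der_functional a q x (\<lambda>\<xi>. k \<xi> + m \<xi>) = der_functional a q x k + der_functional a q x m"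
  unfolding der_functional_def nder_add[OF assms]
  using suminf_add[OF der_functional_summable[OF assms(1)] der_functional_summable[OF assms(2)]]
  by (simp add: distrib_left)

lemma der_functional_cmult:
  assumes "smooth_real k"
  shows "der_functional a q x (\<lambda>\<xi>. c * k \<xi>) = c * der_functional a q x k"
  unfolding der_functional_def nder_cmult[OF assms]
  using suminf_mult[OF der_functional_summable[OF assms], of c] by (simp add: mult_ac)

lemma der_functional_0: "der_functional a q x (\<lambda>_. 0) = 0"
  using der_functional_cmult[OF smooth_real_const, of q 0 0] by simp

lemma der_functional_sum:
  assumes "\<And>p. p \<in> P \<Longrightarrow> smooth_real (k p)"
  shows "der_functional a q x (\<lambda>\<xi>. \<Sum>p\<in>P. c p * k p \<xi>) = (\<Sum>p\<in>P. c p * der_functional a q x (k p))"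
  using assms
proof (induction P rule: infinite_finite_induct)
  case (insert p P)
  have "smooth_real (\<lambda>\<xi>. c p * k p \<xi>)" "smooth_real (\<lambda>\<xi>. \<Sum>p\<in>P. c p * k p \<xi>)"
    using insert.prems by (auto intro!: smooth_intros)
  from der_functional_add[OF this] insert show ?case by (simp add: der_functional_cmult)
qed (simp_all add: der_functional_0)

lemma der_functional_smooth:
  assumes Y: "frolicher_space Y"
    and F: "smooth_between (prod_space Y real_space) real_space (\<lambda>p. F (fst p) (snd p))"
  shows "smooth_between Y real_space (\<lambda>y. der_functional a q x (F y))"
  unfolding smooth_between_real_iff
proof
  fix c assume c: "c \<in> curves Y"
  have "smooth2 (\<lambda>s \<xi>. F (c s) \<xi>)"
    unfolding smooth2_def
  proof (intro allI impI)
    fix b d assume "smooth_real b" "smooth_real d"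
    then have "(\<lambda>t. (c (b t), d t)) \<in> curves (prod_space Y real_space)"
      using curve_reparam[OF Y c] by (simp add: curves_prod)
    from curve_smooth_real[OF this F] show "smooth_real (\<lambda>t. F (c (b t)) (d t))" by simp
  qed
  from smooth_weighted_sum_nder[OF this a x]
  show "smooth_real (\<lambda>t. der_functional a q x (F (c t)))" by (simp add: der_functional_def)
qed

lemma expansion_der_functional:
  assumes I: "ideal I (smooth_ring n)" and "expansion n real_space {} {f. ideal_mem n I f} F"
  shows "(\<forall>u\<in>points (euclid n). smooth_real (F u)) \<and> ideal_mem n I (\<lambda>u. der_functional a q x (F u))"
  using assms(2)
proof induction
  case (zero F)
  then have "F u = (\<lambda>_. 0)" if "u \<in> points (euclid n)" for u using that by auto
  then show ?case
    by (auto intro!: ideal_mem_0[OF I] simp: der_functional_0 smooth_real_const)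
next
  case (rest F g T H)
  have H: "H u = (\<lambda>\<xi>. F u \<xi> + g u * T u \<xi>)" if "u \<in> points (euclid n)" for u
    using rest(4)[OF that] by auto
  have T: "smooth_real (T u)" if "u \<in> points (euclid n)" for u
    using smooth_between_slice[OF rest(3) frolicher_euclid that] smooth_real_ident
    by (auto simp: smooth_between_real_iff)
  have sm: "smooth_real (\<lambda>\<xi>. g u * T u \<xi>)" if "u \<in> points (euclid n)" for u
    by (intro smooth_intros T that)
  have "ideal_mem n I (\<lambda>u. der_functional a q x (T u) * g u)"
    using rest(2) by (intro ideal_mem_mult[OF I] der_functional_smooth[OF frolicher_euclid rest(3)]) simp
  from ideal_mem_add[OF I conjunct2[OF rest.IH] this]
  have "ideal_mem n I (\<lambda>u. der_functional a q x (H u))"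
  proof (rule ideal_mem_cong)
    fix u assume u: "u \<in> points (euclid n)"
    then have "smooth_real (F u)" using rest.IH by blast
    from der_functional_add[OF this sm[OF u], of q] der_functional_cmult[OF T[OF u], of q "g u"]
    show "der_functional a q x (F u) + der_functional a q x (T u) * g u = der_functional a q x (H u)"
      by (simp add: H[OF u])
  qed
  then show ?case using rest.IH sm H by (auto intro: smooth_real_add)
qed auto

text \<open>The functionals commute with the linear functionals of a Weil algebra, since both act
  termwise on an expansion.\<close>

lemma weil_dual_der_functional:
  assumes W: "weil_algebra W" and l: "l \<in> weil_dual W"
    and K: "smooth_between (prod_space (weil_dom W) real_space) real_space (\<lambda>z. K (fst z) (snd z))"
  shows "der_functional a q x (\<lambda>\<xi>. l (weil_class W (\<lambda>u. K u \<xi>))) =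
    l (weil_class W (\<lambda>u. der_functional a q x (K u)))"
proof (rule weil_dual_family[OF W l frolicher_real K])
  fix P b assume P: "finite P" "\<And>p. p \<in> P \<Longrightarrow> smooth_between (weil_dom W) real_space p"
    and b: "\<And>p. p \<in> P \<Longrightarrow> smooth_between real_space real_space (b p)"
    and ex: "expansion (wdim W) real_space {} {q. weil_zero W q} (\<lambda>u y. K u y - (\<Sum>p\<in>P. p u * b p y))"
    and eq: "\<And>y. y \<in> points real_space \<Longrightarrow>
      l (weil_class W (\<lambda>u. K u y)) = (\<Sum>p\<in>P. b p y * l (weil_class W p))"
  have b': "smooth_real (b p)" if "p \<in> P" for p
    using b[OF that] smooth_real_ident by (auto simp: smooth_between_real_iff)
  have Ku: "smooth_real (K u)" if "u \<in> points (weil_dom W)" for u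
    using smooth_between_slice[OF K frolicher_euclid that] smooth_real_ident
    by (auto simp: smooth_between_real_iff)
  have "der_functional a q x (\<lambda>\<xi>. l (weil_class W (\<lambda>u. K u \<xi>))) =
      der_functional a q x (\<lambda>\<xi>. \<Sum>p\<in>P. l (weil_class W p) * b p \<xi>)"
    by (simp add: eq mult.commute)
  also have "\<dots> = (\<Sum>p\<in>P. l (weil_class W p) * der_functional a q x (b p))"
    by (rule der_functional_sum[OF b'])
  also have "\<dots> = (\<Sum>p\<in>P. der_functional a q x (b p) * l (weil_class W p))"
    by (simp add: mult.commute)
  also have "\<dots> = l (weil_class W (\<lambda>u. \<Sum>p\<in>P. der_functional a q x (b p) * p u))"
    by (rule weil_dual_sum[OF l P(2), symmetric])
  also have "\<dots> = l (weil_class W (\<lambda>u. der_functional a q x (K u)))"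
  proof (rule weil_dual_cong[OF W, symmetric])
    show "smooth_between (weil_dom W) real_space (\<lambda>u. der_functional a q x (K u))"
      by (rule der_functional_smooth[OF frolicher_euclid K])
    show "smooth_between (weil_dom W) real_space (\<lambda>u. \<Sum>p\<in>P. der_functional a q x (b p) * p u)"
      by (intro smooth_between_real_sum smooth_between_real_mult smooth_between_real_const P)
    from conjunct2[OF expansion_der_functional[OF weil_ideal[OF W] ex, of q]]
    show "weil_zero W (\<lambda>u. der_functional a q x (K u) - (\<Sum>p\<in>P. der_functional a q x (b p) * p u))"
    proof (rule ideal_mem_cong)
      fix u assume u: "u \<in> points (weil_dom W)"
      have sm: "smooth_real (\<lambda>\<xi>. \<Sum>p\<in>P. (- p u) * b p \<xi>)"
        using b' by (intro smooth_intros)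
      have "der_functional a q x (\<lambda>y. K u y - (\<Sum>p\<in>P. p u * b p y)) =
          der_functional a q x (\<lambda>y. K u y + (\<Sum>p\<in>P. (- p u) * b p y))"
        by (simp add: sum_negf)
      also have "\<dots> = der_functional a q x (K u) + (\<Sum>p\<in>P. (- p u) * der_functional a q x (b p))"
        unfolding der_functional_add[OF Ku[OF u] sm]
        using der_functional_sum[where c="\<lambda>p. - p u" and k=b and P=P and q=q, OF b'] by simp
      finally show "der_functional a q x (\<lambda>y. K u y - (\<Sum>p\<in>P. p u * b p y)) =
          der_functional a q x (K u) - (\<Sum>p\<in>P. der_functional a q x (b p) * p u)"
        by (simp add: sum_negf mult.commute)
    qed
  qed
  finally show ?thesis .
qed

end

definition eps_map :: "'y frolicher \<Rightarrow> 'z frolicher \<Rightarrow> weil \<Rightarrow> ('y \<Rightarrow> 'z) jets \<Rightarrow> 'y \<Rightarrow> 'z jets" where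
  "eps_map Y Z W A = (\<lambda>y\<in>points Y. prolong_map (map_space Y Z) Z W (\<lambda>k. k y) A)"

lemma apply_smooth: "frolicher_space Y \<Longrightarrow> y \<in> points Y \<Longrightarrow> smooth_between (map_space Y Z) Z (\<lambda>k. k y)"
  by (rule smooth_between_apply[OF _ smooth_between_id smooth_between_const])

lemma eps_map_jet_class:
  assumes "weil_algebra W" "frolicher_space Y" "frolicher_space Z"
    "smooth_between (weil_dom W) (map_space Y Z) g" "y \<in> points Y"
  shows "eps_map Y Z W (jet_class (map_space Y Z) W g) y = jet_class Z W (\<lambda>u. g u y)"
  unfolding eps_map_def
  using prolong_map_jet_class[OF assms(1) frolicher_map_space[OF assms(2,3)] assms(3)
      apply_smooth[OF assms(2,5)] assms(4)] assms(5) by simp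

text \<open>A curve \<open>t \<mapsto> [g\<^sub>t]\<close> in \<open>Z\<^sup>Y \<otimes> W\<close> consists of jets whose representatives \<open>g\<^sub>t\<close> need not be chosen smoothly
in \<open>t\<close>. It is known only that \<open>l[\<Phi> \<circ> g\<^sub>t]\<close> is smooth in \<open>t\<close> for the functions \<open>\<Phi>\<close> of \<open>Z\<^sup>Y\<close> and the linear
functionals \<open>l\<close> of \<open>W\<close>. Along a curve \<open>y\<close> of \<open>Y\<close> and after a function \<open>\<psi>\<close> of \<open>Z\<close>, the claim is that
\<open>d(\<tau>, \<xi>) = l[\<psi>(g\<^sub>\<tau>(\<cdot>)(y(\<xi>)))]\<close> is smooth on the diagonal. The functionals \<open>\<Sum>a\<^sub>n k\<^bsup>(q)\<^esup>(x\<^sub>n)\<close> of \<open>d(\<tau>, \<cdot>)\<close> commute with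
\<open>l\<close>, so that they are of the form \<open>l[\<Phi> \<circ> g\<^sub>\<tau>]\<close>, and such functionals recognize smooth families.\<close>

lemma eps_map_smooth:
  assumes W: "weil_algebra W" and Y: "frolicher_space Y" and Z: "frolicher_space Z"
  shows "smooth_between (prolong (map_space Y Z) W) (map_space Y (prolong Z W)) (eps_map Y Z W)"
proof -
  let ?M = "map_space Y Z"
  have M: "frolicher_space ?M" by (rule frolicher_map_space[OF Y Z])
  have PM: "frolicher_space (prolong ?M W)" by (rule frolicher_prolong[OF W M])
  let ?e = "\<lambda>A y. prolong_map ?M Z W (\<lambda>k. k y) A"
  have pts: "?e A y \<in> points (prolong Z W)" if "A \<in> points (prolong ?M W)" "y \<in> points Y" for A y
    by (rule smooth_between_points[OF prolong_map_smooth[OF W M Z apply_smooth[OF Y that(2)]] that(1)])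
  have "smooth_between (prod_space (prolong ?M W) Y) (prolong Z W) (\<lambda>p. ?e (fst p) (snd p))"
    unfolding smooth_between_def
  proof (intro conjI ballI)
    show "?e (fst p) (snd p) \<in> points (prolong Z W)" if "p \<in> points (prod_space (prolong ?M W) Y)" for p
      using that by (auto intro: pts)
    fix c assume "c \<in> curves (prod_space (prolong ?M W) Y)"
    then have A: "(\<lambda>t. fst (c t)) \<in> curves (prolong ?M W)" and y: "(\<lambda>t. snd (c t)) \<in> curves Y"
      by (auto simp: curves_prod)
    have At: "fst (c t) \<in> points (prolong ?M W)" for t using A curve_in_points[OF PM] by blast
    have yt: "snd (c t) \<in> points Y" for t using y curve_in_points[OF Y] by blast
    show "(\<lambda>t. ?e (fst (c t)) (snd (c t))) \<in> curves (prolong Z W)"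
      unfolding curves_prolong[OF W Z]
    proof (intro conjI allI impI)
      show "?e (fst (c t)) (snd (c t)) \<in> points (prolong Z W)" for t by (rule pts[OF At yt])
      fix \<psi> l assume \<psi>: "smooth_between Z real_space \<psi>" and l: "l \<in> weil_dual W"
      define r where "r \<tau> = jet_rep ?M W (fst (c \<tau>))" for \<tau>
      have r: "smooth_between (weil_dom W) ?M (r \<tau>)" "jet_class ?M W (r \<tau>) = fst (c \<tau>)" for \<tau>
        unfolding r_def by (rule jet_rep[OF W M At])+
      define K where "K \<tau> u \<xi> = \<psi> (r \<tau> u (snd (c \<xi>)))" for \<tau> u \<xi>
      have K: "smooth_between (prod_space (weil_dom W) real_space) real_space (\<lambda>z. K \<tau> (fst z) (snd z))" for \<tau>
      proof -
        have "smooth_between real_space Y (\<lambda>\<xi>. snd (c \<xi>))"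
          using yt curve_reparam[OF Y y] by (simp add: smooth_between_def)
        from smooth_between_compose[OF this smooth_between_snd_id]
        have "smooth_between (prod_space (weil_dom W) real_space) Y (\<lambda>z. snd (c (snd z)))" .
        from smooth_between_apply[OF Y smooth_between_compose[OF r(1) smooth_between_fst_id] this]
        have "smooth_between (prod_space (weil_dom W) real_space) Z (\<lambda>z. r \<tau> (fst z) (snd (c (snd z))))" .
        from smooth_between_compose[OF \<psi> this] show ?thesis by (simp add: K_def)
      qed
      define d where "d \<tau> \<xi> = l (weil_class W (\<lambda>u. K \<tau> u \<xi>))" for \<tau> \<xi>
      have "regular2 d"
      proof (rule regular2_if_functionals_smooth)
        show "smooth_real (d \<tau>)" for \<tau>
          using weil_dual_smooth[OF W l frolicher_real K[of \<tau>]] smooth_real_ident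
          by (auto simp: smooth_between_real_iff d_def[abs_def])
        fix a x :: "nat \<Rightarrow> real" and q R assume a: "summable (\<lambda>n. \<bar>a n\<bar>)" and x: "\<And>n. \<bar>x n\<bar> \<le> R"
        define \<Phi> where "\<Phi> k = der_functional a q x (\<lambda>\<xi>. \<psi> (k (snd (c \<xi>))))" for k
        have \<Phi>: "smooth_between ?M real_space \<Phi>"
          unfolding \<Phi>_def
        proof (rule der_functional_smooth[OF a x M])
          have "smooth_between real_space Y (\<lambda>\<xi>. snd (c \<xi>))"
            using yt curve_reparam[OF Y y] by (simp add: smooth_between_def)
          from smooth_between_compose[OF this smooth_between_snd_id]
          have "smooth_between (prod_space ?M real_space) Y (\<lambda>z. snd (c (snd z)))" .
          from smooth_between_compose[OF \<psi> smooth_between_apply[OF Y smooth_between_fst_id this]]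
          show "smooth_between (prod_space ?M real_space) real_space (\<lambda>p. \<psi> ((fst p) (snd (c (snd p)))))" .
        qed
        have "(\<Sum>n. a n * nder q (d \<tau>) (x n)) = l (prolong_fun W \<Phi> (fst (c \<tau>)))" for \<tau>
        proof -
          have "prolong_fun W \<Phi> (fst (c \<tau>)) = weil_class W (\<lambda>u. \<Phi> (r \<tau> u))"
            using prolong_fun_jet_class[OF W M r(1) \<Phi>, of \<tau>] by (simp add: r(2))
          also have "\<dots> = weil_class W (\<lambda>u. der_functional a q x (K \<tau> u))"
            by (simp add: \<Phi>_def K_def[abs_def])
          finally show ?thesis
            using weil_dual_der_functional[OF a x W l K[of \<tau>], of q]
            by (simp add: der_functional_def d_def[abs_def])
        qed
        then show "smooth_real (\<lambda>\<tau>. \<Sum>n. a n * nder q (d \<tau>) (x n))"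
          using A \<Phi> l by (simp add: curves_prolong[OF W M])
      qed
      from smooth2D[OF regular2_imp_smooth2[OF this] smooth_real_ident smooth_real_ident]
      have "smooth_real (\<lambda>t. d t t)" .
      moreover have "l (prolong_fun W \<psi> (?e (fst (c t)) (snd (c t)))) = d t t" for t
      proof -
        note ev = apply_smooth[OF Y yt]
        have "?e (fst (c t)) (snd (c t)) = jet_class Z W (\<lambda>u. r t u (snd (c t)))"
          by (simp add: prolong_map_def r_def)
        moreover have "smooth_between (weil_dom W) Z (\<lambda>u. r t u (snd (c t)))"
          by (rule smooth_between_compose[OF ev r(1)])
        ultimately show ?thesis
          using prolong_fun_jet_class[OF W Z _ \<psi>] by (simp add: d_def K_def)
      qed
      ultimately show "smooth_real (\<lambda>t. l (prolong_fun W \<psi> (?e (fst (c t)) (snd (c t)))))" by simp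
    qed
  qed
  from smooth_between_curry[OF PM Y this] show ?thesis by (simp add: eps_map_def[abs_def])
qed

section \<open>Representatives of jets and of families of jets\<close>

text \<open>A choice of representatives of all jets that is smooth in the jet. It exists if \<open>\<epsilon>\<close> is surjective for
\<open>Y = X \<otimes> W\<close>, and it makes \<open>\<epsilon>\<close> surjective for every \<open>Y\<close> by substitution.\<close>

definition has_section :: "'a frolicher \<Rightarrow> weil \<Rightarrow> bool" where
  "has_section X W \<longleftrightarrow>
     (\<exists>G. smooth_between (prod_space (weil_dom W) (prolong X W)) X (\<lambda>p. G (fst p) (snd p)) \<and>
        (\<forall>z\<in>points (prolong X W). jet_class X W (\<lambda>u. G u z) = z))"

definition pointwise_jet_eq ::
    "'y frolicher \<Rightarrow> 'a frolicher \<Rightarrow> weil \<Rightarrow> ((nat \<Rightarrow> real) \<Rightarrow> 'y \<Rightarrow> 'a) \<Rightarrow> ((nat \<Rightarrow> real) \<Rightarrow> 'y \<Rightarrow> 'a) \<Rightarrow> bool" where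
  "pointwise_jet_eq Y X W g g' \<longleftrightarrow>
     smooth_between (prod_space (weil_dom W) Y) X (\<lambda>p. g (fst p) (snd p)) \<and>
     smooth_between (prod_space (weil_dom W) Y) X (\<lambda>p. g' (fst p) (snd p)) \<and>
     (\<forall>y\<in>points Y. jet_eq X W (\<lambda>u. g u y) (\<lambda>u. g' u y))"

text \<open>Injectivity of \<open>\<epsilon>\<close>: families that are pointwise congruent are congruent as maps into \<open>X\<^sup>Y\<close>.\<close>

definition faithful_families :: "'y frolicher \<Rightarrow> 'a frolicher \<Rightarrow> weil \<Rightarrow> bool" where
  "faithful_families Y X W \<longleftrightarrow>
     (\<forall>g g'. pointwise_jet_eq Y X W g g' \<longrightarrow>
        jet_eq (map_space Y X) W (\<lambda>u. restrict (g u) (points Y)) (\<lambda>u. restrict (g' u) (points Y)))"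

lemma pointwise_jet_eq_map:
  assumes "pointwise_jet_eq Y X W g g'" "smooth_between X Z \<phi>"
  shows "pointwise_jet_eq Y Z W (\<lambda>u y. \<phi> (g u y)) (\<lambda>u y. \<phi> (g' u y))"
  using assms smooth_between_compose[OF assms(2)] jet_eq_map[OF _ assms(2)]
  by (auto simp: pointwise_jet_eq_def)

lemma postcompose_smooth:
  assumes X: "frolicher_space X" and Y: "frolicher_space Y" and Z: "frolicher_space Z"
    and \<phi>: "smooth_between X Z \<phi>"
  shows "smooth_between (map_space Y X) (map_space Y Z) (\<lambda>k. \<lambda>y\<in>points Y. \<phi> (k y))"
  by (rule smooth_between_curry[OF frolicher_map_space[OF Y X] Y,
        OF smooth_between_compose[OF \<phi> smooth_between_apply[OF Y smooth_between_fst_id smooth_between_snd_id]]])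

lemma precompose_smooth:
  assumes X: "frolicher_space X" and Y: "frolicher_space Y" and Z: "frolicher_space Z"
    and s: "smooth_between Z Y s"
  shows "smooth_between (map_space Y X) (map_space Z X) (\<lambda>k. \<lambda>z\<in>points Z. k (s z))"
  by (rule smooth_between_curry[OF frolicher_map_space[OF Y X] Z,
        OF smooth_between_apply[OF Y smooth_between_fst_id smooth_between_compose[OF s smooth_between_snd_id]]])

subsection \<open>The space of pairs of equal jets\<close>

text \<open>A pair of maps is packed into one map of vectors that have an additional first coordinate, which
selects the component. So the pairs can be represented within the type of the jets.\<close>

definition encode_pair :: "((nat \<Rightarrow> real) \<Rightarrow> 'a) \<Rightarrow> ((nat \<Rightarrow> real) \<Rightarrow> 'a) \<Rightarrow> 'a jets" where
  "encode_pair f f' =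
     {\<lambda>v. if v 0 = 0 then f (\<lambda>i. v (Suc i)) else f' (\<lambda>i. v (Suc i))}"

definition decode :: "real \<Rightarrow> 'a jets \<Rightarrow> (nat \<Rightarrow> real) \<Rightarrow> 'a" where
  "decode r A u = the_elem A (case_nat r u)"

lemma decode_encode_pair [simp]:
  "decode 0 (encode_pair f f') = f" "decode 1 (encode_pair f f') = f'"
  by (simp_all add: decode_def encode_pair_def fun_eq_iff)

definition jet_pairs :: "'a frolicher \<Rightarrow> weil \<Rightarrow> 'a jets frolicher" where
  "jet_pairs X W = initial_space {encode_pair f f' | f f'. jet_eq X W f f'}
     ((\<lambda>r A. restrict (decode r A) (points (weil_dom W))) ` {0, 1}) (map_space (weil_dom W) X)"

lemma jet_pairs_point:
  "A \<in> points (jet_pairs X W) \<Longrightarrow> jet_eq X W (decode 0 A) (decode 1 A)"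
  by (auto simp: jet_pairs_def)

lemma frolicher_jet_pairs:
  assumes "frolicher_space X"
  shows "frolicher_space (jet_pairs X W)"
  unfolding jet_pairs_def
  by (rule frolicher_initial[OF frolicher_map_space[OF frolicher_euclid assms]])
    (auto intro!: restrict_in_smooth_maps dest: jet_eq_smooth)

lemma decode_smooth:
  assumes X: "frolicher_space X" and r: "r \<in> {0, 1}"
  shows "smooth_between (prod_space (weil_dom W) (jet_pairs X W)) X (\<lambda>p. decode r (snd p) (fst p))"
proof -
  let ?D = "weil_dom W" and ?Q = "jet_pairs X W"
  note M = frolicher_map_space[OF frolicher_euclid X, of "wdim W"]
  have "smooth_between ?Q (map_space ?D X) (\<lambda>A. restrict (decode r A) (points ?D))"
    unfolding smooth_between_def
  proof (intro conjI ballI)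
    fix A assume "A \<in> points ?Q"
    from jet_pairs_point[OF this] show "restrict (decode r A) (points ?D) \<in> points (map_space ?D X)"
      using r by (auto intro!: restrict_in_smooth_maps dest: jet_eq_smooth)
  qed (use r in \<open>auto simp: jet_pairs_def curves_initial\<close>)
  from smooth_between_apply[OF frolicher_euclid smooth_between_compose[OF this smooth_between_snd_id]
      smooth_between_fst_id]
  have "smooth_between (prod_space ?D ?Q) X (\<lambda>p. restrict (decode r (snd p)) (points ?D) (fst p))" .
  then show ?thesis
    by (subst smooth_between_cong[OF frolicher_prod[OF frolicher_euclid frolicher_jet_pairs[OF X]],
          where g="\<lambda>p. restrict (decode r (snd p)) (points ?D) (fst p)"]) auto
qed

text \<open>Every pair of pointwise equal families is pulled back from the tautological one.\<close>

lemma faithful_families_universal: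
  assumes X: "frolicher_space X" and Y: "frolicher_space Y"
    and Q: "faithful_families (jet_pairs X W) X W"
  shows "faithful_families Y X W"
  unfolding faithful_families_def
proof (intro allI impI)
  let ?D = "weil_dom W" and ?Q = "jet_pairs X W"
  note FQ = frolicher_jet_pairs[OF X, of W]
  fix g g' assume gg': "pointwise_jet_eq Y X W g g'"
  define s where "s y = encode_pair (\<lambda>u. g u y) (\<lambda>u. g' u y)" for y
  have dec: "decode 0 (s y) = (\<lambda>u. g u y)" "decode 1 (s y) = (\<lambda>u. g' u y)" for y
    by (simp_all add: s_def)
  have s: "smooth_between Y ?Q s"
    unfolding smooth_between_def
  proof (intro conjI ballI)
    show "s y \<in> points ?Q" if "y \<in> points Y" for y
      using gg' that by (auto simp: jet_pairs_def s_def pointwise_jet_eq_def)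
    then have pts: "s (c t) \<in> points ?Q" if "c \<in> curves Y" for c t
      using curve_in_points[OF Y that] by blast
    have curry: "smooth_between Y (map_space ?D X) (\<lambda>y. restrict (\<lambda>u. k u y) (points ?D))"
      if "smooth_between (prod_space ?D Y) X (\<lambda>p. k (fst p) (snd p))" for k
      by (rule smooth_between_curry[OF Y frolicher_euclid,
            OF smooth_between_subst2[OF that smooth_between_snd_id smooth_between_fst_id]])
    fix c assume c: "c \<in> curves Y"
    have "(\<lambda>t. restrict (\<lambda>u. g u (c t)) (points ?D)) \<in> curves (map_space ?D X)"
      "(\<lambda>t. restrict (\<lambda>u. g' u (c t)) (points ?D)) \<in> curves (map_space ?D X)"
      using gg' by (auto intro!: smooth_between_curves[OF curry c] simp: pointwise_jet_eq_def)
    then show "(\<lambda>t. s (c t)) \<in> curves ?Q"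
      using pts[OF c] by (simp add: jet_pairs_def curves_initial dec)
  qed
  have "pointwise_jet_eq ?Q X W (\<lambda>u A. decode 0 A u) (\<lambda>u A. decode 1 A u)"
    unfolding pointwise_jet_eq_def using decode_smooth[OF X] jet_pairs_point by auto
  then have "jet_eq (map_space ?Q X) W (\<lambda>u. \<lambda>A\<in>points ?Q. decode 0 A u) (\<lambda>u. \<lambda>A\<in>points ?Q. decode 1 A u)"
    using Q unfolding faithful_families_def by blast
  from jet_eq_map[OF this precompose_smooth[OF X FQ Y s]]
  show "jet_eq (map_space Y X) W (\<lambda>u. restrict (g u) (points Y)) (\<lambda>u. restrict (g' u) (points Y))"
    by (rule jet_eq_cong) (auto simp: dec smooth_between_points[OF s] intro!: restrict_ext)
qed

text \<open>Faithfulness for the tautological pair is faithfulness for all spaces of parameters, over any type.\<close>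

definition faithful :: "'a frolicher \<Rightarrow> weil \<Rightarrow> bool" where
  "faithful X W \<longleftrightarrow> faithful_families (jet_pairs X W) X W"

lemma faithfulD:
  assumes "faithful X W" "frolicher_space X" "frolicher_space Y" "pointwise_jet_eq Y X W g g'"
  shows "jet_eq (map_space Y X) W (\<lambda>u. restrict (g u) (points Y)) (\<lambda>u. restrict (g' u) (points Y))"
  using faithful_families_universal[OF assms(2,3)] assms(1,4)
  unfolding faithful_def faithful_families_def by blast

lemma faithfulI:
  assumes "frolicher_space X"
    and "\<And>(Y :: 'a jets frolicher) g g'. frolicher_space Y \<Longrightarrow> pointwise_jet_eq Y X W g g' \<Longrightarrow>
      jet_eq (map_space Y X) W (\<lambda>u. restrict (g u) (points Y)) (\<lambda>u. restrict (g' u) (points Y))"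
  shows "faithful (X :: 'a frolicher) W"
  unfolding faithful_def faithful_families_def using assms(2)[OF frolicher_jet_pairs[OF assms(1)]] by blast

subsection \<open>Retracts, products and mapping spaces\<close>

context
  fixes X :: "'a frolicher" and Z :: "'b frolicher" and i r
  assumes X: "frolicher_space X" and Z: "frolicher_space Z"
    and i: "smooth_between X Z i" and r: "smooth_between Z X r"
    and ri: "\<And>x. x \<in> points X \<Longrightarrow> r (i x) = x"
begin

lemma has_section_retract:
  assumes W: "weil_algebra W" and "has_section Z W"
  shows "has_section X W"
proof -
  let ?D = "weil_dom W"
  obtain G where G: "smooth_between (prod_space ?D (prolong Z W)) Z (\<lambda>p. G (fst p) (snd p))"
    "\<And>z. z \<in> points (prolong Z W) \<Longrightarrow> jet_class Z W (\<lambda>u. G u z) = z"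
    using assms(2) unfolding has_section_def by blast
  note pm = prolong_map_smooth[OF W X Z i]
  have "smooth_between (prod_space ?D (prolong X W)) X
      (\<lambda>p. r (G (fst p) (prolong_map X Z W i (snd p))))"
    by (rule smooth_between_compose[OF r smooth_between_subst2[OF G(1) smooth_between_fst_id
            smooth_between_compose[OF pm smooth_between_snd_id]]])
  moreover have "jet_class X W (\<lambda>u. r (G u (prolong_map X Z W i z))) = z"
    if z: "z \<in> points (prolong X W)" for z
  proof -
    obtain f where f: "smooth_between ?D X f" "z = jet_class X W f"
      using prolong_point[OF W X z] by blast
    note ifs = smooth_between_compose[OF i f(1)]
    have "jet_class Z W (\<lambda>u. G u (prolong_map X Z W i z)) = jet_class Z W (\<lambda>u. i (f u))"
      using G(2)[OF smooth_between_points[OF pm z]] prolong_map_jet_class[OF W X Z i f(1)] by (simp add: f(2))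
    from jet_class_eqD[OF W Z this ifs]
    have "jet_eq Z W (\<lambda>u. G u (prolong_map X Z W i z)) (\<lambda>u. i (f u))" .
    from jet_eq_map[OF this r]
    have "jet_eq X W (\<lambda>u. r (G u (prolong_map X Z W i z))) f"
      by (rule jet_eq_cong) (simp_all add: ri smooth_between_points[OF f(1)])
    from jet_class_eqI[OF W X this] show ?thesis by (simp add: f(2))
  qed
  ultimately show ?thesis
    unfolding has_section_def by (intro exI[of _ "\<lambda>u z. r (G u (prolong_map X Z W i z))"]) blast
qed

lemma faithful_retract:
  assumes "faithful Z W"
  shows "faithful X W"
proof (rule faithfulI[OF X])
  fix Y :: "'a jets frolicher" and g g' assume Y: "frolicher_space Y" and gg': "pointwise_jet_eq Y X W g g'"
  from faithfulD[OF assms Z Y pointwise_jet_eq_map[OF gg' i]]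
  have "jet_eq (map_space Y Z) W (\<lambda>u. \<lambda>y\<in>points Y. i (g u y)) (\<lambda>u. \<lambda>y\<in>points Y. i (g' u y))" .
  from jet_eq_map[OF this postcompose_smooth[OF Z Y X r]]
  show "jet_eq (map_space Y X) W (\<lambda>u. restrict (g u) (points Y)) (\<lambda>u. restrict (g' u) (points Y))"
  proof (rule jet_eq_cong)
    fix u assume "u \<in> points (weil_dom W)"
    then have "g u y \<in> points X" "g' u y \<in> points X" if "y \<in> points Y" for y
      using gg' that by (auto simp: pointwise_jet_eq_def dest!: jet_eq_smooth smooth_between_points bspec)
    then show "(\<lambda>y\<in>points Y. r ((\<lambda>y\<in>points Y. i (g u y)) y)) = restrict (g u) (points Y)"
      "(\<lambda>y\<in>points Y. r ((\<lambda>y\<in>points Y. i (g' u y)) y)) = restrict (g' u) (points Y)"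
      by (auto intro!: restrict_ext simp: ri)
  qed
qed

end

lemma has_section_prod:
  assumes W: "weil_algebra W" and X: "frolicher_space X" and Y: "frolicher_space Y"
    and "has_section X W" "has_section Y W"
  shows "has_section (prod_space X Y) W"
proof -
  let ?D = "weil_dom W" and ?P = "prod_space X Y"
  note P = frolicher_prod[OF X Y]
  obtain G where G: "smooth_between (prod_space ?D (prolong X W)) X (\<lambda>p. G (fst p) (snd p))"
    "\<And>z. z \<in> points (prolong X W) \<Longrightarrow> jet_class X W (\<lambda>u. G u z) = z"
    using assms(4) unfolding has_section_def by blast
  obtain H where H: "smooth_between (prod_space ?D (prolong Y W)) Y (\<lambda>p. H (fst p) (snd p))"
    "\<And>z. z \<in> points (prolong Y W) \<Longrightarrow> jet_class Y W (\<lambda>u. H u z) = z"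
    using assms(5) unfolding has_section_def by blast
  let ?f = "prolong_map ?P X W fst" and ?s = "prolong_map ?P Y W snd"
  note pf = prolong_map_smooth[OF W P X smooth_between_fst_id]
    and ps = prolong_map_smooth[OF W P Y smooth_between_snd_id]
  have "smooth_between (prod_space ?D (prolong ?P W)) ?P
      (\<lambda>p. (G (fst p) (?f (snd p)), H (fst p) (?s (snd p))))"
    by (intro smooth_between_pair
        smooth_between_subst2[OF G(1) smooth_between_fst_id smooth_between_compose[OF pf smooth_between_snd_id]]
        smooth_between_subst2[OF H(1) smooth_between_fst_id smooth_between_compose[OF ps smooth_between_snd_id]])
  moreover have "jet_class ?P W (\<lambda>u. (G u (?f z), H u (?s z))) = z" if z: "z \<in> points (prolong ?P W)" for z
  proof -
    obtain f where f: "smooth_between ?D ?P f" "z = jet_class ?P W f"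
      using prolong_point[OF W P z] by blast
    have "jet_class X W (\<lambda>u. G u (?f z)) = jet_class X W (\<lambda>u. fst (f u))"
      using G(2)[OF smooth_between_points[OF pf z]]
        prolong_map_jet_class[OF W P X smooth_between_fst_id f(1)] by (simp add: f(2))
    from jet_class_eqD[OF W X this smooth_between_fst[OF f(1)]]
    have a: "jet_eq X W (\<lambda>u. G u (?f z)) (\<lambda>u. fst (f u))" .
    have "jet_class Y W (\<lambda>u. H u (?s z)) = jet_class Y W (\<lambda>u. snd (f u))"
      using H(2)[OF smooth_between_points[OF ps z]]
        prolong_map_jet_class[OF W P Y smooth_between_snd_id f(1)] by (simp add: f(2))
    from jet_class_eqD[OF W Y this smooth_between_snd[OF f(1)]]
    have "jet_eq Y W (\<lambda>u. H u (?s z)) (\<lambda>u. snd (f u))" .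
    from jet_class_eqI[OF W P jet_eq_pair[OF W X Y a this]] show ?thesis by (simp add: f(2))
  qed
  ultimately show ?thesis
    unfolding has_section_def by (intro exI[of _ "\<lambda>u z. (G u (?f z), H u (?s z))"]) auto
qed

lemma faithful_prod:
  assumes W: "weil_algebra W" and X: "frolicher_space X" and Y: "frolicher_space Y"
    and "faithful X W" "faithful Y W"
  shows "faithful (prod_space X Y) W"
proof (rule faithfulI[OF frolicher_prod[OF X Y]])
  fix T :: "('a \<times> 'b) jets frolicher" and g g'
  assume T: "frolicher_space T" and gg': "pointwise_jet_eq T (prod_space X Y) W g g'"
  note TX = frolicher_map_space[OF T X] and TY = frolicher_map_space[OF T Y]
  from jet_eq_pair[OF W TX TY
      faithfulD[OF assms(4) X T pointwise_jet_eq_map[OF gg' smooth_between_fst_id]]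
      faithfulD[OF assms(5) Y T pointwise_jet_eq_map[OF gg' smooth_between_snd_id]]]
  have "jet_eq (prod_space (map_space T X) (map_space T Y)) W
      (\<lambda>u. (\<lambda>y\<in>points T. fst (g u y), \<lambda>y\<in>points T. snd (g u y)))
      (\<lambda>u. (\<lambda>y\<in>points T. fst (g' u y), \<lambda>y\<in>points T. snd (g' u y)))" .
  moreover have "smooth_between (prod_space (map_space T X) (map_space T Y)) (map_space T (prod_space X Y))
      (\<lambda>k. \<lambda>y\<in>points T. (fst k y, snd k y))"
    by (rule smooth_between_curry[OF frolicher_prod[OF TX TY] T])
      (rule smooth_between_pair[OF
          smooth_between_apply[OF T smooth_between_fst[OF smooth_between_fst_id] smooth_between_snd_id]
          smooth_between_apply[OF T smooth_between_snd[OF smooth_between_fst_id] smooth_between_snd_id]])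
  ultimately have "jet_eq (map_space T (prod_space X Y)) W
      (\<lambda>u. (\<lambda>k. \<lambda>y\<in>points T. (fst k y, snd k y)) (\<lambda>y\<in>points T. fst (g u y), \<lambda>y\<in>points T. snd (g u y)))
      (\<lambda>u. (\<lambda>k. \<lambda>y\<in>points T. (fst k y, snd k y)) (\<lambda>y\<in>points T. fst (g' u y), \<lambda>y\<in>points T. snd (g' u y)))"
    by (rule jet_eq_map)
  then show "jet_eq (map_space T (prod_space X Y)) W
      (\<lambda>u. restrict (g u) (points T)) (\<lambda>u. restrict (g' u) (points T))"
    by (rule jet_eq_cong) (auto intro!: restrict_ext)
qed

text \<open>A jet in \<open>A\<^sup>X \<otimes> W\<close> is mapped to \<open>(A \<otimes> W)\<^sup>X\<close> by \<open>\<epsilon>\<close>, and representatives are chosen there pointwise. They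
represent the given jet, because they do so at every point of \<open>X\<close>.\<close>

lemma has_section_map_space:
  assumes W: "weil_algebra W" and X: "frolicher_space X" and A: "frolicher_space A"
    and "has_section A W" "faithful A W"
  shows "has_section (map_space X A) W"
proof -
  let ?D = "weil_dom W" and ?M = "map_space X A"
  note M = frolicher_map_space[OF X A]
  note PM = frolicher_prolong[OF W M]
  obtain G where G: "smooth_between (prod_space ?D (prolong A W)) A (\<lambda>p. G (fst p) (snd p))"
    "\<And>z. z \<in> points (prolong A W) \<Longrightarrow> jet_class A W (\<lambda>u. G u z) = z"
    using assms(4) unfolding has_section_def by blast
  note eps = eps_map_smooth[OF W X A]
  let ?H = "\<lambda>u z. \<lambda>x\<in>points X. G u (eps_map X A W z x)"
  have Gx: "smooth_between (prod_space (prod_space ?D (prolong ?M W)) X) A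
      (\<lambda>q. G (fst (fst q)) (eps_map X A W (snd (fst q)) (snd q)))"
    by (rule smooth_between_subst2[OF G(1) smooth_between_fst[OF smooth_between_fst_id]
          smooth_between_apply[OF X smooth_between_compose[OF eps smooth_between_snd[OF smooth_between_fst_id]]
            smooth_between_snd_id]])
  have H: "smooth_between (prod_space ?D (prolong ?M W)) ?M (\<lambda>p. ?H (fst p) (snd p))"
    by (rule smooth_between_curry[OF frolicher_prod[OF frolicher_euclid PM] X Gx])
  moreover have "jet_class ?M W (\<lambda>u. ?H u z) = z" if z: "z \<in> points (prolong ?M W)" for z
  proof -
    obtain g where g: "smooth_between ?D ?M g" "z = jet_class ?M W g"
      using prolong_point[OF W M z] by blast
    note gu = smooth_between_uncurry[OF X g(1)]
    have "pointwise_jet_eq X A W (\<lambda>u x. G u (eps_map X A W z x)) g"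
      unfolding pointwise_jet_eq_def
    proof (intro conjI ballI gu)
      have "smooth_between (prod_space ?D X) (prod_space (prod_space ?D (prolong ?M W)) X)
          (\<lambda>p. ((fst p, z), snd p))"
        by (intro smooth_between_pair smooth_between_fst_id smooth_between_snd_id smooth_between_const[OF PM z])
      from smooth_between_compose[OF Gx this]
      show "smooth_between (prod_space ?D X) A (\<lambda>p. G (fst p) (eps_map X A W z (snd p)))" by simp
      fix x assume x: "x \<in> points X"
      note gx = smooth_between_compose[OF apply_smooth[OF X x] g(1)]
      have e: "eps_map X A W z x = jet_class A W (\<lambda>u. g u x)"
        unfolding g(2) by (rule eps_map_jet_class[OF W X A g(1) x])
      have "jet_class A W (\<lambda>u. G u (eps_map X A W z x)) = jet_class A W (\<lambda>u. g u x)"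
        unfolding e by (rule G(2)[OF jet_class_point[OF W A gx]])
      from jet_class_eqD[OF W A this gx]
      show "jet_eq A W (\<lambda>u. G u (eps_map X A W z x)) (\<lambda>u. g u x)" .
    qed
    from faithfulD[OF assms(5) A X this]
    have "jet_eq ?M W (\<lambda>u. ?H u z) g"
    proof (rule jet_eq_cong)
      fix u assume "u \<in> points ?D"
      then show "restrict (g u) (points X) = g u"
        using smooth_between_points[OF g(1)] smooth_maps_restrict by fastforce
    qed simp
    from jet_class_eqI[OF W M this] show ?thesis by (simp add: g(2))
  qed
  ultimately show ?thesis
    unfolding has_section_def by (intro exI[of _ ?H]) blast
qed

text \<open>By the exponential law, families of maps on \<open>X\<close> with parameters in \<open>T\<close> are families with parameters
in \<open>T \<times> X\<close>.\<close>

lemma faithful_map_space: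
  assumes W: "weil_algebra W" and X: "frolicher_space X" and A: "frolicher_space A"
    and "faithful A W"
  shows "faithful (map_space X A) W"
proof (rule faithfulI[OF frolicher_map_space[OF X A]])
  let ?D = "weil_dom W"
  fix T :: "('a \<Rightarrow> 'b) jets frolicher" and g g'
  assume T: "frolicher_space T" and gg': "pointwise_jet_eq T (map_space X A) W g g'"
  note TX = frolicher_prod[OF T X]
  define k where "k g u = (\<lambda>p. g u (fst p) (snd p))" for g :: "(nat \<Rightarrow> real) \<Rightarrow> ('a \<Rightarrow> 'b) jets \<Rightarrow> 'a \<Rightarrow> 'b" and u
  have sm: "smooth_between (prod_space ?D (prod_space T X)) A (\<lambda>p. k g (fst p) (snd p))"
    if "smooth_between (prod_space ?D T) (map_space X A) (\<lambda>p. g (fst p) (snd p))" for g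
    unfolding k_def
    by (rule smooth_between_apply[OF X smooth_between_subst2[OF that smooth_between_fst_id
            smooth_between_fst[OF smooth_between_snd_id]] smooth_between_snd[OF smooth_between_snd_id]])
  have "pointwise_jet_eq (prod_space T X) A W (k g) (k g')"
    unfolding pointwise_jet_eq_def
  proof (intro conjI ballI sm)
    fix p assume "p \<in> points (prod_space T X)"
    then have "jet_eq (map_space X A) W (\<lambda>u. g u (fst p)) (\<lambda>u. g' u (fst p))" "snd p \<in> points X"
      using gg' by (auto simp: pointwise_jet_eq_def)
    from jet_eq_map[OF this(1) apply_smooth[OF X this(2)]]
    show "jet_eq A W (\<lambda>u. k g u p) (\<lambda>u. k g' u p)" by (simp add: k_def)
  qed (use gg' in \<open>auto simp: pointwise_jet_eq_def\<close>)
  from faithfulD[OF assms(4) A TX this]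
  have "jet_eq (map_space (prod_space T X) A) W (\<lambda>u. restrict (k g u) (points (prod_space T X)))
      (\<lambda>u. restrict (k g' u) (points (prod_space T X)))" .
  moreover have "smooth_between (map_space (prod_space T X) A) (map_space T (map_space X A))
      (\<lambda>m. \<lambda>t\<in>points T. \<lambda>x\<in>points X. m (t, x))"
  proof -
    note M = frolicher_map_space[OF TX A]
    have "smooth_between (prod_space (prod_space (map_space (prod_space T X) A) T) X) A
        (\<lambda>q. fst (fst q) (snd (fst q), snd q))"
      by (rule smooth_between_apply[OF TX smooth_between_fst[OF smooth_between_fst_id]
            smooth_between_pair[OF smooth_between_snd[OF smooth_between_fst_id] smooth_between_snd_id]])
    from smooth_between_curry[OF frolicher_prod[OF M T] X, of A "\<lambda>q x. fst q (snd q, x)", OF this]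
    have "smooth_between (prod_space (map_space (prod_space T X) A) T) (map_space X A)
        (\<lambda>q. \<lambda>x\<in>points X. fst q (snd q, x))" .
    from smooth_between_curry[OF M T, of "map_space X A" "\<lambda>m t. \<lambda>x\<in>points X. m (t, x)", OF this]
    show ?thesis .
  qed
  ultimately have "jet_eq (map_space T (map_space X A)) W
      (\<lambda>u. \<lambda>t\<in>points T. \<lambda>x\<in>points X. restrict (k g u) (points (prod_space T X)) (t, x))
      (\<lambda>u. \<lambda>t\<in>points T. \<lambda>x\<in>points X. restrict (k g' u) (points (prod_space T X)) (t, x))"
    by (rule jet_eq_map)
  then show "jet_eq (map_space T (map_space X A)) W
      (\<lambda>u. restrict (g u) (points T)) (\<lambda>u. restrict (g' u) (points T))"
  proof (rule jet_eq_cong)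
    fix u assume u: "u \<in> points ?D"
    have eq: "(\<lambda>t\<in>points T. \<lambda>x\<in>points X. restrict (k g u) (points (prod_space T X)) (t, x)) = restrict (g u) (points T)"
      if "smooth_between (prod_space ?D T) (map_space X A) (\<lambda>p. g (fst p) (snd p))" for g
    proof (rule restrict_ext)
      fix t assume t: "t \<in> points T"
      have "g u t \<in> smooth_maps X A"
        using smooth_between_points[OF that, of "(u, t)"] u t by simp
      then show "(\<lambda>x\<in>points X. restrict (k g u) (points (prod_space T X)) (t, x)) = g u t"
        using t by (auto simp: k_def fun_eq_iff smooth_maps_iff extensional_def)
    qed
    show "(\<lambda>t\<in>points T. \<lambda>x\<in>points X. restrict (k g u) (points (prod_space T X)) (t, x)) = restrict (g u) (points T)"
      "(\<lambda>t\<in>points T. \<lambda>x\<in>points X. restrict (k g' u) (points (prod_space T X)) (t, x)) = restrict (g' u) (points T)"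
      by (rule eq, use gg' in \<open>simp add: pointwise_jet_eq_def\<close>)+
  qed
qed

subsection \<open>Prolongations of products and of mapping spaces as retracts\<close>

text \<open>The space \<open>X\<close> is a retract of each of its prolongations, by constant jets and base points.\<close>

lemma has_section_of_prolong:
  assumes "weil_algebra W\<^sub>1" "weil_algebra W\<^sub>2" "frolicher_space X" "has_section (prolong X W\<^sub>1) W\<^sub>2"
  shows "has_section X W\<^sub>2"
  by (rule has_section_retract[OF assms(3) frolicher_prolong[OF assms(1,3)] jet_const_smooth[OF assms(1,3)]
        jet_base_smooth[OF assms(1,3)] jet_base_const[OF assms(1,3)] assms(2,4)])

lemma faithful_of_prolong:
  assumes "weil_algebra W\<^sub>1" "frolicher_space X" "faithful (prolong X W\<^sub>1) W\<^sub>2"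
  shows "faithful X W\<^sub>2"
  by (rule faithful_retract[OF assms(2) frolicher_prolong[OF assms(1,2)] jet_const_smooth[OF assms(1,2)]
        jet_base_smooth[OF assms(1,2)] jet_base_const[OF assms(1,2)] assms(3)])

lemma prolong_prod_retract:
  assumes W: "weil_algebra W" and X: "frolicher_space X" and Y: "frolicher_space Y"
    and "has_section X W" "has_section Y W"
  obtains r where
    "smooth_between (prolong (prod_space X Y) W) (prod_space (prolong X W) (prolong Y W))
       (\<lambda>z. (prolong_map (prod_space X Y) X W fst z, prolong_map (prod_space X Y) Y W snd z))"
    "smooth_between (prod_space (prolong X W) (prolong Y W)) (prolong (prod_space X Y) W) r"
    "\<And>z. z \<in> points (prolong (prod_space X Y) W) \<Longrightarrow>
       r (prolong_map (prod_space X Y) X W fst z, prolong_map (prod_space X Y) Y W snd z) = z"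
    "\<And>f g. smooth_between (weil_dom W) X f \<Longrightarrow> smooth_between (weil_dom W) Y g \<Longrightarrow>
       r (jet_class X W f, jet_class Y W g) = jet_class (prod_space X Y) W (\<lambda>u. (f u, g u))"
proof -
  let ?D = "weil_dom W" and ?P = "prod_space X Y"
  note P = frolicher_prod[OF X Y]
  note AB = frolicher_prod[OF frolicher_prolong[OF W X] frolicher_prolong[OF W Y]]
  obtain G where G: "smooth_between (prod_space ?D (prolong X W)) X (\<lambda>p. G (fst p) (snd p))"
    "\<And>z. z \<in> points (prolong X W) \<Longrightarrow> jet_class X W (\<lambda>u. G u z) = z"
    using assms(4) unfolding has_section_def by blast
  obtain H where H: "smooth_between (prod_space ?D (prolong Y W)) Y (\<lambda>p. H (fst p) (snd p))"
    "\<And>z. z \<in> points (prolong Y W) \<Longrightarrow> jet_class Y W (\<lambda>u. H u z) = z"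
    using assms(5) unfolding has_section_def by blast
  let ?f = "prolong_map ?P X W fst" and ?s = "prolong_map ?P Y W snd"
  let ?r = "\<lambda>q. jet_class ?P W (\<lambda>u. (G u (fst q), H u (snd q)))"
  have rfg: "?r (jet_class X W f, jet_class Y W g) = jet_class ?P W (\<lambda>u. (f u, g u))"
    if f: "smooth_between ?D X f" and g: "smooth_between ?D Y g" for f g
  proof -
    have "jet_eq X W (\<lambda>u. G u (jet_class X W f)) f"
      by (rule jet_class_eqD[OF W X G(2)[OF jet_class_point[OF W X f]] f])
    moreover have "jet_eq Y W (\<lambda>u. H u (jet_class Y W g)) g"
      by (rule jet_class_eqD[OF W Y H(2)[OF jet_class_point[OF W Y g]] g])
    ultimately show ?thesis
      using jet_class_eqI[OF W P jet_eq_pair[OF W X Y]] by simp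
  qed
  show ?thesis
  proof (rule that[of ?r])
    show "smooth_between (prolong ?P W) (prod_space (prolong X W) (prolong Y W)) (\<lambda>z. (?f z, ?s z))"
      by (intro smooth_between_pair prolong_map_smooth[OF W P X smooth_between_fst_id]
          prolong_map_smooth[OF W P Y smooth_between_snd_id])
    show "smooth_between (prod_space (prolong X W) (prolong Y W)) (prolong ?P W) ?r"
      by (rule jet_class_smooth[OF W P AB])
        (intro smooth_between_pair
          smooth_between_subst2[OF G(1) smooth_between_fst_id smooth_between_fst[OF smooth_between_snd_id]]
          smooth_between_subst2[OF H(1) smooth_between_fst_id smooth_between_snd[OF smooth_between_snd_id]])
    fix z assume "z \<in> points (prolong ?P W)"
    then obtain f where f: "smooth_between ?D ?P f" "z = jet_class ?P W f"
      using prolong_point[OF W P] by blast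
    have "?f z = jet_class X W (\<lambda>u. fst (f u))" "?s z = jet_class Y W (\<lambda>u. snd (f u))"
      unfolding f(2) by (rule prolong_map_jet_class[OF W P X smooth_between_fst_id f(1)]
          prolong_map_jet_class[OF W P Y smooth_between_snd_id f(1)])+
    then show "?r (?f z, ?s z) = z"
      using rfg[OF smooth_between_fst[OF f(1)] smooth_between_snd[OF f(1)]] by (simp add: f(2))
  qed (rule rfg)
qed

lemma prolong_map_space_retract:
  assumes W: "weil_algebra W" and X: "frolicher_space X" and Y: "frolicher_space Y"
    and "has_section Y W" "faithful Y W"
  obtains r where
    "smooth_between (map_space X (prolong Y W)) (prolong (map_space X Y) W) r"
    "\<And>z. z \<in> points (prolong (map_space X Y) W) \<Longrightarrow> r (eps_map X Y W z) = z"
    "\<And>\<theta>. \<theta> \<in> points (map_space X (prolong Y W)) \<Longrightarrow> eps_map X Y W (r \<theta>) = \<theta>"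
proof -
  let ?D = "weil_dom W" and ?M = "map_space X Y" and ?A = "map_space X (prolong Y W)"
  note M = frolicher_map_space[OF X Y] and A = frolicher_map_space[OF X frolicher_prolong[OF W Y]]
  obtain G where G: "smooth_between (prod_space ?D (prolong Y W)) Y (\<lambda>p. G (fst p) (snd p))"
    "\<And>z. z \<in> points (prolong Y W) \<Longrightarrow> jet_class Y W (\<lambda>u. G u z) = z"
    using assms(4) unfolding has_section_def by blast
  let ?h = "\<lambda>u \<theta>. \<lambda>x\<in>points X. G u (\<theta> x)"
  have h: "smooth_between (prod_space ?D ?A) ?M (\<lambda>p. ?h (fst p) (snd p))"
    by (rule smooth_between_curry[OF frolicher_prod[OF frolicher_euclid A] X])
      (rule smooth_between_subst2[OF G(1) smooth_between_fst[OF smooth_between_fst_id]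
          smooth_between_apply[OF X smooth_between_snd[OF smooth_between_fst_id] smooth_between_snd_id]])
  show ?thesis
  proof (rule that[of "\<lambda>\<theta>. jet_class ?M W (\<lambda>u. ?h u \<theta>)"])
    show "smooth_between ?A (prolong ?M W) (\<lambda>\<theta>. jet_class ?M W (\<lambda>u. ?h u \<theta>))"
      by (rule jet_class_smooth[OF W M A h])
    show "eps_map X Y W (jet_class ?M W (\<lambda>u. ?h u \<theta>)) = \<theta>" if \<theta>: "\<theta> \<in> points ?A" for \<theta>
    proof
      fix x
      have hs: "smooth_between ?D ?M (\<lambda>u. ?h u \<theta>)"
        by (rule smooth_between_subst2[OF h smooth_between_id smooth_between_const[OF A \<theta>]])
      show "eps_map X Y W (jet_class ?M W (\<lambda>u. ?h u \<theta>)) x = \<theta> x"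
      proof (cases "x \<in> points X")
        case True
        then have "\<theta> x \<in> points (prolong Y W)"
          using \<theta> by (auto simp: smooth_maps_iff smooth_between_points)
        then show ?thesis using eps_map_jet_class[OF W X Y hs True] True G(2) by simp
      next
        case False
        then show ?thesis using \<theta> by (auto simp: eps_map_def smooth_maps_iff extensional_def)
      qed
    qed
    fix z assume "z \<in> points (prolong ?M W)"
    then obtain g where g: "smooth_between ?D ?M g" "z = jet_class ?M W g"
      using prolong_point[OF W M] by blast
    let ?\<theta> = "eps_map X Y W z"
    have \<theta>: "?\<theta> \<in> points ?A"
      by (rule smooth_between_points[OF eps_map_smooth[OF W X Y]])
        (simp add: g(2) jet_class_point[OF W M g(1)])
    have "pointwise_jet_eq X Y W (\<lambda>u x. G u (?\<theta> x)) g"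
      unfolding pointwise_jet_eq_def
    proof (intro conjI ballI smooth_between_uncurry[OF X g(1)])
      have "smooth_between X (prolong Y W) ?\<theta>" using \<theta> by (simp add: smooth_maps_iff)
      from smooth_between_subst2[OF G(1) smooth_between_fst_id smooth_between_compose[OF this smooth_between_snd_id]]
      show "smooth_between (prod_space ?D X) Y (\<lambda>p. G (fst p) (?\<theta> (snd p)))" .
      fix x assume x: "x \<in> points X"
      note gx = smooth_between_compose[OF apply_smooth[OF X x] g(1)]
      have e: "?\<theta> x = jet_class Y W (\<lambda>u. g u x)"
        unfolding g(2) by (rule eps_map_jet_class[OF W X Y g(1) x])
      show "jet_eq Y W (\<lambda>u. G u (?\<theta> x)) (\<lambda>u. g u x)"
        unfolding e by (rule jet_class_eqD[OF W Y G(2)[OF jet_class_point[OF W Y gx]] gx])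
    qed
    from faithfulD[OF assms(5) Y X this]
    have "jet_eq ?M W (\<lambda>u. ?h u ?\<theta>) g"
    proof (rule jet_eq_cong)
      fix u assume "u \<in> points ?D"
      then show "restrict (g u) (points X) = g u"
        using smooth_between_points[OF g(1)] smooth_maps_restrict by fastforce
    qed simp
    from jet_class_eqI[OF W M this] show "jet_class ?M W (\<lambda>u. ?h u ?\<theta>) = z" by (simp add: g(2))
  qed
qed

section \<open>The coproduct of two Weil algebras\<close>

lemma smooth_ring_uminus:
  assumes "f \<in> carrier (smooth_ring n)"
  shows "\<ominus>\<^bsub>smooth_ring n\<^esub> f = (\<lambda>x\<in>points (euclid n). - f x)"
proof -
  interpret cring "smooth_ring n" by (rule cring_smooth_ring)
  have "\<ominus>\<^bsub>smooth_ring n\<^esub> f = \<zero>\<^bsub>smooth_ring n\<^esub> \<ominus>\<^bsub>smooth_ring n\<^esub> f"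
    using assms by (simp add: a_minus_def del: smooth_ring_simps)
  also have "\<dots> = (\<lambda>x\<in>points (euclid n). - f x)"
    using smooth_ring_minus[OF zero_closed assms] by (auto simp: fun_eq_iff)
  finally show ?thesis .
qed

lemma ideal_max_ideal: "ideal (max_ideal n) (smooth_ring n)"
proof (rule idealI[OF ring_smooth_ring])
  interpret cring "smooth_ring n" by (rule cring_smooth_ring)
  show "subgroup (max_ideal n) (add_monoid (smooth_ring n))"
  proof (rule group.subgroupI[OF a_group])
    show "max_ideal n \<subseteq> carrier (add_monoid (smooth_ring n))" by (auto simp: max_ideal_def)
    have "\<zero>\<^bsub>smooth_ring n\<^esub> \<in> max_ideal n"
      unfolding max_ideal_def using zero_closed by auto
    then show "max_ideal n \<noteq> {}" by blast
    fix f assume "f \<in> max_ideal n"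
    then have f: "f \<in> carrier (smooth_ring n)" "f origin = 0" by (auto simp: max_ideal_def)
    show "inv\<^bsub>add_monoid (smooth_ring n)\<^esub> f \<in> max_ideal n"
      unfolding a_inv_def[symmetric] using a_inv_closed[OF f(1)] f
      by (simp add: max_ideal_def smooth_ring_uminus)
    fix g assume "g \<in> max_ideal n"
    then have g: "g \<in> carrier (smooth_ring n)" "g origin = 0" by (auto simp: max_ideal_def)
    show "f \<otimes>\<^bsub>add_monoid (smooth_ring n)\<^esub> g \<in> max_ideal n"
      using a_closed[OF f(1) g(1)] f g by (simp add: max_ideal_def)
  qed
  fix f h assume "f \<in> max_ideal n" and h: "h \<in> carrier (smooth_ring n)"
  then have f: "f \<in> carrier (smooth_ring n)" "f origin = 0" by (auto simp: max_ideal_def)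
  show "h \<otimes>\<^bsub>smooth_ring n\<^esub> f \<in> max_ideal n" "f \<otimes>\<^bsub>smooth_ring n\<^esub> h \<in> max_ideal n"
    using m_closed[OF h f(1)] m_closed[OF f(1) h] f by (simp_all add: max_ideal_def)
qed

lemma weil_tensor_simps:
  "wdim (weil_tensor W\<^sub>1 W\<^sub>2) = wdim W\<^sub>1 + wdim W\<^sub>2"
  by (simp add: weil_tensor_def Let_def)

lemma fst_vec_smooth: "smooth_between (euclid (n + m)) (euclid n) (fst_vec n)"
  by (rule smooth_between_euclidI) (auto simp: fst_vec_def smooth_between_coord)

lemma snd_vec_smooth: "smooth_between (euclid (n + m)) (euclid m) (snd_vec n)"
  by (rule smooth_between_euclidI) (auto simp: snd_vec_def smooth_between_coord points_euclid)

lemma join_vec_smooth: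
  "smooth_between (prod_space (euclid n) (euclid m)) (euclid (n + m)) (\<lambda>p. join_vec n (fst p) (snd p))"
proof (rule smooth_between_euclidI[OF frolicher_prod[OF frolicher_euclid frolicher_euclid]])
  fix i
  show "smooth_between (prod_space (euclid n) (euclid m)) real_space (\<lambda>p. join_vec n (fst p) (snd p) i)"
    using smooth_between_compose[OF smooth_between_coord smooth_between_fst_id]
      smooth_between_compose[OF smooth_between_coord smooth_between_snd_id]
    by (cases "i < n") (simp_all add: join_vec_def)
qed (auto simp: join_vec_def points_euclid)

lemma join_vec_fst_snd [simp]: "join_vec n (fst_vec n w) (snd_vec n w) = w"
  by (auto simp: join_vec_def fst_vec_def snd_vec_def)

lemma fst_vec_join_vec: "u \<in> points (euclid n) \<Longrightarrow> fst_vec n (join_vec n u v) = u"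
  by (auto simp: join_vec_def fst_vec_def points_euclid)

lemma snd_vec_join_vec [simp]: "snd_vec n (join_vec n u v) = v"
  by (auto simp: join_vec_def snd_vec_def)

lemma vec_origin [simp]: "fst_vec n origin = origin" "snd_vec n origin = origin"
  "join_vec n origin origin = origin"
  by (auto simp: fst_vec_def snd_vec_def join_vec_def)

lemma monomial_split:
  "p \<in> monomials (n + m) N \<Longrightarrow> \<exists>a b f g. a + b = N \<and> f \<in> monomials n a \<and> g \<in> monomials m b \<and>
     (\<forall>w. p w = f (fst_vec n w) * g (snd_vec n w))"
proof (induction N arbitrary: p)
  case 0
  then show ?case by (intro exI[of _ 0] exI[of _ "\<lambda>_. 1"]) auto
next
  case (Suc N)
  then obtain i q where p: "i < n + m" "q \<in> monomials (n + m) N" "p = (\<lambda>w. w i * q w)" by auto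
  from Suc.IH[OF p(2)] obtain a b f g where q: "a + b = N" "f \<in> monomials n a" "g \<in> monomials m b"
    "\<And>w. q w = f (fst_vec n w) * g (snd_vec n w)" by blast
  show ?case
  proof (cases "i < n")
    case True
    then have "(\<lambda>u. u i * f u) \<in> monomials n (Suc a)" using q(2) by force
    moreover have "p w = (\<lambda>u. u i * f u) (fst_vec n w) * g (snd_vec n w)" for w
      using True by (simp add: p(3) q(4) fst_vec_def)
    ultimately show ?thesis using q(1,3)
      by (intro exI[of _ "Suc a"] exI[of _ b] exI[of _ "\<lambda>u. u i * f u"] exI[of _ g]) simp
  next
    case False
    then have "(\<lambda>u. u (i - n) * g u) \<in> monomials m (Suc b)" using q(3) p(1) by force
    moreover have "p w = f (fst_vec n w) * (\<lambda>u. u (i - n) * g u) (snd_vec n w)" for w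
      using False by (simp add: p(3) q(4) snd_vec_def)
    ultimately show ?thesis using q(1,2)
      by (intro exI[of _ a] exI[of _ "Suc b"] exI[of _ f] exI[of _ "\<lambda>u. u (i - n) * g u"]) simp
  qed
qed

lemma weil_zero_monomials:
  assumes W: "weil_algebra W" and k: "\<And>p. p \<in> monomials (wdim W) (Suc k) \<Longrightarrow> weil_zero W p"
  shows "Suc k \<le> a \<Longrightarrow> p \<in> monomials (wdim W) a \<Longrightarrow> weil_zero W p"
proof (induction a arbitrary: p rule: dec_induct)
  case base
  then show ?case by (rule k)
next
  case (step a)
  then obtain i q where "q \<in> monomials (wdim W) a" "p = (\<lambda>u. u i * q u)" by auto
  then show ?case using ideal_mem_mult[OF weil_ideal[OF W] smooth_between_coord step.IH] by simp
qed

lemma expansion_shift: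
  assumes "expansion n Y {} (monomials n k) F" "i < n"
  shows "expansion n Y {} (monomials n (Suc k)) (\<lambda>u y. u i * F u y)"
  using assms(1)
proof induction
  case (zero F)
  then show ?case by (intro expansion.zero) auto
next
  case (rest F q R H)
  have "(\<lambda>u. u i * q u) \<in> monomials n (Suc k)" using rest(2) assms(2) by force
  from expansion_rest1[OF this rest(3)]
  have "expansion n Y {} (monomials n (Suc k)) (\<lambda>u y. (u i * q u) * R u y)" .
  from expansion_add[OF rest.IH this] show ?case
    by (rule expansion_cong) (simp add: rest(4) distrib_left)
qed auto

lemma max_ideal_decompose:
  assumes "f \<in> max_ideal n"
  obtains R where
    "\<And>i. i < n \<Longrightarrow> smooth_between (prod_space (euclid n) one_space) real_space (\<lambda>p. R i (fst p) (snd p))"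
    "\<And>u y. u \<in> points (euclid n) \<Longrightarrow> f u = (\<Sum>i<n. u i * R i u y)"
proof -
  have f: "smooth_between (euclid n) real_space f" "f origin = 0"
    using assms by (auto simp: max_ideal_def carrier_smooth_ring)
  have K: "smooth_between (prod_space (euclid n) one_space) real_space (\<lambda>p. f (fst p))"
    by (rule smooth_between_compose[OF f(1) smooth_between_fst_id])
  show ?thesis
  proof (rule hadamard[OF frolicher_one, of n "\<lambda>u _. f u", OF K])
    fix R
    assume R: "\<And>i. i < n \<Longrightarrow> smooth_between (prod_space (euclid n) one_space) real_space (\<lambda>p. R i (fst p) (snd p))"
      "\<And>u y. u \<in> points (euclid n) \<Longrightarrow> y \<in> points one_space \<Longrightarrow> f u = f origin + (\<Sum>i<n. u i * R i u y)"
    have "f u = (\<Sum>i<n. u i * R i u y)" if "u \<in> points (euclid n)" for u y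
      using R(2)[OF that, of y] f(2) by (simp add: one_space_def)
    with R(1) show ?thesis by (rule that)
  qed
qed

text \<open>By Hadamard's lemma, products of \<open>k + 1\<close> functions vanishing at the origin are combinations of
monomials of degree \<open>k + 1\<close>.\<close>

lemma max_ideal_power_expansion:
  "f \<in> (ideal_prod (smooth_ring n) (max_ideal n) ^^ k) (max_ideal n) \<Longrightarrow>
   f \<in> extensional (points (euclid n)) \<and>
   expansion n one_space {} (monomials n (Suc k)) (\<lambda>u _. f u)"
proof (induction k arbitrary: f)
  case 0
  then have f: "f \<in> max_ideal n" by simp
  obtain R where
    R: "\<And>i. i < n \<Longrightarrow> smooth_between (prod_space (euclid n) one_space) real_space (\<lambda>p. R i (fst p) (snd p))"
    "\<And>u y. u \<in> points (euclid n) \<Longrightarrow> f u = (\<Sum>i<n. u i * R i u y)"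
    using max_ideal_decompose[OF f] by blast
  have "expansion n one_space {} (monomials n (Suc 0)) (\<lambda>u y. \<Sum>i<n. (u i * 1) * R i u y)"
    by (intro expansion_sum expansion_rest1 R) force+
  then have "expansion n one_space {} (monomials n (Suc 0)) (\<lambda>u _. f u)"
    by (rule expansion_cong) (simp add: R(2)[symmetric])
  then show ?case using f by (simp add: max_ideal_def carrier_smooth_ring)
next
  case (Suc k)
  have "f \<in> ideal_prod (smooth_ring n) (max_ideal n)
      ((ideal_prod (smooth_ring n) (max_ideal n) ^^ k) (max_ideal n))" using Suc.prems by simp
  then show ?case
  proof induction
    case (prod f g)
    obtain R where
      R: "\<And>i. i < n \<Longrightarrow> smooth_between (prod_space (euclid n) one_space) real_space (\<lambda>p. R i (fst p) (snd p))"
      "\<And>u y. u \<in> points (euclid n) \<Longrightarrow> f u = (\<Sum>i<n. u i * R i u y)"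
      using max_ideal_decompose[OF prod(1)] by blast
    have "expansion n one_space {} (monomials n (Suc (Suc k))) (\<lambda>u y. \<Sum>i<n. u i * (R i u y * g u))"
      by (intro expansion_sum expansion_shift expansion_mult R conjunct2[OF Suc.IH[OF prod(2)]]) auto
    then have "expansion n one_space {} (monomials n (Suc (Suc k)))
        (\<lambda>u _. (f \<otimes>\<^bsub>smooth_ring n\<^esub> g) u)"
    proof (rule expansion_cong)
      fix u :: "nat \<Rightarrow> real" and y assume u: "u \<in> points (euclid n)"
      with R(2)[OF u, of y]
      show "(\<Sum>i<n. u i * (R i u y * g u)) = (f \<otimes>\<^bsub>smooth_ring n\<^esub> g) u"
        by (simp add: sum_distrib_right mult.assoc)
    qed
    moreover have "f \<otimes>\<^bsub>smooth_ring n\<^esub> g \<in> extensional (points (euclid n))"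
      unfolding smooth_ring_simps by (rule restrict_extensional)
    ultimately show ?case by blast
  next
    case (sum f g)
    then have "expansion n one_space {} (monomials n (Suc (Suc k))) (\<lambda>u y. f u + g u)"
      by (intro expansion_add) auto
    then have "expansion n one_space {} (monomials n (Suc (Suc k))) (\<lambda>u _. (f \<oplus>\<^bsub>smooth_ring n\<^esub> g) u)"
      by (rule expansion_cong) simp
    moreover have "f \<oplus>\<^bsub>smooth_ring n\<^esub> g \<in> extensional (points (euclid n))"
      unfolding smooth_ring_simps by (rule restrict_extensional)
    ultimately show ?case by blast
  qed
qed

context
  fixes W\<^sub>1 W\<^sub>2 :: weil assumes W\<^sub>1: "weil_algebra W\<^sub>1" and W\<^sub>2: "weil_algebra W\<^sub>2"
begin

lemma weil_tensor_generators:
  defines "S \<equiv> (\<lambda>f. compose (points (euclid (wdim W\<^sub>1 + wdim W\<^sub>2))) f (fst_vec (wdim W\<^sub>1))) ` wideal W\<^sub>1 \<union>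
    (\<lambda>g. compose (points (euclid (wdim W\<^sub>1 + wdim W\<^sub>2))) g (snd_vec (wdim W\<^sub>1))) ` wideal W\<^sub>2"
  shows "wideal (weil_tensor W\<^sub>1 W\<^sub>2) = genideal (smooth_ring (wdim W\<^sub>1 + wdim W\<^sub>2)) S" "S \<subseteq> max_ideal (wdim W\<^sub>1 + wdim W\<^sub>2)"
proof -
  show "wideal (weil_tensor W\<^sub>1 W\<^sub>2) = genideal (smooth_ring (wdim W\<^sub>1 + wdim W\<^sub>2)) S"
    by (simp add: weil_tensor_def Let_def S_def)
  have "compose (points (euclid (wdim W\<^sub>1 + wdim W\<^sub>2))) f (fst_vec (wdim W\<^sub>1)) \<in> max_ideal (wdim W\<^sub>1 + wdim W\<^sub>2)" if f: "f \<in> wideal W\<^sub>1" for f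
  proof -
    have f': "weil_zero W\<^sub>1 f" by (rule ideal_mem_of_mem[OF weil_ideal[OF W\<^sub>1] f])
    show ?thesis
      using restrict_in_carrier[OF smooth_between_compose[OF ideal_mem_smooth[OF weil_ideal[OF W\<^sub>1] f'] fst_vec_smooth]]
        weil_zero_origin[OF W\<^sub>1 f']
      by (simp add: max_ideal_def compose_def)
  qed
  moreover have "compose (points (euclid (wdim W\<^sub>1 + wdim W\<^sub>2))) g (snd_vec (wdim W\<^sub>1)) \<in> max_ideal (wdim W\<^sub>1 + wdim W\<^sub>2)" if g: "g \<in> wideal W\<^sub>2" for g
  proof -
    have g': "weil_zero W\<^sub>2 g" by (rule ideal_mem_of_mem[OF weil_ideal[OF W\<^sub>2] g])
    show ?thesis
      using restrict_in_carrier[OF smooth_between_compose[OF ideal_mem_smooth[OF weil_ideal[OF W\<^sub>2] g'] snd_vec_smooth]]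
        weil_zero_origin[OF W\<^sub>2 g']
      by (simp add: max_ideal_def compose_def)
  qed
  ultimately show "S \<subseteq> max_ideal (wdim W\<^sub>1 + wdim W\<^sub>2)" by (auto simp: S_def)
qed

lemma weil_tensor_ideal: "ideal (wideal (weil_tensor W\<^sub>1 W\<^sub>2)) (smooth_ring (wdim W\<^sub>1 + wdim W\<^sub>2))"
  unfolding weil_tensor_generators(1)
  by (rule ring.genideal_ideal[OF ring_smooth_ring]) (use weil_tensor_generators(2) in \<open>auto simp: max_ideal_def\<close>)

lemma weil_tensor_pullback:
  shows "weil_zero W\<^sub>1 f \<Longrightarrow> weil_zero (weil_tensor W\<^sub>1 W\<^sub>2) (\<lambda>w. f (fst_vec (wdim W\<^sub>1) w))"
    and "weil_zero W\<^sub>2 g \<Longrightarrow> weil_zero (weil_tensor W\<^sub>1 W\<^sub>2) (\<lambda>w. g (snd_vec (wdim W\<^sub>1) w))"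
proof -
  let ?P = "points (euclid (wdim W\<^sub>1 + wdim W\<^sub>2))"
  have sub: "(\<lambda>f. compose ?P f (fst_vec (wdim W\<^sub>1))) ` wideal W\<^sub>1 \<union> (\<lambda>g. compose ?P g (snd_vec (wdim W\<^sub>1))) ` wideal W\<^sub>2
      \<subseteq> wideal (weil_tensor W\<^sub>1 W\<^sub>2)"
    unfolding weil_tensor_generators(1)
    by (rule ring.genideal_self[OF ring_smooth_ring]) (use weil_tensor_generators(2) in \<open>auto simp: max_ideal_def\<close>)
  show "weil_zero (weil_tensor W\<^sub>1 W\<^sub>2) (\<lambda>w. f (fst_vec (wdim W\<^sub>1) w))" if "weil_zero W\<^sub>1 f"
  proof -
    have "compose ?P (restrict f (points (weil_dom W\<^sub>1))) (fst_vec (wdim W\<^sub>1)) \<in> wideal (weil_tensor W\<^sub>1 W\<^sub>2)"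
      using that sub by (auto simp: ideal_mem_def)
    moreover have "compose ?P (restrict f (points (weil_dom W\<^sub>1))) (fst_vec (wdim W\<^sub>1)) = restrict (\<lambda>w. f (fst_vec (wdim W\<^sub>1) w)) ?P"
      unfolding compose_def using smooth_between_points[OF fst_vec_smooth] by (auto intro!: restrict_ext)
    ultimately show ?thesis by (simp add: ideal_mem_def weil_tensor_simps)
  qed
  show "weil_zero (weil_tensor W\<^sub>1 W\<^sub>2) (\<lambda>w. g (snd_vec (wdim W\<^sub>1) w))" if "weil_zero W\<^sub>2 g"
  proof -
    have "compose ?P (restrict g (points (weil_dom W\<^sub>2))) (snd_vec (wdim W\<^sub>1)) \<in> wideal (weil_tensor W\<^sub>1 W\<^sub>2)"
      using that sub by (auto simp: ideal_mem_def)
    moreover have "compose ?P (restrict g (points (weil_dom W\<^sub>2))) (snd_vec (wdim W\<^sub>1)) = restrict (\<lambda>w. g (snd_vec (wdim W\<^sub>1) w)) ?P"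
      unfolding compose_def using smooth_between_points[OF snd_vec_smooth] by (auto intro!: restrict_ext)
    ultimately show ?thesis by (simp add: ideal_mem_def weil_tensor_simps)
  qed
qed

text \<open>If the monomials of degree \<open>k + 1\<close> and \<open>l + 1\<close> belong to the two ideals, then those of degree \<open>k + l + 1\<close>
in all variables belong to the ideal generated by both, since one of the two partial degrees is large.\<close>

lemma weil_tensor_weil_algebra: "weil_algebra (weil_tensor W\<^sub>1 W\<^sub>2)"
proof -
  note I = weil_tensor_ideal
  have "wideal (weil_tensor W\<^sub>1 W\<^sub>2) \<subseteq> max_ideal (wdim W\<^sub>1 + wdim W\<^sub>2)"
    unfolding weil_tensor_generators(1)
    by (rule ring.genideal_minimal[OF ring_smooth_ring ideal_max_ideal weil_tensor_generators(2)])
  moreover obtain k where k: "\<And>p. p \<in> monomials (wdim W\<^sub>1) (Suc k) \<Longrightarrow> weil_zero W\<^sub>1 p"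
    using weil_monomials[OF W\<^sub>1] by blast
  obtain l where l: "\<And>p. p \<in> monomials (wdim W\<^sub>2) (Suc l) \<Longrightarrow> weil_zero W\<^sub>2 p"
    using weil_monomials[OF W\<^sub>2] by blast
  have mon: "ideal_mem (wdim W\<^sub>1 + wdim W\<^sub>2) (wideal (weil_tensor W\<^sub>1 W\<^sub>2)) p" if p: "p \<in> monomials (wdim W\<^sub>1 + wdim W\<^sub>2) (Suc (k + l))" for p
  proof -
    obtain a b f g where *: "a + b = Suc (k + l)" "f \<in> monomials (wdim W\<^sub>1) a" "g \<in> monomials (wdim W\<^sub>2) b"
      "\<And>w. p w = f (fst_vec (wdim W\<^sub>1) w) * g (snd_vec (wdim W\<^sub>1) w)" using monomial_split[OF p] by blast
    have sm: "smooth_between (euclid (wdim W\<^sub>1 + wdim W\<^sub>2)) real_space (\<lambda>w. f (fst_vec (wdim W\<^sub>1) w))"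
      "smooth_between (euclid (wdim W\<^sub>1 + wdim W\<^sub>2)) real_space (\<lambda>w. g (snd_vec (wdim W\<^sub>1) w))"
      using smooth_between_compose[OF monomials_smooth[OF *(2)] fst_vec_smooth]
        smooth_between_compose[OF monomials_smooth[OF *(3)] snd_vec_smooth] .
    consider "Suc k \<le> a" | "Suc l \<le> b" using *(1) by linarith
    then show ?thesis
    proof cases
      case 1
      have "weil_zero W\<^sub>1 f" by (rule weil_zero_monomials[OF W\<^sub>1 k 1 *(2)])
      from ideal_mem_mult[OF I sm(2) weil_tensor_pullback(1)[OF this, unfolded weil_tensor_simps]]
      show ?thesis by (rule ideal_mem_cong) (simp add: *(4) mult.commute)
    next
      case 2
      have "weil_zero W\<^sub>2 g" by (rule weil_zero_monomials[OF W\<^sub>2 l 2 *(3)])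
      from ideal_mem_mult[OF I sm(1) weil_tensor_pullback(2)[OF this, unfolded weil_tensor_simps]]
      show ?thesis by (rule ideal_mem_cong) (simp add: *(4))
    qed
  qed
  have "(ideal_prod (smooth_ring (wdim W\<^sub>1 + wdim W\<^sub>2)) (max_ideal (wdim W\<^sub>1 + wdim W\<^sub>2)) ^^ (k + l)) (max_ideal (wdim W\<^sub>1 + wdim W\<^sub>2)) \<subseteq> wideal (weil_tensor W\<^sub>1 W\<^sub>2)"
  proof
    fix f assume "f \<in> (ideal_prod (smooth_ring (wdim W\<^sub>1 + wdim W\<^sub>2)) (max_ideal (wdim W\<^sub>1 + wdim W\<^sub>2)) ^^ (k + l)) (max_ideal (wdim W\<^sub>1 + wdim W\<^sub>2))"
    from max_ideal_power_expansion[OF this]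
    have f: "f \<in> extensional (points (euclid (wdim W\<^sub>1 + wdim W\<^sub>2)))"
      "expansion (wdim W\<^sub>1 + wdim W\<^sub>2) one_space {} (monomials (wdim W\<^sub>1 + wdim W\<^sub>2) (Suc (k + l))) (\<lambda>u _. f u)" by auto
    have "expansion (wdim W\<^sub>1 + wdim W\<^sub>2) one_space {} {q. ideal_mem (wdim W\<^sub>1 + wdim W\<^sub>2) (wideal (weil_tensor W\<^sub>1 W\<^sub>2)) q} (\<lambda>u _. f u)"
      by (rule expansion_mono[OF f(2)]) (use mon in \<open>auto simp del: monomials.simps\<close>)
    from expansion_ideal_mem[OF I this smooth_between_const[OF frolicher_one, of "()"]]
    have "ideal_mem (wdim W\<^sub>1 + wdim W\<^sub>2) (wideal (weil_tensor W\<^sub>1 W\<^sub>2)) f" by (simp add: one_space_def)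
    then show "f \<in> wideal (weil_tensor W\<^sub>1 W\<^sub>2)" using f(1) by (simp add: ideal_mem_def extensional_restrict)
  qed
  ultimately show ?thesis
    unfolding weil_algebra_def weil_tensor_simps using I by blast
qed

lemma expansion_weil_tensor:
  assumes "expansion (wdim W\<^sub>1) (weil_dom W\<^sub>2) {} {q. weil_zero W\<^sub>1 q} F"
  shows "weil_zero (weil_tensor W\<^sub>1 W\<^sub>2) (\<lambda>w. F (fst_vec (wdim W\<^sub>1) w) (snd_vec (wdim W\<^sub>1) w))"
  using assms unfolding weil_tensor_simps
proof induction
  note pts = smooth_between_points[OF fst_vec_smooth] smooth_between_points[OF snd_vec_smooth]
  case (zero F)
  then show ?case using pts by (intro ideal_mem_0[OF weil_tensor_ideal]) auto
next
  note pts = smooth_between_points[OF fst_vec_smooth] smooth_between_points[OF snd_vec_smooth]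
  case (rest F q R H)
  have "smooth_between (euclid (wdim W\<^sub>1 + wdim W\<^sub>2)) real_space (\<lambda>w. R (fst_vec (wdim W\<^sub>1) w) (snd_vec (wdim W\<^sub>1) w))"
    by (rule smooth_between_subst2[OF rest(3) fst_vec_smooth snd_vec_smooth])
  moreover have "ideal_mem (wdim W\<^sub>1 + wdim W\<^sub>2) (wideal (weil_tensor W\<^sub>1 W\<^sub>2)) (\<lambda>w. q (fst_vec (wdim W\<^sub>1) w))"
    using weil_tensor_pullback(1)[of q] rest(2) by (simp add: weil_tensor_simps)
  ultimately have "ideal_mem (wdim W\<^sub>1 + wdim W\<^sub>2) (wideal (weil_tensor W\<^sub>1 W\<^sub>2))
      (\<lambda>w. R (fst_vec (wdim W\<^sub>1) w) (snd_vec (wdim W\<^sub>1) w) * q (fst_vec (wdim W\<^sub>1) w))"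
    by (rule ideal_mem_mult[OF weil_tensor_ideal])
  from ideal_mem_add[OF weil_tensor_ideal rest.IH this] show ?case
    by (rule ideal_mem_cong) (simp add: rest(4) pts)
qed auto

end

section \<open>Weil exponentiability\<close>

text \<open>The representative of \<open>\<kappa>[h]\<close>. That its class depends only on the jet of \<open>h\<close> is the condition on \<open>\<kappa>\<close>
that remains when sections exist.\<close>

definition kappa_family :: "'a frolicher \<Rightarrow> weil \<Rightarrow> ((nat \<Rightarrow> real) \<Rightarrow> 'a) \<Rightarrow> (nat \<Rightarrow> real) \<Rightarrow> 'a jets" where
  "kappa_family X W h v = jet_class X W (\<lambda>u. h (join_vec (wdim W) u v))"

definition kappa_well_defined :: "'a frolicher \<Rightarrow> weil \<Rightarrow> weil \<Rightarrow> bool" where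
  "kappa_well_defined X W\<^sub>1 W\<^sub>2 \<longleftrightarrow> (\<forall>h h'. jet_eq X (weil_tensor W\<^sub>1 W\<^sub>2) h h' \<longrightarrow>
     jet_eq (prolong X W\<^sub>1) W\<^sub>2 (kappa_family X W\<^sub>1 h) (kappa_family X W\<^sub>1 h'))"

lemma kappa_rep_eq:
  "kappa_rep X W\<^sub>1 W\<^sub>2 h = restrict (kappa_family X W\<^sub>1 h) (points (weil_dom W\<^sub>2))"
  by (simp add: kappa_rep_def kappa_family_def[abs_def] jet_class_def)

lemma join_vec_slice:
  assumes "v \<in> points (euclid m)"
  shows "smooth_between (euclid n) (euclid (n + m)) (\<lambda>u. join_vec n u v)"
  by (rule smooth_between_subst2[OF join_vec_smooth smooth_between_id
        smooth_between_const[OF frolicher_euclid assms]])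

lemma frolicher_isoI:
  assumes X: "frolicher_space X" and Y: "frolicher_space Y"
    and f: "smooth_between X Y f" and g: "smooth_between Y X g"
    and gf: "\<And>x. x \<in> points X \<Longrightarrow> g (f x) = x" and fg: "\<And>y. y \<in> points Y \<Longrightarrow> f (g y) = y"
  shows "frolicher_iso X Y (restrict f (points X))"
proof -
  let ?f = "restrict f (points X)"
  have bij: "bij_betw ?f (points X) (points Y)"
    by (rule bij_betw_byWitness[where f'=g])
      (use gf fg smooth_between_points[OF f] smooth_between_points[OF g] in auto)
  have "inv_into (points X) ?f y = g y" if "y \<in> points Y" for y
    by (rule inv_into_f_eq[OF bij_betw_imp_inj_on[OF bij]])
      (use that fg smooth_between_points[OF g] in auto)
  then have "(\<lambda>y\<in>points Y. inv_into (points X) ?f y) = restrict g (points Y)"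
    by (auto intro!: restrict_ext)
  then show ?thesis
    using bij restrict_in_smooth_maps[OF X f] restrict_in_smooth_maps[OF Y g]
    by (simp add: frolicher_iso_def)
qed

context
  fixes W\<^sub>1 W\<^sub>2 :: weil and X :: "'a frolicher"
  assumes W\<^sub>1: "weil_algebra W\<^sub>1" and W\<^sub>2: "weil_algebra W\<^sub>2" and X: "frolicher_space X"
begin

lemma kappa_family_point:
  assumes h: "smooth_between (weil_dom (weil_tensor W\<^sub>1 W\<^sub>2)) X h" and v: "v \<in> points (weil_dom W\<^sub>2)"
  shows "smooth_between (weil_dom W\<^sub>1) X (\<lambda>u. h (join_vec (wdim W\<^sub>1) u v))"
  using smooth_between_compose[OF h[unfolded weil_tensor_simps] join_vec_slice[OF v]] .

lemma kappa_family_smooth: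
  assumes h: "smooth_between (weil_dom (weil_tensor W\<^sub>1 W\<^sub>2)) X h"
  shows "smooth_between (weil_dom W\<^sub>2) (prolong X W\<^sub>1) (kappa_family X W\<^sub>1 h)"
  unfolding kappa_family_def
  by (rule jet_class_smooth[OF W\<^sub>1 X frolicher_euclid])
    (rule smooth_between_compose[OF h[unfolded weil_tensor_simps] join_vec_smooth])

text \<open>Injectivity of \<open>\<kappa>\<close>. In the expansion
  \<open>\<Sum>p(u) a\<^sub>p(v)\<close> of \<open>\<psi>(h(u, v)) - \<psi>(h'(u, v))\<close> with respect to a basis of the first algebra, each
  \<open>a\<^sub>p\<close> is the difference of the values of a real function on \<open>X \<otimes> W\<^sub>1\<close>, and so lies in the
  ideal of the second algebra.\<close>

lemma kappa_family_reflects: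
  assumes h: "smooth_between (weil_dom (weil_tensor W\<^sub>1 W\<^sub>2)) X h"
    and h': "smooth_between (weil_dom (weil_tensor W\<^sub>1 W\<^sub>2)) X h'"
    and eq: "jet_eq (prolong X W\<^sub>1) W\<^sub>2 (kappa_family X W\<^sub>1 h) (kappa_family X W\<^sub>1 h')"
  shows "jet_eq X (weil_tensor W\<^sub>1 W\<^sub>2) h h'"
proof -
  let ?n = "wdim W\<^sub>1" and ?m = "wdim W\<^sub>2" and ?T = "weil_tensor W\<^sub>1 W\<^sub>2"
  let ?D1 = "weil_dom W\<^sub>1" and ?D2 = "weil_dom W\<^sub>2"
  note I1 = weil_ideal[OF W\<^sub>1] and I2 = weil_ideal[OF W\<^sub>2]
    and IT = weil_ideal[OF weil_tensor_weil_algebra[OF W\<^sub>1 W\<^sub>2]]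
  note slice = kappa_family_point[OF h] kappa_family_point[OF h']
  have "kappa_family X W\<^sub>1 h origin = kappa_family X W\<^sub>1 h' origin" using eq by (simp add: jet_eq_def)
  then have "jet_eq X W\<^sub>1 (\<lambda>u. h (join_vec ?n u origin)) (\<lambda>u. h' (join_vec ?n u origin))"
    unfolding kappa_family_def by (rule jet_class_eqD[OF W\<^sub>1 X _ slice(2)]) simp
  then have "h (join_vec ?n origin origin) = h' (join_vec ?n origin origin)"
    unfolding jet_eq_def by blast
  then have base: "h origin = h' origin" by simp
  have "weil_zero ?T (\<lambda>w. \<psi> (h w) - \<psi> (h' w))" if \<psi>: "smooth_between X real_space \<psi>" for \<psi>
  proof -
    define K where "K u v = \<psi> (h (join_vec ?n u v)) - \<psi> (h' (join_vec ?n u v))" for u v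
    have K: "smooth_between (prod_space ?D1 ?D2) real_space (\<lambda>z. K (fst z) (snd z))"
      unfolding K_def
      by (rule smooth_between_real_diff[OF
            smooth_between_compose[OF \<psi> smooth_between_compose[OF h[unfolded weil_tensor_simps] join_vec_smooth]]
            smooth_between_compose[OF \<psi> smooth_between_compose[OF h'[unfolded weil_tensor_simps] join_vec_smooth]]])
    obtain P where P: "weil_basis W\<^sub>1 P" using weil_basis_exists[OF W\<^sub>1] by blast
    then have fin: "finite P" and Psm: "\<And>p. p \<in> P \<Longrightarrow> smooth_between ?D1 real_space p"
      by (auto simp: weil_basis_def)
    obtain a where a: "\<And>p. p \<in> P \<Longrightarrow> smooth_between ?D2 real_space (a p)"
      "expansion ?n ?D2 {} {q. weil_zero W\<^sub>1 q} (\<lambda>u v. K u v - (\<Sum>p\<in>P. p u * a p v))"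
      using expansion_extract[OF fin weil_basis_expansion[OF W\<^sub>1 P frolicher_euclid K]] by blast
    have az: "weil_zero W\<^sub>2 (a p)" if p: "p \<in> P" for p
    proof -
      obtain l where l: "l \<in> weil_dual W\<^sub>1" "\<And>f c. smooth_between ?D1 real_space f \<Longrightarrow>
          weil_zero W\<^sub>1 (\<lambda>u. f u - (\<Sum>p\<in>P. c p * p u)) \<Longrightarrow> l (weil_class W\<^sub>1 f) = c p"
        using weil_basis_coordinate[OF W\<^sub>1 P p] by blast
      define \<Psi> where "\<Psi> z = l (prolong_fun W\<^sub>1 \<psi> z)" for z
      have "smooth_between (prolong X W\<^sub>1) real_space \<Psi>"
        unfolding smooth_between_real_iff \<Psi>_def using \<psi> l(1) by (simp add: curves_prolong[OF W\<^sub>1 X])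
      with eq have "weil_zero W\<^sub>2 (\<lambda>v. \<Psi> (kappa_family X W\<^sub>1 h v) - \<Psi> (kappa_family X W\<^sub>1 h' v))"
        unfolding jet_eq_def by blast
      then show ?thesis
      proof (rule ideal_mem_cong)
        fix v assume v: "v \<in> points ?D2"
        note sl = smooth_between_compose[OF \<psi> slice(1)[OF v]] smooth_between_compose[OF \<psi> slice(2)[OF v]]
        have "\<Psi> (kappa_family X W\<^sub>1 h v) - \<Psi> (kappa_family X W\<^sub>1 h' v) =
            l (weil_class W\<^sub>1 (\<lambda>u. \<psi> (h (join_vec ?n u v)))) - l (weil_class W\<^sub>1 (\<lambda>u. \<psi> (h' (join_vec ?n u v))))"
          unfolding \<Psi>_def kappa_family_def
          by (simp add: prolong_fun_jet_class[OF W\<^sub>1 X slice(1)[OF v] \<psi>] prolong_fun_jet_class[OF W\<^sub>1 X slice(2)[OF v] \<psi>])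
        also have "\<dots> = l (weil_class W\<^sub>1 (\<lambda>u. K u v))"
          using weil_dual_linear[OF l(1) sl, of 1 "-1"] by (simp add: K_def)
        also have "\<dots> = a p v"
        proof (rule l(2)[where c="\<lambda>p. a p v"])
          show "smooth_between ?D1 real_space (\<lambda>u. K u v)"
            unfolding K_def by (rule smooth_between_real_diff[OF sl])
          have "weil_zero W\<^sub>1 (\<lambda>u. K u v - (\<Sum>p\<in>P. p u * a p v))"
            using expansion_ideal_mem[OF I1 a(2) smooth_between_const[OF frolicher_euclid v]] .
          then show "weil_zero W\<^sub>1 (\<lambda>u. K u v - (\<Sum>p\<in>P. a p v * p u))" by (simp add: mult.commute)
        qed
        finally show "\<Psi> (kappa_family X W\<^sub>1 h v) - \<Psi> (kappa_family X W\<^sub>1 h' v) = a p v" .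
      qed
    qed
    have "weil_zero ?T (\<lambda>w. \<Sum>p\<in>P. p (fst_vec ?n w) * a p (snd_vec ?n w))"
    proof (rule ideal_mem_sum[OF IT])
      fix p assume p: "p \<in> P"
      show "weil_zero ?T (\<lambda>w. p (fst_vec ?n w) * a p (snd_vec ?n w))"
      proof (rule ideal_mem_mult[OF IT _ weil_tensor_pullback(2)[OF W\<^sub>1 W\<^sub>2 az[OF p]]])
        show "smooth_between (weil_dom ?T) real_space (\<lambda>w. p (fst_vec ?n w))"
          unfolding weil_tensor_simps by (rule smooth_between_compose[OF Psm[OF p] fst_vec_smooth])
      qed
    qed
    from ideal_mem_add[OF IT expansion_weil_tensor[OF W\<^sub>1 W\<^sub>2 a(2)] this]
    show ?thesis by (rule ideal_mem_cong) (simp add: K_def)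
  qed
  then show ?thesis using h h' base by (simp add: jet_eq_def)
qed

text \<open>With sections \<open>G\<close> of \<open>X\<close>, \<open>H\<close> of \<open>X \<otimes> W\<^sub>1\<close> and \<open>L\<close> for the coproduct, \<open>\<kappa>\<close> is \<open>z \<mapsto> [v \<mapsto> [L(\<cdot>, v; z)]]\<close>, and it is
inverted by \<open>\<zeta> \<mapsto> [(u, v) \<mapsto> G(u; H(v; \<zeta>))]\<close>. Both are jets of smooth families, hence smooth.\<close>

lemma kappa_isoI:
  assumes "has_section X W\<^sub>1" "has_section (prolong X W\<^sub>1) W\<^sub>2" "has_section X (weil_tensor W\<^sub>1 W\<^sub>2)"
    and wd: "kappa_well_defined X W\<^sub>1 W\<^sub>2"
  shows "kappa_iso X W\<^sub>1 W\<^sub>2"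
proof -
  let ?n = "wdim W\<^sub>1" and ?T = "weil_tensor W\<^sub>1 W\<^sub>2"
  let ?D1 = "weil_dom W\<^sub>1" and ?D2 = "weil_dom W\<^sub>2" and ?DT = "weil_dom ?T"
  let ?P1 = "prolong X W\<^sub>1" and ?P2 = "prolong (prolong X W\<^sub>1) W\<^sub>2" and ?PT = "prolong X ?T"
  note T = weil_tensor_weil_algebra[OF W\<^sub>1 W\<^sub>2]
  note P1 = frolicher_prolong[OF W\<^sub>1 X] and PT = frolicher_prolong[OF T X]
  note P2 = frolicher_prolong[OF W\<^sub>2 P1]
  obtain G where G: "smooth_between (prod_space ?D1 ?P1) X (\<lambda>p. G (fst p) (snd p))"
    "\<And>z. z \<in> points ?P1 \<Longrightarrow> jet_class X W\<^sub>1 (\<lambda>u. G u z) = z"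
    using assms(1) unfolding has_section_def by blast
  obtain H where H: "smooth_between (prod_space ?D2 ?P2) ?P1 (\<lambda>p. H (fst p) (snd p))"
    "\<And>z. z \<in> points ?P2 \<Longrightarrow> jet_class ?P1 W\<^sub>2 (\<lambda>v. H v z) = z"
    using assms(2) unfolding has_section_def by blast
  obtain L where L: "smooth_between (prod_space ?DT ?PT) X (\<lambda>p. L (fst p) (snd p))"
    "\<And>z. z \<in> points ?PT \<Longrightarrow> jet_class X ?T (\<lambda>w. L w z) = z"
    using assms(3) unfolding has_section_def by blast
  define \<kappa> where "\<kappa> z = jet_class ?P1 W\<^sub>2 (kappa_family X W\<^sub>1 (\<lambda>w. L w z))" for z
  define \<mu> where "\<mu> \<zeta> = jet_class X ?T (\<lambda>w. G (fst_vec ?n w) (H (snd_vec ?n w) \<zeta>))" for \<zeta>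
  have Lz: "smooth_between ?DT X (\<lambda>w. L w z)" if "z \<in> points ?PT" for z
    by (rule smooth_between_subst2[OF L(1) smooth_between_id smooth_between_const[OF PT that]])
  have \<kappa>_class: "\<kappa> (jet_class X ?T h) = jet_class ?P1 W\<^sub>2 (kappa_family X W\<^sub>1 h)"
    if h: "smooth_between ?DT X h" for h
  proof -
    have "jet_eq X ?T (\<lambda>w. L w (jet_class X ?T h)) h"
      by (rule jet_class_eqD[OF T X L(2)[OF jet_class_point[OF T X h]] h])
    then have "jet_eq ?P1 W\<^sub>2 (kappa_family X W\<^sub>1 (\<lambda>w. L w (jet_class X ?T h))) (kappa_family X W\<^sub>1 h)"
      using wd unfolding kappa_well_defined_def by blast
    from jet_class_eqI[OF W\<^sub>2 P1 this] show ?thesis by (simp add: \<kappa>_def)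
  qed
  have \<kappa>_smooth: "smooth_between ?PT ?P2 \<kappa>"
    unfolding \<kappa>_def kappa_family_def
  proof (rule jet_class_smooth[OF W\<^sub>2 P1 PT])
    let ?Y = "prod_space ?D2 ?PT"
    have "smooth_between (prod_space ?D1 ?Y) ?DT (\<lambda>p. join_vec ?n (fst p) (fst (snd p)))"
      unfolding weil_tensor_simps
      by (rule smooth_between_subst2[OF join_vec_smooth smooth_between_fst_id smooth_between_fst[OF smooth_between_snd_id]])
    from smooth_between_subst2[OF L(1) this smooth_between_snd[OF smooth_between_snd_id]]
    show "smooth_between ?Y ?P1 (\<lambda>p. jet_class X W\<^sub>1 (\<lambda>u. L (join_vec ?n u (fst p)) (snd p)))"
      by (rule jet_class_smooth[OF W\<^sub>1 X frolicher_prod[OF frolicher_euclid PT]])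
  qed
  have GH: "smooth_between (prod_space ?DT ?P2) X (\<lambda>p. G (fst_vec ?n (fst p)) (H (snd_vec ?n (fst p)) (snd p)))"
    unfolding weil_tensor_simps
    by (rule smooth_between_subst2[OF G(1) smooth_between_compose[OF fst_vec_smooth smooth_between_fst_id]
          smooth_between_subst2[OF H(1) smooth_between_compose[OF snd_vec_smooth smooth_between_fst_id] smooth_between_snd_id]])
  have \<mu>_smooth: "smooth_between ?P2 ?PT \<mu>"
    unfolding \<mu>_def by (rule jet_class_smooth[OF T X P2 GH])
  have \<kappa>\<mu>: "\<kappa> (\<mu> \<zeta>) = \<zeta>" if \<zeta>: "\<zeta> \<in> points ?P2" for \<zeta>
  proof -
    have "smooth_between ?DT X (\<lambda>w. G (fst_vec ?n w) (H (snd_vec ?n w) \<zeta>))"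
      using smooth_between_subst2[where f="\<lambda>w \<zeta>. G (fst_vec ?n w) (H (snd_vec ?n w) \<zeta>)",
          OF GH smooth_between_id smooth_between_const[OF P2 \<zeta>]] .
    from \<kappa>_class[OF this]
    have "\<kappa> (\<mu> \<zeta>) = jet_class ?P1 W\<^sub>2 (kappa_family X W\<^sub>1 (\<lambda>w. G (fst_vec ?n w) (H (snd_vec ?n w) \<zeta>)))"
      by (simp add: \<mu>_def)
    also have "\<dots> = jet_class ?P1 W\<^sub>2 (\<lambda>v. H v \<zeta>)"
    proof (rule jet_class_cong)
      fix v assume v: "v \<in> points ?D2"
      have "kappa_family X W\<^sub>1 (\<lambda>w. G (fst_vec ?n w) (H (snd_vec ?n w) \<zeta>)) v = jet_class X W\<^sub>1 (\<lambda>u. G u (H v \<zeta>))"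
        unfolding kappa_family_def by (rule jet_class_cong) (simp add: fst_vec_join_vec)
      also have "\<dots> = H v \<zeta>"
        using smooth_between_points[OF H(1), of "(v, \<zeta>)"] v \<zeta> by (intro G(2)) simp
      finally show "kappa_family X W\<^sub>1 (\<lambda>w. G (fst_vec ?n w) (H (snd_vec ?n w) \<zeta>)) v = H v \<zeta>" .
    qed
    also have "\<dots> = \<zeta>" by (rule H(2)[OF \<zeta>])
    finally show ?thesis .
  qed
  have inj: "z = z'" if z: "z \<in> points ?PT" "z' \<in> points ?PT" and eq: "\<kappa> z = \<kappa> z'" for z z'
  proof -
    have "jet_eq ?P1 W\<^sub>2 (kappa_family X W\<^sub>1 (\<lambda>w. L w z)) (kappa_family X W\<^sub>1 (\<lambda>w. L w z'))"
      by (rule jet_class_eqD[OF W\<^sub>2 P1 eq[unfolded \<kappa>_def] kappa_family_smooth[OF Lz[OF z(2)]]])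
    from jet_class_eqI[OF T X kappa_family_reflects[OF Lz[OF z(1)] Lz[OF z(2)] this]]
    show ?thesis by (simp add: L(2) z)
  qed
  have \<mu>\<kappa>: "\<mu> (\<kappa> z) = z" if z: "z \<in> points ?PT" for z
    by (rule inj[OF smooth_between_points[OF \<mu>_smooth smooth_between_points[OF \<kappa>_smooth z]] z
          \<kappa>\<mu>[OF smooth_between_points[OF \<kappa>_smooth z]]])
  show ?thesis
    unfolding kappa_iso_def
  proof (intro exI[of _ "restrict \<kappa> (points ?PT)"] conjI ballI)
    show "frolicher_iso ?PT ?P2 (restrict \<kappa> (points ?PT))"
      by (rule frolicher_isoI[OF PT P2 \<kappa>_smooth \<mu>_smooth \<mu>\<kappa> \<kappa>\<mu>])
    fix h assume "h \<in> smooth_maps (euclid (wdim W\<^sub>1 + wdim W\<^sub>2)) X"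
    then have h: "smooth_between ?DT X h" "prolong_class X ?T h = jet_class X ?T h"
      by (auto simp: weil_tensor_simps smooth_maps_smooth_between jet_class_def smooth_maps_restrict)
    show "kappa_rep X W\<^sub>1 W\<^sub>2 h \<in> smooth_maps ?D2 ?P1"
      unfolding kappa_rep_eq by (rule restrict_in_smooth_maps[OF frolicher_euclid kappa_family_smooth[OF h(1)]])
    show "restrict \<kappa> (points ?PT) (prolong_class X ?T h) = prolong_class ?P1 W\<^sub>2 (kappa_rep X W\<^sub>1 W\<^sub>2 h)"
      unfolding h(2) kappa_rep_eq jet_class_def[symmetric]
      using \<kappa>_class[OF h(1)] jet_class_point[OF T X h(1)] by simp
  qed
qed

lemma kappa_iso_imp_well_defined:
  assumes "kappa_iso X W\<^sub>1 W\<^sub>2"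
  shows "kappa_well_defined X W\<^sub>1 W\<^sub>2"
  unfolding kappa_well_defined_def
proof (intro allI impI)
  let ?T = "weil_tensor W\<^sub>1 W\<^sub>2" and ?P1 = "prolong X W\<^sub>1"
  let ?DT = "weil_dom ?T"
  note T = weil_tensor_weil_algebra[OF W\<^sub>1 W\<^sub>2]
  note P1 = frolicher_prolong[OF W\<^sub>1 X]
  obtain \<kappa> where \<kappa>: "\<And>h. h \<in> smooth_maps ?DT X \<Longrightarrow>
      \<kappa> (prolong_class X ?T h) = prolong_class ?P1 W\<^sub>2 (kappa_rep X W\<^sub>1 W\<^sub>2 h)"
    using assms unfolding kappa_iso_def weil_tensor_simps by blast
  have \<kappa>': "\<kappa> (jet_class X ?T h) = jet_class ?P1 W\<^sub>2 (kappa_family X W\<^sub>1 h)"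
    if h: "smooth_between ?DT X h" for h
  proof -
    have "kappa_rep X W\<^sub>1 W\<^sub>2 (restrict h (points ?DT)) = kappa_rep X W\<^sub>1 W\<^sub>2 h"
      unfolding kappa_rep_def
    proof (rule restrict_ext)
      fix v assume v: "v \<in> points (weil_dom W\<^sub>2)"
      have "(\<lambda>u\<in>points (weil_dom W\<^sub>1). restrict h (points ?DT) (join_vec (wdim W\<^sub>1) u v)) =
          (\<lambda>u\<in>points (weil_dom W\<^sub>1). h (join_vec (wdim W\<^sub>1) u v))"
        using smooth_between_points[OF join_vec_slice[OF v, of "wdim W\<^sub>1"]]
        by (intro restrict_ext) (simp add: weil_tensor_simps)
      then show "prolong_class X W\<^sub>1 (\<lambda>u\<in>points (weil_dom W\<^sub>1). restrict h (points ?DT) (join_vec (wdim W\<^sub>1) u v)) =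
          prolong_class X W\<^sub>1 (\<lambda>u\<in>points (weil_dom W\<^sub>1). h (join_vec (wdim W\<^sub>1) u v))" by simp
    qed
    then show ?thesis
      using \<kappa>[OF restrict_in_smooth_maps[OF frolicher_euclid h]]
      by (simp add: jet_class_def kappa_rep_eq)
  qed
  fix h h' assume hh': "jet_eq X ?T h h'"
  note sm = jet_eq_smooth[OF hh']
  have "jet_class ?P1 W\<^sub>2 (kappa_family X W\<^sub>1 h) = jet_class ?P1 W\<^sub>2 (kappa_family X W\<^sub>1 h')"
    unfolding \<kappa>'[OF sm(1), symmetric] \<kappa>'[OF sm(2), symmetric] jet_class_eqI[OF T X hh'] ..
  from jet_class_eqD[OF W\<^sub>2 P1 this kappa_family_smooth[OF sm(2)]]
  show "jet_eq ?P1 W\<^sub>2 (kappa_family X W\<^sub>1 h) (kappa_family X W\<^sub>1 h')" .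
qed

end

lemma eps_rep_eq: "eps_rep W g y = restrict (\<lambda>u. g u y) (points (weil_dom W))"
  by (simp add: eps_rep_def)

lemma eps_isoI:
  assumes W: "weil_algebra W" and Y: "frolicher_space Y" and Z: "frolicher_space Z"
    and "has_section Z W" "faithful Z W"
  shows "eps_iso Y Z W"
proof -
  let ?M = "map_space Y Z"
  note M = frolicher_map_space[OF Y Z]
  note PM = frolicher_prolong[OF W M] and MP = frolicher_map_space[OF Y frolicher_prolong[OF W Z]]
  obtain r where r: "smooth_between (map_space Y (prolong Z W)) (prolong ?M W) r"
    "\<And>z. z \<in> points (prolong ?M W) \<Longrightarrow> r (eps_map Y Z W z) = z"
    "\<And>\<theta>. \<theta> \<in> points (map_space Y (prolong Z W)) \<Longrightarrow> eps_map Y Z W (r \<theta>) = \<theta>"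
    using prolong_map_space_retract[OF W Y Z assms(4,5)] by blast
  show ?thesis
    unfolding eps_iso_def
  proof (intro exI[of _ "restrict (eps_map Y Z W) (points (prolong ?M W))"] conjI ballI)
    show "frolicher_iso (prolong ?M W) (map_space Y (prolong Z W))
        (restrict (eps_map Y Z W) (points (prolong ?M W)))"
      by (rule frolicher_isoI[OF PM MP eps_map_smooth[OF W Y Z] r])
    fix g assume "g \<in> smooth_maps (weil_dom W) ?M"
    then have g: "smooth_between (weil_dom W) ?M g" "prolong_class ?M W g = jet_class ?M W g"
      by (auto simp: smooth_maps_smooth_between jet_class_def smooth_maps_restrict)
    show "eps_rep W g y \<in> smooth_maps (weil_dom W) Z" if "y \<in> points Y" for y
      unfolding eps_rep_eq
      by (rule restrict_in_smooth_maps[OF frolicher_euclid smooth_between_compose[OF apply_smooth[OF Y that] g(1)]])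
    show "restrict (eps_map Y Z W) (points (prolong ?M W)) (prolong_class ?M W g) =
        (\<lambda>y\<in>points Y. prolong_class Z W (eps_rep W g y))"
    proof
      fix y
      show "restrict (eps_map Y Z W) (points (prolong ?M W)) (prolong_class ?M W g) y =
          (\<lambda>y\<in>points Y. prolong_class Z W (eps_rep W g y)) y"
        using jet_class_point[OF W M g(1)] eps_map_jet_class[OF W Y Z g(1)]
        unfolding g(2) eps_rep_eq jet_class_def[symmetric]
        by (cases "y \<in> points Y") (auto simp: eps_map_def)
    qed
  qed
qed

lemma eps_isoD:
  assumes "eps_iso Y Z W" and Y: "frolicher_space Y"
  obtains \<epsilon> where "bij_betw \<epsilon> (points (prolong (map_space Y Z) W)) (smooth_maps Y (prolong Z W))"
    "\<And>g. smooth_between (weil_dom W) (map_space Y Z) g \<Longrightarrow>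
      \<epsilon> (jet_class (map_space Y Z) W g) = (\<lambda>y\<in>points Y. jet_class Z W (\<lambda>u. g u y))"
proof -
  obtain \<epsilon> where \<epsilon>: "frolicher_iso (prolong (map_space Y Z) W) (map_space Y (prolong Z W)) \<epsilon>"
    "\<And>g. g \<in> smooth_maps (weil_dom W) (map_space Y Z) \<Longrightarrow>
      \<epsilon> (prolong_class (map_space Y Z) W g) = (\<lambda>y\<in>points Y. prolong_class Z W (eps_rep W g y))"
    using assms(1) unfolding eps_iso_def by blast
  have "\<epsilon> (jet_class (map_space Y Z) W g) = (\<lambda>y\<in>points Y. jet_class Z W (\<lambda>u. g u y))"
    if g: "smooth_between (weil_dom W) (map_space Y Z) g" for g
  proof -
    have "(\<lambda>u\<in>points (weil_dom W). restrict g (points (weil_dom W)) u y) = (\<lambda>u\<in>points (weil_dom W). g u y)" for y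
      by (rule restrict_ext) simp
    then show ?thesis
      using \<epsilon>(2)[OF restrict_in_smooth_maps[OF frolicher_euclid g]] by (simp add: jet_class_def eps_rep_def)
  qed
  moreover have "bij_betw \<epsilon> (points (prolong (map_space Y Z) W)) (smooth_maps Y (prolong Z W))"
    using \<epsilon>(1) by (simp add: frolicher_iso_def)
  ultimately show ?thesis by (intro that[of \<epsilon>])
qed

text \<open>The section is the preimage of the identity, in exponential form.\<close>

lemma eps_iso_imp_has_section:
  assumes W: "weil_algebra W" and Z: "frolicher_space Z" and "eps_iso (prolong Z W) Z W"
  shows "has_section Z W"
proof -
  let ?P = "prolong Z W"
  note P = frolicher_prolong[OF W Z]
  note M = frolicher_map_space[OF P Z]
  obtain \<epsilon> where \<epsilon>: "bij_betw \<epsilon> (points (prolong (map_space ?P Z) W)) (smooth_maps ?P ?P)"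
    "\<And>g. smooth_between (weil_dom W) (map_space ?P Z) g \<Longrightarrow>
      \<epsilon> (jet_class (map_space ?P Z) W g) = (\<lambda>y\<in>points ?P. jet_class Z W (\<lambda>u. g u y))"
    using eps_isoD[OF assms(3) P] by blast
  have "(\<lambda>z\<in>points ?P. z) \<in> smooth_maps ?P ?P"
    by (rule restrict_in_smooth_maps[OF P smooth_between_id])
  then have "(\<lambda>z\<in>points ?P. z) \<in> \<epsilon> ` points (prolong (map_space ?P Z) W)"
    using bij_betw_imp_surj_on[OF \<epsilon>(1)] by simp
  then obtain A where A: "(\<lambda>z\<in>points ?P. z) = \<epsilon> A" "A \<in> points (prolong (map_space ?P Z) W)"
    by (rule imageE)
  obtain g where g: "smooth_between (weil_dom W) (map_space ?P Z) g" "A = jet_class (map_space ?P Z) W g"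
    using prolong_point[OF W M A(2)] by blast
  have "jet_class Z W (\<lambda>u. g u z) = z" if "z \<in> points ?P" for z
    using fun_cong[OF trans[OF \<epsilon>(2)[OF g(1), folded g(2), symmetric] A(1)[symmetric]], of z] that by simp
  then show ?thesis
    unfolding has_section_def using smooth_between_uncurry[OF P g(1)] by blast
qed

text \<open>Pointwise congruent families have the same image under \<open>\<epsilon>\<close>; here \<open>\<epsilon>\<close> is injective.\<close>

lemma eps_iso_imp_faithful:
  assumes W: "weil_algebra W" and Z: "frolicher_space Z" and "eps_iso (jet_pairs Z W) Z W"
  shows "faithful Z W"
  unfolding faithful_def faithful_families_def
proof (intro allI impI)
  let ?Q = "jet_pairs Z W" and ?D = "weil_dom W"
  let ?M = "map_space ?Q Z"
  note Q = frolicher_jet_pairs[OF Z, of W]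
  note M = frolicher_map_space[OF Q Z]
  obtain \<epsilon> where \<epsilon>: "bij_betw \<epsilon> (points (prolong ?M W)) (smooth_maps ?Q (prolong Z W))"
    "\<And>g. smooth_between ?D ?M g \<Longrightarrow>
      \<epsilon> (jet_class ?M W g) = (\<lambda>y\<in>points ?Q. jet_class Z W (\<lambda>u. g u y))"
    using eps_isoD[OF assms(3) Q] by blast
  fix g g' assume gg': "pointwise_jet_eq ?Q Z W g g'"
  let ?g = "\<lambda>u. restrict (g u) (points ?Q)" and ?g' = "\<lambda>u. restrict (g' u) (points ?Q)"
  have sm: "smooth_between ?D ?M ?g" "smooth_between ?D ?M ?g'"
    using gg' smooth_between_curry[OF frolicher_euclid Q] unfolding pointwise_jet_eq_def by blast+
  have "\<epsilon> (jet_class ?M W ?g) = \<epsilon> (jet_class ?M W ?g')"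
    unfolding \<epsilon>(2)[OF sm(1)] \<epsilon>(2)[OF sm(2)]
  proof (rule restrict_ext)
    fix y assume y: "y \<in> points ?Q"
    then have "jet_eq Z W (\<lambda>u. g u y) (\<lambda>u. g' u y)" using gg' unfolding pointwise_jet_eq_def by blast
    from jet_class_eqI[OF W Z this]
    show "jet_class Z W (\<lambda>u. ?g u y) = jet_class Z W (\<lambda>u. ?g' u y)" using y by simp
  qed
  then have "jet_class ?M W ?g = jet_class ?M W ?g'"
    using \<epsilon>(1) jet_class_point[OF W M sm(1)] jet_class_point[OF W M sm(2)]
    by (meson bij_betw_imp_inj_on inj_onD)
  from jet_class_eqD[OF W M this sm(2)] show "jet_eq ?M W ?g ?g'" .
qed

subsection \<open>A description without a universe of test spaces\<close>

text \<open>The conditions do not mention a space \<open>Y\<close>. Therefore they can be transferred between spaces over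
different types, and they are equivalent to Weil exponentiability with \<open>Y\<close> over any type that
contains \<open>(X \<otimes> W\<^sub>1) \<otimes> W\<^sub>2\<close> and the space of pairs of congruent maps.\<close>

definition weil_good :: "'a frolicher \<Rightarrow> bool" where
  "weil_good X \<longleftrightarrow> frolicher_space X \<and>
     (\<forall>W\<^sub>1 W\<^sub>2. weil_algebra W\<^sub>1 \<longrightarrow> weil_algebra W\<^sub>2 \<longrightarrow>
        has_section (prolong X W\<^sub>1) W\<^sub>2 \<and> faithful (prolong X W\<^sub>1) W\<^sub>2 \<and> kappa_well_defined X W\<^sub>1 W\<^sub>2)"

lemma weil_good_section_faithful:
  assumes "weil_good X" "weil_algebra W"
  shows "has_section X W" "faithful X W"
  using has_section_of_prolong[OF assms(2,2), of X] faithful_of_prolong[OF assms(2), of X] assms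
  by (auto simp: weil_good_def)

lemma weil_good_exponentiable_at:
  assumes X: "weil_good X" and S: "frolicher_space S"
  shows "weil_exponentiable_at S X"
  unfolding weil_exponentiable_at_def
proof (intro allI impI conjI)
  fix W\<^sub>1 W\<^sub>2 assume W: "weil_algebra W\<^sub>1" "weil_algebra W\<^sub>2"
  have FX: "frolicher_space X" using X by (simp add: weil_good_def)
  have g: "has_section (prolong X W\<^sub>1) W\<^sub>2" "faithful (prolong X W\<^sub>1) W\<^sub>2" "kappa_well_defined X W\<^sub>1 W\<^sub>2"
    using X W by (auto simp: weil_good_def)
  show "kappa_iso X W\<^sub>1 W\<^sub>2"
    by (rule kappa_isoI[OF W FX weil_good_section_faithful(1)[OF X W(1)] g(1)
          weil_good_section_faithful(1)[OF X weil_tensor_weil_algebra[OF W]] g(3)])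
  show "eps_iso S (prolong X W\<^sub>1) W\<^sub>2"
    by (rule eps_isoI[OF W(2) S frolicher_prolong[OF W(1) FX] g(1,2)])
qed

lemma weil_exponentiable_iff: "weil_exponentiable X \<longleftrightarrow> weil_good X"
proof
  assume X: "weil_exponentiable X"
  then have FX: "frolicher_space X" by (simp add: weil_exponentiable_def)
  have "has_section (prolong X W\<^sub>1) W\<^sub>2 \<and> faithful (prolong X W\<^sub>1) W\<^sub>2 \<and> kappa_well_defined X W\<^sub>1 W\<^sub>2"
    if W: "weil_algebra W\<^sub>1" "weil_algebra W\<^sub>2" for W\<^sub>1 W\<^sub>2
  proof -
    note P = frolicher_prolong[OF W(1) FX]
    have at: "kappa_iso X W\<^sub>1 W\<^sub>2 \<and> eps_iso Y (prolong X W\<^sub>1) W\<^sub>2" if "frolicher_space Y" for Y :: "'a jets jets frolicher"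
      using X that W unfolding weil_exponentiable_def weil_exponentiable_at_def by blast
    show ?thesis
      using eps_iso_imp_has_section[OF W(2) P] eps_iso_imp_faithful[OF W(2) P]
        kappa_iso_imp_well_defined[OF W FX] at[OF frolicher_prolong[OF W(2) P]] at[OF frolicher_jet_pairs[OF P]]
      by blast
  qed
  then show "weil_good X" using FX by (simp add: weil_good_def)
next
  assume "weil_good X"
  then show "weil_exponentiable X"
    unfolding weil_exponentiable_def using weil_good_exponentiable_at by (auto simp: weil_good_def)
qed

section \<open>Cartesian closedness\<close>

lemma weil_good_one: "weil_good one_space"
proof -
  have single: "has_section Z W" "faithful Z W"
    if W: "weil_algebra W" and Z: "frolicher_space Z" "points Z = {a}" for Z :: "'a frolicher" and a W
  proof -
    have f: "f u = a" if "smooth_between (weil_dom W) Z f" "u \<in> points (weil_dom W)" for f u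
      using smooth_between_points[OF that] Z(2) by simp
    have "jet_class Z W (\<lambda>u. a) = z" if "z \<in> points (prolong Z W)" for z
    proof (rule prolong_point[OF W Z(1) that])
      fix k assume k: "smooth_between (weil_dom W) Z k" "z = jet_class Z W k"
      show ?thesis unfolding k(2) by (rule jet_class_cong) (simp add: f[OF k(1)])
    qed
    then show "has_section Z W"
      unfolding has_section_def
      by (intro exI[of _ "\<lambda>_ _. a"]) (simp add: smooth_between_const Z)
    show "faithful Z W"
    proof (rule faithfulI[OF Z(1)])
      fix Y :: "'a jets frolicher" and g g'
      assume Y: "frolicher_space Y" and gg': "pointwise_jet_eq Y Z W g g'"
      have a: "g u y = a \<and> g' u y = a" if "u \<in> points (weil_dom W)" "y \<in> points Y" for u y
      proof -
        have j: "jet_eq Z W (\<lambda>u. g u y) (\<lambda>u. g' u y)"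
          using gg' that(2) unfolding pointwise_jet_eq_def by blast
        show ?thesis using f[OF jet_eq_smooth(1)[OF j] that(1)] f[OF jet_eq_smooth(2)[OF j] that(1)] by simp
      qed
      have "smooth_between (weil_dom W) (map_space Y Z) (\<lambda>u. restrict (g u) (points Y))"
        using gg' smooth_between_curry[OF frolicher_euclid Y] unfolding pointwise_jet_eq_def by blast
      from jet_eq_refl[OF W this]
      show "jet_eq (map_space Y Z) W (\<lambda>u. restrict (g u) (points Y)) (\<lambda>u. restrict (g' u) (points Y))"
        by (rule jet_eq_cong) (auto intro!: restrict_ext simp: a)
    qed
  qed
  have "has_section (prolong one_space W\<^sub>1) W\<^sub>2 \<and> faithful (prolong one_space W\<^sub>1) W\<^sub>2 \<and> kappa_well_defined one_space W\<^sub>1 W\<^sub>2"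
    if W: "weil_algebra W\<^sub>1" "weil_algebra W\<^sub>2" for W\<^sub>1 W\<^sub>2
  proof -
    have c: "smooth_between (weil_dom W\<^sub>1) one_space (\<lambda>_. ())"
      by (rule smooth_between_const[OF frolicher_one]) (simp add: one_space_def)
    have "z = jet_class one_space W\<^sub>1 (\<lambda>_. ())" if "z \<in> points (prolong one_space W\<^sub>1)" for z
    proof (rule prolong_point[OF W(1) frolicher_one that])
      fix k assume "z = jet_class one_space W\<^sub>1 k"
      then show ?thesis by (simp add: jet_class_cong[of W\<^sub>1 k "\<lambda>_. ()"])
    qed
    then have "points (prolong one_space W\<^sub>1) = {jet_class one_space W\<^sub>1 (\<lambda>_. ())}"
      using jet_class_point[OF W(1) frolicher_one c] by blast
    note s = single[OF W(2) frolicher_prolong[OF W(1) frolicher_one] this]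
    have "kappa_well_defined one_space W\<^sub>1 W\<^sub>2"
      unfolding kappa_well_defined_def
    proof (intro allI impI)
      fix h h' :: "(nat \<Rightarrow> real) \<Rightarrow> unit" assume "jet_eq one_space (weil_tensor W\<^sub>1 W\<^sub>2) h h'"
      note h = jet_eq_smooth(1)[OF this]
      have "h' = h" by (rule ext) simp
      then show "jet_eq (prolong one_space W\<^sub>1) W\<^sub>2 (kappa_family one_space W\<^sub>1 h) (kappa_family one_space W\<^sub>1 h')"
        using jet_eq_refl[OF W(2) kappa_family_smooth[OF W(1,2) frolicher_one h]] by simp
    qed
    with s show ?thesis by blast
  qed
  then show ?thesis by (simp add: weil_good_def)
qed

text \<open>The prolongation of a product is a retract of the product of the prolongations, and \<open>\<kappa>\<close> is well defined
since it is so for both components.\<close>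

lemma weil_good_prod:
  assumes GX: "weil_good X" and GY: "weil_good Y"
  shows "weil_good (prod_space X Y)"
proof -
  have X: "frolicher_space X" and Y: "frolicher_space Y" using assms by (auto simp: weil_good_def)
  note P = frolicher_prod[OF X Y]
  have "has_section (prolong (prod_space X Y) W\<^sub>1) W\<^sub>2 \<and> faithful (prolong (prod_space X Y) W\<^sub>1) W\<^sub>2 \<and>
      kappa_well_defined (prod_space X Y) W\<^sub>1 W\<^sub>2"
    if W: "weil_algebra W\<^sub>1" "weil_algebra W\<^sub>2" for W\<^sub>1 W\<^sub>2
  proof -
    let ?P = "prod_space X Y" and ?A = "prolong X W\<^sub>1" and ?B = "prolong Y W\<^sub>1"
    note A = frolicher_prolong[OF W(1) X] and B = frolicher_prolong[OF W(1) Y]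
    note AB = frolicher_prod[OF A B] and PP = frolicher_prolong[OF W(1) P]
    have gX: "has_section ?A W\<^sub>2" "faithful ?A W\<^sub>2" "kappa_well_defined X W\<^sub>1 W\<^sub>2"
      and gY: "has_section ?B W\<^sub>2" "faithful ?B W\<^sub>2" "kappa_well_defined Y W\<^sub>1 W\<^sub>2"
      using GX GY W by (auto simp: weil_good_def)
    let ?i = "\<lambda>z. (prolong_map ?P X W\<^sub>1 fst z, prolong_map ?P Y W\<^sub>1 snd z)"
    obtain r where r: "smooth_between (prolong ?P W\<^sub>1) (prod_space ?A ?B) ?i"
      "smooth_between (prod_space ?A ?B) (prolong ?P W\<^sub>1) r"
      "\<And>z. z \<in> points (prolong ?P W\<^sub>1) \<Longrightarrow> r (?i z) = z"
      "\<And>f g. smooth_between (weil_dom W\<^sub>1) X f \<Longrightarrow> smooth_between (weil_dom W\<^sub>1) Y g \<Longrightarrow>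
         r (jet_class X W\<^sub>1 f, jet_class Y W\<^sub>1 g) = jet_class ?P W\<^sub>1 (\<lambda>u. (f u, g u))"
      using prolong_prod_retract[OF W(1) X Y weil_good_section_faithful(1)[OF GX W(1)]
          weil_good_section_faithful(1)[OF GY W(1)]] by blast
    have "kappa_well_defined ?P W\<^sub>1 W\<^sub>2"
      unfolding kappa_well_defined_def
    proof (intro allI impI)
      fix h h' assume hh': "jet_eq ?P (weil_tensor W\<^sub>1 W\<^sub>2) h h'"
      have 1: "jet_eq ?A W\<^sub>2 (kappa_family X W\<^sub>1 (\<lambda>w. fst (h w))) (kappa_family X W\<^sub>1 (\<lambda>w. fst (h' w)))"
        using gX(3) jet_eq_map[OF hh' smooth_between_fst_id] unfolding kappa_well_defined_def by blast
      have 2: "jet_eq ?B W\<^sub>2 (kappa_family Y W\<^sub>1 (\<lambda>w. snd (h w))) (kappa_family Y W\<^sub>1 (\<lambda>w. snd (h' w)))"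
        using gY(3) jet_eq_map[OF hh' smooth_between_snd_id] unfolding kappa_well_defined_def by blast
      from jet_eq_map[OF jet_eq_pair[OF W(2) A B 1 2] r(2)]
      have "jet_eq (prolong ?P W\<^sub>1) W\<^sub>2
          (\<lambda>v. r (kappa_family X W\<^sub>1 (\<lambda>w. fst (h w)) v, kappa_family Y W\<^sub>1 (\<lambda>w. snd (h w)) v))
          (\<lambda>v. r (kappa_family X W\<^sub>1 (\<lambda>w. fst (h' w)) v, kappa_family Y W\<^sub>1 (\<lambda>w. snd (h' w)) v))"
        .
      then show "jet_eq (prolong ?P W\<^sub>1) W\<^sub>2 (kappa_family ?P W\<^sub>1 h) (kappa_family ?P W\<^sub>1 h')"
      proof (rule jet_eq_cong)
        have r_pair: "r (kappa_family X W\<^sub>1 (\<lambda>w. fst (k w)) v, kappa_family Y W\<^sub>1 (\<lambda>w. snd (k w)) v) =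
          kappa_family ?P W\<^sub>1 k v"
        if k: "smooth_between (weil_dom (weil_tensor W\<^sub>1 W\<^sub>2)) ?P k" and v: "v \<in> points (weil_dom W\<^sub>2)" for k v
        unfolding kappa_family_def
        using r(4)[OF kappa_family_point[OF W X smooth_between_fst[OF k] v] kappa_family_point[OF W Y smooth_between_snd[OF k] v]]
        by simp
        fix v assume v: "v \<in> points (weil_dom W\<^sub>2)"
        show "r (kappa_family X W\<^sub>1 (\<lambda>w. fst (h w)) v, kappa_family Y W\<^sub>1 (\<lambda>w. snd (h w)) v) =
            kappa_family ?P W\<^sub>1 h v" by (rule r_pair[OF jet_eq_smooth(1)[OF hh'] v])
        show "r (kappa_family X W\<^sub>1 (\<lambda>w. fst (h' w)) v, kappa_family Y W\<^sub>1 (\<lambda>w. snd (h' w)) v) =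
            kappa_family ?P W\<^sub>1 h' v" by (rule r_pair[OF jet_eq_smooth(2)[OF hh'] v])
      qed
    qed
    then show ?thesis
      using has_section_retract[OF PP AB r(1,2,3) W(2) has_section_prod[OF W(2) A B gX(1) gY(1)]]
        faithful_retract[OF PP AB r(1,2,3) faithful_prod[OF W(2) A B gX(2) gY(2)]] by blast
  qed
  then show ?thesis using P by (simp add: weil_good_def)
qed

text \<open>The prolongation of \<open>Y\<^sup>X\<close> is a retract of \<open>(Y \<otimes> W\<^sub>1)\<^sup>X\<close>. If \<open>h\<close> and \<open>h'\<close> are congruent, then so are
\<open>h(\<cdot>)(x)\<close> and \<open>h'(\<cdot>)(x)\<close> for every \<open>x\<close>. Hence their images under \<open>\<kappa>\<close> are congruent at every \<open>x\<close>, and by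
faithfulness they are congruent as maps into \<open>(Y \<otimes> W\<^sub>1)\<^sup>X\<close>.\<close>

lemma weil_good_map_space:
  assumes X: "frolicher_space X" and GY: "weil_good Y"
  shows "weil_good (map_space X Y)"
proof -
  have Y: "frolicher_space Y" using assms by (auto simp: weil_good_def)
  note M = frolicher_map_space[OF X Y]
  have "has_section (prolong (map_space X Y) W\<^sub>1) W\<^sub>2 \<and> faithful (prolong (map_space X Y) W\<^sub>1) W\<^sub>2 \<and>
      kappa_well_defined (map_space X Y) W\<^sub>1 W\<^sub>2"
    if W: "weil_algebra W\<^sub>1" "weil_algebra W\<^sub>2" for W\<^sub>1 W\<^sub>2
  proof -
    let ?M = "map_space X Y" and ?A = "prolong Y W\<^sub>1" and ?T = "weil_tensor W\<^sub>1 W\<^sub>2"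
    note A = frolicher_prolong[OF W(1) Y]
    note MA = frolicher_map_space[OF X A] and PM = frolicher_prolong[OF W(1) M]
    have gY: "has_section ?A W\<^sub>2" "faithful ?A W\<^sub>2" "kappa_well_defined Y W\<^sub>1 W\<^sub>2"
      using GY W by (auto simp: weil_good_def)
    note e = eps_map_smooth[OF W(1) X Y]
    obtain r where r: "smooth_between (map_space X ?A) (prolong ?M W\<^sub>1) r"
      "\<And>z. z \<in> points (prolong ?M W\<^sub>1) \<Longrightarrow> r (eps_map X Y W\<^sub>1 z) = z"
      "\<And>\<theta>. \<theta> \<in> points (map_space X ?A) \<Longrightarrow> eps_map X Y W\<^sub>1 (r \<theta>) = \<theta>"
      using prolong_map_space_retract[OF W(1) X Y weil_good_section_faithful[OF GY W(1)]] by blast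
    have "kappa_well_defined ?M W\<^sub>1 W\<^sub>2"
      unfolding kappa_well_defined_def
    proof (intro allI impI)
      fix h h' assume hh': "jet_eq ?M ?T h h'"
      have sm: "smooth_between (prod_space (weil_dom W\<^sub>2) X) ?A
          (\<lambda>p. kappa_family Y W\<^sub>1 (\<lambda>w. k w (snd p)) (fst p))"
        if k: "smooth_between (weil_dom ?T) ?M k" for k
        unfolding kappa_family_def
      proof (rule jet_class_smooth[OF W(1) Y frolicher_prod[OF frolicher_euclid X]])
        let ?Z = "prod_space (weil_dom W\<^sub>1) (prod_space (weil_dom W\<^sub>2) X)"
        have "smooth_between ?Z (weil_dom ?T) (\<lambda>p. join_vec (wdim W\<^sub>1) (fst p) (fst (snd p)))"
          unfolding weil_tensor_simps
          by (rule smooth_between_subst2[OF join_vec_smooth smooth_between_fst_id smooth_between_fst[OF smooth_between_snd_id]])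
        from smooth_between_apply[OF X smooth_between_compose[OF k this] smooth_between_snd[OF smooth_between_snd_id]]
        show "smooth_between ?Z Y (\<lambda>p. k (join_vec (wdim W\<^sub>1) (fst p) (fst (snd p))) (snd (snd p)))" .
      qed
      have "pointwise_jet_eq X ?A W\<^sub>2 (\<lambda>v x. kappa_family Y W\<^sub>1 (\<lambda>w. h w x) v) (\<lambda>v x. kappa_family Y W\<^sub>1 (\<lambda>w. h' w x) v)"
        unfolding pointwise_jet_eq_def
      proof (intro conjI ballI sm jet_eq_smooth[OF hh'])
        fix x assume x: "x \<in> points X"
        show "jet_eq ?A W\<^sub>2 (\<lambda>v. kappa_family Y W\<^sub>1 (\<lambda>w. h w x) v) (\<lambda>v. kappa_family Y W\<^sub>1 (\<lambda>w. h' w x) v)"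
          using gY(3) jet_eq_map[OF hh' apply_smooth[OF X x]] unfolding kappa_well_defined_def by blast
      qed
      from jet_eq_map[OF faithfulD[OF gY(2) A X this] r(1)]
      show "jet_eq (prolong ?M W\<^sub>1) W\<^sub>2 (kappa_family ?M W\<^sub>1 h) (kappa_family ?M W\<^sub>1 h')"
      proof (rule jet_eq_cong)
        have "r (\<lambda>x\<in>points X. kappa_family Y W\<^sub>1 (\<lambda>w. k w x) v) = kappa_family ?M W\<^sub>1 k v"
          if k: "smooth_between (weil_dom ?T) ?M k" and v: "v \<in> points (weil_dom W\<^sub>2)" for k v
        proof -
          note kv = kappa_family_point[OF W M k v]
          have "(\<lambda>x\<in>points X. kappa_family Y W\<^sub>1 (\<lambda>w. k w x) v) = eps_map X Y W\<^sub>1 (kappa_family ?M W\<^sub>1 k v)"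
          proof
            fix x
            show "(\<lambda>x\<in>points X. kappa_family Y W\<^sub>1 (\<lambda>w. k w x) v) x = eps_map X Y W\<^sub>1 (kappa_family ?M W\<^sub>1 k v) x"
              using eps_map_jet_class[OF W(1) X Y kv, of x]
              by (cases "x \<in> points X") (simp_all add: kappa_family_def, simp add: eps_map_def)
          qed
          then show ?thesis using r(2)[OF jet_class_point[OF W(1) M kv]] by (simp add: kappa_family_def)
        qed
        then show "r (\<lambda>x\<in>points X. kappa_family Y W\<^sub>1 (\<lambda>w. h w x) v) = kappa_family ?M W\<^sub>1 h v"
          "r (\<lambda>x\<in>points X. kappa_family Y W\<^sub>1 (\<lambda>w. h' w x) v) = kappa_family ?M W\<^sub>1 h' v"
          if "v \<in> points (weil_dom W\<^sub>2)" for v using jet_eq_smooth[OF hh'] that by blast+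
      qed
    qed
    then show ?thesis
      using has_section_retract[OF PM MA e r(1,2) W(2) has_section_map_space[OF W(2) X A gY(1,2)]]
        faithful_retract[OF PM MA e r(1,2) faithful_map_space[OF W(2) X A gY(2)]] by blast
  qed
  then show ?thesis using M by (simp add: weil_good_def)
qed

lemma is_terminal_one: "is_terminal Obj one_space"
  unfolding is_terminal_def
proof (intro allI impI)
  fix T :: "'t frolicher"
  have "(\<lambda>x\<in>points T. ()) \<in> smooth_maps T one_space"
    by (simp add: smooth_maps_iff smooth_between_def one_space_def)
  moreover have "f = (\<lambda>x\<in>points T. ())" if "f \<in> smooth_maps T one_space" for f
    using that by (auto simp: smooth_maps_iff fun_eq_iff extensional_def)
  ultimately show "\<exists>!f. f \<in> smooth_maps T one_space" by blast
qed

lemma is_product_prod_space: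
  assumes X: "frolicher_space X" and Y: "frolicher_space Y"
    and Obj: "\<And>T. Obj T \<Longrightarrow> frolicher_space T"
  shows "is_product Obj X Y (prod_space X Y)
    (\<lambda>p\<in>points (prod_space X Y). fst p) (\<lambda>p\<in>points (prod_space X Y). snd p)"
  unfolding is_product_def
proof (intro conjI allI impI ballI)
  let ?P = "prod_space X Y"
  let ?p = "\<lambda>p\<in>points ?P. fst p" and ?q = "\<lambda>p\<in>points ?P. snd p"
  note P = frolicher_prod[OF X Y]
  show "?p \<in> smooth_maps ?P X" "?q \<in> smooth_maps ?P Y"
    by (rule restrict_in_smooth_maps[OF P] smooth_between_fst_id smooth_between_snd_id)+
  fix T f g assume "Obj T" and f: "f \<in> smooth_maps T X" and g: "g \<in> smooth_maps T Y"
  have T: "frolicher_space T" using Obj \<open>Obj T\<close> .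
  let ?h = "\<lambda>t\<in>points T. (f t, g t)"
  show "\<exists>!h. h \<in> smooth_maps T ?P \<and> compose (points T) ?p h = f \<and> compose (points T) ?q h = g"
  proof (rule ex1I[of _ ?h])
    have "?h \<in> smooth_maps T ?P"
      using f g by (intro restrict_in_smooth_maps[OF T] smooth_between_pair) (auto simp: smooth_maps_iff)
    moreover have "f t \<in> points X" "g t \<in> points Y" if "t \<in> points T" for t
      using f g that by (auto simp: smooth_maps_iff smooth_between_points)
    ultimately show "?h \<in> smooth_maps T ?P \<and> compose (points T) ?p ?h = f \<and> compose (points T) ?q ?h = g"
      using f g by (auto simp: compose_def fun_eq_iff smooth_maps_iff extensional_def)
  next
    fix h assume h: "h \<in> smooth_maps T ?P \<and> compose (points T) ?p h = f \<and> compose (points T) ?q h = g"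
    have eqs: "?p (h t) = f t" "?q (h t) = g t" if "t \<in> points T" for t
      using fun_cong[OF conjunct1[OF conjunct2[OF h]], of t] fun_cong[OF conjunct2[OF conjunct2[OF h]], of t] that
      by (simp_all add: compose_def)
    show "h = ?h"
    proof
      fix t
      show "h t = ?h t"
      proof (cases "t \<in> points T")
        case True
        then have "h t \<in> points ?P"
          using h smooth_between_points[of T ?P h] by (simp add: smooth_maps_iff)
        then show ?thesis using eqs[OF True] True by (simp add: prod_eq_iff)
      next
        case False
        then show ?thesis using h by (simp add: smooth_maps_iff extensional_def)
      qed
    qed
  qed
qed

lemma is_exponential_map_space:
  assumes X: "frolicher_space X" and Y: "frolicher_space Y"
    and Obj: "\<And>T. Obj T \<Longrightarrow> frolicher_space T"
  shows "is_exponential Obj X Y (map_space X Y) (eval_map X Y)"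
  unfolding is_exponential_def
proof (intro conjI allI impI ballI)
  let ?M = "map_space X Y"
  note M = frolicher_map_space[OF X Y]
  show "eval_map X Y \<in> smooth_maps (prod_space ?M X) Y"
    unfolding eval_map_def
    by (rule restrict_in_smooth_maps[OF frolicher_prod[OF M X]
          smooth_between_apply[OF X smooth_between_fst_id smooth_between_snd_id]])
  fix T f assume "Obj T" and f: "f \<in> smooth_maps (prod_space T X) Y"
  have T: "frolicher_space T" using Obj \<open>Obj T\<close> .
  let ?h = "\<lambda>t\<in>points T. \<lambda>x\<in>points X. f (t, x)"
  show "\<exists>!h. h \<in> smooth_maps T ?M \<and> (\<lambda>p\<in>points T \<times> points X. eval_map X Y (h (fst p), snd p)) = f"
  proof (rule ex1I[of _ ?h])
    have "smooth_between T ?M (\<lambda>t. \<lambda>x\<in>points X. f (t, x))"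
      by (rule smooth_between_curry[OF T X]) (use f in \<open>simp add: smooth_maps_iff\<close>)
    then have h: "?h \<in> smooth_maps T ?M" by (rule restrict_in_smooth_maps[OF T])
    then have "?h t \<in> smooth_maps X Y" if "t \<in> points T" for t
      using that smooth_between_points[of T ?M ?h t] by (auto simp: smooth_maps_iff[of ?h])
    then have "(\<lambda>p\<in>points T \<times> points X. eval_map X Y (?h (fst p), snd p)) = f"
      using f by (auto simp: eval_map_def fun_eq_iff smooth_maps_iff[of f] extensional_def)
    with h show "?h \<in> smooth_maps T ?M \<and> (\<lambda>p\<in>points T \<times> points X. eval_map X Y (?h (fst p), snd p)) = f"
      by blast
  next
    fix h assume h: "h \<in> smooth_maps T ?M \<and> (\<lambda>p\<in>points T \<times> points X. eval_map X Y (h (fst p), snd p)) = f"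
    have ht: "h t \<in> smooth_maps X Y" if "t \<in> points T" for t
      using h that smooth_between_points[of T ?M h t] by (auto simp: smooth_maps_iff[of h])
    show "h = ?h"
    proof
      fix t
      show "h t = ?h t"
      proof (cases "t \<in> points T")
        case True
        have "h t x = f (t, x)" if "x \<in> points X" for x
          using fun_cong[OF conjunct2[OF h], of "(t, x)"] ht[OF True] True that by (simp add: eval_map_def)
        then show ?thesis
          using True ht[OF True] by (auto simp: fun_eq_iff smooth_maps_iff extensional_def)
      next
        case False
        then show ?thesis using h by (simp add: smooth_maps_iff extensional_def)
      qed
    qed
  qed
qed

theorem theorem14:
  fixes X :: "'a frolicher" and Y :: "'b frolicher" and S :: "'s frolicher"
  shows
    "(weil_exponentiable X \<longrightarrow> frolicher_space S \<longrightarrow> weil_exponentiable_at S X) \<and>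
     weil_exponentiable one_space \<and>
     is_terminal (weil_exponentiable :: 't frolicher \<Rightarrow> bool) one_space \<and>
     (weil_exponentiable X \<longrightarrow> weil_exponentiable Y \<longrightarrow>
        weil_exponentiable (prod_space X Y) \<and>
        is_product (weil_exponentiable :: 't frolicher \<Rightarrow> bool) X Y (prod_space X Y)
          (\<lambda>p\<in>points (prod_space X Y). fst p) (\<lambda>p\<in>points (prod_space X Y). snd p) \<and>
        weil_exponentiable (map_space X Y) \<and>
        is_exponential (weil_exponentiable :: 't frolicher \<Rightarrow> bool) X Y
          (map_space X Y) (eval_map X Y))"
proof (intro conjI impI)
  have fr: "frolicher_space T" if "weil_exponentiable T" for T
    using that by (simp add: weil_exponentiable_def)
  show "weil_exponentiable_at S X" if "weil_exponentiable X" "frolicher_space S"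
    by (rule weil_good_exponentiable_at[OF that(1)[unfolded weil_exponentiable_iff] that(2)])
  show "weil_exponentiable one_space"
    unfolding weil_exponentiable_iff by (rule weil_good_one)
  show "is_terminal (weil_exponentiable :: 't frolicher \<Rightarrow> bool) one_space"
    by (rule is_terminal_one)
  assume X: "weil_exponentiable X" and Y: "weil_exponentiable Y"
  note good = X[unfolded weil_exponentiable_iff] Y[unfolded weil_exponentiable_iff]
  show "weil_exponentiable (prod_space X Y)"
    unfolding weil_exponentiable_iff by (rule weil_good_prod[OF good])
  show "weil_exponentiable (map_space X Y)"
    unfolding weil_exponentiable_iff by (rule weil_good_map_space[OF fr[OF X] good(2)])
  show "is_product (weil_exponentiable :: 't frolicher \<Rightarrow> bool) X Y (prod_space X Y)
      (\<lambda>p\<in>points (prod_space X Y). fst p) (\<lambda>p\<in>points (prod_space X Y). snd p)"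
    by (rule is_product_prod_space[OF fr[OF X] fr[OF Y]]) (simp add: weil_exponentiable_def)
  show "is_exponential (weil_exponentiable :: 't frolicher \<Rightarrow> bool) X Y (map_space X Y) (eval_map X Y)"
    by (rule is_exponential_map_space[OF fr[OF X] fr[OF Y]]) (simp add: weil_exponentiable_def)
qed

end
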